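(* Let $\Omega\subset\mathbb{R}^2\cong\mathbb{C}$ be a bounded strictly convex domain having an outer unit normal $\nu(\zeta)$ at every boundary point $\zeta$. Let $\Lambda\subset\partial\Omega$ be a smooth boundary arc, normalized so that the chord $L$ joining its endpoints is the real interval $(-s,s)$, $s>0$, and $\Lambda$ lies in the upper half plane. Let $\Omega^+$ be the region bounded by $\Lambda\cup L$ (the interior of the convex hull of $\Lambda$). Let $1/2<\mu<1$ and let $f=(f_1,f_2)\in C_0^{1,\mu}(\Omega;\mathbb{R}^2)$ (real valued, compactly supported in $\Omega$). Then $f|_{\Omega^+}$ is recovered from the values of $I^0f(\zeta,\theta)$ and $I^1f(\zeta,\theta)$ with $(\zeta,\theta)\in\Lambda\times S^1$, $\nu(\zeta)\cdot\theta>0$, as follows. Let $v^0,v^1$, their Fourier modes $v^k_{n}$, the data $g^k$ on $\Lambda\times S^1$, the functionals $F[\cdot,\cdot]_{-n}$, the operators $\mathcal{B},\mathcal{T}$ (on $\Omega^+$), the finite Hilbert transform $H_s$ and the left shift $\mathcal{L}$ be as defined in the context, and put $\mathbf{v}^k=(v^k_0,v^k_{-1},v^k_{-2},\dots)$. Then $v^k|_{\Lambda\times S^1}=g^k$ for $k=0,1$ (so $\mathbf{v}^0|_\Lambda,\mathbf{v}^1|_\Lambda$ are determined by the data), and: (1) For each $n\ge 1$, $v^0_{-n}|_L$ is the unique solution in $L^2(-s,s)$ of $[I-iH_s](v^0_{-n})(x)=F[\mathbf{v}^0|_\Lambda,\mathbf{0}]_{-n}(x)$, $x\in L$; and $\mathcal{L}\mathbf{v}^0=\mathcal{B}\big(\mathcal{L}\mathbf{v}^0|_{\Lambda\cup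 L}\big)$ in $\Omega^+$. (2) For each $n\ge 0$, $v^1_{-n}|_L$ is the unique solution in $L^2(-s,s)$ of $[I-iH_s](v^1_{-n})(x)=F[\mathbf{v}^1|_\Lambda,\mathcal{L}\mathbf{v}^0]_{-n}(x)$, $x\in L$; and $\mathbf{v}^1=\mathcal{B}\big(\mathbf{v}^1|_{\Lambda\cup L}\big)+\mathcal{T}(\mathcal{L}\mathbf{v}^0)$ in $\Omega^+$. (3) $v^0_0(z)=2\,\mathrm{Re}\,\partial v^1_{-1}(z)$ for $z\in\Omega^+$. (4) $f(z)=\big(2\,\mathrm{Re}\{\overline{\partial}v^0_0(z)+\partial v^0_{-2}(z)\},\;2\,\mathrm{Im}\{\overline{\partial}v^0_0(z)+\partial v^0_{-2}(z)\}\big)$ for $z\in\Omega^+$. In particular, $f|_{\Omega^+}$ is uniquely determined by $I^0f$ and $I^1f$ restricted to the lines intersecting $\Lambda$.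
   Context: Points of $\mathbb{R}^2$ are identified with complex numbers; $\partial=(\partial_x-i\partial_y)/2$, $\overline{\partial}=(\partial_x+i\partial_y)/2$; $\theta=(\cos\varphi,\sin\varphi)\in S^1$. Moment ray transforms: for $k=0,1$, $I^kf(x,\theta)=\int_{-\infty}^{\infty}t^k\,\theta\cdot f(\Pi_\theta(x)+t\theta)\,dt$, where $\Pi_\theta(x)=x-(x\cdot\theta)\theta$. Transport solutions: $v^0,v^1$ are the unique solutions of $\theta\cdot\nabla v^0(x,\theta)=\theta\cdot f(x)$ and $\theta\cdot\nabla v^1(x,\theta)=v^0(x,\theta)$ for $(x,\theta)\in\Omega\times S^1$, with $v^0=v^1=0$ on $\{(\zeta,\theta)\in\partial\Omega\times S^1:\nu(\zeta)\cdot\theta<0\}$. Their Fourier modes are $v^k_n(z)=\frac1{2\pi}\int_{-\pi}^{\pi}v^k(z,\theta)e^{-in\varphi}\,d\varphi$, $n\in\mathbb{Z}$. Data: with $\Sigma_+=\{(\zeta,\theta)\in\Lambda\times S^1:\nu(\zeta)\cdot\theta>0\}$, set $g^0(\zeta,\theta)=I^0f(\zeta,\theta)$ and $g^1(\zeta,\theta)=(\zeta\cdot\theta)I^0f(\zeta,\theta)-I^1f(\zeta,\theta)$ for $(\zeta,\theta)\in\Sigma_+$, and $g^0=g^1=0$ on $(\Lambda\times S^1)\setminus\Sigma_+$. Sequence notation: sequences are indexed as $\mathbf{v}=(v_0,v_{-1},v_{-2},\dots)$, and $\mathcal{L}(v_0,v_{-1},v_{-2},\dots)=(v_{-1},v_{-2},\dots)$.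 Operators on $\Omega^+$: $\partial\Omega^+=\Lambda\cup L$ is oriented counterclockwise (so $L$ runs from $-s$ to $s$ and $\Lambda$ from $s$ to $-s$). For $n\ge0$, $z\in\Omega^+$, $\zeta=\xi+i\eta$: $$(\mathcal{B}\mathbf{v})_{-n}(z)=\frac1{2\pi i}\int_{\partial\Omega^+}\frac{v_{-n}(\zeta)}{\zeta-z}d\zeta+\frac1{2\pi i}\sum_{j=1}^\infty\int_{\partial\Omega^+}\left\{\frac{d\zeta}{\zeta-z}-\frac{d\overline\zeta}{\overline\zeta-\overline z}\right\}v_{-n-2j}(\zeta)\left(\frac{\overline\zeta-\overline z}{\zeta-z}\right)^j,$$ $$(\mathcal{T}\mathbf{w})_{-n}(z)=-\frac1\pi\sum_{j=0}^\infty\int_{\Omega^+}w_{-n-2j}(\zeta)\frac1{\zeta-z}\left(\frac{\overline\zeta-\overline z}{\zeta-z}\right)^jd\xi\,d\eta.$$ For $n\ge0$ and $z\in L$ (endpoints excluded): $$F[\mathbf{v}|_\Lambda,\mathbf{w}]_{-n}(z)=\frac1{i\pi}\int_\Lambda\frac{v_{-n}(\zeta)}{\zeta-z}d\zeta+\frac1{i\pi}\sum_{j=1}^\infty\int_\Lambda\left\{\frac{d\zeta}{\zeta-z}-\frac{d\overline\zeta}{\overline\zeta-z}\right\}v_{-n-2j}(\zeta)\left(\frac{\overline\zeta-z}{\zeta-z}\right)^j-\frac2\pi\sum_{j=0}^\infty\iint_{\Omega^+}\frac{w_{-n-2j}(\xi,\eta)}{(\xi-z)+i\eta}\left(\frac{(\xi-z)-i\eta}{(\xi-z)+i\eta}\right)^jd\xi\,d\eta.$$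 Finite Hilbert transform: $H_s[f](x)=\frac1\pi\,\mathrm{p.v.}\int_{-s}^{s}\frac{f(y)}{x-y}\,dy$ for functions on $(-s,s)$; $I$ is the identity. *)

theory Defs
  imports "HOL-Complex_Analysis.Complex_Analysis"
begin

text \<open>
  The plane is \<^typ>\<open>complex\<close>: a vector field (f1, f2) is the function f1 + i f2, the Euclidean
  inner product is the library's inner product on \<^typ>\<open>complex\<close>, and the unit circle is
  \<^term>\<open>sphere (0::complex) 1\<close>.
\<close>

definition strictly_convex_domain :: "complex set \<Rightarrow> bool" where
  "strictly_convex_domain \<Omega> \<longleftrightarrow>
     open \<Omega> \<and> \<Omega> \<noteq> {} \<and> convex \<Omega> \<and>
     (\<forall>x\<in>closure \<Omega>. \<forall>y\<in>closure \<Omega>. x \<noteq> y \<longrightarrow> open_segment x y \<subseteq> \<Omega>)"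

text \<open>
  At a boundary point of a convex domain some unit vector always satisfies this condition;
  it is the uniqueness of that vector which says that the boundary has a normal there.
\<close>

definition outer_unit_normal :: "complex set \<Rightarrow> complex \<Rightarrow> complex \<Rightarrow> bool" where
  "outer_unit_normal \<Omega> \<zeta> n \<longleftrightarrow> norm n = 1 \<and> (\<forall>x\<in>\<Omega>. (x - \<zeta>) \<bullet> n \<le> 0)"

text \<open>\<open>D k\<close> is the \<open>k\<close>-th derivative, one-sided at the endpoints.\<close>

definition smooth_arc :: "(real \<Rightarrow> complex) \<Rightarrow> bool" where
  "smooth_arc \<gamma> \<longleftrightarrow> arc \<gamma> \<and>
     (\<exists>D :: nat \<Rightarrow> real \<Rightarrow> complex. D 0 = \<gamma> \<and>
        (\<forall>k. \<forall>t\<in>{0..1}. (D k has_vector_derivative D (Suc k) t) (at t within {0..1})) \<and>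
        (\<forall>t\<in>{0..1}. D 1 t \<noteq> 0))"

text \<open>A field on \<open>\<Omega>\<close> with compact support is identified with its extension by zero.\<close>

definition C0_1_holder :: "complex set \<Rightarrow> real \<Rightarrow> (complex \<Rightarrow> complex) \<Rightarrow> bool" where
  "C0_1_holder \<Omega> \<mu> f \<longleftrightarrow>
     (\<exists>K. compact K \<and> K \<subseteq> \<Omega> \<and> (\<forall>z. z \<notin> K \<longrightarrow> f z = 0)) \<and>
     (\<exists>f' :: complex \<Rightarrow> complex \<Rightarrow>\<^sub>L complex.
        (\<forall>z. (f has_derivative blinfun_apply (f' z)) (at z)) \<and>
        (\<exists>C. \<forall>x y. norm (f' x - f' y) \<le> C * dist x y powr \<mu>))"

definition ray_moment :: "nat \<Rightarrow> (complex \<Rightarrow> complex) \<Rightarrow> complex \<Rightarrow> complex \<Rightarrow> real" where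
  "ray_moment k f x \<theta> =
     (\<integral>t. t ^ k * (\<theta> \<bullet> f (x - (x \<bullet> \<theta>) *\<^sub>R \<theta> + t *\<^sub>R \<theta>)) \<partial>lborel)"

definition data0 :: "(complex \<Rightarrow> complex) \<Rightarrow> (complex \<Rightarrow> complex) \<Rightarrow> complex \<Rightarrow> complex \<Rightarrow> real" where
  "data0 \<nu> f \<zeta> \<theta> = (if \<nu> \<zeta> \<bullet> \<theta> > 0 then ray_moment 0 f \<zeta> \<theta> else 0)"

definition data1 :: "(complex \<Rightarrow> complex) \<Rightarrow> (complex \<Rightarrow> complex) \<Rightarrow> complex \<Rightarrow> complex \<Rightarrow> real" where
  "data1 \<nu> f \<zeta> \<theta> =
     (if \<nu> \<zeta> \<bullet> \<theta> > 0 then (\<zeta> \<bullet> \<theta>) * ray_moment 0 f \<zeta> \<theta> - ray_moment 1 f \<zeta> \<theta> else 0)"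

text \<open>
  Continuity up to the boundary gives the boundary values of \<open>v\<close> a meaning, also at
  tangential directions. Off \<open>closure \<Omega> \<times> sphere 0 1\<close>, where a solution is not defined,
  it is normalized to 0, so that uniqueness can be stated for total functions.
\<close>

definition solves_transport ::
  "complex set \<Rightarrow> (complex \<Rightarrow> complex) \<Rightarrow> (complex \<Rightarrow> complex \<Rightarrow> real) \<Rightarrow>
   (complex \<Rightarrow> complex \<Rightarrow> real) \<Rightarrow> bool" where
  "solves_transport \<Omega> \<nu> a v \<longleftrightarrow>
     continuous_on (closure \<Omega> \<times> sphere 0 1) (\<lambda>(z, \<theta>). v z \<theta>) \<and>
     (\<forall>z\<in>\<Omega>. \<forall>\<theta>\<in>sphere 0 1. ((\<lambda>t. v (z + t *\<^sub>R \<theta>) \<theta>) has_real_derivative a z \<theta>) (at 0)) \<and>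
     (\<forall>\<zeta>\<in>frontier \<Omega>. \<forall>\<theta>\<in>sphere 0 1. \<nu> \<zeta> \<bullet> \<theta> < 0 \<longrightarrow> v \<zeta> \<theta> = 0) \<and>
     (\<forall>z \<theta>. z \<notin> closure \<Omega> \<or> \<theta> \<notin> sphere 0 1 \<longrightarrow> v z \<theta> = 0)"

definition transport_solution ::
  "complex set \<Rightarrow> (complex \<Rightarrow> complex) \<Rightarrow> (complex \<Rightarrow> complex \<Rightarrow> real) \<Rightarrow>
   (complex \<Rightarrow> complex \<Rightarrow> real)" where
  "transport_solution \<Omega> \<nu> a = (THE v. solves_transport \<Omega> \<nu> a v)"

definition fourier_mode :: "(complex \<Rightarrow> complex \<Rightarrow> real) \<Rightarrow> int \<Rightarrow> complex \<Rightarrow> complex" where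
  "fourier_mode v n z =
     1 / (2 * of_real pi) *
     integral {-pi..pi} (\<lambda>\<phi>. of_real (v z (cis \<phi>)) * exp (- \<i> * of_int n * of_real \<phi>))"

text \<open>A sequence (v_0, v_{-1}, v_{-2}, ...) is represented by \<open>n \<mapsto> v_{-n}\<close>.\<close>

type_synonym mode_seq = "nat \<Rightarrow> complex \<Rightarrow> complex"

definition modes :: "(complex \<Rightarrow> complex \<Rightarrow> real) \<Rightarrow> mode_seq" where
  "modes v n = fourier_mode v (- int n)"

definition left_shift :: "mode_seq \<Rightarrow> mode_seq" where
  "left_shift v n = v (Suc n)"

definition contour_integral_cnj :: "(real \<Rightarrow> complex) \<Rightarrow> (complex \<Rightarrow> complex) \<Rightarrow> complex" where
  "contour_integral_cnj \<gamma> h =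
     integral {0..1} (\<lambda>t. h (\<gamma> t) * cnj (vector_derivative \<gamma> (at t within {0..1})))"

text \<open>
  The integral over \<open>\<gamma>\<close> of
  \<open>{d\<zeta> / (\<zeta> - z) - d(cnj \<zeta>) / (cnj \<zeta> - cnj z)} h(\<zeta>) ((cnj \<zeta> - cnj z) / (\<zeta> - z)) ^ j\<close>.
\<close>

definition kernel_integral ::
  "(real \<Rightarrow> complex) \<Rightarrow> complex \<Rightarrow> nat \<Rightarrow> (complex \<Rightarrow> complex) \<Rightarrow> complex" where
  "kernel_integral \<gamma> z j h =
     contour_integral \<gamma> (\<lambda>\<zeta>. h \<zeta> * ((cnj \<zeta> - cnj z) / (\<zeta> - z)) ^ j / (\<zeta> - z)) -
     contour_integral_cnj \<gamma> (\<lambda>\<zeta>. h \<zeta> * ((cnj \<zeta> - cnj z) / (\<zeta> - z)) ^ j / (cnj \<zeta> - cnj z))"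

text \<open>\<open>\<gamma>\<close> is the positively oriented boundary of the region.\<close>

definition B_op :: "(real \<Rightarrow> complex) \<Rightarrow> mode_seq \<Rightarrow> mode_seq" where
  "B_op \<gamma> v n z =
     1 / (2 * of_real pi * \<i>) * contour_integral \<gamma> (\<lambda>\<zeta>. v n \<zeta> / (\<zeta> - z)) +
     1 / (2 * of_real pi * \<i>) * (\<Sum>i. kernel_integral \<gamma> z (Suc i) (v (n + 2 * Suc i)))"

definition T_op :: "complex set \<Rightarrow> mode_seq \<Rightarrow> mode_seq" where
  "T_op R w n z =
     - (1 / of_real pi) *
     (\<Sum>j. \<integral>\<zeta>\<in>R. w (n + 2 * j) \<zeta> * (1 / (\<zeta> - z)) * ((cnj \<zeta> - cnj z) / (\<zeta> - z)) ^ j \<partial>lborel)"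

text \<open>
  \<open>\<gamma>\<close> parametrizes only the arc, from \<open>s\<close> to \<open>-s\<close>. The functional is evaluated at real points,
  where \<open>cnj z = z\<close>.
\<close>

definition F_fun :: "(real \<Rightarrow> complex) \<Rightarrow> complex set \<Rightarrow> mode_seq \<Rightarrow> mode_seq \<Rightarrow> nat \<Rightarrow> real \<Rightarrow> complex" where
  "F_fun \<gamma> R v w n x = (let z = complex_of_real x in
     1 / (\<i> * of_real pi) * contour_integral \<gamma> (\<lambda>\<zeta>. v n \<zeta> / (\<zeta> - z)) +
     1 / (\<i> * of_real pi) * (\<Sum>i. kernel_integral \<gamma> z (Suc i) (v (n + 2 * Suc i))) -
     2 / of_real pi *
     (\<Sum>j. \<integral>\<zeta>\<in>R. w (n + 2 * j) \<zeta> / (\<zeta> - z) * ((cnj \<zeta> - z) / (\<zeta> - z)) ^ j \<partial>lborel))"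

definition truncated_hilbert :: "real \<Rightarrow> (real \<Rightarrow> complex) \<Rightarrow> real \<Rightarrow> real \<Rightarrow> complex" where
  "truncated_hilbert s u x \<epsilon> =
     1 / of_real pi * (\<integral>y\<in>{y\<in>{-s<..<s}. \<epsilon> < \<bar>x - y\<bar>}. u y / of_real (x - y) \<partial>lebesgue)"

definition has_finite_hilbert :: "real \<Rightarrow> (real \<Rightarrow> complex) \<Rightarrow> real \<Rightarrow> complex \<Rightarrow> bool" where
  "has_finite_hilbert s u x h \<longleftrightarrow> (truncated_hilbert s u x \<longlongrightarrow> h) (at_right 0)"

definition in_L2 :: "real \<Rightarrow> (real \<Rightarrow> complex) \<Rightarrow> bool" where
  "in_L2 s u \<longleftrightarrow>
     u \<in> borel_measurable (lebesgue_on {-s<..<s}) \<and>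
     integrable (lebesgue_on {-s<..<s}) (\<lambda>x. (norm (u x))\<^sup>2)"

text \<open>The equation \<open>[I - i H_s] u = F\<close> at the point \<open>x\<close>, including existence of the principal value.\<close>

definition hilbert_equation_at :: "real \<Rightarrow> (real \<Rightarrow> complex) \<Rightarrow> (real \<Rightarrow> complex) \<Rightarrow> real \<Rightarrow> bool" where
  "hilbert_equation_at s u F x \<longleftrightarrow> (\<exists>h. has_finite_hilbert s u x h \<and> u x - \<i> * h = F x)"

text \<open>
  \<open>u\<close> satisfies the equation at every point of the interval, and every square integrable
  function satisfying it almost everywhere equals \<open>u\<close> almost everywhere.
\<close>

definition unique_L2_solution :: "real \<Rightarrow> (real \<Rightarrow> complex) \<Rightarrow> (real \<Rightarrow> complex) \<Rightarrow> bool" where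
  "unique_L2_solution s F u \<longleftrightarrow>
     in_L2 s u \<and> (\<forall>x\<in>{-s<..<s}. hilbert_equation_at s u F x) \<and>
     (\<forall>w. in_L2 s w \<and> (AE x in lebesgue_on {-s<..<s}. hilbert_equation_at s w F x) \<longrightarrow>
        (AE x in lebesgue_on {-s<..<s}. w x = u x))"

definition d_z :: "(complex \<Rightarrow> complex) \<Rightarrow> complex \<Rightarrow> complex" where
  "d_z u z = (frechet_derivative u (at z) 1 - \<i> * frechet_derivative u (at z) \<i>) / 2"

definition d_zbar :: "(complex \<Rightarrow> complex) \<Rightarrow> complex \<Rightarrow> complex" where
  "d_zbar u z = (frechet_derivative u (at z) 1 + \<i> * frechet_derivative u (at z) \<i>) / 2"

end

theory Submission
  imports Defs "HOL-Complex_Analysis.Complex_Analysis" "HOL-Real_Asymp.Real_Asymp"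
begin

text \<open>
  The idea. On \<open>closure \<Omega> \<times> S\<^sup>1\<close> the transport solutions are \<open>v\<^sup>k(z,\<theta>) = \<integral>\<^sub>0\<^sup>T t\<^sup>k \<theta> \<cdot> f(z - t\<theta>) dt\<close> for
  a fixed large \<open>T\<close>. This formula makes sense for every \<open>z\<close> in the plane, so every Fourier mode
  \<open>v_{-n}\<close> is the restriction of a \<open>C\<^sup>1\<close> function with compact support (\<open>C1c_ray_mode\<close>), and
  the transport equation turns into the Bukhgeim-Beltrami system
  \<open>dbar v_{-n} + d v_{-n-2} = w_{-n}\<close>: here \<open>w = 0\<close> for \<open>v\<^sup>0\<close> and \<open>n \<ge> 1\<close>, while
  \<open>w\<close> is the shift of \<open>v\<^sup>0\<close> for \<open>v\<^sup>1\<close> (\<open>ray_mode_transport\<close>). The formulas (3) and (4) are the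
  two equations of this system that involve \<open>v\<^sup>0_0\<close> and \<open>f\<close>, combined with \<open>v_n = cnj v_{-n}\<close>.

  The representation formulas follow from Green's formula, as the modes are smooth up to the boundary. Put \<open>\<omega> = cnj (\<zeta> - z) / (\<zeta> - z)\<close>. For \<open>j \<ge> 1\<close> the pair
  \<open>(\<omega>\<^sup>j / (\<zeta> - z), \<omega>\<^sup>j / cnj (\<zeta> - z))\<close> is closed, so Green's formula turns the \<open>j\<close>-th kernel integral
  of \<open>V_{-n-2j}\<close> into two area integrals of \<open>dbar V_{-n-2j}\<close> and \<open>d V_{-n-2j}\<close> (\<open>kernel_Suc_interior\<close>), and the
  system makes the sum over \<open>j\<close> telescope (\<open>kernel_sums\<close>). The remainder tends to \<open>0\<close> by Bessel's
  inequality. The Cauchy integral (\<open>j = 0\<close>) contributes \<open>V_{-n}(z)\<close> inside \<open>\<Omega>\<^sup>+\<close>. At a point of \<open>L\<close> it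
  contributes half of that and leaves a principal value over \<open>L\<close>, which is the finite Hilbert transform;
  the kernels with \<open>j \<ge> 1\<close> vanish on \<open>L\<close> when \<open>z\<close> is real (\<open>interior_formula\<close>, \<open>boundary_formula\<close>).

  Uniqueness of the square integrable solution is \<open>hilbert_equation_unique\<close>. If \<open>u = i H u\<close> on the interval, the Cauchy
  transform of \<open>u\<close> has weak boundary value \<open>0\<close> from one side of the line. Its \<open>L\<^sup>2\<close> norms on parallel lines
  are controlled by pairing it with \<open>u\<close> itself, so they tend to \<open>0\<close>; hence it vanishes in that half plane,
  all moments of \<open>u\<close> vanish, and \<open>u = 0\<close> as polynomials are dense.

  For the last claim the formulas are read as an algorithm: equal data on \<open>\<Lambda>\<close> give equal modes on \<open>\<Lambda>\<close>, then
  on \<open>L\<close> by uniqueness, then in \<open>\<Omega>\<^sup>+\<close> by the representation, and finally equal fields (\<open>field_determined\<close>).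
\<close>

lemmas integrable_dominated = Bochner_Integration.integrable_bound
lemmas lebesgue_integral_cong = Bochner_Integration.integral_cong

section \<open>Compactly supported functions of class C1\<close>

text \<open>The derivative is given by its two Wirtinger components: \<open>a\<close> is \<open>d g\<close> and \<open>b\<close> is \<open>dbar g\<close>.\<close>
definition C1c :: "(complex \<Rightarrow> complex) \<Rightarrow> (complex \<Rightarrow> complex) \<Rightarrow> (complex \<Rightarrow> complex) \<Rightarrow> bool" where
  "C1c g a b \<longleftrightarrow>
     (\<forall>z. (g has_derivative (\<lambda>h. a z * h + b z * cnj h)) (at z)) \<and>
     continuous_on UNIV a \<and> continuous_on UNIV b \<and>
     (\<exists>R>0. \<forall>z. R < norm z \<longrightarrow> g z = 0 \<and> a z = 0 \<and> b z = 0)"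

lemma C1c_derivatives_continuous: "C1c g a b \<Longrightarrow> continuous_on UNIV a" "C1c g a b \<Longrightarrow> continuous_on UNIV b"
  unfolding C1c_def by auto

lemma C1c_continuous: "C1c g a b \<Longrightarrow> continuous_on UNIV g"
  unfolding C1c_def continuous_on_eq_continuous_at[OF open_UNIV] using has_derivative_continuous by blast

lemma continuous_compact_support_bounded:
  fixes g :: "complex \<Rightarrow> complex"
  assumes "continuous_on UNIV g" "\<And>z. R < norm z \<Longrightarrow> g z = 0"
  obtains M where "M > 0" "\<And>z. norm (g z) \<le> M"
proof -
  have "compact (g ` cball 0 R)"
    using assms(1) by (intro compact_continuous_image) (auto intro: continuous_on_subset)
  then obtain M where "M > 0" "\<forall>x\<in>g ` cball 0 R. norm x \<le> M"
    using bounded_pos compact_imp_bounded by blast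
  moreover have "norm (g z) \<le> M" if "\<not> norm z \<le> R" for z using that assms(2)[of z] \<open>M > 0\<close> by auto
  ultimately show ?thesis using that[of M] by (metis image_eqI mem_cball_0)
qed

lemma continuous_compact_support_integrable:
  fixes g :: "complex \<Rightarrow> complex"
  assumes "continuous_on UNIV g" "\<And>z. R < norm z \<Longrightarrow> g z = 0"
  shows "integrable lborel g"
proof -
  have "integrable lborel (\<lambda>z. indicator (cball 0 R) z *\<^sub>R g z)"
    using assms(1) by (intro borel_integrable_compact) (auto intro: continuous_on_subset)
  moreover have "(\<lambda>z. indicator (cball 0 R) z *\<^sub>R g z) = g"
    using assms(2) by (force simp: indicator_def fun_eq_iff)
  ultimately show ?thesis by simp
qed

lemma C1c_bounds:
  assumes "C1c g a b"
  obtains R M where "R > 0" "M > 0" "\<And>z. R < norm z \<Longrightarrow> g z = 0 \<and> a z = 0 \<and> b z = 0"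
    "\<And>z. norm (g z) \<le> M" "\<And>z. norm (a z) \<le> M" "\<And>z. norm (b z) \<le> M"
proof -
  from assms obtain R where R: "R > 0" "\<And>z. R < norm z \<Longrightarrow> g z = 0 \<and> a z = 0 \<and> b z = 0"
    unfolding C1c_def by auto
  have c: "continuous_on UNIV a" "continuous_on UNIV b" using assms unfolding C1c_def by auto
  obtain M1 where "M1 > 0" "\<And>z. norm (g z) \<le> M1"
    using continuous_compact_support_bounded[OF C1c_continuous[OF assms], of R] R by metis
  moreover obtain M2 where "M2 > 0" "\<And>z. norm (a z) \<le> M2"
    using continuous_compact_support_bounded[OF c(1), of R] R by metis
  moreover obtain M3 where "M3 > 0" "\<And>z. norm (b z) \<le> M3"
    using continuous_compact_support_bounded[OF c(2), of R] R by metis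
  ultimately show ?thesis using that[of R "max M1 (max M2 M3)"] R by (auto simp: le_max_iff_disj)
qed

lemma C1c_integrable:
  assumes "C1c g a b" shows "integrable lborel g" "integrable lborel a" "integrable lborel b"
  using assms continuous_compact_support_integrable C1c_continuous[OF assms]
  unfolding C1c_def by meson+

lemma C1c_Lipschitz:
  assumes "C1c g a b"
  obtains M where "M > 0" "\<And>x y. norm (g x - g y) \<le> M * norm (x - y)"
proof -
  obtain R M where M: "M > 0" "\<And>z. norm (a z) \<le> M" "\<And>z. norm (b z) \<le> M"
    using C1c_bounds[OF assms] by metis
  have on: "onorm (\<lambda>h. a z * h + b z * cnj h) \<le> 2 * M" for z
  proof (rule onorm_le)
    fix h
    have "norm (a z * h + b z * cnj h) \<le> norm (a z) * norm h + norm (b z) * norm h"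
      by (metis complex_mod_cnj norm_mult norm_triangle_ineq)
    also have "\<dots> \<le> M * norm h + M * norm h"
      by (intro add_mono mult_right_mono M) auto
    finally show "norm (a z * h + b z * cnj h) \<le> 2 * M * norm h" by simp
  qed
  have "norm (g x - g y) \<le> (2 * M) * norm (x - y)" for x y
    using assms on unfolding C1c_def
    by (intro differentiable_bound[where S=UNIV and f'="\<lambda>z h. a z * h + b z * cnj h"]) auto
  with M(1) show ?thesis using that[of "2*M"] by auto
qed

lemma lborel_integral_translate:
  fixes f :: "complex \<Rightarrow> complex"
  assumes [measurable]: "f \<in> borel_measurable borel"
  shows "(\<integral>x. f (c + x) \<partial>lborel) = (\<integral>x. f x \<partial>lborel)"
proof -
  have "(\<integral>x. f x \<partial>lborel) = (\<integral>x. f x \<partial>(distr lborel borel ((+) c)))"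
    by (simp add: lborel_distr_plus)
  also have "\<dots> = (\<integral>x. f (c + x) \<partial>lborel)" by (subst integral_distr) auto
  finally show ?thesis by simp
qed

text \<open>The integral of \<open>g\<close> is invariant under translations. Difference quotients are bounded by the Lipschitz constant and supported in a fixed ball, so the derivative may be taken under the integral.\<close>
lemma C1c_integral_derivative:
  assumes "C1c g a b"
  shows "(\<integral>z. a z * h + b z * cnj h \<partial>lborel) = 0"
proof -
  obtain R M0 where R: "R > 0" "\<And>z. R < norm z \<Longrightarrow> g z = 0 \<and> a z = 0 \<and> b z = 0"
    using C1c_bounds[OF assms] by metis
  obtain M where M: "M > 0" "\<And>x y. norm (g x - g y) \<le> M * norm (x - y)"
    using C1c_Lipschitz[OF assms] by metis
  have cg: "continuous_on UNIV g" by (rule C1c_continuous[OF assms])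
  then have [measurable]: "g \<in> borel_measurable borel" by (rule borel_measurable_continuous_onI)
  have [measurable]: "a \<in> borel_measurable borel" "b \<in> borel_measurable borel"
    using assms unfolding C1c_def by (auto intro: borel_measurable_continuous_onI)
  define q where "q n z = of_nat (Suc n) * (g (h / of_nat (Suc n) + z) - g z)" for n z
  have ig: "integrable lborel g" by (rule C1c_integrable[OF assms])
  have igt: "integrable lborel (\<lambda>z. g (c + z))" for c
  proof (rule continuous_compact_support_integrable[where R="R + norm c"])
    show "continuous_on UNIV (\<lambda>z. g (c + z))"
      by (intro continuous_on_compose2[OF cg] continuous_intros) auto
    fix z :: complex assume "R + norm c < norm z"
    then have "R < norm (c + z)" using norm_triangle_ineq2[of z "-c"] by (simp add: add.commute)
    then show "g (c + z) = 0" using R by auto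
  qed
  have q0: "(\<integral>z. q n z \<partial>lborel) = 0" for n
    unfolding q_def using ig igt by (simp add: lborel_integral_translate)
  have "(\<lambda>n. \<integral>z. q n z \<partial>lborel) \<longlonglongrightarrow> (\<integral>z. a z * h + b z * cnj h \<partial>lborel)"
  proof (rule integral_dominated_convergence[where w="\<lambda>z. indicator (cball 0 (R + norm h)) z * (M * norm h)"])
    show "AE z in lborel. (\<lambda>n. q n z) \<longlonglongrightarrow> a z * h + b z * cnj h"
    proof (rule AE_I2)
      fix z
      have d: "(g has_derivative (\<lambda>h. a z * h + b z * cnj h)) (at z)"
        using assms unfolding C1c_def by auto
      have "((\<lambda>t. g (z + of_real t * h)) has_vector_derivative (a z * h + b z * cnj h)) (at 0)"
      proof -
        have "((\<lambda>t::real. z + of_real t * h) has_derivative (\<lambda>t. of_real t * h)) (at 0)"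
          by (auto intro!: derivative_eq_intros)
        from has_derivative_compose[OF this, of g "\<lambda>h. a z * h + b z * cnj h"] d
        have "((\<lambda>t. g (z + of_real t * h)) has_derivative (\<lambda>t. a z * (of_real t * h) + b z * cnj (of_real t * h))) (at 0)"
          by simp
        then show ?thesis unfolding has_vector_derivative_def
          by (rule has_derivative_eq_rhs) (auto simp: scaleR_conv_of_real algebra_simps)
      qed
      then have l: "((\<lambda>t. (g (z + of_real t * h) - g z) /\<^sub>R t) \<longlongrightarrow> (a z * h + b z * cnj h)) (at 0)"
        unfolding has_vector_derivative_def has_derivative_at
      proof (elim conjE)
        assume *: "(\<lambda>t. norm (g (z + of_real (0 + t) * h) - g (z + of_real 0 * h) - t *\<^sub>R (a z * h + b z * cnj h)) / norm t) \<midarrow>0\<rightarrow> 0"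
        have "((\<lambda>t. norm ((g (z + of_real t * h) - g z) /\<^sub>R t - (a z * h + b z * cnj h))) \<longlongrightarrow> 0) (at 0)"
        proof (rule Lim_transform_eventually[OF *])
          have "norm (g (z + of_real (0 + t) * h) - g (z + of_real 0 * h) - t *\<^sub>R (a z * h + b z * cnj h)) / norm t
             = norm ((g (z + of_real t * h) - g z) /\<^sub>R t - (a z * h + b z * cnj h))" if "t \<noteq> 0" for t :: real
          proof -
            have "norm (g (z + of_real (0 + t) * h) - g (z + of_real 0 * h) - t *\<^sub>R (a z * h + b z * cnj h)) / norm t =
              norm ((g (z + of_real t * h) - g z - t *\<^sub>R (a z * h + b z * cnj h)) /\<^sub>R t)" by (simp add: divide_inverse)
            also have "(g (z + of_real t * h) - g z - t *\<^sub>R (a z * h + b z * cnj h)) /\<^sub>R t = (g (z + of_real t * h) - g z) /\<^sub>R t - (a z * h + b z * cnj h)"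
              using that by (simp add: scaleR_diff_right)
            finally show ?thesis .
          qed
          then show "\<forall>\<^sub>F t in at 0. norm (g (z + of_real (0 + t) * h) - g (z + of_real 0 * h) - t *\<^sub>R (a z * h + b z * cnj h)) / norm t
             = norm ((g (z + of_real t * h) - g z) /\<^sub>R t - (a z * h + b z * cnj h))"
            by (auto simp: eventually_at_filter)
        qed
        from LIM_zero_cancel[OF tendsto_norm_zero_cancel[OF this]] show ?thesis .
      qed
      have "(\<lambda>n. 1 / real (Suc n)) \<longlonglongrightarrow> 0" by (rule LIMSEQ_Suc[OF lim_1_over_n])
      then have "filterlim (\<lambda>n. 1 / real (Suc n)) (at 0) sequentially"
        by (auto simp: filterlim_at)
      from filterlim_compose[OF l this] show "(\<lambda>n. q n z) \<longlonglongrightarrow> a z * h + b z * cnj h"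
        unfolding q_def by (simp add: scaleR_conv_of_real algebra_simps divide_inverse)
    qed
    show "AE z in lborel. norm (q n z) \<le> indicator (cball 0 (R + norm h)) z * (M * norm h)" for n
    proof (rule AE_I2)
      fix z
      have hn: "norm (h / of_nat (Suc n)) \<le> norm h"
        by (simp add: norm_divide divide_le_eq mult_le_cancel_left1 del: of_nat_Suc)
      show "norm (q n z) \<le> indicator (cball 0 (R + norm h)) z * (M * norm h)"
      proof (cases "norm z \<le> R + norm h")
        case True
        have "norm (q n z) \<le> real (Suc n) * (M * norm (h / of_nat (Suc n)))"
          unfolding q_def norm_mult using M(2)[of "h / of_nat (Suc n) + z" z]
          by (simp add: mult_left_mono del: of_nat_Suc)
        also have "\<dots> = M * norm h" by (simp add: norm_divide del: of_nat_Suc)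
        finally show ?thesis using True by simp
      next
        case False
        then have "R < norm z" using norm_ge_zero[of h] by linarith
        moreover have "R < norm (h / of_nat (Suc n) + z)"
          using False norm_triangle_ineq2[of z "- (h / of_nat (Suc n))"] hn
          by (auto simp: add.commute simp del: of_nat_Suc)
        ultimately show ?thesis using R M unfolding q_def by auto
      qed
    qed
    have "integrable lborel (\<lambda>z. indicator (cball 0 (R + norm h)) z *\<^sub>R (M * norm h))"
      by (intro borel_integrable_compact) (auto intro: continuous_intros)
    then show "integrable lborel (\<lambda>z. indicator (cball (0::complex) (R + norm h)) z * (M * norm h))" by simp
    show "(\<lambda>z. q n z) \<in> borel_measurable lborel" for n unfolding q_def by measurable
    show "(\<lambda>z. a z * h + b z * cnj h) \<in> borel_measurable lborel" by measurable
  qed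
  then show ?thesis unfolding q0 by (simp add: LIMSEQ_const_iff)
qed

lemma C1c_integral_zero:
  assumes "C1c g a b" shows "(\<integral>z. a z \<partial>lborel) = 0" "(\<integral>z. b z \<partial>lborel) = 0"
proof -
  note i = C1c_integrable[OF assms]
  have "(\<integral>z. a z \<partial>lborel) + (\<integral>z. b z \<partial>lborel) = 0"
    using C1c_integral_derivative[OF assms, of 1] i by simp
  moreover have "(\<integral>z. a z \<partial>lborel) * \<i> - (\<integral>z. b z \<partial>lborel) * \<i> = 0"
    using C1c_integral_derivative[OF assms, of \<i>] i by simp
  ultimately show "(\<integral>z. a z \<partial>lborel) = 0" "(\<integral>z. b z \<partial>lborel) = 0"
    by (auto simp: algebra_simps add_eq_0_iff)
qed

text \<open>A radial integral over the plane, computed from the area of discs instead of polar coordinates.\<close>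
lemma nn_integral_layer_cake:
  fixes k :: "real \<Rightarrow> ennreal"
  assumes [measurable]: "k \<in> borel_measurable borel"
  shows "(\<integral>\<^sup>+w. (\<integral>\<^sup>+t. k t * indicator {norm (w::complex)<..} t \<partial>lborel) \<partial>lborel) =
         (\<integral>\<^sup>+t. k t * ennreal (pi * t\<^sup>2) * indicator {0<..} t \<partial>lborel)"
proof -
  have "(\<integral>\<^sup>+w. (\<integral>\<^sup>+t. k t * indicator {norm (w::complex)<..} t \<partial>lborel) \<partial>lborel) =
      (\<integral>\<^sup>+t. (\<integral>\<^sup>+w. k t * indicator {norm (w::complex)<..} t \<partial>lborel) \<partial>lborel)"
  proof (rule lborel_pair.Fubini')
    have "(\<lambda>(t, w). k t * indicator {norm (w::complex)<..} t) = 
      (\<lambda>x. k (fst x) * (if norm (snd x :: complex) < fst x then 1 else 0))"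
      by (auto simp: fun_eq_iff indicator_def)
    moreover have "(\<lambda>x. k (fst x) * (if norm (snd x :: complex) < fst x then 1 else 0)) \<in> borel_measurable (lborel \<Otimes>\<^sub>M lborel)"
      by measurable
    ultimately show "(\<lambda>(t, w). k t * indicator {norm (w::complex)<..} t) \<in> borel_measurable (lborel \<Otimes>\<^sub>M lborel)"
      by simp
  qed
  also have "\<dots> = (\<integral>\<^sup>+t. k t * ennreal (pi * t\<^sup>2) * indicator {0<..} t \<partial>lborel)"
  proof (rule nn_integral_cong)
    fix t :: real
    have "(\<integral>\<^sup>+w. k t * indicator {norm (w::complex)<..} t \<partial>lborel) =
        (\<integral>\<^sup>+w. k t * indicator (ball (0::complex) t) w \<partial>lborel)"
      by (intro nn_integral_cong) (auto simp: indicator_def)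
    also have "\<dots> = k t * emeasure lborel (ball (0::complex) t)"
      by (subst nn_integral_cmult) (auto intro!: borel_measurable_indicator)
    also have "\<dots> = k t * ennreal (pi * t\<^sup>2) * indicator {0<..} t"
      by (cases "t > 0") (auto simp: emeasure_ball unit_ball_vol_2 ball_empty)
    finally show "(\<integral>\<^sup>+w. k t * indicator {norm (w::complex)<..} t \<partial>lborel) = k t * ennreal (pi * t\<^sup>2) * indicator {0<..} t" .
  qed
  finally show ?thesis .
qed


text \<open>The mass of the approximate identity that arises from regularizing \<open>1 / w\<close>.\<close>
lemma integral_Cauchy_kernel:
  "integrable lborel (\<lambda>w::complex. 1 / (1 + (norm w)\<^sup>2)\<^sup>2)"
  "(\<integral>w. 1 / (1 + (norm (w::complex))\<^sup>2)\<^sup>2 \<partial>lborel) = pi"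
proof -
  define k where "k t = ennreal (if 0 \<le> t then 4 * t / (1 + t\<^sup>2) ^ 3 else 0)" for t :: real
  have km[measurable]: "k \<in> borel_measurable borel" unfolding k_def by measurable
  have pos: "1 + t\<^sup>2 > 0" for t :: real by (smt (verit) zero_le_power2)
  have ne: "1 + t\<^sup>2 \<noteq> 0" for t :: real using pos[of t] by linarith
  have in1: "(\<integral>\<^sup>+t. k t * indicator {r<..} t \<partial>lborel) = ennreal (1 / (1 + r\<^sup>2)\<^sup>2)" if r: "r \<ge> 0" for r
  proof -
    have "(\<integral>\<^sup>+t. k t * indicator {r<..} t \<partial>lborel) = (\<integral>\<^sup>+t. ennreal (4 * t / (1 + t\<^sup>2) ^ 3) * indicator {r..} t \<partial>lborel)"
      using r by (intro nn_integral_cong_AE AE_I[where N="{r}"]) (auto simp: k_def indicator_def)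
    also have "\<dots> = 0 - (- 1 / (1 + r\<^sup>2)\<^sup>2)"
    proof (rule nn_integral_FTC_atLeast)
      show "((\<lambda>t::real. - 1 / (1 + t\<^sup>2)\<^sup>2) \<longlongrightarrow> 0) at_top" by real_asymp
      show "DERIV (\<lambda>t. - 1 / (1 + t\<^sup>2)\<^sup>2) t :> 4 * t / (1 + t\<^sup>2) ^ 3" for t :: real
      proof -
        have "4 * t / x ^ 3 = 2 * (2 * t * x) / (x\<^sup>2 * x\<^sup>2)" if "x \<noteq> 0" for x :: real
          using that by (simp add: field_simps eval_nat_numeral)
        from this[OF ne[of t]] show ?thesis
          using ne[of t] by (auto intro!: derivative_eq_intros)
      qed
    qed (use r pos in \<open>auto intro!: divide_nonneg_pos\<close>)
    finally show ?thesis by simp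
  qed
  have "(\<integral>\<^sup>+w. ennreal (1 / (1 + (norm (w::complex))\<^sup>2)\<^sup>2) \<partial>lborel) = (\<integral>\<^sup>+t. k t * ennreal (pi * t\<^sup>2) * indicator {0<..} t \<partial>lborel)"
    using nn_integral_layer_cake[OF km] in1 by simp
  also have "\<dots> = (\<integral>\<^sup>+t. ennreal (4 * pi * t ^ 3 / (1 + t\<^sup>2) ^ 3) * indicator {0..} t \<partial>lborel)"
    by (intro nn_integral_cong_AE AE_I[where N="{0}"])
       (auto simp: k_def indicator_def ennreal_mult'[symmetric] power2_eq_square power3_eq_cube split: if_splits intro!: arg_cong[where f=ennreal])
  also have "\<dots> = pi - (pi * 0 ^ 4 / (1 + 0\<^sup>2)\<^sup>2)"
  proof (rule nn_integral_FTC_atLeast)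
    show "((\<lambda>t::real. pi * t ^ 4 / (1 + t\<^sup>2)\<^sup>2) \<longlongrightarrow> pi) at_top" by real_asymp
    show "DERIV (\<lambda>t. pi * t ^ 4 / (1 + t\<^sup>2)\<^sup>2) t :> 4 * pi * t ^ 3 / (1 + t\<^sup>2) ^ 3" for t :: real
    proof -
      have "4 * pi * t ^ 3 / x ^ 3 = (pi * (4 * t ^ 3) * x\<^sup>2 - pi * t ^ 4 * (2 * (2 * t * x))) / (x\<^sup>2 * x\<^sup>2)"
        if "x \<noteq> 0" "x = 1 + t\<^sup>2" for x :: real
      proof -
        have "pi * (4 * t ^ 3) * x\<^sup>2 - pi * t ^ 4 * (2 * (2 * t * x)) = 4 * pi * t ^ 3 * x * (x - t\<^sup>2)"
          by (simp add: algebra_simps eval_nat_numeral)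
        also have "x - t\<^sup>2 = 1" using that by simp
        finally show ?thesis using that(1) by (simp add: field_simps eval_nat_numeral)
      qed
      from this[OF ne[of t] refl] show ?thesis
        using ne[of t] by (auto intro!: derivative_eq_intros)
    qed
  qed (use pos in \<open>auto intro!: divide_nonneg_pos\<close>)
  finally have *: "(\<integral>\<^sup>+w. ennreal (1 / (1 + (norm (w::complex))\<^sup>2)\<^sup>2) \<partial>lborel) = ennreal pi" by simp
  have hb: "has_bochner_integral lborel (\<lambda>w::complex. 1 / (1 + (norm w)\<^sup>2)\<^sup>2) pi"
    by (rule has_bochner_integral_nn_integral) (use * in auto)
  then show "integrable lborel (\<lambda>w::complex. 1 / (1 + (norm w)\<^sup>2)\<^sup>2)"
    "(\<integral>w. 1 / (1 + (norm (w::complex))\<^sup>2)\<^sup>2 \<partial>lborel) = pi"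
    by (auto simp: has_bochner_integral_iff)
qed

lemma nn_integral_inverse_norm:
  fixes c :: complex
  assumes R: "R > 0"
  shows "(\<integral>\<^sup>+w. ennreal (1 / norm (w - c)) * indicator (ball c R) w \<partial>lborel) \<le> ennreal (2 * pi * R)"
proof -
  define k where "k t = ennreal (if 0 < t \<and> t < R then 1 / t\<^sup>2 else 0)" for t :: real
  have km[measurable]: "k \<in> borel_measurable borel" unfolding k_def by measurable
  have in1: "(\<integral>\<^sup>+t. k t * indicator {r<..} t \<partial>lborel) = ennreal (1 / r - 1 / R)" if r: "r > 0" "r < R" for r
  proof -
    have "(\<integral>\<^sup>+t. k t * indicator {r<..} t \<partial>lborel) = (\<integral>\<^sup>+t. ennreal (1 / t\<^sup>2) * indicator {r..R} t \<partial>lborel)"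
      using r by (intro nn_integral_cong_AE AE_I[where N="{r,R}"]) (auto simp: k_def indicator_def emeasure_lborel_countable)
    also have "\<dots> = (- 1 / R) - (- 1 / r)"
      by (rule nn_integral_FTC_Icc) (use r in \<open>auto intro!: derivative_eq_intros simp: power2_eq_square\<close>)
    finally show ?thesis by simp
  qed
  have "(\<integral>\<^sup>+w. ennreal (1 / norm (w - c)) * indicator (ball c R) w \<partial>lborel) =
     (\<integral>\<^sup>+w. ennreal (1 / norm (w - c)) * indicator (ball c R) w \<partial>distr lborel borel ((+) c))"
    by (simp add: lborel_distr_plus)
  also have "\<dots> = (\<integral>\<^sup>+w. ennreal (1 / norm (w::complex)) * indicator (ball 0 R) w \<partial>lborel)"
    by (subst nn_integral_distr) (auto intro!: nn_integral_cong simp: indicator_def dist_norm)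
  also have "\<dots> \<le> (\<integral>\<^sup>+w. (\<integral>\<^sup>+t. k t * indicator {norm (w::complex)<..} t \<partial>lborel) + ennreal (1 / R) * indicator (ball 0 R) w \<partial>lborel)"
  proof (rule nn_integral_mono_AE, rule AE_I[where N="{0}"])
    show "{w \<in> space lborel. \<not> ennreal (1 / norm w) * indicator (ball 0 R) w \<le> (\<integral>\<^sup>+t. k t * indicator {norm (w::complex)<..} t \<partial>lborel) + ennreal (1 / R) * indicator (ball 0 R) w} \<subseteq> {0}"
    proof clarsimp
      fix w :: complex assume w: "\<not> ennreal (1 / norm w) * indicator (ball 0 R) w \<le> (\<integral>\<^sup>+t. k t * indicator {norm w<..} t \<partial>lborel) + ennreal (1 / R) * indicator (ball 0 R) w"
      show "w = 0"
      proof (rule ccontr)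
        assume "w \<noteq> 0"
        with w have "norm w < R" by (cases "norm w < R") (auto simp: indicator_def)
        then have "(\<integral>\<^sup>+t. k t * indicator {norm w<..} t \<partial>lborel) + ennreal (1 / R) * indicator (ball 0 R) w = ennreal (1 / norm w)"
          using in1[of "norm w"] \<open>w \<noteq> 0\<close> R by (simp add: ennreal_plus[symmetric] frac_le del: ennreal_plus)
        with w \<open>norm w < R\<close> show False by simp
      qed
    qed
  qed auto
  also have "\<dots> = (\<integral>\<^sup>+w. (\<integral>\<^sup>+t. k t * indicator {norm (w::complex)<..} t \<partial>lborel) \<partial>lborel) + ennreal (1 / R) * emeasure lborel (ball (0::complex) R)"
  proof -
    have "(\<lambda>w::complex. \<integral>\<^sup>+t. k t * indicator {norm w<..} t \<partial>lborel) = (\<lambda>w::complex. \<integral>\<^sup>+t. k t * (if norm w < t then 1 else 0) \<partial>lborel)"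
      by (auto simp: fun_eq_iff indicator_def intro!: nn_integral_cong)
    moreover have "(\<lambda>w::complex. \<integral>\<^sup>+t. k t * (if norm w < t then 1 else 0) \<partial>lborel) \<in> borel_measurable lborel" by measurable
    moreover have "(\<lambda>w::complex. ennreal (1 / R) * indicator (ball 0 R) w) \<in> borel_measurable lborel"
      by (intro borel_measurable_times_ennreal borel_measurable_const borel_measurable_indicator) auto
    ultimately show ?thesis by (subst nn_integral_add) (auto simp: nn_integral_cmult_indicator)
  qed
  also have "(\<integral>\<^sup>+w. (\<integral>\<^sup>+t. k t * indicator {norm (w::complex)<..} t \<partial>lborel) \<partial>lborel) = (\<integral>\<^sup>+t. ennreal pi * indicator {0<..<R} t \<partial>lborel)"
    unfolding nn_integral_layer_cake[OF km]
    by (intro nn_integral_cong) (auto simp: k_def indicator_def ennreal_mult'[symmetric])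
  also have "\<dots> = ennreal (pi * R)" using R by (simp add: nn_integral_cmult ennreal_mult')
  also have "ennreal (1 / R) * emeasure lborel (ball (0::complex) R) = ennreal (pi * R)"
    using R by (simp add: emeasure_ball unit_ball_vol_2 ennreal_mult'[symmetric] power2_eq_square)
  also have "ennreal (pi * R) + ennreal (pi * R) = ennreal (2 * pi * R)"
    using R by (simp add: ennreal_plus[symmetric] del: ennreal_plus)
  finally show ?thesis .
qed

lemma inverse_norm_integrable:
  fixes c :: complex
  assumes "bounded S" "S \<in> sets borel"
  shows "set_integrable lborel S (\<lambda>w. 1 / norm (w - c))"
proof -
  obtain R where R: "R > 0" "S \<subseteq> ball c R"
    using bounded_subset_ballD[OF assms(1)] by blast
  have [measurable]: "S \<in> sets borel" by fact
  have "(\<integral>\<^sup>+w. ennreal (norm (indicat_real S w *\<^sub>R (1 / norm (w - c)))) \<partial>lborel) \<le> (\<integral>\<^sup>+w. ennreal (1 / norm (w - c)) * indicator (ball c R) w \<partial>lborel)"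
    using R(2) by (intro nn_integral_mono) (auto simp: indicator_def)
  also have "\<dots> \<le> ennreal (2 * pi * R)" by (rule nn_integral_inverse_norm[OF R(1)])
  finally show ?thesis unfolding set_integrable_def
    by (intro integrableI_bounded) (auto simp: le_less_trans)
qed

section \<open>Wirtinger calculus and the Pompeiu formula\<close>

text \<open>\<open>a\<close> and \<open>b\<close> are the values of \<open>d g\<close> and \<open>dbar g\<close> at the point \<open>z\<close>. The rules below are the usual calculus of these operators.\<close>
definition wirt :: "(complex \<Rightarrow> complex) \<Rightarrow> complex \<Rightarrow> complex \<Rightarrow> complex \<Rightarrow> bool" where
  "wirt g a b z \<longleftrightarrow> (g has_derivative (\<lambda>h. a * h + b * cnj h)) (at z)"

lemma wirt_eq: "wirt g a b z \<Longrightarrow> a = a' \<Longrightarrow> b = b' \<Longrightarrow> wirt g a' b' z" by simp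

lemma wirt_const: "wirt (\<lambda>_. c) 0 0 z"
  unfolding wirt_def by (auto intro!: derivative_eq_intros)

lemma wirt_diff_const: "wirt (\<lambda>w. w - c) 1 0 z"
  unfolding wirt_def by (auto intro!: derivative_eq_intros)

lemma wirt_cnj: "wirt g a b z \<Longrightarrow> wirt (\<lambda>w. cnj (g w)) (cnj b) (cnj a) z"
  unfolding wirt_def by (auto intro!: derivative_eq_intros simp: algebra_simps)

lemma wirt_add: "wirt g a b z \<Longrightarrow> wirt g' a' b' z \<Longrightarrow> wirt (\<lambda>w. g w + g' w) (a + a') (b + b') z"
  unfolding wirt_def by (auto intro!: derivative_eq_intros simp: algebra_simps)

lemma wirt_mult: "wirt g a b z \<Longrightarrow> wirt g' a' b' z \<Longrightarrow>
   wirt (\<lambda>w. g w * g' w) (a * g' z + g z * a') (b * g' z + g z * b') z"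
  unfolding wirt_def by (auto intro!: derivative_eq_intros simp: algebra_simps)

lemma wirt_cmult: "wirt g a b z \<Longrightarrow> wirt (\<lambda>w. c * g w) (c * a) (c * b) z"
  unfolding wirt_def by (auto intro!: derivative_eq_intros simp: algebra_simps)

lemma wirt_power: "wirt g a b z \<Longrightarrow> wirt (\<lambda>w. g w ^ n) (of_nat n * g z ^ (n - 1) * a) (of_nat n * g z ^ (n - 1) * b) z"
  unfolding wirt_def by (auto intro!: derivative_eq_intros simp: algebra_simps)

lemma wirt_divide_power:
  assumes "wirt g a b z" "wirt q a' b' z" "q z \<noteq> 0"
  shows "wirt (\<lambda>w. g w / q w ^ m)
     ((a * q z - of_nat m * g z * a') / q z ^ Suc m) ((b * q z - of_nat m * g z * b') / q z ^ Suc m) z"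
proof -
  have "((\<lambda>w. g w * inverse (q w ^ m)) has_derivative
     (\<lambda>h. g z * - (inverse (q z ^ m) * (of_nat m * (a' * h + b' * cnj h) * q z ^ (m - 1)) * inverse (q z ^ m)) + (a * h + b * cnj h) * inverse (q z ^ m))) (at z)"
    using assms unfolding wirt_def by (auto intro!: derivative_eq_intros)
  moreover have "g z * - (inverse (q z ^ m) * (of_nat m * (a' * h + b' * cnj h) * q z ^ (m - 1)) * inverse (q z ^ m)) + (a * h + b * cnj h) * inverse (q z ^ m)
    = (a * q z - of_nat m * g z * a') / q z ^ Suc m * h + (b * q z - of_nat m * g z * b') / q z ^ Suc m * cnj h" for h
    using assms(3) by (cases m) (auto simp: field_simps)
  ultimately show ?thesis unfolding wirt_def by (simp add: divide_inverse)
qed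

text \<open>The squared distance \<open>|w|\<^sup>2 + e\<^sup>2\<close>, written so that it can be differentiated with respect to \<open>w\<close> and \<open>cnj w\<close>.\<close>
definition qq :: "real \<Rightarrow> complex \<Rightarrow> complex" where "qq e w = w * cnj w + of_real (e\<^sup>2)"

lemma qq_eq: "qq e w = of_real ((norm w)\<^sup>2 + e\<^sup>2)"
  unfolding qq_def by (simp add: complex_norm_square[symmetric])

lemma qq_pos: "e > 0 \<Longrightarrow> (norm w)\<^sup>2 + e\<^sup>2 > 0" by (simp add: add_nonneg_pos)

lemma qq_nonzero: "e > 0 \<Longrightarrow> qq e w \<noteq> 0"
  unfolding qq_eq using qq_pos[of e w] by (metis less_irrefl of_real_eq_0_iff)

lemma norm_qq: "norm (qq e w) = (norm w)\<^sup>2 + e\<^sup>2"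
  unfolding qq_eq norm_of_real by simp

lemma wirt_qq: "wirt (\<lambda>w. qq e (w - c)) (cnj (z - c)) (z - c) z"
  unfolding qq_def
  by (rule wirt_eq[OF wirt_add[OF wirt_mult[OF wirt_diff_const wirt_cnj[OF wirt_diff_const]] wirt_const]]) auto

text \<open>All kernels used below are combinations of these smooth monomials in \<open>w\<close>, \<open>cnj w\<close> and \<open>1 / (|w|\<^sup>2 + e\<^sup>2)\<close>; \<open>rk_d\<close> and \<open>rk_db\<close> are their Wirtinger derivatives. The regularized Cauchy kernel is \<open>rk e 0 1 1 w = cnj w / (|w|\<^sup>2 + e\<^sup>2)\<close>.\<close>
definition rk :: "real \<Rightarrow> nat \<Rightarrow> nat \<Rightarrow> nat \<Rightarrow> complex \<Rightarrow> complex" where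
  "rk e p r m w = w ^ p * cnj w ^ r / qq e w ^ m"
definition rk_d :: "real \<Rightarrow> nat \<Rightarrow> nat \<Rightarrow> nat \<Rightarrow> complex \<Rightarrow> complex" where
  "rk_d e p r m w = (of_nat p * w ^ (p - 1) * cnj w ^ r * qq e w - of_nat m * (w ^ p * cnj w ^ r) * cnj w) / qq e w ^ Suc m"
definition rk_db :: "real \<Rightarrow> nat \<Rightarrow> nat \<Rightarrow> nat \<Rightarrow> complex \<Rightarrow> complex" where
  "rk_db e p r m w = (of_nat r * w ^ p * cnj w ^ (r - 1) * qq e w - of_nat m * (w ^ p * cnj w ^ r) * w) / qq e w ^ Suc m"

lemma wirt_rk: "e > 0 \<Longrightarrow> wirt (\<lambda>w. rk e p r m (w - c)) (rk_d e p r m (z - c)) (rk_db e p r m (z - c)) z"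
  unfolding rk_def rk_d_def rk_db_def
  by (rule wirt_eq[OF wirt_divide_power[OF wirt_mult[OF wirt_power[OF wirt_diff_const] wirt_power[OF wirt_cnj[OF wirt_diff_const]]] wirt_qq qq_nonzero]])
     (auto simp: algebra_simps)

lemma continuous_rk [continuous_intros]:
  assumes "e > 0"
  shows "continuous_on UNIV (\<lambda>w. rk e p r m (w - c))"
    "continuous_on UNIV (\<lambda>w. rk_d e p r m (w - c))"
    "continuous_on UNIV (\<lambda>w. rk_db e p r m (w - c))"
proof -
  have [continuous_intros]: "continuous_on UNIV (\<lambda>w. qq e (w - c))" unfolding qq_def by (intro continuous_intros)
  show "continuous_on UNIV (\<lambda>w. rk e p r m (w - c))"
    "continuous_on UNIV (\<lambda>w. rk_d e p r m (w - c))"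
    "continuous_on UNIV (\<lambda>w. rk_db e p r m (w - c))"
    using qq_nonzero[OF assms] unfolding rk_def rk_d_def rk_db_def
    by (auto intro!: continuous_intros)
qed

text \<open>As \<open>C1c\<close>, without the condition on the support.\<close>
definition C1 :: "(complex \<Rightarrow> complex) \<Rightarrow> (complex \<Rightarrow> complex) \<Rightarrow> (complex \<Rightarrow> complex) \<Rightarrow> bool" where
  "C1 K a b \<longleftrightarrow> (\<forall>z. wirt K (a z) (b z) z) \<and> continuous_on UNIV a \<and> continuous_on UNIV b"

lemma C1_rk: "e > 0 \<Longrightarrow> C1 (\<lambda>w. rk e p r m (w - c)) (\<lambda>w. rk_d e p r m (w - c)) (\<lambda>w. rk_db e p r m (w - c))"
  unfolding C1_def using wirt_rk continuous_rk by auto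

lemma C1_continuous: "C1 g a b \<Longrightarrow> continuous_on UNIV g"
  unfolding C1_def wirt_def continuous_on_eq_continuous_at[OF open_UNIV] using has_derivative_continuous by blast

lemma C1_add: "C1 g a b \<Longrightarrow> C1 g' a' b' \<Longrightarrow> C1 (\<lambda>w. g w + g' w) (\<lambda>w. a w + a' w) (\<lambda>w. b w + b' w)"
  unfolding C1_def using wirt_add by (auto intro!: continuous_intros)

lemma C1_cmult: "C1 g a b \<Longrightarrow> C1 (\<lambda>w. c * g w) (\<lambda>w. c * a w) (\<lambda>w. c * b w)"
  unfolding C1_def using wirt_cmult by (auto intro!: continuous_intros)

lemma C1c_mult:
  assumes g: "C1c g a b" and K: "C1 K a' b'"
  shows "C1c (\<lambda>w. g w * K w) (\<lambda>w. a w * K w + g w * a' w) (\<lambda>w. b w * K w + g w * b' w)"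
proof -
  have "wirt g (a z) (b z) z" for z using g unfolding C1c_def wirt_def by auto
  moreover have "wirt K (a' z) (b' z) z" for z using K unfolding C1_def by auto
  ultimately have "wirt (\<lambda>w. g w * K w) (a z * K z + g z * a' z) (b z * K z + g z * b' z) z" for z
    by (rule wirt_mult)
  moreover note C1_continuous[OF K] C1c_continuous[OF g]
  moreover have "\<exists>R>0. \<forall>z. R < norm z \<longrightarrow> g z * K z = 0 \<and> a z * K z + g z * a' z = 0 \<and> b z * K z + g z * b' z = 0"
    using g unfolding C1c_def by (metis add_0 mult_zero_left)
  ultimately show ?thesis using g K
    unfolding C1c_def C1_def wirt_def by (auto intro!: continuous_intros)
qed

lemma C1c_cnj: "C1c g a b \<Longrightarrow> C1c (\<lambda>w. cnj (g w)) (\<lambda>w. cnj (b w)) (\<lambda>w. cnj (a w))"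
  using wirt_cnj[of g] unfolding C1c_def wirt_def by (auto intro!: continuous_intros)

text \<open>Thus \<open>dbar\<close> of the regularized Cauchy kernel is \<open>\<pi>\<close> times an approximate identity.\<close>
lemma cauchy_reg_db: "e > 0 \<Longrightarrow> rk_db e 0 1 1 w = of_real (e\<^sup>2 / ((norm w)\<^sup>2 + e\<^sup>2)\<^sup>2)"
proof -
  have "rk_db e 0 1 1 w = (qq e w - cnj w * w) / (qq e w)\<^sup>2"
    unfolding rk_db_def by (simp add: power2_eq_square)
  also have "qq e w - cnj w * w = of_real (e\<^sup>2)" unfolding qq_def by (simp add: mult.commute)
  finally show ?thesis unfolding qq_eq by simp
qed

lemma norm_cauchy_reg: "norm (rk e 0 1 1 w) \<le> 1 / norm w"
proof (cases "w = 0")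
  case False
  have "norm (rk e 0 1 1 w) = norm w / ((norm w)\<^sup>2 + e\<^sup>2)" 
    unfolding rk_def norm_divide norm_mult by (simp add: norm_qq)
  also have "\<dots> \<le> norm w / (norm w)\<^sup>2" using False by (intro divide_left_mono) (auto simp: add_pos_nonneg)
  also have "\<dots> = 1 / norm w" by (simp add: power2_eq_square)
  finally show ?thesis .
qed (simp add: rk_def)

definition eps :: "nat \<Rightarrow> real" where "eps n = 1 / real (Suc n)"
abbreviation bump where "bump n w \<equiv> complex_of_real ((eps n)\<^sup>2 / ((norm w)\<^sup>2 + (eps n)\<^sup>2)\<^sup>2)"
lemma eps_pos: "eps n > 0" by (simp add: eps_def)
lemma eps_lim: "eps \<longlonglongrightarrow> 0" unfolding eps_def by (rule LIMSEQ_Suc[OF lim_1_over_n])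

lemma rk_limit:
  assumes "w \<noteq> 0"
  shows "(\<lambda>n. rk (eps n) p r m w) \<longlonglongrightarrow> w ^ p * cnj w ^ r / (w * cnj w) ^ m"
proof -
  have "(\<lambda>n. qq (eps n) w) \<longlonglongrightarrow> w * cnj w + of_real (0\<^sup>2)"
    unfolding qq_def by (intro tendsto_intros eps_lim)
  from tendsto_power[OF this, of m] have a: "(\<lambda>n. qq (eps n) w ^ m) \<longlonglongrightarrow> (w * cnj w) ^ m" by simp
  have b: "(w * cnj w) ^ m \<noteq> 0" using assms by simp
  show ?thesis unfolding rk_def by (rule tendsto_divide[OF tendsto_const a b])
qed

lemma lborel_complex_scale:
  fixes F :: "complex \<Rightarrow> complex"
  assumes [measurable]: "F \<in> borel_measurable borel" and e: "e \<noteq> 0"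
  shows "(\<integral>p. F p \<partial>lborel) = of_real (e\<^sup>2) * (\<integral>w. F (c + e *\<^sub>R w) \<partial>lborel)"
proof -
  have "(\<integral>p. F p \<partial>lborel) = (\<integral>p. F p \<partial>density (distr lborel borel (\<lambda>w. c + e *\<^sub>R w)) (\<lambda>_. ennreal (\<bar>e\<bar> ^ DIM(complex))))"
    using lborel_affine[OF e, of c] by simp
  also have "\<dots> = of_real (e\<^sup>2) * (\<integral>w. F (c + e *\<^sub>R w) \<partial>lborel)"
    by (subst integral_density) (auto simp: integral_distr scaleR_conv_of_real)
  finally show ?thesis .
qed

text \<open>The region seen from a point after blowing up: the whole plane at an interior point, and the upper half plane at a point of the chord. The flag distinguishes the two cases.\<close>
definition Hset :: "bool \<Rightarrow> complex set" where "Hset full = (if full then UNIV else {w. Im w > 0})"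

lemma Hset_borel [measurable]: "Hset full \<in> sets borel"
  unfolding Hset_def by (auto intro!: borel_open simp: open_halfspace_Im_gt)

lemma null_real_line: "{w::complex. Im w = 0} \<in> null_sets lborel"
proof -
  have "negligible {w::complex. \<i> \<bullet> w = 0}" by (rule negligible_hyperplane) auto
  then have "{w::complex. Im w = 0} \<in> null_sets lebesgue"
    unfolding negligible_iff_null_sets by (simp add: inner_complex_def)
  moreover have "{w::complex. Im w = 0} \<in> sets borel" by (intro borel_closed) (simp add: closed_halfspace_Im_eq)
  ultimately show ?thesis by (auto simp: null_sets_completion_iff)
qed

text \<open>The share of the mass of the approximate identity that lies in the region: \<open>1\<close> inside and \<open>1/2\<close> on the chord. The second value produces the identity operator in \<open>I - i H\<close>.\<close>
definition dens :: "bool \<Rightarrow> real" where "dens full = (if full then 1 else 1/2)"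

text \<open>In the half plane the value is one half by the symmetry \<open>w \<mapsto> cnj w\<close>.\<close>
lemma integral_Cauchy_kernel_Hset:
  "(\<integral>w. indicator (Hset full) w * (1 / (1 + (norm w)\<^sup>2)\<^sup>2) \<partial>lborel) = pi * dens full"
proof (cases full)
  case True then show ?thesis using integral_Cauchy_kernel(2) by (simp add: Hset_def dens_def)
next
  case False
  let ?k = "\<lambda>w::complex. 1 / (1 + (norm w)\<^sup>2)\<^sup>2"
  have [measurable]: "{w::complex. Im w > 0} \<in> sets borel" "{w::complex. Im w < 0} \<in> sets borel"
    by (auto intro!: borel_open simp: open_halfspace_Im_gt open_halfspace_Im_lt)
  have i: "integrable lborel (\<lambda>w. indicator {w. Im w > 0} w * ?k w)" "integrable lborel (\<lambda>w. indicator {w. Im w < 0} w * ?k w)"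
    by (rule integrable_dominated[OF integral_Cauchy_kernel(1)]; simp add: indicator_def)+
  have "complex_of_real (\<integral>w. indicator {w. Im w > 0} w * ?k w \<partial>lborel) = (\<integral>w. of_real (indicator {w. Im w > 0} w * ?k w) \<partial>lborel)"
    by (rule integral_complex_of_real[symmetric])
  also have "\<dots> = (\<integral>w. of_real (indicator {w. Im w > 0} (-w) * ?k (-w)) \<partial>lborel)"
    by (subst lborel_complex_scale[where e="-1" and c=0]) auto
  also have "\<dots> = complex_of_real (\<integral>w. indicator {w. Im w < 0} w * ?k w \<partial>lborel)"
    by (subst integral_complex_of_real[symmetric]) (auto intro!: lebesgue_integral_cong simp: indicator_def)
  finally have eq: "(\<integral>w. indicator {w. Im w > 0} w * ?k w \<partial>lborel) = (\<integral>w. indicator {w. Im w < 0} w * ?k w \<partial>lborel)"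
    by (simp only: of_real_eq_iff)
  have "pi = (\<integral>w. ?k w \<partial>lborel)" using integral_Cauchy_kernel(2) by simp
  also have "\<dots> = (\<integral>w. indicator {w. Im w > 0} w * ?k w + indicator {w. Im w < 0} w * ?k w \<partial>lborel)"
    using null_real_line by (intro integral_cong_AE AE_I'[OF null_real_line]) (auto simp: indicator_def)
  also have "\<dots> = 2 * (\<integral>w. indicator {w. Im w > 0} w * ?k w \<partial>lborel)"
    using i eq by simp
  finally show ?thesis using False by (simp add: Hset_def dens_def)
qed

text \<open>Substitute \<open>p = z + eps n *\<^sub>R w\<close>: only the limit of \<open>G\<close> along rays from \<open>z\<close> matters, so that \<open>G\<close> may jump across the chord.\<close>
lemma approx_identity:
  fixes G :: "complex \<Rightarrow> complex"
  assumes [measurable]: "G \<in> borel_measurable borel" and M: "\<And>p. norm (G p) \<le> M"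
    and lim: "\<And>w. Im w \<noteq> 0 \<Longrightarrow> (\<lambda>n. G (z + eps n *\<^sub>R w)) \<longlonglongrightarrow> indicator (Hset full) w * L"
  shows "(\<lambda>n. \<integral>p. G p * bump n (p - z) \<partial>lborel) \<longlonglongrightarrow> of_real (pi * dens full) * L"
proof -
  let ?k = "\<lambda>w::complex. 1 / (1 + (norm w)\<^sup>2)\<^sup>2"
  have "(\<integral>p. G p * bump n (p - z) \<partial>lborel) = (\<integral>w. G (z + eps n *\<^sub>R w) * of_real (?k w) \<partial>lborel)" for n
  proof -
    let ?e = "eps n"
    have e: "?e > 0" by (rule eps_pos)
    have k: "?e\<^sup>2 * (?e\<^sup>2 / ((norm (?e *\<^sub>R w))\<^sup>2 + ?e\<^sup>2)\<^sup>2) = ?k w" for w :: complex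
    proof -
      have "(norm (?e *\<^sub>R w))\<^sup>2 + ?e\<^sup>2 = ?e\<^sup>2 * (1 + (norm w)\<^sup>2)" using e by (simp add: power_mult_distrib algebra_simps)
      then show ?thesis using e by (simp add: power_mult_distrib power2_eq_square)
    qed
    have "(\<integral>p. G p * of_real (?e\<^sup>2 / ((norm (p - z))\<^sup>2 + ?e\<^sup>2)\<^sup>2) \<partial>lborel) =
      of_real (?e\<^sup>2) * (\<integral>w. G (z + ?e *\<^sub>R w) * of_real (?e\<^sup>2 / ((norm (?e *\<^sub>R w))\<^sup>2 + ?e\<^sup>2)\<^sup>2) \<partial>lborel)"
      using e by (subst lborel_complex_scale[where e="?e" and c=z]) auto
    also have "\<dots> = (\<integral>w. G (z + ?e *\<^sub>R w) * of_real (?e\<^sup>2 * (?e\<^sup>2 / ((norm (?e *\<^sub>R w))\<^sup>2 + ?e\<^sup>2)\<^sup>2)) \<partial>lborel)"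
      by (subst integral_mult_right_zero[symmetric]) (simp add: mult_ac)
    finally show ?thesis unfolding k .
  qed
  moreover have "(\<lambda>n. \<integral>w. G (z + eps n *\<^sub>R w) * of_real (?k w) \<partial>lborel) \<longlonglongrightarrow> (\<integral>w. (indicator (Hset full) w * L) * of_real (?k w) \<partial>lborel)"
  proof (rule integral_dominated_convergence[where w="\<lambda>w. M * ?k w"])
    show "integrable lborel (\<lambda>w. M * ?k w)" by (rule integrable_mult_right[OF integral_Cauchy_kernel(1)])
    show "AE w in lborel. (\<lambda>n. G (z + eps n *\<^sub>R w) * of_real (?k w)) \<longlonglongrightarrow> (indicator (Hset full) w * L) * of_real (?k w)"
    proof (rule AE_I'[OF null_real_line], clarify)
      fix w assume w: "\<not> (\<lambda>n. G (z + eps n *\<^sub>R w) * of_real (?k w)) \<longlonglongrightarrow> (indicator (Hset full) w * L) * of_real (?k w)"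
      show "Im w = 0" using w tendsto_mult[OF lim[of w] tendsto_const] by blast
    qed
    show "AE w in lborel. norm (G (z + eps n *\<^sub>R w) * of_real (?k w)) \<le> M * ?k w" for n
      unfolding norm_mult norm_of_real by (intro AE_I2 mult_mono M) (auto intro: order_trans[OF norm_ge_zero M])
  qed auto
  moreover have "(\<integral>w. (indicator (Hset full) w * L) * of_real (?k w) \<partial>lborel) = of_real (pi * dens full) * L"
  proof -
    have "(\<integral>w. (indicator (Hset full) w * L) * of_real (?k w) \<partial>lborel) = (\<integral>w. L * of_real (indicator (Hset full) w * ?k w) \<partial>lborel)"
      by (intro lebesgue_integral_cong) (auto simp: indicator_def)
    also have "\<dots> = L * of_real (\<integral>w. indicator (Hset full) w * ?k w \<partial>lborel)" by (simp only: integral_mult_right_zero integral_complex_of_real)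
    finally show ?thesis unfolding integral_Cauchy_kernel_Hset by simp
  qed
  ultimately show ?thesis by simp
qed

lemma eps_scaled_limit:
  assumes "continuous_on UNIV (g :: complex \<Rightarrow> complex)"
  shows "(\<lambda>n. g (z + eps n *\<^sub>R w)) \<longlonglongrightarrow> g z"
proof -
  have "(\<lambda>n. z + eps n *\<^sub>R w) \<longlonglongrightarrow> z + 0 *\<^sub>R w" by (intro tendsto_intros eps_lim)
  then show ?thesis using assms by (auto intro: continuous_on_tendsto_compose)
qed

lemma bounded_times_Cauchy_integrable:
  fixes c :: complex
  assumes "integrable lborel b" "\<And>z. norm (b z :: complex) \<le> M" "\<And>z. R < norm z \<Longrightarrow> b z = 0" "M > 0"
  shows "integrable lborel (\<lambda>p. M * (indicator (cball 0 R) p * (1 / norm (p - c))))"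
    "norm (b p) * (1 / norm (p - c)) \<le> M * (indicator (cball 0 R) p * (1 / norm (p - c)))"
    "integrable lborel (\<lambda>p. b p / (p - c))"
proof -
  have "set_integrable lborel (cball 0 R) (\<lambda>w. 1 / norm (w - c))"
    by (rule inverse_norm_integrable) auto
  then show i: "integrable lborel (\<lambda>p. M * (indicator (cball 0 R) p * (1 / norm (p - c))))"
    unfolding set_integrable_def by (intro integrable_mult_right) simp
  show le: "norm (b p) * (1 / norm (p - c)) \<le> M * (indicator (cball 0 R) p * (1 / norm (p - c)))" for p
  proof (cases "norm p \<le> R")
    case True then show ?thesis using assms(2)[of p] by (auto simp: divide_right_mono)
  next
    case False then show ?thesis using assms(3)[of p] by (simp add: indicator_def)
  qed
  have [measurable]: "b \<in> borel_measurable borel" using assms(1) by auto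
  show "integrable lborel (\<lambda>p. b p / (p - c))"
    by (rule integrable_dominated[OF i]) (use le assms(4) in \<open>auto simp: norm_divide abs_mult\<close>)
qed

text \<open>The product of \<open>g\<close> with the regularized Cauchy kernel has compact support, so that \<open>dbar\<close> of it has integral zero; then the regularization is removed.\<close>
theorem Pompeiu:
  assumes g: "C1c g a b"
  shows "integrable lborel (\<lambda>p. b p / (p - z))" "g z = - (1 / of_real pi) * (\<integral>p. b p / (p - z) \<partial>lborel)"
proof -
  obtain R M where B: "R > 0" "M > 0" "\<And>z. R < norm z \<Longrightarrow> g z = 0 \<and> a z = 0 \<and> b z = 0"
    "\<And>z. norm (g z) \<le> M" "\<And>z. norm (a z) \<le> M" "\<And>z. norm (b z) \<le> M" using C1c_bounds[OF g] by metis
  note int = C1c_integrable[OF g]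
  have b0: "\<And>z. R < norm z \<Longrightarrow> b z = 0" using B(3) by auto
  note bt = bounded_times_Cauchy_integrable[OF int(3) B(6) b0 B(2)]
  show "integrable lborel (\<lambda>p. b p / (p - z))" by (rule bt(3))
  have [measurable]: "g \<in> borel_measurable borel" "b \<in> borel_measurable borel" using int by auto
  have mm[measurable]: "(\<lambda>p. rk (eps n) 0 1 1 (p - z)) \<in> borel_measurable borel" for n
    by (intro borel_measurable_continuous_onI continuous_rk eps_pos)
  have L1: "(\<lambda>n. \<integral>p. g p * bump n (p - z) \<partial>lborel) \<longlonglongrightarrow> of_real (pi * dens True) * g z"
    by (rule approx_identity[OF _ B(4)]) (use eps_scaled_limit[OF C1c_continuous[OF g]] in \<open>auto simp: Hset_def\<close>)
  have L2: "(\<lambda>n. \<integral>p. b p * rk (eps n) 0 1 1 (p - z) \<partial>lborel) \<longlonglongrightarrow> (\<integral>p. b p / (p - z) \<partial>lborel)"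
  proof (rule integral_dominated_convergence[where w="\<lambda>p. M * (indicator (cball 0 R) p * (1 / norm (p - z)))"])
    show "AE p in lborel. (\<lambda>n. b p * rk (eps n) 0 1 1 (p - z)) \<longlonglongrightarrow> b p / (p - z)"
    proof (rule AE_I'[where N="{z}"])
      show "{p \<in> space lborel. \<not> (\<lambda>n. b p * rk (eps n) 0 1 1 (p - z)) \<longlonglongrightarrow> b p / (p - z)} \<subseteq> {z}"
      proof clarsimp
        fix p assume p: "\<not> (\<lambda>n. b p * rk (eps n) 0 (Suc 0) (Suc 0) (p - z)) \<longlonglongrightarrow> b p / (p - z)"
        show "p = z"
        proof (rule ccontr)
          assume "p \<noteq> z"
          then show False using p tendsto_mult[OF tendsto_const rk_limit[of "p - z" 0 1 1], of "b p"] by simp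
        qed
      qed
    qed auto
    show "AE p in lborel. norm (b p * rk (eps n) 0 1 1 (p - z)) \<le> M * (indicator (cball 0 R) p * (1 / norm (p - z)))" for n
      unfolding norm_mult using norm_cauchy_reg
      by (intro AE_I2 order_trans[OF _ bt(2)] mult_left_mono) auto
    show "integrable lborel (\<lambda>p. M * (indicator (cball 0 R) p * (1 / norm (p - z))))" by (rule bt(1))
    show "(\<lambda>p. b p * rk (eps n) 0 1 1 (p - z)) \<in> borel_measurable lborel" for n using mm[of n] by measurable
  qed (use int in auto)
  have S: "(\<integral>p. b p * rk (eps n) 0 1 1 (p - z) \<partial>lborel) + (\<integral>p. g p * bump n (p - z) \<partial>lborel) = 0" for n
  proof -
    have c: "C1c (\<lambda>w. g w * rk (eps n) 0 1 1 (w - z)) (\<lambda>w. a w * rk (eps n) 0 1 1 (w - z) + g w * rk_d (eps n) 0 1 1 (w - z)) (\<lambda>w. b w * rk (eps n) 0 1 1 (w - z) + g w * rk_db (eps n) 0 1 1 (w - z))"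
      by (rule C1c_mult[OF g C1_rk[OF eps_pos]])
    have cs: "integrable lborel (\<lambda>w. b w * rk (eps n) 0 1 1 (w - z))"
      "integrable lborel (\<lambda>w. g w * rk_db (eps n) 0 1 1 (w - z))"
      using g b0 B(3) C1c_continuous[OF g]
      by (auto intro!: continuous_compact_support_integrable[where R=R] continuous_intros eps_pos simp: C1c_def)
    show ?thesis using C1c_integral_zero(2)[OF c] Bochner_Integration.integral_add[OF cs] 
      unfolding cauchy_reg_db[OF eps_pos] by simp
  qed
  have "(\<lambda>n::nat. 0) \<longlonglongrightarrow> (\<integral>p. b p / (p - z) \<partial>lborel) + of_real (pi * dens True) * g z"
    using tendsto_add[OF L2 L1] unfolding S .
  then have "(\<integral>p. b p / (p - z) \<partial>lborel) + of_real (pi * dens True) * g z = 0"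
    by (simp only: LIMSEQ_const_iff)
  then show "g z = - (1 / of_real pi) * (\<integral>p. b p / (p - z) \<partial>lborel)"
    by (simp add: dens_def field_simps add_eq_0_iff)
qed

section \<open>Green's formula\<close>

text \<open>A contour integral with respect to a prescribed continuous derivative \<open>E\<close>. Taking the conjugate derivative gives integrals with respect to \<open>d cnj \<zeta>\<close>.\<close>
definition pint :: "(real \<Rightarrow> complex) \<Rightarrow> (real \<Rightarrow> complex) \<Rightarrow> (complex \<Rightarrow> complex) \<Rightarrow> complex" where
  "pint \<gamma> E g = (\<integral>t. indicator {0..1} t *\<^sub>R (g (\<gamma> t) * E t) \<partial>lborel)"

lemma pint_integrable:
  fixes \<gamma> E :: "real \<Rightarrow> complex" and g :: "complex \<Rightarrow> complex"
  assumes "continuous_on {0..1} \<gamma>" "continuous_on {0..1} E" "continuous_on (\<gamma> ` {0..1}) g"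
  shows "integrable lborel (\<lambda>t. indicator {0..1} t *\<^sub>R (g (\<gamma> t) * E t))"
proof (rule borel_integrable_compact)
  have "continuous_on {0..1} (\<lambda>t. g (\<gamma> t))" by (rule continuous_on_compose2[OF assms(3,1)]) auto
  then show "continuous_on {0..1} (\<lambda>t. g (\<gamma> t) * E t)" by (intro continuous_on_mult assms(2))
qed auto

lemma pint_eq_integral:
  assumes "continuous_on {0..1} \<gamma>" "continuous_on {0..1} E" "continuous_on (\<gamma> ` {0..1}) g"
  shows "pint \<gamma> E g = integral {0..1} (\<lambda>t. g (\<gamma> t) * E t)"
  using set_borel_integral_eq_integral(2)[of "{0..1::real}" "\<lambda>t. g (\<gamma> t) * E t"] pint_integrable[OF assms]
  unfolding pint_def set_lebesgue_integral_def set_integrable_def by simp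

lemma pint_cnj: "cnj (pint \<gamma> E g) = pint \<gamma> (\<lambda>t. cnj (E t)) (\<lambda>\<zeta>. cnj (g \<zeta>))"
  unfolding pint_def Bochner_Integration.integral_cnj[symmetric] by simp

text \<open>Inserting the Pompeiu formula for \<open>g\<close> and exchanging the integrals reduces every contour integral to those of Cauchy kernels, that is, to winding numbers.\<close>
lemma pint_representation:
  assumes g: "C1c g a b" and c: "continuous_on {0..1} \<gamma>" "continuous_on {0..1} E"
  shows "pint \<gamma> E g = - (1 / of_real pi) * (\<integral>p. b p * pint \<gamma> E (\<lambda>\<zeta>. 1 / (p - \<zeta>)) \<partial>lborel)"
    "integrable lborel (\<lambda>p. b p * pint \<gamma> E (\<lambda>\<zeta>. 1 / (p - \<zeta>)))"
proof -
  obtain R M where B: "R > 0" "M > 0" "\<And>z. R < norm z \<Longrightarrow> g z = 0 \<and> a z = 0 \<and> b z = 0"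
    "\<And>z. norm (b z) \<le> M" using C1c_bounds[OF g] by metis
  define \<gamma>' where "\<gamma>' t = indicator {0..1} t *\<^sub>R \<gamma> t" for t :: real
  define E' where "E' t = indicator {0..1} t *\<^sub>R E t" for t :: real
  have [measurable]: "\<gamma>' \<in> borel_measurable borel" "E' \<in> borel_measurable borel"
    unfolding \<gamma>'_def E'_def using c by (auto intro: borel_measurable_continuous_on_indicator)
  have [measurable]: "b \<in> borel_measurable borel" using C1c_integrable[OF g] by auto
  obtain G where G: "G > 0" "\<And>t. t \<in> {0..1} \<Longrightarrow> norm (\<gamma> t) \<le> G"
    using compact_imp_bounded[OF compact_continuous_image[OF c(1)]] unfolding bounded_pos by auto
  obtain C where C: "C > 0" "\<And>t. t \<in> {0..1} \<Longrightarrow> norm (E t) \<le> C"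
    using compact_imp_bounded[OF compact_continuous_image[OF c(2)]] unfolding bounded_pos by auto
  define F where "F t p = E' t * (b p / (p - \<gamma>' t))" for t p
  have Fm[measurable]: "case_prod F \<in> borel_measurable (lborel \<Otimes>\<^sub>M lborel)"
    unfolding F_def by measurable
  have inner: "(\<integral>\<^sup>+p. ennreal (norm (F t p)) \<partial>lborel) \<le> ennreal (C * M * (2 * pi * (R + G))) * indicator {0..1} t" for t
  proof (cases "t \<in> {0..1}")
    case True
    show ?thesis
    proof -
      have sub: "ball 0 R \<subseteq> ball (\<gamma> t) (R + G)"
      proof
        fix x :: complex assume "x \<in> ball 0 R"
        then show "x \<in> ball (\<gamma> t) (R + G)"
          using G(2)[OF True] norm_triangle_ineq4[of "\<gamma> t" x] by (auto simp: dist_norm)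
      qed
      have b0: "norm (b p) \<le> M * indicator (ball 0 R) p" for p
      proof (cases "norm p < R")
        case False
        have "b p = 0" if "norm p = R"
        proof -
          have "continuous_on UNIV b" using g unfolding C1c_def by auto
          then have "isCont b p" by (simp add: continuous_on_eq_continuous_at)
          moreover have "(\<lambda>n. (1 + eps n) *\<^sub>R p) \<longlonglongrightarrow> (1 + 0) *\<^sub>R p" by (intro tendsto_intros eps_lim)
          ultimately have "(\<lambda>n. b ((1 + eps n) *\<^sub>R p)) \<longlonglongrightarrow> b p"
            using isCont_tendsto_compose[of p b] by simp
          moreover have "b ((1 + eps n) *\<^sub>R p) = 0" for n
            using that B(1) eps_pos[of n] B(3)[of "(1 + eps n) *\<^sub>R p"] by simp
          ultimately show ?thesis by (simp add: LIMSEQ_const_iff)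
        qed
        then show ?thesis using False B(3)[of p] by (cases "norm p = R") auto
      qed (use B(4) in auto)
      have "(\<integral>\<^sup>+p. ennreal (norm (F t p)) \<partial>lborel) \<le> (\<integral>\<^sup>+p. ennreal (C * M) * (ennreal (1 / norm (p - \<gamma> t)) * indicator (ball (\<gamma> t) (R + G)) p) \<partial>lborel)"
      proof (rule nn_integral_mono)
        fix p
        have "norm (F t p) = norm (E t) * (norm (b p) * (1 / norm (p - \<gamma> t)))"
          using True by (simp add: F_def E'_def \<gamma>'_def norm_mult norm_divide)
        also have "\<dots> \<le> C * ((M * indicator (ball 0 R) p) * (1 / norm (p - \<gamma> t)))"
          using C(1) by (intro mult_mono C(2) True b0 mult_right_mono) (auto simp: B(2) less_imp_le)
        also have "\<dots> \<le> C * M * (1 / norm (p - \<gamma> t) * indicator (ball (\<gamma> t) (R + G)) p)"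
          using sub C(1) B(2) by (auto simp: indicator_def)
        finally have "ennreal (norm (F t p)) \<le> ennreal (C * M * (1 / norm (p - \<gamma> t) * indicator (ball (\<gamma> t) (R + G)) p))"
          by (rule ennreal_leI)
        also have "\<dots> = ennreal (C * M) * (ennreal (1 / norm (p - \<gamma> t)) * indicator (ball (\<gamma> t) (R + G)) p)"
          using C(1) B(2) by (simp add: ennreal_mult'[symmetric] indicator_def)
        finally show "ennreal (norm (F t p)) \<le> ennreal (C * M) * (ennreal (1 / norm (p - \<gamma> t)) * indicator (ball (\<gamma> t) (R + G)) p)" .
      qed
      also have "\<dots> = ennreal (C * M) * (\<integral>\<^sup>+p. ennreal (1 / norm (p - \<gamma> t)) * indicator (ball (\<gamma> t) (R + G)) p \<partial>lborel)"
        by (rule nn_integral_cmult) (intro borel_measurable_times_ennreal borel_measurable_indicator; simp)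
      also have "\<dots> \<le> ennreal (C * M) * ennreal (2 * pi * (R + G))"
        using G(1) B(1) by (intro mult_left_mono nn_integral_inverse_norm) auto
      also have "\<dots> = ennreal (C * M * (2 * pi * (R + G))) * indicator {0..1} t"
        using True C(1) B(2) by (simp add: ennreal_mult'[symmetric])
      finally show ?thesis .
    qed
  qed (simp add: F_def E'_def)
  have Fi: "integrable (lborel \<Otimes>\<^sub>M lborel) (case_prod F)"
  proof (rule integrableI_bounded)
    have "(\<integral>\<^sup>+x. ennreal (norm (case_prod F x)) \<partial>(lborel \<Otimes>\<^sub>M lborel)) = (\<integral>\<^sup>+t. (\<integral>\<^sup>+p. ennreal (norm (F t p)) \<partial>lborel) \<partial>lborel)"
      using lborel.nn_integral_fst[of "\<lambda>x. ennreal (norm (case_prod F x))" lborel] by simp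
    also have "\<dots> \<le> (\<integral>\<^sup>+t. ennreal (C * M * (2 * pi * (R + G))) * indicator {0..1::real} t \<partial>lborel)"
      by (intro nn_integral_mono inner)
    also have "\<dots> < \<infinity>" by (simp add: nn_integral_cmult ennreal_mult_less_top)
    finally show "(\<integral>\<^sup>+x. ennreal (norm (case_prod F x)) \<partial>(lborel \<Otimes>\<^sub>M lborel)) < \<infinity>" .
  qed (rule Fm)
  have i1: "(\<integral>t. F t p \<partial>lborel) = b p * pint \<gamma> E (\<lambda>\<zeta>. 1 / (p - \<zeta>))" for p
    unfolding pint_def integral_mult_right_zero[symmetric] F_def
    by (intro lebesgue_integral_cong) (auto simp: E'_def \<gamma>'_def indicator_def)
  have i2: "(\<integral>p. F t p \<partial>lborel) = - of_real pi * (indicator {0..1} t *\<^sub>R (g (\<gamma> t) * E t))" for t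
  proof -
    have "(\<integral>p. F t p \<partial>lborel) = E' t * (\<integral>p. b p / (p - \<gamma>' t) \<partial>lborel)"
      unfolding F_def by (rule integral_mult_right_zero)
    also have "(\<integral>p. b p / (p - \<gamma>' t) \<partial>lborel) = - of_real pi * g (\<gamma>' t)"
      using Pompeiu(2)[OF g, of "\<gamma>' t"] by (simp add: field_simps)
    finally show ?thesis by (auto simp: E'_def \<gamma>'_def indicator_def)
  qed
  have "integrable lborel (\<lambda>p. \<integral>t. F t p \<partial>lborel)"
    using lborel_pair.integrable_snd[OF Fi] .
  then show "integrable lborel (\<lambda>p. b p * pint \<gamma> E (\<lambda>\<zeta>. 1 / (p - \<zeta>)))" unfolding i1 .
  have "(\<integral>p. b p * pint \<gamma> E (\<lambda>\<zeta>. 1 / (p - \<zeta>)) \<partial>lborel) = (\<integral>t. - of_real pi * (indicator {0..1} t *\<^sub>R (g (\<gamma> t) * E t)) \<partial>lborel)"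
    using lborel_pair.Fubini_integral[OF Fi] unfolding i1 i2 .
  also have "\<dots> = - of_real pi * pint \<gamma> E g" unfolding pint_def by (rule integral_mult_right_zero)
  finally show "pint \<gamma> E g = - (1 / of_real pi) * (\<integral>p. b p * pint \<gamma> E (\<lambda>\<zeta>. 1 / (p - \<zeta>)) \<partial>lborel)"
    by (simp add: field_simps)
qed

definition seg :: "real \<Rightarrow> real \<Rightarrow> complex" where "seg s t = of_real (2 * s * t - s)"

abbreviation pint_seg where "pint_seg s \<equiv> pint (seg s) (\<lambda>_. of_real (2 * s))"

lemma seg_continuous [continuous_intros]: "continuous_on S (seg s)"
  unfolding seg_def by (intro continuous_intros)

text \<open>The boundary consists of the chord \<open>seg s\<close> and the arc \<open>\<gamma>\<close> with derivative \<open>D\<close>. The geometry enters through the winding number at almost every point.\<close>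
locale region =
  fixes \<gamma> D :: "real \<Rightarrow> complex" and s :: real and R :: "complex set"
  assumes s_pos: "s > 0"
    and \<gamma>_cont: "continuous_on {0..1} \<gamma>" and D_cont: "continuous_on {0..1} D"
    and R_borel [measurable]: "R \<in> sets borel" and R_bounded: "bounded R"
    and winding: "AE p in lborel. pint_seg s (\<lambda>\<zeta>. 1 / (\<zeta> - p)) + pint \<gamma> D (\<lambda>\<zeta>. 1 / (\<zeta> - p)) =
        2 * of_real pi * \<i> * indicator R p"
begin

lemma Green:
  assumes g: "C1c g a b"
  shows "pint_seg s g + pint \<gamma> D g = 2 * \<i> * (\<integral>p. indicator R p * b p \<partial>lborel)"
proof -
  let ?J = "pint_seg s"
  note r1 = pint_representation[OF g seg_continuous continuous_on_const, of s "of_real (2 * s)"]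
  note r2 = pint_representation[OF g \<gamma>_cont D_cont]
  have [measurable]: "b \<in> borel_measurable borel" using C1c_integrable[OF g] by auto
  have neg: "pint \<gamma> E (\<lambda>\<zeta>. 1 / (p - \<zeta>)) = - pint \<gamma> E (\<lambda>\<zeta>. 1 / (\<zeta> - p))" for \<gamma> E p
  proof -
    have "1 / (p - \<zeta>) = - (1 / (\<zeta> - p))" for \<zeta> by (metis minus_diff_eq minus_divide_right)
    then have "pint \<gamma> E (\<lambda>\<zeta>. 1 / (p - \<zeta>)) = (\<integral>t. - (indicator {0..1} t *\<^sub>R (1 / (\<gamma> t - p) * E t)) \<partial>lborel)"
      unfolding pint_def by simp
    then show ?thesis unfolding pint_def by (simp only: integral_minus)
  qed
  have "?J g + pint \<gamma> D g = - (1 / of_real pi) * (\<integral>p. b p * ?J (\<lambda>\<zeta>. 1 / (p - \<zeta>)) + b p * pint \<gamma> D (\<lambda>\<zeta>. 1 / (p - \<zeta>)) \<partial>lborel)"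
    unfolding r1(1) r2(1) Bochner_Integration.integral_add[OF r1(2) r2(2)] by (simp add: algebra_simps)
  also have "(\<integral>p. b p * ?J (\<lambda>\<zeta>. 1 / (p - \<zeta>)) + b p * pint \<gamma> D (\<lambda>\<zeta>. 1 / (p - \<zeta>)) \<partial>lborel)
     = (\<integral>p. (- 2 * of_real pi * \<i>) * (indicator R p * b p) \<partial>lborel)"
  proof (rule integral_cong_AE)
    show "AE p in lborel. b p * ?J (\<lambda>\<zeta>. 1 / (p - \<zeta>)) + b p * pint \<gamma> D (\<lambda>\<zeta>. 1 / (p - \<zeta>)) = (- 2 * of_real pi * \<i>) * (indicator R p * b p)"
      using winding
    proof eventually_elim
      case (elim p)
      have "b p * ?J (\<lambda>\<zeta>. 1 / (p - \<zeta>)) + b p * pint \<gamma> D (\<lambda>\<zeta>. 1 / (p - \<zeta>)) = - b p * (?J (\<lambda>\<zeta>. 1 / (\<zeta> - p)) + pint \<gamma> D (\<lambda>\<zeta>. 1 / (\<zeta> - p)))"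
        unfolding neg by (simp add: algebra_simps)
      then show ?case unfolding elim by simp
    qed
    show "(\<lambda>p. b p * ?J (\<lambda>\<zeta>. 1 / (p - \<zeta>)) + b p * pint \<gamma> D (\<lambda>\<zeta>. 1 / (p - \<zeta>))) \<in> borel_measurable lborel"
      using r1(2) r2(2) by (intro borel_measurable_add borel_measurable_integrable)
    show "(\<lambda>p. (- 2 * of_real pi * \<i>) * (indicator R p * b p)) \<in> borel_measurable lborel" by measurable
  qed
  also have "- (1 / of_real pi) * (\<integral>p. (- 2 * of_real pi * \<i>) * (indicator R p * b p) \<partial>lborel) = 2 * \<i> * (\<integral>p. indicator R p * b p \<partial>lborel)"
    unfolding integral_mult_right_zero by simp
  finally show ?thesis .
qed

lemma Green_cnj:
  assumes g: "C1c g a b"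
  shows "pint_seg s g + pint \<gamma> (\<lambda>t. cnj (D t)) g = - 2 * \<i> * (\<integral>p. indicator R p * a p \<partial>lborel)"
proof -
  have "cnj (pint_seg s (\<lambda>w. cnj (g w)) + pint \<gamma> D (\<lambda>w. cnj (g w))) = cnj (2 * \<i> * (\<integral>p. indicator R p * cnj (a p) \<partial>lborel))"
    using Green[OF C1c_cnj[OF g]] by (rule arg_cong)
  moreover have "cnj (\<integral>p. indicator R p * cnj (a p) \<partial>lborel) = (\<integral>p. indicator R p * a p \<partial>lborel)"
    unfolding Bochner_Integration.integral_cnj[symmetric] by (intro lebesgue_integral_cong) (auto simp: indicator_def)
  ultimately show ?thesis by (simp add: pint_cnj)
qed

end

section \<open>Integral formulas with the powers of the kernel\<close>

lemma norm_rk: "norm (rk e p r m w) = norm w ^ (p + r) / ((norm w)\<^sup>2 + e\<^sup>2) ^ m"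
  unfolding rk_def by (simp add: norm_divide norm_mult norm_power norm_qq power_add)

lemma norm_rk_bound:
  assumes "p + r + 1 = 2 * m"
  shows "norm (rk e p r m w) \<le> 1 / norm w"
proof (cases "w = 0")
  case True with assms show ?thesis unfolding norm_rk by (cases m) (auto simp: power_0_left)
next
  case False
  have m: "norm w ^ (p + r) * norm w = ((norm w)\<^sup>2) ^ m"
    unfolding power_mult[symmetric] assms[symmetric] by simp
  have "norm (rk e p r m w) \<le> norm w ^ (p + r) / ((norm w)\<^sup>2) ^ m"
    unfolding norm_rk using False by (intro divide_left_mono power_mono mult_pos_pos zero_less_power) (auto simp: add_pos_nonneg)
  also have "\<dots> = 1 / norm w" unfolding m[symmetric] using False by simp
  finally show ?thesis .
qed

text \<open>The correction terms carry a factor \<open>e\<^sup>2\<close> and vanish in the limit. This bound uniform in \<open>e\<close> makes them dominated by the integrable function \<open>1 / |w|\<close>.\<close>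
lemma norm_e_rk_bound:
  assumes "p + r + 3 = 2 * m" "e > 0"
  shows "norm (of_real (e\<^sup>2) * rk e p r m w) \<le> 1 / norm w"
proof -
  obtain k where k: "m = Suc k" using assms by (cases m) auto
  have "norm (of_real (e\<^sup>2) * rk e p r m w) = (e\<^sup>2 / ((norm w)\<^sup>2 + e\<^sup>2)) * norm (rk e p r k w)"
    unfolding norm_rk norm_mult k norm_of_real by (simp add: norm_rk mult_ac)
  also have "\<dots> \<le> 1 * norm (rk e p r k w)"
    using assms(2) by (intro mult_right_mono) (auto simp: divide_le_eq add_nonneg_pos)
  also have "\<dots> \<le> 1 / norm w" using norm_rk_bound[of p r k e w] assms(1) k by simp
  finally show ?thesis .
qed

text \<open>With \<open>j = i + 1\<close>, \<open>Ak i e\<close> and \<open>Bk i e\<close> are smooth approximations of \<open>\<omega>\<^sup>j / w\<close> and \<open>\<omega>\<^sup>j / cnj w\<close>, where \<open>\<omega> = cnj w / w\<close>. The terms with the factor \<open>e\<^sup>2\<close> are chosen so that two properties of the limits hold exactly for every \<open>e\<close>: \<open>dbar A + d B = 0\<close>, and \<open>A = B\<close> on the real line. Thus no point mass appears at \<open>w = 0\<close>.\<close>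
definition Ak :: "nat \<Rightarrow> real \<Rightarrow> complex \<Rightarrow> complex" where
  "Ak i e w = rk e 0 (2*i+3) (i+2) w + of_real (e\<^sup>2) * rk e i (i+1) (i+2) w"
definition Bk :: "nat \<Rightarrow> real \<Rightarrow> complex \<Rightarrow> complex" where
  "Bk i e w = rk e 1 (2*i+2) (i+2) w + of_real (e\<^sup>2) * (2 * rk e 0 (2*i+1) (i+2) w + (-1) * rk e (i+1) i (i+2) w)"

definition Ak_d where "Ak_d i e w = rk_d e 0 (2*i+3) (i+2) w + of_real (e\<^sup>2) * rk_d e i (i+1) (i+2) w"
definition Ak_db where "Ak_db i e w = rk_db e 0 (2*i+3) (i+2) w + of_real (e\<^sup>2) * rk_db e i (i+1) (i+2) w"
definition Bk_d where "Bk_d i e w = rk_d e 1 (2*i+2) (i+2) w + of_real (e\<^sup>2) * (2 * rk_d e 0 (2*i+1) (i+2) w + (-1) * rk_d e (i+1) i (i+2) w)"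
definition Bk_db where "Bk_db i e w = rk_db e 1 (2*i+2) (i+2) w + of_real (e\<^sup>2) * (2 * rk_db e 0 (2*i+1) (i+2) w + (-1) * rk_db e (i+1) i (i+2) w)"

lemma C1_Ak: "e > 0 \<Longrightarrow> C1 (\<lambda>w. Ak i e (w - c)) (\<lambda>w. Ak_d i e (w - c)) (\<lambda>w. Ak_db i e (w - c))"
  unfolding Ak_def Ak_d_def Ak_db_def by (intro C1_add C1_cmult C1_rk)

lemma C1_Bk: "e > 0 \<Longrightarrow> C1 (\<lambda>w. Bk i e (w - c)) (\<lambda>w. Bk_d i e (w - c)) (\<lambda>w. Bk_db i e (w - c))"
  unfolding Bk_def Bk_d_def Bk_db_def by (intro C1_add C1_cmult C1_rk)

lemma Ak_Bk_closed:
  assumes "e > 0" shows "Ak_db i e w + Bk_d i e w = 0"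
proof -
  define v q E where "v = cnj w" and "q = qq e w" and "E = complex_of_real (e\<^sup>2)"
  have q: "q = w * v + E" unfolding q_def v_def E_def qq_def ..
  have [simp]: "q \<noteq> 0" using qq_nonzero[OF assms] q_def by simp
  have n: "of_nat (2*i+3) * v ^ (2*i+2) * q - of_nat (i+2) * v ^ (2*i+3) * w
      + E * (of_nat (i+1) * w ^ i * v ^ i * q - of_nat (i+2) * (w ^ i * v ^ (i+1)) * w)
      + (v ^ (2*i+2) * q - of_nat (i+2) * (w * v ^ (2*i+2)) * v)
      + E * (2 * (- (of_nat (i+2) * v ^ (2*i+1) * v)) - (of_nat (i+1) * w ^ i * v ^ i * q - of_nat (i+2) * (w ^ (i+1) * v ^ i) * v)) = 0"
  proof -
    define a b N where "a = v ^ (2*i)" and "b = w ^ i * v ^ i" and "N = (of_nat i :: complex)"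
    have r: "v ^ (2*i+1) = a * v" "v ^ (2*i+2) = a * v * v" "v ^ (2*i+3) = a * v * v * v" "w ^ i * v ^ (i+1) = b * v" "w ^ (i+1) * v ^ i = b * w"
      "(of_nat (2*i+3) :: complex) = 2 * N + 3" "(of_nat (i+2) :: complex) = N + 2" "(of_nat (i+1) :: complex) = N + 1"
      "\<And>c. c * w ^ i * v ^ i = c * b"
      by (simp_all add: a_def b_def N_def eval_nat_numeral)
    show ?thesis unfolding r q by (simp add: algebra_simps)
  qed
  have x1: "rk_db e 0 (2*i+3) (i+2) w = (of_nat (2*i+3) * v ^ (2*i+2) * q - of_nat (i+2) * v ^ (2*i+3) * w) / q ^ Suc (i+2)"
    unfolding rk_db_def v_def q_def by simp
  have x2: "rk_db e i (i+1) (i+2) w = (of_nat (i+1) * w ^ i * v ^ i * q - of_nat (i+2) * (w ^ i * v ^ (i+1)) * w) / q ^ Suc (i+2)"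
    unfolding rk_db_def v_def q_def by simp
  have x3: "rk_d e 1 (2*i+2) (i+2) w = (v ^ (2*i+2) * q - of_nat (i+2) * (w * v ^ (2*i+2)) * v) / q ^ Suc (i+2)"
    unfolding rk_d_def v_def q_def by simp
  have x4: "rk_d e 0 (2*i+1) (i+2) w = - (of_nat (i+2) * v ^ (2*i+1) * v) / q ^ Suc (i+2)"
    unfolding rk_d_def v_def q_def by simp
  have x5: "rk_d e (i+1) i (i+2) w = (of_nat (i+1) * w ^ i * v ^ i * q - of_nat (i+2) * (w ^ (i+1) * v ^ i) * v) / q ^ Suc (i+2)"
    unfolding rk_d_def v_def q_def by simp
  have gen: "X1 / Q + E * (X2 / Q) + (X3 / Q + E * (2 * (X4 / Q) + (-1) * (X5 / Q))) = (X1 + E * X2 + X3 + E * (2 * X4 - X5)) / Q"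
    for X1 X2 X3 X4 X5 Q :: complex by (simp add: add_divide_distrib diff_divide_distrib right_diff_distrib)
  have "Ak_db i e w + Bk_d i e w = (of_nat (2*i+3) * v ^ (2*i+2) * q - of_nat (i+2) * v ^ (2*i+3) * w
      + E * (of_nat (i+1) * w ^ i * v ^ i * q - of_nat (i+2) * (w ^ i * v ^ (i+1)) * w)
      + (v ^ (2*i+2) * q - of_nat (i+2) * (w * v ^ (2*i+2)) * v)
      + E * (2 * (- (of_nat (i+2) * v ^ (2*i+1) * v)) - (of_nat (i+1) * w ^ i * v ^ i * q - of_nat (i+2) * (w ^ (i+1) * v ^ i) * v))) / q ^ Suc (i+2)"
    unfolding Ak_db_def Bk_d_def x1 x2 x3 x4 x5 E_def[symmetric] gen ..
  then show ?thesis unfolding n by simp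
qed

lemma Ak_eq_Bk_real:
  assumes "cnj w = w" shows "Ak i e w = Bk i e w"
proof -
  define Q P P' where "Q = qq e w ^ (i + 2)" and "P = w ^ (2*i+1)" and "P' = w ^ (2*i+3)"
  have "rk e 0 (2*i+3) (i+2) w = P' / Q" "rk e 0 (2*i+1) (i+2) w = P / Q"
    unfolding rk_def assms Q_def P_def P'_def by (simp_all only: power_0 mult_1)
  moreover have "1 + (2*i+2) = 2*i+3" "i + (i+1) = 2*i+1" "(i+1) + i = 2*i+1" by simp_all
  then have "rk e 1 (2*i+2) (i+2) w = P' / Q" "rk e i (i+1) (i+2) w = P / Q" "rk e (i+1) i (i+2) w = P / Q"
    unfolding rk_def assms Q_def P_def P'_def power_add[symmetric] by metis+
  ultimately show ?thesis unfolding Ak_def Bk_def by (simp add: algebra_simps)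
qed

lemma norm_Ak:
  assumes "e > 0" shows "norm (Ak i e w) \<le> 4 / norm w"
proof -
  have "norm (Ak i e w) \<le> 1 / norm w + 1 / norm w"
    unfolding Ak_def
    by (rule order_trans[OF norm_triangle_ineq add_mono[OF norm_rk_bound norm_e_rk_bound[OF _ assms]]]) simp_all
  also have "\<dots> \<le> 4 / norm w" by (simp add: divide_right_mono)
  finally show ?thesis .
qed

lemma norm_Bk: 
  assumes "e > 0" shows "norm (Bk i e w) \<le> 4 / norm w"
proof -
  let ?a = "rk e 1 (2*i+2) (i+2) w" and ?b = "of_real (e\<^sup>2) * rk e 0 (2*i+1) (i+2) w" and ?c = "of_real (e\<^sup>2) * rk e (i+1) i (i+2) w"
  have eq: "Bk i e w = ?a + (?b + ?b) - ?c"
  proof -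
    have "a + E * (2 * b + (-1) * c) = a + (E * b + E * b) - E * c" for a b c E :: complex by (simp add: algebra_simps)
    then show ?thesis unfolding Bk_def .
  qed
  have "norm (x + (y + y) - z) \<le> norm x + (norm y + norm y) + norm z" for x y z :: complex
    using norm_triangle_ineq4[of "x + (y + y)" z] norm_triangle_ineq[of x "y + y"] norm_triangle_ineq[of y y] by linarith
  from this[of ?a ?b ?c] have "norm (Bk i e w) \<le> norm ?a + (norm ?b + norm ?b) + norm ?c" unfolding eq .
  moreover have "norm ?a \<le> 1 / norm w" by (rule norm_rk_bound) simp
  moreover have "norm ?b \<le> 1 / norm w" by (rule norm_e_rk_bound[OF _ assms]) simp
  moreover have "norm ?c \<le> 1 / norm w" by (rule norm_e_rk_bound[OF _ assms]) simp
  ultimately show ?thesis by simp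
qed

lemma e_rk_limit:
  assumes "w \<noteq> 0"
  shows "(\<lambda>n. of_real ((eps n)\<^sup>2) * rk (eps n) p r m w) \<longlonglongrightarrow> 0"
proof -
  have "(\<lambda>n. complex_of_real ((eps n)\<^sup>2)) \<longlonglongrightarrow> of_real (0\<^sup>2)" by (intro tendsto_intros eps_lim)
  from tendsto_mult[OF this rk_limit[OF assms, of p r m]] show ?thesis by simp
qed

lemma Ak_limit: "w \<noteq> 0 \<Longrightarrow> (\<lambda>n. Ak i (eps n) w) \<longlonglongrightarrow> (cnj w / w) ^ Suc i / w"
proof -
  assume w: "w \<noteq> 0"
  have "w ^ 0 * cnj w ^ (2*i+3) / (w * cnj w) ^ (i+2) + 0 = (cnj w / w) ^ Suc i / w"
  proof -
    have "cnj w ^ (2*i+3) = cnj w ^ (i+2) * cnj w ^ Suc i" by (simp only: power_add[symmetric]) (simp add: mult_2 eval_nat_numeral)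
    moreover have "w ^ (i+2) = w ^ Suc i * w" by simp
    moreover have "cnj w ^ (i+2) \<noteq> 0" using w by simp
    ultimately show ?thesis unfolding power_mult_distrib power_divide by (simp del: power_Suc)
  qed
  note eq = this
  show ?thesis unfolding Ak_def eq[symmetric] by (rule tendsto_add[OF rk_limit[OF w] e_rk_limit[OF w]])
qed

lemma Bk_limit: "w \<noteq> 0 \<Longrightarrow> (\<lambda>n. Bk i (eps n) w) \<longlonglongrightarrow> (cnj w / w) ^ Suc i / cnj w"
proof -
  assume w: "w \<noteq> 0"
  have "w ^ 1 * cnj w ^ (2*i+2) / (w * cnj w) ^ (i+2) + (2 * 0 + (- 1) * 0) = (cnj w / w) ^ Suc i / cnj w"
  proof -
    have "cnj w ^ (2*i+2) * cnj w = cnj w ^ (i+2) * cnj w ^ Suc i" by (simp only: power_add[symmetric] power_Suc2[symmetric]) (simp add: mult_2 eval_nat_numeral)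
    moreover have "w ^ (i+2) = w ^ Suc i * w" by simp
    moreover have "cnj w ^ (i+2) \<noteq> 0" "cnj w \<noteq> 0" using w by simp_all
    ultimately have "w * cnj w ^ (2*i+2) / (w ^ (i+2) * cnj w ^ (i+2)) = cnj w ^ Suc i / w ^ Suc i / cnj w"
    proof -
      have "x * A / ((W * x) * B) = C / W / v" if "A * v = B * C" "B \<noteq> 0" "v \<noteq> 0" "x \<noteq> 0" for x A W B C v :: complex
        using that by (cases "W = 0") (simp_all add: divide_simps mult_ac)
      from this[of "cnj w ^ (2*i+2)" "cnj w" "cnj w ^ (i+2)" "cnj w ^ Suc i" w "w ^ Suc i"]
      show "cnj w ^ (2*i+2) * cnj w = cnj w ^ (i+2) * cnj w ^ Suc i \<Longrightarrow> w ^ (i+2) = w ^ Suc i * w \<Longrightarrow> cnj w ^ (i+2) \<noteq> 0 \<Longrightarrow> cnj w \<noteq> 0 \<Longrightarrow> 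
        w * cnj w ^ (2*i+2) / (w ^ (i+2) * cnj w ^ (i+2)) = cnj w ^ Suc i / w ^ Suc i / cnj w"
        using w by (simp del: power_Suc)
    qed
    then show ?thesis unfolding power_mult_distrib power_divide by simp
  qed
  note eq = this
  have "(\<lambda>n. rk (eps n) 1 (2*i+2) (i+2) w + (2 * (of_real ((eps n)\<^sup>2) * rk (eps n) 0 (2*i+1) (i+2) w) + (-1) * (of_real ((eps n)\<^sup>2) * rk (eps n) (i+1) i (i+2) w))) \<longlonglongrightarrow> w ^ 1 * cnj w ^ (2*i+2) / (w * cnj w) ^ (i+2) + (2 * 0 + (- 1) * 0)"
    by (rule tendsto_add[OF rk_limit[OF w] tendsto_add[OF tendsto_mult[OF tendsto_const e_rk_limit[OF w]] tendsto_mult[OF tendsto_const e_rk_limit[OF w]]]])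
  moreover have "rk e 1 (2*i+2) (i+2) w + (2 * (of_real (e\<^sup>2) * rk e 0 (2*i+1) (i+2) w) + (-1) * (of_real (e\<^sup>2) * rk e (i+1) i (i+2) w)) = Bk i e w" for e
    unfolding Bk_def by (simp only: distrib_left mult.left_commute)
  ultimately show ?thesis unfolding eq by (simp only:)
qed

lemma pint_limit:
  assumes \<gamma>: "continuous_on {0..1} \<gamma>" and E: "continuous_on {0..1} E" and V: "continuous_on UNIV V"
    and Kn: "\<And>n. continuous_on UNIV (\<lambda>w. Kn n (w - z))" and bd: "\<And>n w. norm (Kn n w) \<le> C / norm w"
    and K: "continuous_on (-{0}) K" and lim: "\<And>w. w \<noteq> 0 \<Longrightarrow> (\<lambda>n. Kn n w) \<longlonglongrightarrow> K w"
    and z: "z \<notin> \<gamma> ` {0..1}"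
  shows "(\<lambda>n. pint \<gamma> E (\<lambda>\<zeta>. V \<zeta> * Kn n (\<zeta> - z))) \<longlonglongrightarrow> pint \<gamma> E (\<lambda>\<zeta>. V \<zeta> * K (\<zeta> - z))"
proof -
  have c: "compact (\<gamma> ` {0..1})" using \<gamma> by (intro compact_continuous_image) auto
  have cVE: "continuous_on {0..1} (\<lambda>t. V (\<gamma> t) * E t)"
    by (intro continuous_on_mult E continuous_on_compose2[OF V \<gamma>]) auto
  obtain M where M: "M > 0" "\<And>t. t \<in> {0..1} \<Longrightarrow> norm (V (\<gamma> t) * E t) \<le> M"
    using compact_imp_bounded[OF compact_continuous_image[OF cVE]] unfolding bounded_pos by auto
  have "C \<ge> 0" using order_trans[OF norm_ge_zero bd[of 0 1]] by simp
  obtain d where d: "d > 0" "\<And>t. t \<in> {0..1} \<Longrightarrow> d \<le> norm (\<gamma> t - z)"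
  proof -
    have "closed (\<gamma> ` {0..1})" using c by (rule compact_imp_closed)
    then obtain d where "d > 0" "\<forall>x\<in>\<gamma> ` {0..1}. d \<le> dist z x" using separate_point_closed[OF _ z] by auto
    then show ?thesis using that[of d] by (auto simp: dist_norm norm_minus_commute)
  qed
  have int: "integrable lborel (\<lambda>t. indicator {0..1} t *\<^sub>R (V (\<gamma> t) * Kn n (\<gamma> t - z) * E t))" for n
  proof (rule pint_integrable[OF \<gamma> E])
    have "continuous_on UNIV (\<lambda>\<zeta>. V \<zeta> * Kn n (\<zeta> - z))" by (rule continuous_on_mult[OF V Kn])
    then show "continuous_on (\<gamma> ` {0..1}) (\<lambda>\<zeta>. V \<zeta> * Kn n (\<zeta> - z))" by (rule continuous_on_subset) simp
  qed
  have int': "integrable lborel (\<lambda>t. indicator {0..1} t *\<^sub>R (V (\<gamma> t) * K (\<gamma> t - z) * E t))"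
  proof (rule pint_integrable[OF \<gamma> E])
    have "continuous_on (\<gamma> ` {0..1}) (\<lambda>\<zeta>. K (\<zeta> - z))"
      by (rule continuous_on_compose2[OF K]) (use z in \<open>auto intro!: continuous_on_diff continuous_on_id continuous_on_const\<close>)
    then show "continuous_on (\<gamma> ` {0..1}) (\<lambda>\<zeta>. V \<zeta> * K (\<zeta> - z))"
      by (rule continuous_on_mult[OF continuous_on_subset[OF V subset_UNIV]])
  qed
  show ?thesis unfolding pint_def
  proof (rule integral_dominated_convergence[where w="\<lambda>t. indicator {0..1} t * (M * (C / d))"])
    show "AE t in lborel. norm (indicator {0..1} t *\<^sub>R (V (\<gamma> t) * Kn n (\<gamma> t - z) * E t)) \<le> indicator {0..1} t * (M * (C / d))" for n
    proof (rule AE_I2)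
      fix t :: real
      show "norm (indicator {0..1} t *\<^sub>R (V (\<gamma> t) * Kn n (\<gamma> t - z) * E t)) \<le> indicator {0..1} t * (M * (C / d))"
      proof (cases "t \<in> {0..1}")
        case True
        have "norm (Kn n (\<gamma> t - z)) \<le> C / d"
        proof (rule order_trans[OF bd])
          have "d \<le> norm (\<gamma> t - z)" by (rule d(2)[OF True])
          then show "C / norm (\<gamma> t - z) \<le> C / d" using d(1) \<open>C \<ge> 0\<close>
            by (intro divide_left_mono mult_pos_pos) linarith+
        qed
        then have "norm (V (\<gamma> t) * E t) * norm (Kn n (\<gamma> t - z)) \<le> M * (C / d)"
          using M(1) by (intro mult_mono M(2)[OF True]) auto
        moreover have "norm (indicator {0..1} t *\<^sub>R (V (\<gamma> t) * Kn n (\<gamma> t - z) * E t)) = norm (V (\<gamma> t) * E t) * norm (Kn n (\<gamma> t - z))"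
          using True by (simp add: norm_mult)
        ultimately show ?thesis using True by simp
      qed auto
    qed
    show "AE t in lborel. (\<lambda>n. indicator {0..1} t *\<^sub>R (V (\<gamma> t) * Kn n (\<gamma> t - z) * E t)) \<longlonglongrightarrow> indicator {0..1} t *\<^sub>R (V (\<gamma> t) * K (\<gamma> t - z) * E t)"
    proof (rule AE_I2)
      fix t :: real
      show "(\<lambda>n. indicator {0..1} t *\<^sub>R (V (\<gamma> t) * Kn n (\<gamma> t - z) * E t)) \<longlonglongrightarrow> indicator {0..1} t *\<^sub>R (V (\<gamma> t) * K (\<gamma> t - z) * E t)"
      proof (cases "t \<in> {0..1}")
        case True
        then have "\<gamma> t - z \<noteq> 0" using z by auto
        then show ?thesis by (intro tendsto_scaleR tendsto_mult tendsto_const lim)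
      qed auto
    qed
    show "integrable lborel (\<lambda>t. indicator {0..1::real} t * (M * (C / d)))"
      using borel_integrable_compact[of "{0..1::real}" "\<lambda>_. M * (C / d)"] by simp
  qed (rule borel_measurable_integrable[OF int'], rule borel_measurable_integrable[OF int])
qed

lemma area_limit:
  assumes b: "integrable lborel b" "\<And>z. norm (b z :: complex) \<le> M" "\<And>z::complex. r < norm z \<Longrightarrow> b z = 0" "M > 0"
    and [measurable]: "R \<in> sets borel"
    and Kn: "\<And>n. continuous_on UNIV (\<lambda>w. Kn n (w - z))" and bd: "\<And>n w. norm (Kn n w) \<le> C / norm w"
    and K[measurable]: "K \<in> borel_measurable borel" and lim: "\<And>w. w \<noteq> 0 \<Longrightarrow> (\<lambda>n. Kn n w) \<longlonglongrightarrow> K w"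
  shows "(\<lambda>n. \<integral>p. indicator R p * (b p * Kn n (p - z)) \<partial>lborel) \<longlonglongrightarrow> (\<integral>p. indicator R p * (b p * K (p - z)) \<partial>lborel)"
    "integrable lborel (\<lambda>p. indicator R p * (b p * K (p - z)))"
    "integrable lborel (\<lambda>p. indicator R p * (b p * Kn n (p - z)))"
proof -
  have [measurable]: "b \<in> borel_measurable borel" using borel_measurable_integrable[OF b(1)] by simp
  have km[measurable]: "(\<lambda>w. Kn n (w - z)) \<in> borel_measurable borel" for n by (rule borel_measurable_continuous_onI[OF Kn])
  note bt = bounded_times_Cauchy_integrable[OF b]
  have C0: "C \<ge> 0" using order_trans[OF norm_ge_zero bd[of 0 1]] by simp
  let ?w = "\<lambda>p. C * (M * (indicator (cball 0 r) p * (1 / norm (p - z))))"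
  have wi: "integrable lborel ?w" by (rule integrable_mult_right[OF bt(1)])
  have le: "AE p in lborel. norm (indicator R p * (b p * Kn n (p - z))) \<le> ?w p" for n
  proof (rule AE_I2)
    fix p
    have "norm (indicator R p * (b p * Kn n (p - z))) \<le> norm (b p) * norm (Kn n (p - z))" by (auto simp: indicator_def norm_mult)
    also have "\<dots> \<le> norm (b p) * (C / norm (p - z))" by (intro mult_left_mono bd) auto
    also have "\<dots> = C * (norm (b p) * (1 / norm (p - z)))" by simp
    also have "\<dots> \<le> ?w p" by (intro mult_left_mono bt(2) C0)
    finally show "norm (indicator R p * (b p * Kn n (p - z))) \<le> ?w p" .
  qed
  have l: "AE p in lborel. (\<lambda>n. indicator R p * (b p * Kn n (p - z))) \<longlonglongrightarrow> indicator R p * (b p * K (p - z))"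
  proof (rule AE_I'[where N="{z}"])
    show "{p \<in> space lborel. \<not> (\<lambda>n. indicator R p * (b p * Kn n (p - z))) \<longlonglongrightarrow> indicator R p * (b p * K (p - z))} \<subseteq> {z}"
    proof clarify
      fix p assume p: "\<not> (\<lambda>n. indicator R p * (b p * Kn n (p - z))) \<longlonglongrightarrow> indicator R p * (b p * K (p - z))"
      show "p = z"
      proof (rule ccontr)
        assume "p \<noteq> z"
        then have "(\<lambda>n. indicator R p * (b p * Kn n (p - z))) \<longlonglongrightarrow> indicator R p * (b p * K (p - z))" by (intro tendsto_intros lim) auto
        with p show False by blast
      qed
    qed
  qed auto
  have m1: "(\<lambda>p. indicator R p * (b p * K (p - z))) \<in> borel_measurable lborel" by measurable
  have m2: "(\<lambda>p. indicator R p * (b p * Kn n (p - z))) \<in> borel_measurable lborel" for n by measurable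
  show "(\<lambda>n. \<integral>p. indicator R p * (b p * Kn n (p - z)) \<partial>lborel) \<longlonglongrightarrow> (\<integral>p. indicator R p * (b p * K (p - z)) \<partial>lborel)"
    by (rule integral_dominated_convergence[OF m1 m2 wi l le])
  show "integrable lborel (\<lambda>p. indicator R p * (b p * K (p - z)))"
    by (rule integrable_dominated_convergence[OF m1 m2 wi l le])
  show "integrable lborel (\<lambda>p. indicator R p * (b p * Kn n (p - z)))"
  proof (rule integrable_dominated[OF wi m2], rule eventually_mono[OF le[of n]])
    fix p assume "norm (indicator R p * (b p * Kn n (p - z))) \<le> ?w p"
    then show "norm (indicator R p * (b p * Kn n (p - z))) \<le> norm (?w p)"
      unfolding real_norm_def by (rule order_trans[OF _ abs_ge_self])
  qed
qed

context region
begin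

lemma area_limit_C1c:
  assumes g: "integrable lborel b" "continuous_on UNIV b" "\<And>z. norm (b z :: complex) \<le> M" "\<And>z::complex. r < norm z \<Longrightarrow> b z = 0" "M > 0"
    and Kn: "\<And>n. continuous_on UNIV (\<lambda>w. Kn n (w - z))" and bd: "\<And>n w. norm (Kn n w) \<le> C / norm w"
    and K[measurable]: "K \<in> borel_measurable borel" and lim: "\<And>w. w \<noteq> 0 \<Longrightarrow> (\<lambda>n. Kn n w) \<longlonglongrightarrow> K w"
  shows "(\<lambda>n. \<integral>p. indicator R p * (b p * Kn n (p - z)) \<partial>lborel) \<longlonglongrightarrow> (\<integral>p. indicator R p * (b p * K (p - z)) \<partial>lborel)"
    "integrable lborel (\<lambda>p. indicator R p * (b p * K (p - z)))"
    "integrable lborel (\<lambda>p. indicator R p * (b p * Kn n (p - z)))"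
  using area_limit[OF g(1,3,4,5) R_borel Kn bd K lim] by blast+

text \<open>Green's formula for \<open>g\<close> times the regularized Cauchy kernel. The approximate identity leaves \<open>g z\<close> weighted by the density of the region at \<open>z\<close>. The chord integral stays regularized, since at a point of the chord its limit is a principal value.\<close>
lemma kernel_zero:
  assumes g: "C1c g a b" and z: "z \<notin> \<gamma> ` {0..1}"
    and dn: "\<And>w. Im w \<noteq> 0 \<Longrightarrow> \<forall>\<^sub>F n in sequentially. (z + eps n *\<^sub>R w \<in> R) = (w \<in> Hset full)"
  shows "(\<lambda>n. pint_seg s (\<lambda>\<zeta>. g \<zeta> * rk (eps n) 0 1 1 (\<zeta> - z))) \<longlonglongrightarrow>
     2 * \<i> * (\<integral>p. indicator R p * (b p * (1 / (p - z))) \<partial>lborel) + 2 * \<i> * of_real (pi * dens full) * g z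
      - pint \<gamma> D (\<lambda>\<zeta>. g \<zeta> * (1 / (\<zeta> - z)))"
proof -
  obtain r M where B: "r > 0" "M > 0" "\<And>z. r < norm z \<Longrightarrow> g z = 0 \<and> a z = 0 \<and> b z = 0"
    "\<And>z. norm (g z) \<le> M" "\<And>z. norm (a z) \<le> M" "\<And>z. norm (b z) \<le> M" using C1c_bounds[OF g] by metis
  note gi = C1c_integrable[OF g]
  note cg = C1c_continuous[OF g]
  have cb: "continuous_on UNIV b" using g unfolding C1c_def by auto
  have [measurable]: "g \<in> borel_measurable borel" using borel_measurable_integrable[OF gi(1)] by simp
  let ?K = "\<lambda>n w. rk (eps n) 0 1 1 w"
  have cK: "continuous_on UNIV (\<lambda>w. ?K n (w - z))" for n by (rule continuous_rk(1)[OF eps_pos])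
  have bK: "norm (?K n w) \<le> 1 / norm w" for n w by (rule norm_cauchy_reg)
  have lK: "(\<lambda>n. ?K n w) \<longlonglongrightarrow> 1 / w" if "w \<noteq> 0" for w
    using rk_limit[OF that, of 0 1 1] that by simp
  have L1: "(\<lambda>n. pint \<gamma> D (\<lambda>\<zeta>. g \<zeta> * ?K n (\<zeta> - z))) \<longlonglongrightarrow> pint \<gamma> D (\<lambda>\<zeta>. g \<zeta> * (1 / (\<zeta> - z)))"
    by (rule pint_limit[OF \<gamma>_cont D_cont cg cK bK _ lK z]) (auto intro!: continuous_intros)
  have b0: "r < norm p \<Longrightarrow> b p = 0" for p using B(3) by blast
  note al = area_limit_C1c[OF gi(3) cb B(6) b0 B(2) cK bK _ lK]
  have L2: "(\<lambda>n. \<integral>p. indicator R p * (b p * ?K n (p - z)) \<partial>lborel) \<longlonglongrightarrow> (\<integral>p. indicator R p * (b p * (1 / (p - z))) \<partial>lborel)"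
    by (rule al(1)) auto
  have L3: "(\<lambda>n. \<integral>p. (indicator R p * g p) * bump n (p - z) \<partial>lborel) \<longlonglongrightarrow> of_real (pi * dens full) * g z"
  proof (rule approx_identity[where M=M])
    show "norm (indicator R p * g p) \<le> M" for p using B(4)[of p] B(2) by (auto simp: indicator_def)
    fix w :: complex assume w: "Im w \<noteq> 0"
    have "\<forall>\<^sub>F n in sequentially. indicator (Hset full) w * g (z + eps n *\<^sub>R w) = indicator R (z + eps n *\<^sub>R w) * g (z + eps n *\<^sub>R w)"
      using dn[OF w] by eventually_elim (auto simp: indicator_def)
    then show "(\<lambda>n. indicator R (z + eps n *\<^sub>R w) * g (z + eps n *\<^sub>R w)) \<longlonglongrightarrow> indicator (Hset full) w * g z"
      by (rule Lim_transform_eventually[rotated]) (intro tendsto_mult tendsto_const eps_scaled_limit cg)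
  qed auto
  have eq: "pint_seg s (\<lambda>\<zeta>. g \<zeta> * ?K n (\<zeta> - z)) =
     2 * \<i> * ((\<integral>p. indicator R p * (b p * ?K n (p - z)) \<partial>lborel) + (\<integral>p. (indicator R p * g p) * bump n (p - z) \<partial>lborel))
      - pint \<gamma> D (\<lambda>\<zeta>. g \<zeta> * ?K n (\<zeta> - z))" for n
  proof -
    have c: "C1c (\<lambda>w. g w * ?K n (w - z)) (\<lambda>w. a w * ?K n (w - z) + g w * rk_d (eps n) 0 1 1 (w - z)) (\<lambda>w. b w * ?K n (w - z) + g w * rk_db (eps n) 0 1 1 (w - z))"
      by (rule C1c_mult[OF g C1_rk[OF eps_pos]])
    have i1: "integrable lborel (\<lambda>p. indicator R p * (b p * ?K n (p - z)))" by (rule al(3)) auto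
    have "integrable lborel (\<lambda>p. g p * rk_db (eps n) 0 1 1 (p - z))"
      by (rule continuous_compact_support_integrable[where R=r])
        (use B(3) in \<open>auto intro!: continuous_on_mult cg continuous_rk eps_pos\<close>)
    then have "integrable lborel (\<lambda>p. indicator R p *\<^sub>R (g p * rk_db (eps n) 0 1 1 (p - z)))"
      by (intro integrable_mult_indicator) auto
    moreover have e: "indicator R p *\<^sub>R (g p * rk_db (eps n) 0 1 1 (p - z)) = (indicator R p * g p) * bump n (p - z)" for p
      unfolding cauchy_reg_db[OF eps_pos] by (simp add: indicator_def)
    ultimately have i2: "integrable lborel (\<lambda>p. (indicator R p * g p) * bump n (p - z))" by simp
    have "(\<integral>p. indicator R p * (b p * ?K n (p - z) + g p * rk_db (eps n) 0 1 1 (p - z)) \<partial>lborel) = (\<integral>p. indicator R p * (b p * ?K n (p - z)) + (indicator R p * g p) * bump n (p - z) \<partial>lborel)"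
      unfolding e[symmetric] by (intro lebesgue_integral_cong) (auto simp: indicator_def)
    also have "\<dots> = (\<integral>p. indicator R p * (b p * ?K n (p - z)) \<partial>lborel) + (\<integral>p. (indicator R p * g p) * bump n (p - z) \<partial>lborel)"
      by (rule Bochner_Integration.integral_add[OF i1 i2])
    finally show ?thesis using Green[OF c] by (simp only: eq_diff_eq)
  qed
  have fin: "(\<lambda>n. 2 * \<i> * ((\<integral>p. indicator R p * (b p * ?K n (p - z)) \<partial>lborel) + (\<integral>p. (indicator R p * g p) * bump n (p - z) \<partial>lborel))
      - pint \<gamma> D (\<lambda>\<zeta>. g \<zeta> * ?K n (\<zeta> - z))) \<longlonglongrightarrow> 2 * \<i> * ((\<integral>p. indicator R p * (b p * (1 / (p - z))) \<partial>lborel) + of_real (pi * dens full) * g z)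
      - pint \<gamma> D (\<lambda>\<zeta>. g \<zeta> * (1 / (\<zeta> - z)))"
    by (intro tendsto_diff tendsto_mult tendsto_add tendsto_const L1 L2 L3)
  have "2 * \<i> * ((\<integral>p. indicator R p * (b p * (1 / (p - z))) \<partial>lborel) + of_real (pi * dens full) * g z) = 2 * \<i> * (\<integral>p. indicator R p * (b p * (1 / (p - z))) \<partial>lborel) + 2 * \<i> * of_real (pi * dens full) * g z"
    by (simp add: algebra_simps)
  then show ?thesis unfolding eq using fin by (simp only:)
qed

text \<open>The two Green formulas for \<open>g A\<close> and \<open>g B\<close>, subtracted: as \<open>dbar A + d B = 0\<close>, only derivatives of \<open>g\<close> remain under the area integral.\<close>
lemma kernel_Suc_reg:
  fixes i :: nat
  assumes g: "C1c g a b" and z: "z \<notin> \<gamma> ` {0..1}"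
  defines "W \<equiv> \<lambda>\<zeta>. (cnj (\<zeta> - z) / (\<zeta> - z)) ^ Suc i"
  shows "(\<lambda>n. pint_seg s (\<lambda>\<zeta>. g \<zeta> * Ak i (eps n) (\<zeta> - z)) - pint_seg s (\<lambda>\<zeta>. g \<zeta> * Bk i (eps n) (\<zeta> - z)))
     \<longlonglongrightarrow> 2 * \<i> * ((\<integral>p. indicator R p * (b p * (W p / (p - z))) \<partial>lborel) + (\<integral>p. indicator R p * (a p * (W p / cnj (p - z))) \<partial>lborel))
       - (pint \<gamma> D (\<lambda>\<zeta>. g \<zeta> * (W \<zeta> / (\<zeta> - z))) - pint \<gamma> (\<lambda>t. cnj (D t)) (\<lambda>\<zeta>. g \<zeta> * (W \<zeta> / cnj (\<zeta> - z))))"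
proof -
  obtain r M where B: "r > 0" "M > 0" "\<And>z. r < norm z \<Longrightarrow> g z = 0 \<and> a z = 0 \<and> b z = 0"
    "\<And>z. norm (g z) \<le> M" "\<And>z. norm (a z) \<le> M" "\<And>z. norm (b z) \<le> M" using C1c_bounds[OF g] by metis
  note gi = C1c_integrable[OF g]
  note cg = C1c_continuous[OF g]
  have cb: "continuous_on UNIV b" "continuous_on UNIV a" using g unfolding C1c_def by auto
  have cD: "continuous_on {0..1} (\<lambda>t. cnj (D t))" by (intro continuous_intros D_cont)
  let ?A = "\<lambda>n w. Ak i (eps n) w" and ?B = "\<lambda>n w. Bk i (eps n) w"
  have cA: "continuous_on UNIV (\<lambda>w. ?A n (w - z))" for n by (rule C1_continuous[OF C1_Ak[OF eps_pos]])
  have cB: "continuous_on UNIV (\<lambda>w. ?B n (w - z))" for n by (rule C1_continuous[OF C1_Bk[OF eps_pos]])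
  have bA: "norm (?A n w) \<le> 4 / norm w" for n w by (rule norm_Ak[OF eps_pos])
  have bB: "norm (?B n w) \<le> 4 / norm w" for n w by (rule norm_Bk[OF eps_pos])
  let ?KA = "\<lambda>w. (cnj w / w) ^ Suc i / w" and ?KB = "\<lambda>w. (cnj w / w) ^ Suc i / cnj w"
  have cKA: "continuous_on (-{0}) ?KA" "continuous_on (-{0}) ?KB"
    by (intro continuous_intros; simp)+
  have L1: "(\<lambda>n. pint \<gamma> D (\<lambda>\<zeta>. g \<zeta> * ?A n (\<zeta> - z))) \<longlonglongrightarrow> pint \<gamma> D (\<lambda>\<zeta>. g \<zeta> * (W \<zeta> / (\<zeta> - z)))"
    unfolding W_def by (rule pint_limit[OF \<gamma>_cont D_cont cg cA bA cKA(1) Ak_limit z])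
  have L2: "(\<lambda>n. pint \<gamma> (\<lambda>t. cnj (D t)) (\<lambda>\<zeta>. g \<zeta> * ?B n (\<zeta> - z))) \<longlonglongrightarrow> pint \<gamma> (\<lambda>t. cnj (D t)) (\<lambda>\<zeta>. g \<zeta> * (W \<zeta> / cnj (\<zeta> - z)))"
    unfolding W_def by (rule pint_limit[OF \<gamma>_cont cD cg cB bB cKA(2) Bk_limit z])
  have b0: "r < norm p \<Longrightarrow> b p = 0" "r < norm p \<Longrightarrow> a p = 0" for p using B(3) by blast+
  have [measurable]: "cnj \<in> borel_measurable borel" by (intro borel_measurable_continuous_onI continuous_intros)
  have mK: "?KA \<in> borel_measurable borel" "?KB \<in> borel_measurable borel" by measurable
  note al = area_limit_C1c[OF gi(3) cb(1) B(6) b0(1) B(2) cA bA mK(1) Ak_limit]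
  note bl = area_limit_C1c[OF gi(2) cb(2) B(5) b0(2) B(2) cB bB mK(2) Bk_limit]
  have L3: "(\<lambda>n. \<integral>p. indicator R p * (b p * ?A n (p - z)) \<partial>lborel) \<longlonglongrightarrow> (\<integral>p. indicator R p * (b p * (W p / (p - z))) \<partial>lborel)"
    unfolding W_def by (rule al(1))
  have L4: "(\<lambda>n. \<integral>p. indicator R p * (a p * ?B n (p - z)) \<partial>lborel) \<longlonglongrightarrow> (\<integral>p. indicator R p * (a p * (W p / cnj (p - z))) \<partial>lborel)"
    unfolding W_def by (rule bl(1))
  have eq: "pint_seg s (\<lambda>\<zeta>. g \<zeta> * ?A n (\<zeta> - z)) - pint_seg s (\<lambda>\<zeta>. g \<zeta> * ?B n (\<zeta> - z)) =
     2 * \<i> * ((\<integral>p. indicator R p * (b p * ?A n (p - z)) \<partial>lborel) + (\<integral>p. indicator R p * (a p * ?B n (p - z)) \<partial>lborel))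
      - (pint \<gamma> D (\<lambda>\<zeta>. g \<zeta> * ?A n (\<zeta> - z)) - pint \<gamma> (\<lambda>t. cnj (D t)) (\<lambda>\<zeta>. g \<zeta> * ?B n (\<zeta> - z)))" for n
  proof -
    let ?Ad = "\<lambda>w. Ak_db i (eps n) (w - z)" and ?Bd = "\<lambda>w. Bk_d i (eps n) (w - z)"
    note c1 = C1c_mult[OF g C1_Ak[OF eps_pos[of n], of i z]]
    note c2 = C1c_mult[OF g C1_Bk[OF eps_pos[of n], of i z]]
    have i1: "integrable lborel (\<lambda>p. indicator R p * (b p * ?A n (p - z)))" by (rule al(3))
    have i2: "integrable lborel (\<lambda>p. indicator R p * (a p * ?B n (p - z)))" by (rule bl(3))
    have "integrable lborel (\<lambda>p. indicator R p *\<^sub>R (b p * ?A n (p - z) + g p * ?Ad p))"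
      using C1c_integrable(3)[OF c1] by (intro integrable_mult_indicator) auto
    then have j1: "integrable lborel (\<lambda>p. indicator R p * (b p * ?A n (p - z) + g p * ?Ad p))"
      by (rule Bochner_Integration.integrable_cong[THEN iffD1, rotated -1]) (auto simp: indicator_def)
    have "integrable lborel (\<lambda>p. indicator R p *\<^sub>R (a p * ?B n (p - z) + g p * ?Bd p))"
      using C1c_integrable(2)[OF c2] by (intro integrable_mult_indicator) auto
    then have j2: "integrable lborel (\<lambda>p. indicator R p * (a p * ?B n (p - z) + g p * ?Bd p))"
      by (rule Bochner_Integration.integrable_cong[THEN iffD1, rotated -1]) (auto simp: indicator_def)
    have "(\<integral>p. indicator R p * (b p * ?A n (p - z) + g p * ?Ad p) \<partial>lborel) + (\<integral>p. indicator R p * (a p * ?B n (p - z) + g p * ?Bd p) \<partial>lborel)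
      = (\<integral>p. indicator R p * (b p * ?A n (p - z) + g p * ?Ad p) + indicator R p * (a p * ?B n (p - z) + g p * ?Bd p) \<partial>lborel)"
      by (rule Bochner_Integration.integral_add[OF j1 j2, symmetric])
    also have "\<dots> = (\<integral>p. indicator R p * (b p * ?A n (p - z)) + indicator R p * (a p * ?B n (p - z)) \<partial>lborel)"
    proof (intro lebesgue_integral_cong refl)
      fix p
      have "?Bd p = - ?Ad p" using Ak_Bk_closed[OF eps_pos[of n], of i "p - z"] by (simp add: add_eq_0_iff)
      then show "indicator R p * (b p * ?A n (p - z) + g p * ?Ad p) + indicator R p * (a p * ?B n (p - z) + g p * ?Bd p) = indicator R p * (b p * ?A n (p - z)) + indicator R p * (a p * ?B n (p - z))"
        by (simp add: algebra_simps)
    qed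
    also have "\<dots> = (\<integral>p. indicator R p * (b p * ?A n (p - z)) \<partial>lborel) + (\<integral>p. indicator R p * (a p * ?B n (p - z)) \<partial>lborel)"
      by (rule Bochner_Integration.integral_add[OF i1 i2])
    finally have S: "2 * \<i> * (\<integral>p. indicator R p * (b p * ?A n (p - z) + g p * ?Ad p) \<partial>lborel) - (- 2 * \<i> * (\<integral>p. indicator R p * (a p * ?B n (p - z) + g p * ?Bd p) \<partial>lborel))
      = 2 * \<i> * ((\<integral>p. indicator R p * (b p * ?A n (p - z)) \<partial>lborel) + (\<integral>p. indicator R p * (a p * ?B n (p - z)) \<partial>lborel))"
      by (simp add: distrib_left[symmetric])
    show ?thesis unfolding S[symmetric] Green[OF c1, symmetric] Green_cnj[OF c2, symmetric] by simp
  qed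
  show ?thesis unfolding eq by (intro tendsto_diff tendsto_mult tendsto_add tendsto_const L1 L2 L3 L4)
qed

text \<open>For real \<open>z\<close> the kernels coincide on the chord, which therefore does not contribute.\<close>
lemma kernel_Suc_real:
  fixes i :: nat
  assumes g: "C1c g a b" and z: "z \<notin> \<gamma> ` {0..1}" and real: "Im z = 0"
  defines "W \<equiv> \<lambda>\<zeta>. (cnj (\<zeta> - z) / (\<zeta> - z)) ^ Suc i"
  shows "pint \<gamma> D (\<lambda>\<zeta>. g \<zeta> * (W \<zeta> / (\<zeta> - z))) - pint \<gamma> (\<lambda>t. cnj (D t)) (\<lambda>\<zeta>. g \<zeta> * (W \<zeta> / cnj (\<zeta> - z))) =
    2 * \<i> * ((\<integral>p. indicator R p * (b p * (W p / (p - z))) \<partial>lborel) + (\<integral>p. indicator R p * (a p * (W p / cnj (p - z))) \<partial>lborel))"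
proof -
  have "cnj (seg s t - z) = seg s t - z" for t using real by (simp add: seg_def complex_eq_iff)
  then have "Ak i (eps n) (seg s t - z) = Bk i (eps n) (seg s t - z)" for n t
    by (rule Ak_eq_Bk_real)
  then have "pint_seg s (\<lambda>\<zeta>. g \<zeta> * Ak i (eps n) (\<zeta> - z)) - pint_seg s (\<lambda>\<zeta>. g \<zeta> * Bk i (eps n) (\<zeta> - z)) = 0" for n
    unfolding pint_def by simp
  note zero = kernel_Suc_reg[OF g z, of i, unfolded this LIMSEQ_const_iff]
  have "y = x" if "0 = x - y" for x y :: complex using that by simp
  from this[OF zero] show ?thesis unfolding W_def .
qed

lemma kernel_Suc_interior:
  fixes i :: nat
  assumes g: "C1c g a b" and z: "z \<notin> \<gamma> ` {0..1}" and z': "z \<notin> seg s ` {0..1}"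
  defines "W \<equiv> \<lambda>\<zeta>. (cnj (\<zeta> - z) / (\<zeta> - z)) ^ Suc i"
  shows "(pint_seg s (\<lambda>\<zeta>. g \<zeta> * (W \<zeta> / (\<zeta> - z))) - pint_seg s (\<lambda>\<zeta>. g \<zeta> * (W \<zeta> / cnj (\<zeta> - z))))
    + (pint \<gamma> D (\<lambda>\<zeta>. g \<zeta> * (W \<zeta> / (\<zeta> - z))) - pint \<gamma> (\<lambda>t. cnj (D t)) (\<lambda>\<zeta>. g \<zeta> * (W \<zeta> / cnj (\<zeta> - z)))) =
    2 * \<i> * ((\<integral>p. indicator R p * (b p * (W p / (p - z))) \<partial>lborel) + (\<integral>p. indicator R p * (a p * (W p / cnj (p - z))) \<partial>lborel))"
proof -
  note cg = C1c_continuous[OF g]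
  have cA: "continuous_on UNIV (\<lambda>w. Ak i (eps n) (w - z))" for n by (rule C1_continuous[OF C1_Ak[OF eps_pos]])
  have cB: "continuous_on UNIV (\<lambda>w. Bk i (eps n) (w - z))" for n by (rule C1_continuous[OF C1_Bk[OF eps_pos]])
  let ?KA = "\<lambda>w. (cnj w / w) ^ Suc i / w" and ?KB = "\<lambda>w. (cnj w / w) ^ Suc i / cnj w"
  have cKA: "continuous_on (-{0}) ?KA" "continuous_on (-{0}) ?KB"
    by (intro continuous_intros; simp)+
  have L1: "(\<lambda>n. pint_seg s (\<lambda>\<zeta>. g \<zeta> * Ak i (eps n) (\<zeta> - z))) \<longlonglongrightarrow> pint_seg s (\<lambda>\<zeta>. g \<zeta> * (W \<zeta> / (\<zeta> - z)))"
    unfolding W_def by (rule pint_limit[OF seg_continuous continuous_on_const cg cA norm_Ak[OF eps_pos] cKA(1) Ak_limit z'])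
  have L2: "(\<lambda>n. pint_seg s (\<lambda>\<zeta>. g \<zeta> * Bk i (eps n) (\<zeta> - z))) \<longlonglongrightarrow> pint_seg s (\<lambda>\<zeta>. g \<zeta> * (W \<zeta> / cnj (\<zeta> - z)))"
    unfolding W_def by (rule pint_limit[OF seg_continuous continuous_on_const cg cB norm_Bk[OF eps_pos] cKA(2) Bk_limit z'])
  have "a + y = x" if "a = x - y" for a x y :: complex using that by simp
  from this[OF LIMSEQ_unique[OF tendsto_diff[OF L1 L2] kernel_Suc_reg[OF g z, of i]]] show ?thesis unfolding W_def .
qed

lemma kernel_zero_interior:
  assumes g: "C1c g a b" and z: "z \<notin> \<gamma> ` {0..1}" and z': "z \<notin> seg s ` {0..1}" and R: "open R" "z \<in> R"
  shows "pint_seg s (\<lambda>\<zeta>. g \<zeta> * (1 / (\<zeta> - z))) + pint \<gamma> D (\<lambda>\<zeta>. g \<zeta> * (1 / (\<zeta> - z))) =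
     2 * \<i> * (\<integral>p. indicator R p * (b p * (1 / (p - z))) \<partial>lborel) + 2 * \<i> * of_real pi * g z"
proof -
  note cg = C1c_continuous[OF g]
  have dn: "\<forall>\<^sub>F n in sequentially. (z + eps n *\<^sub>R w \<in> R) = (w \<in> Hset True)" for w
  proof -
    have "(\<lambda>n. z + eps n *\<^sub>R w) \<longlonglongrightarrow> z + 0 *\<^sub>R w" by (intro tendsto_intros eps_lim)
    then have "\<forall>\<^sub>F n in sequentially. z + eps n *\<^sub>R w \<in> R" using R by (auto simp: tendsto_def)
    then show ?thesis by (simp add: Hset_def)
  qed
  have L1: "(\<lambda>n. pint_seg s (\<lambda>\<zeta>. g \<zeta> * rk (eps n) 0 1 1 (\<zeta> - z))) \<longlonglongrightarrow> pint_seg s (\<lambda>\<zeta>. g \<zeta> * (1 / (\<zeta> - z)))"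
  proof (rule pint_limit[OF seg_continuous continuous_on_const cg _ norm_cauchy_reg _ _ z'])
    show "continuous_on UNIV (\<lambda>w. rk (eps n) 0 1 1 (w - z))" for n by (rule continuous_rk(1)[OF eps_pos])
    show "continuous_on (- {0}) (\<lambda>w::complex. 1 / w)" by (intro continuous_intros) auto
    show "(\<lambda>n. rk (eps n) 0 1 1 w) \<longlonglongrightarrow> 1 / w" if "w \<noteq> 0" for w
      using rk_limit[OF that, of 0 1 1] that by simp
  qed
  have "a + y = x" if "a = x - y" for a x y :: complex using that by simp
  from this[OF LIMSEQ_unique[OF L1 kernel_zero[OF g z dn]]] show ?thesis by (simp add: dens_def)
qed

end

section \<open>Smoothed principal values and weak limits\<close>

text \<open>The elementary identity \<open>t\<^sup>2 / (t\<^sup>2 + e\<^sup>2) = \<integral> w(r) [e r < |t|] dr\<close>, with a probability density \<open>w\<close>, exhibits the smooth truncation \<open>t / (t\<^sup>2 + e\<^sup>2)\<close> of \<open>1 / t\<close> as an average of sharp truncations. This lemma is its computation.\<close>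
lemma pv_weight_integral:
  fixes c :: real assumes "c > 0"
  shows "integrable lborel (\<lambda>r. indicator {0..c} r * (2 * r / (1 + r\<^sup>2)\<^sup>2))"
    "(\<integral>r. indicator {0..c} r * (2 * r / (1 + r\<^sup>2)\<^sup>2) \<partial>lborel) = c\<^sup>2 / (1 + c\<^sup>2)"
proof -
  have ne: "1 + r\<^sup>2 \<noteq> 0" for r :: real by (smt (verit) zero_le_power2)
  have hb: "has_bochner_integral lborel (\<lambda>r. indicator {0..c} r *\<^sub>R (2 * r / (1 + r\<^sup>2)\<^sup>2)) (- 1 / (1 + c\<^sup>2) - - 1 / (1 + 0\<^sup>2))"
  proof (rule has_bochner_integral_FTC_Icc)
    show "0 \<le> c" using assms by simp
    show "((\<lambda>r. - 1 / (1 + r\<^sup>2)) has_vector_derivative 2 * r / (1 + r\<^sup>2)\<^sup>2) (at r within {0..c})" for r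
      using ne[of r] unfolding has_real_derivative_iff_has_vector_derivative[symmetric]
      by (auto intro!: derivative_eq_intros simp: power2_eq_square)
    show "continuous_on {0..c} (\<lambda>r. 2 * r / (1 + r\<^sup>2)\<^sup>2)" using ne by (intro continuous_intros) auto
  qed
  moreover have "- 1 / (1 + c\<^sup>2) - - 1 / (1 + 0\<^sup>2) = c\<^sup>2 / (1 + c\<^sup>2)" using ne[of c] by (simp add: field_simps)
  ultimately show "integrable lborel (\<lambda>r. indicator {0..c} r * (2 * r / (1 + r\<^sup>2)\<^sup>2))"
    "(\<integral>r. indicator {0..c} r * (2 * r / (1 + r\<^sup>2)\<^sup>2) \<partial>lborel) = c\<^sup>2 / (1 + c\<^sup>2)"
    by (auto simp: has_bochner_integral_iff)
qed

definition pvw :: "real \<Rightarrow> real" where "pvw r = indicator {0..} r * (2 * r / (1 + r\<^sup>2)\<^sup>2)"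

lemma pvw_measurable [measurable]: "pvw \<in> borel_measurable borel" unfolding pvw_def by measurable
lemma pvw_nonneg: "pvw r \<ge> 0" unfolding pvw_def by (auto simp: indicator_def)

lemma pvw_integral: "integrable lborel pvw" "(\<integral>r. pvw r \<partial>lborel) = 1"
proof -
  have ne: "1 + r\<^sup>2 \<noteq> 0" for r :: real by (smt (verit) zero_le_power2)
  have "(\<integral>\<^sup>+r. ennreal (2 * r / (1 + r\<^sup>2)\<^sup>2) * indicator {0..} r \<partial>lborel) = ennreal (0 - (- 1 / (1 + 0\<^sup>2)))"
  proof (rule nn_integral_FTC_atLeast)
    show "((\<lambda>r::real. - 1 / (1 + r\<^sup>2)) \<longlongrightarrow> 0) at_top" by real_asymp
    show "DERIV (\<lambda>r. - 1 / (1 + r\<^sup>2)) r :> 2 * r / (1 + r\<^sup>2)\<^sup>2" for r :: real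
      using ne[of r] by (auto intro!: derivative_eq_intros simp: power2_eq_square)
  qed auto
  also have "(\<integral>\<^sup>+r. ennreal (2 * r / (1 + r\<^sup>2)\<^sup>2) * indicator {0..} r \<partial>lborel) = (\<integral>\<^sup>+r. ennreal (pvw r) \<partial>lborel)"
    by (intro nn_integral_cong) (auto simp: pvw_def indicator_def)
  finally have "has_bochner_integral lborel pvw 1"
    by (intro has_bochner_integral_nn_integral) (auto simp: pvw_nonneg)
  then show "integrable lborel pvw" "(\<integral>r. pvw r \<partial>lborel) = 1" by (auto simp: has_bochner_integral_iff)
qed

lemma pvw_truncated:
  assumes "e > 0" "t \<noteq> 0"
  shows "integrable lborel (\<lambda>r. pvw r * (if e * r < \<bar>t\<bar> then 1 else 0))"
    "(\<integral>r. pvw r * (if e * r < \<bar>t\<bar> then 1 else 0) \<partial>lborel) = t\<^sup>2 / (t\<^sup>2 + e\<^sup>2)"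
proof -
  have c: "\<bar>t\<bar> / e > 0" using assms by simp
  have ae: "AE r in lborel. indicator {0..\<bar>t\<bar> / e} r * (2 * r / (1 + r\<^sup>2)\<^sup>2) = pvw r * (if e * r < \<bar>t\<bar> then 1 else 0)"
  proof (rule AE_I[where N="{\<bar>t\<bar> / e}"])
    show "{r \<in> space lborel. \<not> indicator {0..\<bar>t\<bar> / e} r * (2 * r / (1 + r\<^sup>2)\<^sup>2) = pvw r * (if e * r < \<bar>t\<bar> then 1 else 0)} \<subseteq> {\<bar>t\<bar> / e}"
      using assms(1) by (auto simp: pvw_def indicator_def field_simps split: if_splits)
  qed auto
  show "integrable lborel (\<lambda>r. pvw r * (if e * r < \<bar>t\<bar> then 1 else 0))"
    by (rule integrable_cong_AE_imp[OF pv_weight_integral(1)[OF c] _ ae]) measurable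
  have "(\<integral>r. pvw r * (if e * r < \<bar>t\<bar> then 1 else 0) \<partial>lborel) = (\<integral>r. indicator {0..\<bar>t\<bar> / e} r * (2 * r / (1 + r\<^sup>2)\<^sup>2) \<partial>lborel)"
    by (rule integral_cong_AE[OF _ _ AE_symmetric[OF ae]]) measurable
  also have "\<dots> = (\<bar>t\<bar> / e)\<^sup>2 / (1 + (\<bar>t\<bar> / e)\<^sup>2)" by (rule pv_weight_integral(2)[OF c])
  also have "\<dots> = t\<^sup>2 / (t\<^sup>2 + e\<^sup>2)" using assms by (simp add: power_divide field_simps add_nonneg_eq_0_iff)
  finally show "(\<integral>r. pvw r * (if e * r < \<bar>t\<bar> then 1 else 0) \<partial>lborel) = t\<^sup>2 / (t\<^sup>2 + e\<^sup>2)" .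
qed

abbreviation LS :: "real \<Rightarrow> real measure" where "LS s \<equiv> lebesgue_on {-s<..<s}"

lemma LS_id_measurable [measurable]: "(\<lambda>y. y) \<in> LS s \<rightarrow>\<^sub>M borel"
  by (rule measurable_restrict_space1, rule measurable_completion) simp

lemma finite_LS: "finite_measure (LS s)"
proof (rule finite_measureI)
  show "emeasure (LS s) (space (LS s)) \<noteq> \<infinity>"
    by (cases "-s \<le> s") (auto simp: emeasure_restrict_space space_restrict_space)
qed

lemma truncated_hilbert_LS:
  "truncated_hilbert s u x e = 1 / of_real pi * (\<integral>y. (if e < \<bar>x - y\<bar> then u y / of_real (x - y) else 0) \<partial>LS s)"
proof -
  have "(\<integral>y. (if e < \<bar>x - y\<bar> then u y / of_real (x - y) else 0) \<partial>LS s) = (\<integral>y. indicator {-s<..<s} y *\<^sub>R (if e < \<bar>x - y\<bar> then u y / of_real (x - y) else 0) \<partial>lebesgue)"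
    by (subst integral_restrict_space) (auto simp: set_lebesgue_integral_def)
  also have "\<dots> = (\<integral>y\<in>{y\<in>{-s<..<s}. e < \<bar>x - y\<bar>}. u y / of_real (x - y) \<partial>lebesgue)"
    unfolding set_lebesgue_integral_def by (intro lebesgue_integral_cong) (auto simp: indicator_def)
  finally show ?thesis unfolding truncated_hilbert_def by simp
qed

text \<open>By Fubini the smoothed integral is the \<open>pvw\<close>-average of truncated Hilbert transforms at the levels \<open>eps n * r\<close>. These are bounded and converge, so dominated convergence applies.\<close>
lemma smoothed_hilbert_limit:
  assumes u: "integrable (LS s) u" and h: "has_finite_hilbert s u x h"
  shows "(\<lambda>n. \<integral>y. u y * of_real ((x - y) / ((x - y)\<^sup>2 + (eps n)\<^sup>2)) \<partial>LS s) \<longlonglongrightarrow> of_real pi * h"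
proof -
  interpret M: finite_measure "LS s" by (rule finite_LS)
  interpret pair_sigma_finite "LS s" lborel ..
  have [measurable]: "u \<in> borel_measurable (LS s)" using u by auto
  define T where "T d = (\<integral>y. (if d < \<bar>x - y\<bar> then u y / of_real (x - y) else 0) \<partial>LS s)" for d
  have lim0: "(T \<longlongrightarrow> of_real pi * h) (at_right 0)"
  proof -
    have "((\<lambda>e. of_real pi * truncated_hilbert s u x e) \<longlongrightarrow> of_real pi * h) (at_right 0)"
      using h unfolding has_finite_hilbert_def by (intro tendsto_intros)
    then show ?thesis unfolding truncated_hilbert_LS T_def by simp
  qed
  obtain B where B: "\<And>d. d > 0 \<Longrightarrow> norm (T d) \<le> B"
  proof -
    have "\<forall>\<^sub>F d in at_right 0. dist (T d) (of_real pi * h) < 1" using lim0 by (auto simp: tendsto_iff)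
    then obtain c where c: "c > 0" "\<And>d. 0 < d \<Longrightarrow> d < c \<Longrightarrow> dist (T d) (of_real pi * h) < 1"
      unfolding eventually_at_right_field by auto
    have 1: "norm (T d) \<le> 1 + norm (of_real pi * h)" if "0 < d" "d < c" for d
      using c(2)[OF that] norm_triangle_ineq2[of "T d" "of_real pi * h"] by (simp add: dist_norm)
    have 2: "norm (T d) \<le> (\<integral>y. norm (u y) / c \<partial>LS s)" if "d \<ge> c" for d
    proof -
      have "norm (T d) \<le> (\<integral>y. norm (if d < \<bar>x - y\<bar> then u y / of_real (x - y) else 0) \<partial>LS s)" unfolding T_def by (rule integral_norm_bound)
      also have "\<dots> \<le> (\<integral>y. norm (u y) / c \<partial>LS s)"
      proof (rule integral_mono')
        show "integrable (LS s) (\<lambda>y. norm (u y) / c)" using u by auto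
        show "norm (if d < \<bar>x - y\<bar> then u y / of_real (x - y) else 0) \<le> norm (u y) / c" for y
          using c(1) that by (auto simp: norm_divide simp del: of_real_diff intro!: divide_left_mono mult_pos_pos)
        show "0 \<le> norm (u y) / c" for y using c(1) by auto
      qed
      finally show ?thesis .
    qed
    show ?thesis
      by (rule that[of "max (1 + norm (of_real pi * h)) (\<integral>y. norm (u y) / c \<partial>LS s)"])
         (metis 1 2 max.coboundedI1 max.coboundedI2 not_le)
  qed
  define F where "F e y r = of_real (pvw r) * (if e * r < \<bar>x - y\<bar> then u y / of_real (x - y) else 0)" for e y r
  have Fm[measurable]: "case_prod (F e) \<in> borel_measurable (LS s \<Otimes>\<^sub>M lborel)" for e
    unfolding F_def by measurable
  have Feq: "F e y r = of_real (pvw r * (if e * r < \<bar>x - y\<bar> then 1 else 0)) * (u y / of_real (x - y))" for e y r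
    unfolding F_def by auto
  have Fi: "integrable (LS s \<Otimes>\<^sub>M lborel) (case_prod (F e))" if e: "e > 0" for e
  proof (rule Fubini_integrable[OF Fm])
    show "AE y in LS s. integrable lborel (\<lambda>r. case_prod (F e) (y, r))"
    proof (rule AE_I2)
      fix y
      show "integrable lborel (\<lambda>r. case_prod (F e) (y, r))"
      proof (cases "x - y = 0")
        case False
        show ?thesis unfolding prod.case Feq
          by (intro integrable_mult_left integrable_of_real pvw_truncated(1)[OF e False])
      qed (simp add: Feq)
    qed
    have n: "(\<integral>r. norm (case_prod (F e) (y, r)) \<partial>lborel) = norm (u y) * (\<bar>x - y\<bar> / ((x - y)\<^sup>2 + e\<^sup>2))" for y
    proof (cases "x - y = 0")
      case False
      have "(\<integral>r. norm (case_prod (F e) (y, r)) \<partial>lborel) = (\<integral>r. pvw r * (if e * r < \<bar>x - y\<bar> then 1 else 0) * (norm (u y) / \<bar>x - y\<bar>) \<partial>lborel)"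
        by (intro lebesgue_integral_cong) (auto simp: F_def norm_mult norm_divide pvw_nonneg simp del: of_real_diff)
      also have "\<dots> = (x - y)\<^sup>2 / ((x - y)\<^sup>2 + e\<^sup>2) * (norm (u y) / \<bar>x - y\<bar>)"
        using pvw_truncated(2)[OF e False] by (subst integral_mult_left_zero) simp
      also have "t\<^sup>2 / q * (a / \<bar>t\<bar>) = a * (\<bar>t\<bar> / q)" if "t \<noteq> 0" for a t q :: real
      proof -
        have "t\<^sup>2 = \<bar>t\<bar> * \<bar>t\<bar>" by (simp add: power2_eq_square)
        then have "t\<^sup>2 / q * (a / \<bar>t\<bar>) = \<bar>t\<bar> * \<bar>t\<bar> / q * (a / \<bar>t\<bar>)" by (simp only:)
        also have "b * b / q * (a / b) = a * (b / q)" if "b \<noteq> 0" for b using that by simp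
        from this[of "\<bar>t\<bar>"] that have "\<bar>t\<bar> * \<bar>t\<bar> / q * (a / \<bar>t\<bar>) = a * (\<bar>t\<bar> / q)" by simp
        finally show ?thesis .
      qed
      from this[OF False] have "(x - y)\<^sup>2 / ((x - y)\<^sup>2 + e\<^sup>2) * (norm (u y) / \<bar>x - y\<bar>) = norm (u y) * (\<bar>x - y\<bar> / ((x - y)\<^sup>2 + e\<^sup>2))" .
      finally show ?thesis .
    qed (simp add: Feq)
    show "integrable (LS s) (\<lambda>y. \<integral>r. norm (case_prod (F e) (y, r)) \<partial>lborel)"
      unfolding n
    proof (rule integrable_dominated[of _ "\<lambda>y. norm (u y) * (1 / e)"])
      show "AE y in LS s. norm (norm (u y) * (\<bar>x - y\<bar> / ((x - y)\<^sup>2 + e\<^sup>2))) \<le> norm (norm (u y) * (1 / e))"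
      proof (rule AE_I2)
        fix y
        have "\<bar>t\<bar> / (t\<^sup>2 + e\<^sup>2) \<le> 1 / e" for t :: real
        proof -
          have "0 \<le> (\<bar>t\<bar> - e)\<^sup>2" by simp
          then have "2 * (\<bar>t\<bar> * e) \<le> t\<^sup>2 + e\<^sup>2" by (simp add: power2_eq_square algebra_simps)
          moreover have "0 \<le> \<bar>t\<bar> * e" using e by simp
          ultimately have "\<bar>t\<bar> * e \<le> t\<^sup>2 + e\<^sup>2" by linarith
          moreover have "t\<^sup>2 + e\<^sup>2 > 0" using e by (simp add: add_nonneg_pos)
          ultimately show ?thesis using e by (simp add: divide_simps)
        qed
        then have "norm (u y) * (\<bar>x - y\<bar> / ((x - y)\<^sup>2 + e\<^sup>2)) \<le> norm (u y) * (1 / e)" by (intro mult_left_mono) auto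
        then show "norm (norm (u y) * (\<bar>x - y\<bar> / ((x - y)\<^sup>2 + e\<^sup>2))) \<le> norm (norm (u y) * (1 / e))"
          using e by (simp add: abs_mult)
      qed
      show "integrable (LS s) (\<lambda>y. norm (u y) * (1 / e))" using u by auto
    qed auto
  qed
  have i1: "(\<integral>r. F e y r \<partial>lborel) = u y * of_real ((x - y) / ((x - y)\<^sup>2 + e\<^sup>2))" if e: "e > 0" for e y
  proof (cases "x - y = 0")
    case False
    have "(\<integral>r. F e y r \<partial>lborel) = of_real ((x - y)\<^sup>2 / ((x - y)\<^sup>2 + e\<^sup>2)) * (u y / of_real (x - y))"
      unfolding Feq pvw_truncated(2)[OF e False, symmetric] by (simp only: integral_mult_left_zero integral_complex_of_real)
    also have "complex_of_real (t\<^sup>2 / q) * (a / of_real t) = a * of_real (t / q)" if "t \<noteq> 0" for a t q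
      using that by (simp add: power2_eq_square)
    from this[OF False] have "of_real ((x - y)\<^sup>2 / ((x - y)\<^sup>2 + e\<^sup>2)) * (u y / of_real (x - y)) = u y * of_real ((x - y) / ((x - y)\<^sup>2 + e\<^sup>2))" .
    finally show ?thesis .
  qed (simp add: Feq)
  have i2: "(\<integral>y. F e y r \<partial>LS s) = of_real (pvw r) * T (e * r)" for e r
    unfolding F_def T_def by (rule integral_mult_right_zero)
  have "(\<integral>y. u y * of_real ((x - y) / ((x - y)\<^sup>2 + e\<^sup>2)) \<partial>LS s) = (\<integral>r. of_real (pvw r) * T (e * r) \<partial>lborel)" if e: "e > 0" for e
    using Fubini_integral[OF Fi[OF e]] unfolding i1[OF e] i2 by simp
  note eq = this[OF eps_pos]
  have "(\<lambda>n. \<integral>r. of_real (pvw r) * T (eps n * r) \<partial>lborel) \<longlonglongrightarrow> (\<integral>r. of_real (pvw r) * (of_real pi * h) \<partial>lborel)"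
  proof (rule integral_dominated_convergence[where w="\<lambda>r. pvw r * B"])
    show "integrable lborel (\<lambda>r. pvw r * B)" using pvw_integral(1) by auto
    show "(\<lambda>r. of_real (pvw r) * T (eps n * r)) \<in> borel_measurable lborel" for n
      using integrable_snd[OF Fi[OF eps_pos[of n]]] unfolding i2 by auto
    show "AE r in lborel. (\<lambda>n. of_real (pvw r) * T (eps n * r)) \<longlonglongrightarrow> of_real (pvw r) * (of_real pi * h)"
    proof (rule AE_I2)
      fix r
      show "(\<lambda>n. of_real (pvw r) * T (eps n * r)) \<longlonglongrightarrow> of_real (pvw r) * (of_real pi * h)"
      proof (cases "r > 0")
        case True
        have "(\<lambda>n. eps n * r) \<longlonglongrightarrow> 0 * r" by (intro tendsto_intros eps_lim)
        then have "filterlim (\<lambda>n. eps n * r) (at_right 0) sequentially"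
          using True eps_pos by (auto simp: filterlim_at less_imp_neq[symmetric] eps_def)
        from filterlim_compose[OF lim0 this] show ?thesis by (intro tendsto_intros)
      next
        case False
        then have "pvw r = 0" by (cases "r = 0") (auto simp: pvw_def)
        then show ?thesis by simp
      qed
    qed
    show "AE r in lborel. norm (of_real (pvw r) * T (eps n * r)) \<le> pvw r * B" for n
    proof (rule AE_I2)
      fix r
      show "norm (of_real (pvw r) * T (eps n * r)) \<le> pvw r * B"
      proof (cases "r > 0")
        case True then show ?thesis using B[of "eps n * r"] eps_pos[of n] pvw_nonneg[of r]
          by (auto simp: norm_mult intro!: mult_left_mono)
      next
        case False
        then have "pvw r = 0" by (cases "r = 0") (auto simp: pvw_def)
        then show ?thesis by simp
      qed
    qed
  qed auto
  moreover have "(\<integral>r. of_real (pvw r) * (of_real pi * h) \<partial>lborel) = of_real pi * h"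
    by (simp only: integral_mult_left_zero integral_complex_of_real pvw_integral(2) of_real_1 mult_1)
  ultimately show ?thesis unfolding eq by (simp only:)
qed

lemma weak_limit:
  fixes f :: "nat \<Rightarrow> 'a \<Rightarrow> complex"
  assumes fm[measurable]: "\<And>n. f n \<in> borel_measurable M" and vm[measurable]: "v \<in> borel_measurable M"
    and fi: "\<And>n. integrable M (\<lambda>x. (norm (f n x))\<^sup>2)" and B: "\<And>n. (\<integral>x. (norm (f n x))\<^sup>2 \<partial>M) \<le> B"
    and v: "integrable M (\<lambda>x. (norm (v x))\<^sup>2)"
    and lim: "AE x in M. (\<lambda>n. f n x) \<longlonglongrightarrow> 0"
  shows "(\<lambda>n. \<integral>x. f n x * v x \<partial>M) \<longlonglongrightarrow> 0"
proof (rule LIMSEQ_I)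
  fix \<epsilon> :: real assume \<epsilon>: "\<epsilon> > 0"
  have B0: "B \<ge> 0" using order_trans[OF integral_nonneg_AE B[of 0]] by auto
  define d where "d = \<epsilon> / (2 * (B + 1))"
  have d: "d > 0" using B0 \<epsilon> by (simp add: d_def)
  have dB: "d * B < \<epsilon> / 2" 
  proof -
    have "d * B < d * (B + 1)" using d by simp
    also have "\<dots> = \<epsilon> / 2" using B0 by (simp add: d_def field_simps)
    finally show ?thesis .
  qed
  let ?m = "\<lambda>n x. min (norm (f n x) * norm (v x)) ((norm (v x))\<^sup>2 / d)"
  have mi: "integrable M (?m n)" for n
    by (rule integrable_dominated[of _ "\<lambda>x. (norm (v x))\<^sup>2 / d"]) (use v d in auto)
  have "(\<lambda>n. \<integral>x. ?m n x \<partial>M) \<longlonglongrightarrow> (\<integral>x. 0 \<partial>M)"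
  proof (rule integral_dominated_convergence[where w="\<lambda>x. (norm (v x))\<^sup>2 / d"])
    show "AE x in M. (\<lambda>n. ?m n x) \<longlonglongrightarrow> 0"
      using lim
    proof eventually_elim
      case (elim x)
      have "(\<lambda>n. ?m n x) \<longlonglongrightarrow> min (norm (0::complex) * norm (v x)) ((norm (v x))\<^sup>2 / d)"
        by (intro tendsto_min tendsto_mult tendsto_norm tendsto_const elim)
      then show ?case using d by simp
    qed
  qed (use v d in \<open>auto simp: min_def\<close>)
  then have "(\<lambda>n. \<integral>x. ?m n x \<partial>M) \<longlonglongrightarrow> 0" by simp
  from LIMSEQ_D[OF this, of "\<epsilon> / 2"] \<epsilon> obtain N where "\<forall>n\<ge>N. norm ((\<integral>x. ?m n x \<partial>M) - 0) < \<epsilon> / 2" by auto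
  then have N: "norm (\<integral>x. ?m n x \<partial>M) < \<epsilon> / 2" if "n \<ge> N" for n using that by (simp only: diff_zero)
  show "\<exists>N. \<forall>n\<ge>N. norm ((\<integral>x. f n x * v x \<partial>M) - 0) < \<epsilon>"
  proof (intro exI allI impI)
    fix n assume n: "n \<ge> N"
    have "norm (\<integral>x. f n x * v x \<partial>M) \<le> (\<integral>x. norm (f n x * v x) \<partial>M)" by (rule integral_norm_bound)
    also have "\<dots> \<le> (\<integral>x. d * (norm (f n x))\<^sup>2 + ?m n x \<partial>M)"
    proof (rule integral_mono')
      show "integrable M (\<lambda>x. d * (norm (f n x))\<^sup>2 + ?m n x)" using fi mi by auto
      fix x
      show "norm (f n x * v x) \<le> d * (norm (f n x))\<^sup>2 + ?m n x"
      proof (cases "norm (f n x) * norm (v x) \<le> (norm (v x))\<^sup>2 / d")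
        case False
        then have "norm (v x) \<noteq> 0" by auto
        then have "norm (v x) < d * norm (f n x)" using False d by (simp add: field_simps power2_eq_square)
        then have "norm (v x) * norm (f n x) \<le> d * norm (f n x) * norm (f n x)" by (intro mult_right_mono) auto
        moreover have "0 \<le> (norm (v x))\<^sup>2 / d" using d by simp
        ultimately show ?thesis using False by (simp add: norm_mult power2_eq_square mult_ac)
      qed (use d in \<open>auto simp: norm_mult\<close>)
      show "0 \<le> d * (norm (f n x))\<^sup>2 + ?m n x" using d by auto
    qed
    also have "\<dots> = d * (\<integral>x. (norm (f n x))\<^sup>2 \<partial>M) + (\<integral>x. ?m n x \<partial>M)" using fi mi by simp
    also have "\<dots> \<le> d * B + norm (\<integral>x. ?m n x \<partial>M)" using B d by (intro add_mono mult_left_mono) auto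
    also have "\<dots> < \<epsilon>" using dB N[OF n] by linarith
    finally show "norm ((\<integral>x. f n x * v x \<partial>M) - 0) < \<epsilon>" by simp
  qed
qed

section \<open>Two analytic tools: a residue integral and density in L2\<close>

lemma integrable_inverse_square: 
  "integrable lborel (\<lambda>x::real. 1 / (1 + x\<^sup>2))" "(\<integral>x. 1 / (1 + (x::real)\<^sup>2) \<partial>lborel) = pi"
proof -
  have ne: "1 + r\<^sup>2 \<noteq> 0" for r :: real by (smt (verit) zero_le_power2)
  let ?f = "\<lambda>x::real. 1 / (1 + x\<^sup>2)"
  have "(\<integral>\<^sup>+x. ennreal (?f x) * indicator {0..} x \<partial>lborel) = ennreal (pi / 2 - arctan 0)"
  proof (rule nn_integral_FTC_atLeast)
    show "(arctan \<longlongrightarrow> pi / 2) at_top" by (rule tendsto_arctan_at_top)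
    show "DERIV arctan x :> ?f x" for x :: real by (auto intro!: derivative_eq_intros simp: divide_inverse)
  qed auto
  also have "(\<integral>\<^sup>+x. ennreal (?f x) * indicator {0..} x \<partial>lborel) = (\<integral>\<^sup>+x. ennreal (indicator {0..} x * ?f x) \<partial>lborel)"
    by (intro nn_integral_cong) (auto simp: indicator_def)
  finally have hb: "has_bochner_integral lborel (\<lambda>x. indicator {0..} x * ?f x) (pi / 2)"
    by (intro has_bochner_integral_nn_integral) auto
  have hb2: "has_bochner_integral lborel (\<lambda>x. indicator {0..} (-x) * ?f (-x)) (pi / 2)"
    using lborel_has_bochner_integral_real_affine_iff[of "-1" "\<lambda>x. indicator {0..} x * ?f x" "pi / 2" 0] hb by simp
  have ae: "AE x in lborel. indicator {0..} x * ?f x + indicator {0..} (-x) * ?f (-x) = ?f x"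
    by (rule AE_I[where N="{0::real}"]) (auto simp: indicator_def)
  have "has_bochner_integral lborel (\<lambda>x. indicator {0..} x * ?f x + indicator {0..} (-x) * ?f (-x)) (pi / 2 + pi / 2)"
    by (rule has_bochner_integral_add[OF hb hb2])
  then have "has_bochner_integral lborel ?f (pi / 2 + pi / 2)"
    by (subst (asm) has_bochner_integral_cong_AE[OF _ _ ae]) auto
  then show "integrable lborel ?f" "(\<integral>x. ?f x \<partial>lborel) = pi" by (auto simp: has_bochner_integral_iff)
qed

lemma inverse_dist_bound:
  fixes a :: complex and x :: real
  assumes "norm a \<le> A" "\<bar>Im a\<bar> \<ge> e" "e > 0"
  shows "1 / (norm (of_real x - a))\<^sup>2 \<le> (2 + (1 + 2 * A\<^sup>2) / e\<^sup>2) / (1 + x\<^sup>2)"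
proof -
  let ?d = "norm (of_real x - a)"
  have "e \<le> ?d" using abs_Im_le_cmod[of "of_real x - a"] assms(2) by simp
  then have d2: "e\<^sup>2 \<le> ?d\<^sup>2" using assms(3) by (intro power_mono) auto
  then have dp: "?d\<^sup>2 > 0" using assms(3) by (smt (verit) zero_less_power)
  have "\<bar>x\<bar> \<le> ?d + A" using norm_triangle_ineq[of "of_real x - a" a] assms(1) by simp
  then have "x\<^sup>2 \<le> (?d + A)\<^sup>2" by (metis abs_ge_zero power2_abs power_mono)
  also have "\<dots> \<le> 2 * ?d\<^sup>2 + 2 * A\<^sup>2" using zero_le_power2[of "?d - A"] by (simp add: power2_eq_square algebra_simps)
  finally have "1 + x\<^sup>2 \<le> 2 * ?d\<^sup>2 + (1 + 2 * A\<^sup>2) * 1" by simp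
  also have "(1 + 2 * A\<^sup>2) * 1 \<le> (1 + 2 * A\<^sup>2) * (?d\<^sup>2 / e\<^sup>2)"
    using d2 assms(3) by (intro mult_left_mono) (auto simp: divide_simps)
  finally have "1 + x\<^sup>2 \<le> (2 + (1 + 2 * A\<^sup>2) / e\<^sup>2) * ?d\<^sup>2" by (simp add: algebra_simps)
  moreover have "1 + x\<^sup>2 > 0" by (simp add: add_pos_nonneg)
  ultimately show ?thesis using dp by (simp add: divide_simps mult.commute)
qed

lemma inverse_product_bound:
  fixes a b :: complex and x :: real
  assumes "norm a \<le> A" "\<bar>Im a\<bar> \<ge> e" "norm b \<le> A" "\<bar>Im b\<bar> \<ge> e" "e > 0"
  shows "norm (1 / ((of_real x - a) * (of_real x - b))) \<le> (2 + (1 + 2 * A\<^sup>2) / e\<^sup>2) / (1 + x\<^sup>2)"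
proof -
  let ?p = "1 / norm (of_real x - a)" and ?q = "1 / norm (of_real x - b)"
  have "2 * (?p * ?q) \<le> ?p\<^sup>2 + ?q\<^sup>2" using zero_le_power2[of "?p - ?q"] by (simp add: power2_eq_square algebra_simps)
  moreover have "?p\<^sup>2 \<le> (2 + (1 + 2 * A\<^sup>2) / e\<^sup>2) / (1 + x\<^sup>2)" "?q\<^sup>2 \<le> (2 + (1 + 2 * A\<^sup>2) / e\<^sup>2) / (1 + x\<^sup>2)"
    using inverse_dist_bound[OF assms(1,2,5), of x] inverse_dist_bound[OF assms(3,4,5), of x] by (simp_all add: power_divide)
  ultimately show ?thesis by (simp add: norm_divide norm_mult)
qed

lemma Ln_diff_limit:
  fixes a b :: complex
  shows "(\<lambda>n. Ln (of_nat n + a) - Ln (of_nat n + b)) \<longlonglongrightarrow> 0"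
proof -
  have L: "(\<lambda>n. Ln (1 + a / of_nat n)) \<longlonglongrightarrow> 0" for a :: complex
  proof -
    have "(\<lambda>n. 1 + a * (1 / of_nat n)) \<longlonglongrightarrow> 1 + a * 0" by (intro tendsto_intros lim_1_over_n)
    then have "(\<lambda>n. Ln (1 + a / of_nat n)) \<longlonglongrightarrow> Ln 1"
      by (intro isCont_tendsto_compose[OF continuous_at_Ln]) (auto simp: complex_nonpos_Reals_iff)
    then show ?thesis by simp
  qed
  have "(\<lambda>n. Ln (1 + a / of_nat n) - Ln (1 + b / of_nat n)) \<longlonglongrightarrow> 0 - 0" by (intro tendsto_diff L)
  moreover have "\<forall>\<^sub>F n in sequentially. Ln (1 + a / of_nat n) - Ln (1 + b / of_nat n) = Ln (of_nat n + a) - Ln (of_nat n + b)"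
  proof -
    have e: "\<forall>\<^sub>F n in sequentially. Ln (of_nat n + a) = ln (real n) + Ln (1 + a / of_nat n)" for a :: complex
    proof (rule eventually_mono[OF eventually_gt_at_top[of "nat \<lceil>norm a\<rceil>"]])
      fix n assume "n > nat \<lceil>norm a\<rceil>"
      then have n: "real n > norm a" "n > 0" by linarith+
      have nz: "1 + a / of_nat n \<noteq> 0"
      proof
        assume "1 + a / of_nat n = 0"
        then have "a = - of_nat n" using n(2) by (simp add: field_simps add_eq_0_iff)
        then show False using n(1) by simp
      qed
      have "of_nat n + a = of_real (real n) * (1 + a / of_nat n)" using n(2) by (simp add: field_simps)
      then show "Ln (of_nat n + a) = ln (real n) + Ln (1 + a / of_nat n)"
        using Ln_times_of_real[of "real n" "1 + a / of_nat n"] n(2) nz by simp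
    qed
    show ?thesis using e[of a] e[of b] by eventually_elim simp
  qed
  ultimately show ?thesis by (auto intro: Lim_transform_eventually)
qed

lemma residue_integral:
  fixes a b :: complex
  assumes a: "Im a > 0" and b: "Im b < 0"
  shows "integrable lborel (\<lambda>x. 1 / ((of_real x - a) * (of_real x - b)))"
    "(\<integral>x. 1 / ((of_real x - a) * (of_real x - b)) \<partial>lborel) = 2 * of_real pi * \<i> / (a - b)"
proof -
  let ?f = "\<lambda>x::real. 1 / ((of_real x - a) * (of_real x - b))"
  have nz: "of_real x - a \<noteq> 0" "of_real x - b \<noteq> 0" for x :: real using a b by (auto simp: complex_eq_iff)
  have ab: "a - b \<noteq> 0" using a b by auto
  define A e where "A = max (norm a) (norm b)" and "e = min (Im a) (- Im b)"
  define C where "C = 2 + (1 + 2 * A\<^sup>2) / e\<^sup>2"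
  have bd: "norm (?f x) \<le> C * (1 / (1 + x\<^sup>2))" for x
    using inverse_product_bound[of a A e b x] a b unfolding A_def e_def C_def by auto
  have i: "integrable lborel (\<lambda>x::real. C * (1 / (1 + x\<^sup>2)))" using integrable_inverse_square by (intro integrable_mult_right)
  show int: "integrable lborel ?f"
  proof (rule integrable_dominated[OF i])
    show "AE x in lborel. norm (?f x) \<le> norm (C * (1 / (1 + x\<^sup>2)))"
      unfolding real_norm_def by (intro AE_I2 order_trans[OF bd abs_ge_self])
  qed auto
  define F where "F x = (Ln (of_real x - a) - Ln (of_real x - b)) / (a - b)" for x :: real
  have FT: "(\<integral>x. indicator {- real n..real n} x *\<^sub>R ?f x \<partial>lborel) = F (real n) - F (- real n)" for n
  proof (rule integral_FTC_atLeastAtMost)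
    show "(F has_vector_derivative ?f x) (at x within {- real n..real n})" for x
    proof -
      have "((\<lambda>z. (Ln (z - a) - Ln (z - b)) / (a - b)) has_field_derivative (1 / (of_real x - a) - 1 / (of_real x - b)) / (a - b)) (at (of_real x))"
        using a b by (auto intro!: derivative_eq_intros simp: complex_nonpos_Reals_iff divide_inverse)
      then have "(F has_vector_derivative (1 / (of_real x - a) - 1 / (of_real x - b)) / (a - b)) (at x within {- real n..real n})"
        unfolding F_def by (rule has_vector_derivative_real_field)
      also have "(1 / (of_real x - a) - 1 / (of_real x - b)) / (a - b) = ?f x"
        using nz[of x] ab by (simp add: divide_simps)
      finally show ?thesis .
    qed
    show "continuous_on {- real n..real n} ?f" using nz by (intro continuous_intros) auto
  qed auto
  have "(\<lambda>n. \<integral>x. indicator {- real n..real n} x *\<^sub>R ?f x \<partial>lborel) \<longlonglongrightarrow> (\<integral>x. ?f x \<partial>lborel)"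
  proof (rule integral_dominated_convergence[where w="\<lambda>x. C * (1 / (1 + x\<^sup>2))"])
    show "AE x in lborel. (\<lambda>n. indicator {- real n..real n} x *\<^sub>R ?f x) \<longlonglongrightarrow> ?f x"
    proof (rule AE_I2)
      fix x :: real
      have "\<forall>\<^sub>F n in sequentially. indicator {- real n..real n} x *\<^sub>R ?f x = ?f x"
        by (rule eventually_mono[OF eventually_ge_at_top[of "nat \<lceil>\<bar>x\<bar>\<rceil>"]]) (auto simp: indicator_def)
      then show "(\<lambda>n. indicator {- real n..real n} x *\<^sub>R ?f x) \<longlonglongrightarrow> ?f x" by (rule tendsto_eventually)
    qed
    show "AE x in lborel. norm (indicator {- real n..real n} x *\<^sub>R ?f x) \<le> C * (1 / (1 + x\<^sup>2))" for n
      using bd order_trans[OF norm_ge_zero bd] by (auto simp: indicator_def)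
  qed (use i int in auto)
  moreover have "(\<lambda>n. F (real n) - F (- real n)) \<longlonglongrightarrow> 2 * of_real pi * \<i> / (a - b)"
  proof -
    have "F (real n) - F (- real n) = ((Ln (of_nat n + (-a)) - Ln (of_nat n + (-b))) - (Ln (of_nat n + a) - Ln (of_nat n + b)) + 2 * of_real pi * \<i>) / (a - b)" for n
    proof -
      have "Ln (of_real (- real n) - a) = Ln (of_nat n + a) - \<i> * pi"
        using a Ln_minus[of "of_nat n + a"] by (auto simp: complex_eq_iff)
      moreover have "Ln (of_real (- real n) - b) = Ln (of_nat n + b) + \<i> * pi"
        using b Ln_minus[of "of_nat n + b"] by (auto simp: complex_eq_iff)
      ultimately show ?thesis unfolding F_def by (simp add: diff_divide_distrib add_divide_distrib)
    qed
    moreover have "(\<lambda>n. ((Ln (of_nat n + (-a)) - Ln (of_nat n + (-b))) - (Ln (of_nat n + a) - Ln (of_nat n + b)) + 2 * of_real pi * \<i>) / (a - b)) \<longlonglongrightarrow> (0 - 0 + 2 * of_real pi * \<i>) / (a - b)"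
      by (intro tendsto_intros Ln_diff_limit ab)
    ultimately show ?thesis by simp
  qed
  ultimately show "(\<integral>x. ?f x \<partial>lborel) = 2 * of_real pi * \<i> / (a - b)"
    unfolding FT by (rule LIMSEQ_unique)
qed

text \<open>Radial retraction onto the disc of radius \<open>K\<close>, a continuous way to make an approximation bounded.\<close>
definition trunc :: "real \<Rightarrow> complex \<Rightarrow> complex" where "trunc K z = (1 / max 1 (norm z / K)) *\<^sub>R z"

lemma continuous_trunc: "K > 0 \<Longrightarrow> continuous_on UNIV (trunc K)"
  unfolding trunc_def by (intro continuous_intros) auto

lemma norm_trunc: "K > 0 \<Longrightarrow> norm (trunc K z) \<le> K"
  unfolding trunc_def by (auto simp: max_def divide_simps)

lemma norm_trunc_le: "K > 0 \<Longrightarrow> norm (trunc K z) \<le> norm z"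
  unfolding trunc_def by (auto simp: max_def divide_simps mult_left_le)

lemma trunc_id: "K > 0 \<Longrightarrow> norm z \<le> K \<Longrightarrow> trunc K z = z"
  unfolding trunc_def by (auto simp: max_def divide_simps)

lemma square_norm_add_le: "(norm (x + y))\<^sup>2 \<le> 2 * (norm x)\<^sup>2 + 2 * (norm (y::complex))\<^sup>2"
proof -
  have "(norm (x + y))\<^sup>2 \<le> (norm x + norm y)\<^sup>2" by (intro power_mono norm_triangle_ineq) auto
  also have "\<dots> \<le> 2 * (norm x)\<^sup>2 + 2 * (norm y)\<^sup>2"
    using zero_le_power2[of "norm x - norm y"] by (simp add: power2_eq_square algebra_simps)
  finally show ?thesis .
qed

lemma continuous_dense_L2:
  fixes v :: "real \<Rightarrow> complex"
  assumes vm[measurable]: "v \<in> borel_measurable (LS s)" and v: "integrable (LS s) (\<lambda>x. (norm (v x))\<^sup>2)" and \<eta>: "\<eta> > 0"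
  obtains g where "continuous_on UNIV g" "integrable (LS s) (\<lambda>x. (norm (v x - g x))\<^sup>2)" "(\<integral>x. (norm (v x - g x))\<^sup>2 \<partial>LS s) < \<eta>"
proof -
  interpret M: finite_measure "LS s" by (rule finite_LS)
  have "v measurable_on {-s<..<s}" using vm by (subst measurable_on_iff_borel_measurable) auto
  then obtain N G where N: "negligible N" "\<And>n. continuous_on UNIV (G n)"
    "\<And>x. x \<notin> N \<Longrightarrow> (\<lambda>n. G n x) \<longlonglongrightarrow> (if x \<in> {-s<..<s} then v x else 0)"
    unfolding measurable_on_def by metis
  have [measurable]: "trunc K \<in> borel_measurable borel" if "K > 0" for K
    using continuous_trunc[OF that] by (rule borel_measurable_continuous_onI)
  have Gm[measurable]: "G n \<in> borel_measurable (LS s)" for n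
    using measurable_compose[OF LS_id_measurable borel_measurable_continuous_onI[OF N(2)]] .
  have tm: "(\<lambda>x. trunc (real (Suc n)) (v x)) \<in> borel_measurable (LS s)" for n by measurable
  have "(\<lambda>n. \<integral>x. (norm (v x - trunc (real (Suc n)) (v x)))\<^sup>2 \<partial>LS s) \<longlonglongrightarrow> (\<integral>x. 0 \<partial>LS s)"
  proof (rule integral_dominated_convergence[where w="\<lambda>x. 4 * (norm (v x))\<^sup>2"])
    show "AE x in LS s. (\<lambda>n. (norm (v x - trunc (real (Suc n)) (v x)))\<^sup>2) \<longlonglongrightarrow> 0"
    proof (rule AE_I2)
      fix x
      have "\<forall>\<^sub>F n in sequentially. (norm (v x - trunc (real (Suc n)) (v x)))\<^sup>2 = 0"
        by (rule eventually_mono[OF eventually_ge_at_top[of "nat \<lceil>norm (v x)\<rceil>"]]) (auto simp: trunc_id le_nat_iff ceiling_le_iff intro!: trunc_id[symmetric])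
      then show "(\<lambda>n. (norm (v x - trunc (real (Suc n)) (v x)))\<^sup>2) \<longlonglongrightarrow> 0" by (rule tendsto_eventually)
    qed
    show "AE x in LS s. norm ((norm (v x - trunc (real (Suc n)) (v x)))\<^sup>2) \<le> 4 * (norm (v x))\<^sup>2" for n
    proof (rule AE_I2)
      fix x
      have "norm (v x - trunc (real (Suc n)) (v x)) \<le> 2 * norm (v x)"
        using norm_triangle_ineq4[of "v x" "trunc (real (Suc n)) (v x)"] norm_trunc_le[of "real (Suc n)" "v x"] by simp
      then have "(norm (v x - trunc (real (Suc n)) (v x)))\<^sup>2 \<le> (2 * norm (v x))\<^sup>2" by (intro power_mono) auto
      then show "norm ((norm (v x - trunc (real (Suc n)) (v x)))\<^sup>2) \<le> 4 * (norm (v x))\<^sup>2" by (simp add: power_mult_distrib)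
    qed
  qed (use v tm in auto)
  then obtain n0 where n0: "norm ((\<integral>x. (norm (v x - trunc (real (Suc n0)) (v x)))\<^sup>2 \<partial>LS s)) < \<eta> / 4"
    using LIMSEQ_D[of _ 0 "\<eta>/4"] \<eta> by fastforce
  define K where "K = real (Suc n0)"
  have K: "K > 0" by (simp add: K_def)
  have [measurable]: "trunc K \<in> borel_measurable borel" using continuous_trunc[OF K] by (rule borel_measurable_continuous_onI)
  have i1: "integrable (LS s) (\<lambda>x. (norm (v x - trunc K (v x)))\<^sup>2)"
  proof (rule integrable_dominated[where f="\<lambda>x. 4 * (norm (v x))\<^sup>2"])
    show "AE x in LS s. norm ((norm (v x - trunc K (v x)))\<^sup>2) \<le> norm (4 * (norm (v x))\<^sup>2)"
    proof (rule AE_I2)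
      fix x
      have "norm (v x - trunc K (v x)) \<le> 2 * norm (v x)"
        using norm_triangle_ineq4[of "v x" "trunc K (v x)"] norm_trunc_le[OF K, of "v x"] by linarith
      then have "(norm (v x - trunc K (v x)))\<^sup>2 \<le> (2 * norm (v x))\<^sup>2" by (intro power_mono) auto
      then show "norm ((norm (v x - trunc K (v x)))\<^sup>2) \<le> norm (4 * (norm (v x))\<^sup>2)" by (simp add: power_mult_distrib)
    qed
  qed (use v in auto)
  have Nn: "AE x in LS s. x \<notin> N \<and> x \<in> {-s<..<s}"
    using N(1) by (auto simp: negligible_iff_null_sets AE_restrict_space_iff dest!: AE_not_in intro: eventually_mono)
  have K4: "(norm (trunc K z - trunc K w))\<^sup>2 \<le> (2*K)\<^sup>2" for z w
  proof (rule power_mono)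
    show "norm (trunc K z - trunc K w) \<le> 2 * K"
      using norm_triangle_ineq4[of "trunc K z" "trunc K w"] norm_trunc[OF K, of z] norm_trunc[OF K, of w] by linarith
  qed simp
  have i2: "integrable (LS s) (\<lambda>x. (norm (trunc K (v x) - trunc K (G n x)))\<^sup>2)" for n
    by (rule M.integrable_const_bound[where B="(2*K)\<^sup>2"], intro AE_I2)
       (use K4 in auto)
  have "(\<lambda>n. \<integral>x. (norm (trunc K (v x) - trunc K (G n x)))\<^sup>2 \<partial>LS s) \<longlonglongrightarrow> (\<integral>x. 0 \<partial>LS s)"
  proof (rule integral_dominated_convergence[where w="\<lambda>x. (2*K)\<^sup>2"])
    show "AE x in LS s. (\<lambda>n. (norm (trunc K (v x) - trunc K (G n x)))\<^sup>2) \<longlonglongrightarrow> 0"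
      using Nn
    proof eventually_elim
      case (elim x)
      then have "(\<lambda>n. G n x) \<longlonglongrightarrow> v x" using N(3)[of x] by auto
      then have "(\<lambda>n. trunc K (G n x)) \<longlonglongrightarrow> trunc K (v x)"
        using continuous_trunc[OF K] by (auto intro: continuous_on_tendsto_compose)
      then have "(\<lambda>n. (norm (trunc K (v x) - trunc K (G n x)))\<^sup>2) \<longlonglongrightarrow> (norm (trunc K (v x) - trunc K (v x)))\<^sup>2"
        by (intro tendsto_intros)
      then show ?case by simp
    qed
    show "AE x in LS s. norm ((norm (trunc K (v x) - trunc K (G n x)))\<^sup>2) \<le> (2*K)\<^sup>2" for n
      by (intro AE_I2)
       (use K4 in auto)
  qed (use i2 in auto)
  then obtain n1 where n1: "norm ((\<integral>x. (norm (trunc K (v x) - trunc K (G n1 x)))\<^sup>2 \<partial>LS s)) < \<eta> / 4"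
    using LIMSEQ_D[of _ 0 "\<eta>/4"] \<eta> by fastforce
  let ?g = "\<lambda>x. trunc K (G n1 x)"
  have le: "(norm (v x - ?g x))\<^sup>2 \<le> 2 * (norm (v x - trunc K (v x)))\<^sup>2 + 2 * (norm (trunc K (v x) - ?g x))\<^sup>2" for x
    using square_norm_add_le[of "v x - trunc K (v x)" "trunc K (v x) - ?g x"] by simp
  have j: "integrable (LS s) (\<lambda>x. 2 * (norm (v x - trunc K (v x)))\<^sup>2 + 2 * (norm (trunc K (v x) - ?g x))\<^sup>2)" using i1 i2 by auto
  show ?thesis
  proof (rule that[of ?g])
    show "continuous_on UNIV ?g" by (rule continuous_on_compose2[OF continuous_trunc[OF K] N(2)]) auto
    show I: "integrable (LS s) (\<lambda>x. (norm (v x - ?g x))\<^sup>2)"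
      by (rule integrable_dominated[OF j]) (use le in \<open>auto intro: order_trans[OF _ abs_ge_self]\<close>)
    have "(\<integral>x. (norm (v x - ?g x))\<^sup>2 \<partial>LS s) \<le> (\<integral>x. 2 * (norm (v x - trunc K (v x)))\<^sup>2 + 2 * (norm (trunc K (v x) - ?g x))\<^sup>2 \<partial>LS s)"
      by (rule integral_mono[OF I j le])
    also have "\<dots> < \<eta>" using i1 i2[of n1] n0 n1 unfolding K_def[symmetric] by simp
    finally show "(\<integral>x. (norm (v x - ?g x))\<^sup>2 \<partial>LS s) < \<eta>" .
  qed
qed

lemma polynomial_dense_L2:
  fixes v :: "real \<Rightarrow> complex"
  assumes vm[measurable]: "v \<in> borel_measurable (LS s)" and v: "integrable (LS s) (\<lambda>x. (norm (v x))\<^sup>2)" and \<eta>: "\<eta> > 0"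
  obtains n c where "integrable (LS s) (\<lambda>x. (norm (v x - (\<Sum>i\<le>n. c i * of_real x ^ i)))\<^sup>2)"
     "(\<integral>x. (norm (v x - (\<Sum>i\<le>n. c i * of_real x ^ i)))\<^sup>2 \<partial>LS s) < \<eta>"
proof -
  interpret M: finite_measure "LS s" by (rule finite_LS)
  define mm where "mm = measure (LS s) (space (LS s))"
  obtain g where g: "continuous_on UNIV g" "integrable (LS s) (\<lambda>x. (norm (v x - g x))\<^sup>2)" "(\<integral>x. (norm (v x - g x))\<^sup>2 \<partial>LS s) < \<eta> / 4"
    using continuous_dense_L2[OF vm v, of "\<eta>/4"] \<eta> by auto
  define d where "d = sqrt (\<eta> / (4 * (mm + 1))) / 2"
  have m0: "mm \<ge> 0" by (simp add: mm_def)
  have d: "d > 0" using \<eta> m0 by (simp add: d_def add_nonneg_pos)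
  have "continuous_on {-s..s} (\<lambda>x. Re (g x))" "continuous_on {-s..s} (\<lambda>x. Im (g x))"
    using g(1) by (auto intro!: continuous_intros intro: continuous_on_subset)
  then obtain p1 p2 where p: "real_polynomial_function p1" "\<And>x. x \<in> {-s..s} \<Longrightarrow> \<bar>Re (g x) - p1 x\<bar> < d"
    "real_polynomial_function p2" "\<And>x. x \<in> {-s..s} \<Longrightarrow> \<bar>Im (g x) - p2 x\<bar> < d"
    using Stone_Weierstrass_real_polynomial_function[OF compact_Icc _ d] by metis
  obtain a1 n1 where a1: "p1 = (\<lambda>x. \<Sum>i\<le>n1. a1 i * x ^ i)" using real_polynomial_function_imp_sum[OF p(1)] by auto
  obtain a2 n2 where a2: "p2 = (\<lambda>x. \<Sum>i\<le>n2. a2 i * x ^ i)" using real_polynomial_function_imp_sum[OF p(3)] by auto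
  define n where "n = max n1 n2"
  define c where "c i = Complex (if i \<le> n1 then a1 i else 0) (if i \<le> n2 then a2 i else 0)" for i
  define P where "P x = (\<Sum>i\<le>n. c i * of_real x ^ i)" for x :: real
  have PR: "Re (P x) = p1 x" for x
  proof -
    have "Re (P x) = (\<Sum>i\<le>n. (if i \<le> n1 then a1 i else 0) * x ^ i)"
      unfolding P_def Re_sum c_def of_real_power[symmetric] by (intro sum.cong) auto
    also have "\<dots> = (\<Sum>i\<le>n1. a1 i * x ^ i)"
      by (rule sum.mono_neutral_cong_right) (auto simp: n_def)
    finally show ?thesis by (simp add: a1)
  qed
  have PI: "Im (P x) = p2 x" for x
  proof -
    have "Im (P x) = (\<Sum>i\<le>n. (if i \<le> n2 then a2 i else 0) * x ^ i)"
      unfolding P_def Im_sum c_def of_real_power[symmetric] by (intro sum.cong) auto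
    also have "\<dots> = (\<Sum>i\<le>n2. a2 i * x ^ i)"
      by (rule sum.mono_neutral_cong_right) (auto simp: n_def)
    finally show ?thesis by (simp add: a2)
  qed
  have gP: "norm (g x - P x) \<le> 2 * d" if "x \<in> {-s<..<s}" for x
  proof -
    have "norm (g x - P x) \<le> \<bar>Re (g x - P x)\<bar> + \<bar>Im (g x - P x)\<bar>" by (rule cmod_le)
    also have "\<dots> \<le> 2 * d" using p(2)[of x] p(4)[of x] that by (simp add: PR PI)
    finally show ?thesis .
  qed
  have gPi: "norm ((norm (g x - P x))\<^sup>2) \<le> (2 * d)\<^sup>2" if "x \<in> space (LS s)" for x
  proof -
    have "(norm (g x - P x))\<^sup>2 \<le> (2 * d)\<^sup>2" using that by (intro power_mono gP) (auto simp: space_restrict_space)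
    then show ?thesis by simp
  qed
  have [measurable]: "g \<in> borel_measurable borel" "P \<in> borel_measurable borel"
    using g(1) unfolding P_def by (auto intro!: borel_measurable_continuous_onI continuous_intros)
  have [measurable]: "(\<lambda>x. g x - P x) \<in> borel_measurable (LS s)"
    by (rule measurable_compose[OF LS_id_measurable]) measurable
  have i2: "integrable (LS s) (\<lambda>x. (norm (g x - P x))\<^sup>2)"
    by (rule M.integrable_const_bound[where B="(2*d)\<^sup>2"]) (use gPi in \<open>auto simp del: space_restrict_space\<close>)
  have "(\<integral>x. (norm (g x - P x))\<^sup>2 \<partial>LS s) \<le> (\<integral>x. (2 * d)\<^sup>2 \<partial>LS s)"
    by (rule integral_mono[OF i2]) (use gPi in \<open>auto simp del: space_restrict_space\<close>)
  then have b2: "(\<integral>x. (norm (g x - P x))\<^sup>2 \<partial>LS s) \<le> (2 * d)\<^sup>2 * mm" by (simp add: mult.commute mm_def)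
  have le: "(norm (v x - P x))\<^sup>2 \<le> 2 * (norm (v x - g x))\<^sup>2 + 2 * (norm (g x - P x))\<^sup>2" for x
    using square_norm_add_le[of "v x - g x" "g x - P x"] by simp
  have j: "integrable (LS s) (\<lambda>x. 2 * (norm (v x - g x))\<^sup>2 + 2 * (norm (g x - P x))\<^sup>2)" using g(2) i2 by auto
  have [measurable]: "P \<in> borel_measurable (LS s)" by (rule measurable_compose[OF LS_id_measurable]) measurable
  have I: "integrable (LS s) (\<lambda>x. (norm (v x - P x))\<^sup>2)"
    by (rule integrable_dominated[OF j]) (use le in \<open>auto intro: order_trans[OF _ abs_ge_self]\<close>)
  have "(\<integral>x. (norm (v x - P x))\<^sup>2 \<partial>LS s) \<le> (\<integral>x. 2 * (norm (v x - g x))\<^sup>2 + 2 * (norm (g x - P x))\<^sup>2 \<partial>LS s)"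
    by (rule integral_mono[OF I j le])
  also have "\<dots> = 2 * (\<integral>x. (norm (v x - g x))\<^sup>2 \<partial>LS s) + 2 * (\<integral>x. (norm (g x - P x))\<^sup>2 \<partial>LS s)" using g(2) i2 by simp
  also have "\<dots> < \<eta>"
  proof -
    have "2 * ((2 * d)\<^sup>2 * mm) \<le> \<eta> / 2"
    proof -
      have "0 \<le> \<eta> / (4 * (mm + 1))" using \<eta> m0 by simp
      then have "(2 * d)\<^sup>2 = \<eta> / (4 * (mm + 1))" unfolding d_def by simp
      moreover have "\<eta> / (4 * (mm + 1)) * mm \<le> \<eta> / 4" using \<eta> m0 by (simp add: divide_simps)
      ultimately have "(2 * d)\<^sup>2 * mm \<le> \<eta> / 4" by (simp only:)
      then show ?thesis by simp
    qed
    then show ?thesis using g(3) b2 by linarith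
  qed
  finally show ?thesis using that[OF I[unfolded P_def]] unfolding P_def by blast
qed

lemma (in pair_sigma_finite) integrable_product_bound:
  fixes F :: "'a \<times> 'b \<Rightarrow> complex"
  assumes F[measurable]: "F \<in> borel_measurable (M1 \<Otimes>\<^sub>M M2)" and f: "integrable M1 f" and g: "integrable M2 g"
    and le: "\<And>x y. x \<in> space M1 \<Longrightarrow> y \<in> space M2 \<Longrightarrow> norm (F (x, y)) \<le> f x * g y"
  shows "integrable (M1 \<Otimes>\<^sub>M M2) F"
proof (rule Fubini_integrable[OF F])
  have i: "integrable M2 (\<lambda>y. F (x, y))" if x: "x \<in> space M1" for x
  proof (rule integrable_dominated[of _ "\<lambda>y. f x * g y"])
    show "integrable M2 (\<lambda>y. f x * g y)" using g by auto
    show "(\<lambda>y. F (x, y)) \<in> borel_measurable M2" using x by measurable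
    show "AE y in M2. norm (F (x, y)) \<le> norm (f x * g y)"
      unfolding real_norm_def by (intro AE_I2 order_trans[OF le[OF x] abs_ge_self])
  qed
  then show "AE x in M1. integrable M2 (\<lambda>y. F (x, y))" by (rule AE_I2)
  show "integrable M1 (\<lambda>x. \<integral>y. norm (F (x, y)) \<partial>M2)"
  proof (rule integrable_dominated[of _ "\<lambda>x. f x * (\<integral>y. g y \<partial>M2)"])
    show "integrable M1 (\<lambda>x. f x * (\<integral>y. g y \<partial>M2))" using f by auto
    show "(\<lambda>x. \<integral>y. norm (F (x, y)) \<partial>M2) \<in> borel_measurable M1" by measurable
    show "AE x in M1. norm (\<integral>y. norm (F (x, y)) \<partial>M2) \<le> norm (f x * (\<integral>y. g y \<partial>M2))"
    proof (rule AE_I2)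
      fix x assume x: "x \<in> space M1"
      have "norm (\<integral>y. norm (F (x, y)) \<partial>M2) = (\<integral>y. norm (F (x, y)) \<partial>M2)" by simp
      also have "\<dots> \<le> (\<integral>y. f x * g y \<partial>M2)"
        using i[OF x] g le[OF x] by (intro integral_mono) auto
      also have "\<dots> = f x * (\<integral>y. g y \<partial>M2)" by simp
      finally show "norm (\<integral>y. norm (F (x, y)) \<partial>M2) \<le> norm (f x * (\<integral>y. g y \<partial>M2))" by simp
    qed
  qed
qed

lemma square_integrable_imp_integrable:
  fixes u :: "real \<Rightarrow> complex"
  assumes [measurable]: "u \<in> borel_measurable (LS s)" and u2: "integrable (LS s) (\<lambda>x. (norm (u x))\<^sup>2)"
  shows "integrable (LS s) u"
proof -
  interpret M: finite_measure "LS s" by (rule finite_LS)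
  show ?thesis
  proof (rule integrable_dominated[of _ "\<lambda>x. 1 + (norm (u x))\<^sup>2"])
    show "AE x in LS s. norm (u x) \<le> norm (1 + (norm (u x))\<^sup>2)"
    proof (rule AE_I2)
      fix x
      have "2 * norm (u x) \<le> 1 + (norm (u x))\<^sup>2" using zero_le_power2[of "norm (u x) - 1"] by (simp add: power2_eq_square algebra_simps)
      then show "norm (u x) \<le> norm (1 + (norm (u x))\<^sup>2)" using norm_ge_zero[of "u x"] by (simp del: norm_ge_zero)
    qed
  qed (use u2 in auto)
qed

abbreviation cden where "cden e x y \<equiv> complex_of_real x - (of_real y + \<i> * of_real e)"

section \<open>Energy of the Cauchy transform\<close>

text \<open>\<open>\<Phi> e\<close> is the Cauchy transform of \<open>u\<close> on the line \<open>Im z = - e\<close>, and \<open>E e\<close> is its energy there. The function \<open>rr\<close> is an explicit square integrable majorant of the kernel.\<close>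
locale cauchy_L2 =
  fixes s :: real and u :: "real \<Rightarrow> complex"
  assumes s: "s > 0" and um [measurable]: "u \<in> borel_measurable (LS s)"
    and u2: "integrable (LS s) (\<lambda>x. (norm (u x))\<^sup>2)"
begin

sublocale M: finite_measure "LS s" by (rule finite_LS)
sublocale P: pair_sigma_finite lborel "LS s" ..

definition \<Phi> :: "real \<Rightarrow> real \<Rightarrow> complex" where
  "\<Phi> e x = (\<integral>y. u y / (cden e x y) \<partial>LS s)"
definition U where "U = (\<integral>y. norm (u y) \<partial>LS s)"
definition q where "q = (\<integral>y. (norm (u y))\<^sup>2 \<partial>LS s)"
definition rr :: "real \<Rightarrow> real \<Rightarrow> real" where "rr e x = sqrt ((2 + (1 + 2 * (s + \<bar>e\<bar>)\<^sup>2) / e\<^sup>2) / (1 + x\<^sup>2))"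
definition E where "E e = (\<integral>x. (norm (\<Phi> e x))\<^sup>2 \<partial>lborel)"

lemma ui: "integrable (LS s) u" by (rule square_integrable_imp_integrable[OF um u2])
lemma space_M: "space (LS s) = {-s<..<s}" by (simp add: space_restrict_space)
lemma U0: "U \<ge> 0" unfolding U_def by simp
lemma q0: "q \<ge> 0" unfolding q_def by simp

lemma \<Phi>_measurable [measurable]: "\<Phi> e \<in> borel_measurable borel"
proof -
  have "(\<lambda>x. \<integral>y. u y / (cden e x y) \<partial>LS s) \<in> borel_measurable lborel"
    by measurable
  then show ?thesis unfolding \<Phi>_def[abs_def] by simp
qed

lemma \<Phi>_measurable_LS: "\<Phi> e \<in> borel_measurable (LS s)"
  by (rule measurable_compose[OF LS_id_measurable \<Phi>_measurable])

lemma rr_nonneg: "rr e x \<ge> 0" unfolding rr_def by (intro real_sqrt_ge_zero divide_nonneg_nonneg add_nonneg_nonneg) auto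

lemma rr_sq: "rr e x * rr e x = (2 + (1 + 2 * (s + \<bar>e\<bar>)\<^sup>2) / e\<^sup>2) * (1 / (1 + x\<^sup>2))"
proof -
  have "0 \<le> (2 + (1 + 2 * (s + \<bar>e\<bar>)\<^sup>2) / e\<^sup>2) / (1 + x\<^sup>2)" by (intro divide_nonneg_nonneg add_nonneg_nonneg) auto
  then show ?thesis unfolding rr_def by simp
qed

lemma rr_sq_integrable: "integrable lborel (\<lambda>x. rr e x * rr e x)"
  unfolding rr_sq by (intro integrable_mult_right integrable_inverse_square)

lemma kernel_le_rr:
  assumes "e \<noteq> 0" "y \<in> {-s<..<s}" "Im a = e" "Re a = y"
  shows "1 / norm (of_real x - a) \<le> rr e x"
proof -
  have "norm a \<le> s + \<bar>e\<bar>" using cmod_le[of a] assms by auto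
  then have "1 / (norm (of_real x - a))\<^sup>2 \<le> (2 + (1 + 2 * (s + \<bar>e\<bar>)\<^sup>2) / \<bar>e\<bar>\<^sup>2) / (1 + x\<^sup>2)"
    using assms by (intro inverse_dist_bound) auto
  then have "(1 / norm (of_real x - a))\<^sup>2 \<le> (rr e x)\<^sup>2" using rr_sq[of e x] by (simp add: power_divide power2_eq_square)
  then show ?thesis by (rule power2_le_imp_le[OF _ rr_nonneg])
qed

lemma kernel_bound: "e \<noteq> 0 \<Longrightarrow> 1 / norm (cden e x y) \<le> 1 / \<bar>e\<bar>"
proof -
  assume e: "e \<noteq> 0"
  have "\<bar>e\<bar> \<le> norm (cden e x y)"
    using abs_Im_le_cmod[of "cden e x y"] by simp
  then show ?thesis using e by (intro divide_left_mono mult_pos_pos) auto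
qed

lemma \<Phi>_integrable: "e \<noteq> 0 \<Longrightarrow> integrable (LS s) (\<lambda>y. u y / (cden e x y))"
proof (rule integrable_dominated[of _ "\<lambda>y. norm (u y) * (1 / \<bar>e\<bar>)"])
  assume e: "e \<noteq> 0"
  show "AE y in LS s. norm (u y / (cden e x y)) \<le> norm (norm (u y) * (1 / \<bar>e\<bar>))"
  proof (rule AE_I2)
    fix y
    have "norm (u y / (cden e x y)) = norm (u y) * (1 / norm (cden e x y))"
      by (simp add: norm_divide)
    also have "\<dots> \<le> norm (u y) * (1 / \<bar>e\<bar>)" by (intro mult_left_mono kernel_bound e) auto
    finally show "norm (u y / (cden e x y)) \<le> norm (norm (u y) * (1 / \<bar>e\<bar>))" by simp
  qed
  show "integrable (LS s) (\<lambda>y. norm (u y) * (1 / \<bar>e\<bar>))" using ui by auto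
qed measurable

lemma \<Phi>_le: assumes e: "e \<noteq> 0" shows "norm (\<Phi> e x) \<le> U * rr e x"
proof -
  have "norm (\<Phi> e x) \<le> (\<integral>y. norm (u y / (cden e x y)) \<partial>LS s)" unfolding \<Phi>_def by (rule integral_norm_bound)
  also have "\<dots> \<le> (\<integral>y. norm (u y) * rr e x \<partial>LS s)"
  proof (rule integral_mono)
    show "integrable (LS s) (\<lambda>y. norm (u y / (cden e x y)))" using \<Phi>_integrable[OF e] by auto
    show "integrable (LS s) (\<lambda>y. norm (u y) * rr e x)" using ui by auto
    fix y assume "y \<in> space (LS s)"
    then have "norm (u y) * (1 / norm (cden e x y)) \<le> norm (u y) * rr e x"
      by (intro mult_left_mono kernel_le_rr[OF e]) (auto simp: space_M)
    then show "norm (u y / (cden e x y)) \<le> norm (u y) * rr e x" by (simp add: norm_divide)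
  qed
  also have "\<dots> = U * rr e x" unfolding U_def by simp
  finally show ?thesis .
qed

lemma \<Phi>_sq_integrable: "e \<noteq> 0 \<Longrightarrow> integrable lborel (\<lambda>x. (norm (\<Phi> e x))\<^sup>2)"
proof (rule integrable_dominated[of _ "\<lambda>x. U\<^sup>2 * (rr e x * rr e x)"])
  assume e: "e \<noteq> 0"
  show "integrable lborel (\<lambda>x. U\<^sup>2 * (rr e x * rr e x))" by (intro integrable_mult_right rr_sq_integrable)
  show "AE x in lborel. norm ((norm (\<Phi> e x))\<^sup>2) \<le> norm (U\<^sup>2 * (rr e x * rr e x))"
  proof (rule AE_I2)
    fix x
    have "(norm (\<Phi> e x))\<^sup>2 \<le> (U * rr e x)\<^sup>2" by (intro power_mono \<Phi>_le e) auto
    then show "norm ((norm (\<Phi> e x))\<^sup>2) \<le> norm (U\<^sup>2 * (rr e x * rr e x))" by (simp add: power2_eq_square mult_ac)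
  qed
  show "(\<lambda>x. (norm (\<Phi> e x))\<^sup>2) \<in> borel_measurable lborel"
    using borel_measurable_power[OF measurable_compose[OF \<Phi>_measurable borel_measurable_norm]] by simp
qed

lemma \<Phi>_against_kernel:
  assumes e: "e > 0" and b: "Im b < 0"
  shows "(\<integral>t. \<Phi> e t / (of_real t - b) \<partial>lborel) = (\<integral>y. u y * (2 * of_real pi * \<i> / (of_real y + \<i> * of_real e - b)) \<partial>LS s)"
    "integrable lborel (\<lambda>t. \<Phi> e t / (of_real t - b))"
proof -
  define A where "A = max (s + e) (norm b)"
  define d where "d = min e (- Im b)"
  define F where "F t y = u y * (1 / ((cden e t y) * (of_real t - b)))" for t y
  have d: "d > 0" using e b by (simp add: d_def)
  have [measurable]: "case_prod F \<in> borel_measurable (lborel \<Otimes>\<^sub>M LS s)" unfolding F_def by measurable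
  have Fi: "integrable (lborel \<Otimes>\<^sub>M LS s) (case_prod F)"
  proof (rule P.integrable_product_bound[where f="\<lambda>t. (2 + (1 + 2 * A\<^sup>2) / d\<^sup>2) * (1 / (1 + t\<^sup>2))" and g="\<lambda>y. norm (u y)"])
    show "integrable lborel (\<lambda>t. (2 + (1 + 2 * A\<^sup>2) / d\<^sup>2) * (1 / (1 + t\<^sup>2)))"
      by (intro integrable_mult_right integrable_inverse_square)
    show "integrable (LS s) (\<lambda>y. norm (u y))" using ui by auto
    fix t y assume "y \<in> space (LS s)"
    then have y: "\<bar>y\<bar> < s" by (auto simp: space_M)
    have "norm (1 / ((cden e t y) * (of_real t - b))) \<le> (2 + (1 + 2 * A\<^sup>2) / d\<^sup>2) / (1 + t\<^sup>2)"
    proof (rule inverse_product_bound[OF _ _ _ _ d])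
      have "norm (of_real y + \<i> * of_real e) \<le> \<bar>y\<bar> + \<bar>e\<bar>" using cmod_le[of "of_real y + \<i> * of_real e"] by simp
      then show "norm (of_real y + \<i> * of_real e) \<le> A" using y e unfolding A_def by simp
    qed (use e b in \<open>auto simp: A_def d_def\<close>)
    then have "norm (u y) * norm (1 / ((cden e t y) * (of_real t - b))) \<le> norm (u y) * ((2 + (1 + 2 * A\<^sup>2) / d\<^sup>2) / (1 + t\<^sup>2))"
      by (intro mult_left_mono) auto
    then show "norm (case_prod F (t, y)) \<le> (2 + (1 + 2 * A\<^sup>2) / d\<^sup>2) * (1 / (1 + t\<^sup>2)) * norm (u y)"
      unfolding F_def prod.case norm_mult by (simp add: mult.commute)
  qed measurable
  have i1: "(\<integral>y. F t y \<partial>LS s) = \<Phi> e t / (of_real t - b)" for t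
    unfolding \<Phi>_def F_def integral_divide_zero[symmetric] by (intro lebesgue_integral_cong) auto
  have i2: "(\<integral>t. F t y \<partial>lborel) = u y * (2 * of_real pi * \<i> / (of_real y + \<i> * of_real e - b))" for y
    unfolding F_def integral_mult_right_zero using residue_integral(2)[of "of_real y + \<i> * of_real e" b] e b by simp
  show "(\<integral>t. \<Phi> e t / (of_real t - b) \<partial>lborel) = (\<integral>y. u y * (2 * of_real pi * \<i> / (of_real y + \<i> * of_real e - b)) \<partial>LS s)"
    using P.Fubini_integral[OF Fi] unfolding i1 i2 by simp
  show "integrable lborel (\<lambda>t. \<Phi> e t / (of_real t - b))"
    using P.integrable_fst[OF Fi] unfolding i1 .
qed

text \<open>The key identity: integrating over the line, a residue computation moves both kernels onto one, so the energy at distance \<open>e\<close> is a pairing of \<open>u\<close> with the transform at distance \<open>2 e\<close>.\<close>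
lemma E_eq:
  assumes e: "e > 0"
  shows "complex_of_real (E e) = - (2 * of_real pi * \<i>) * (\<integral>y. \<Phi> (2 * e) y * cnj (u y) \<partial>LS s)"
proof -
  define F where "F t y = \<Phi> e t * (cnj (u y) / (of_real t - (of_real y - \<i> * of_real e)))" for t y
  have [measurable]: "(\<lambda>y. cnj (u y)) \<in> borel_measurable (LS s)"
    by (rule measurable_compose[OF um borel_measurable_continuous_onI]) (intro continuous_intros)
  have [measurable]: "case_prod F \<in> borel_measurable (lborel \<Otimes>\<^sub>M LS s)" unfolding F_def by measurable
  have Fi: "integrable (lborel \<Otimes>\<^sub>M LS s) (case_prod F)"
  proof (rule P.integrable_product_bound[where f="\<lambda>t. U * (rr e t * rr e t)" and g="\<lambda>y. norm (u y)"])
    show "integrable lborel (\<lambda>t. U * (rr e t * rr e t))"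
      by (intro integrable_mult_right rr_sq_integrable)
    show "integrable (LS s) (\<lambda>y. norm (u y))" using ui by auto
    fix t y assume y: "y \<in> space (LS s)"
    have "1 / norm (of_real t - (of_real y - \<i> * of_real e)) \<le> rr (-e) t"
      using e y by (intro kernel_le_rr[of _ y]) (auto simp: space_M)
    then have k: "1 / norm (of_real t - (of_real y - \<i> * of_real e)) \<le> rr e t" by (simp add: rr_def)
    have "norm (\<Phi> e t) * (norm (u y) * (1 / norm (of_real t - (of_real y - \<i> * of_real e)))) \<le> (U * rr e t) * (norm (u y) * rr e t)"
      using e by (intro mult_mono mult_left_mono k \<Phi>_le) (auto intro!: mult_nonneg_nonneg U0 rr_nonneg)
    then show "norm (case_prod F (t, y)) \<le> U * (rr e t * rr e t) * norm (u y)"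
      unfolding F_def prod.case by (simp add: norm_mult norm_divide mult_ac)
  qed measurable
  have i1: "(\<integral>y. F t y \<partial>LS s) = of_real ((norm (\<Phi> e t))\<^sup>2)" for t
  proof -
    have "(\<integral>y. F t y \<partial>LS s) = \<Phi> e t * (\<integral>y. cnj (u y / (cden e t y)) \<partial>LS s)"
      unfolding F_def integral_mult_right_zero[symmetric] by simp
    also have "\<dots> = \<Phi> e t * cnj (\<Phi> e t)" unfolding \<Phi>_def Bochner_Integration.integral_cnj ..
    finally show ?thesis by (simp only: complex_norm_square)
  qed
  have i2: "(\<integral>t. F t y \<partial>lborel) = - (2 * of_real pi * \<i>) * (\<Phi> (2 * e) y * cnj (u y))" for y
  proof -
    have "(\<integral>t. F t y \<partial>lborel) = (\<integral>t. cnj (u y) * (\<Phi> e t / (of_real t - (of_real y - \<i> * of_real e))) \<partial>lborel)"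
      unfolding F_def by (intro lebesgue_integral_cong) auto
    also have "\<dots> = cnj (u y) * (\<integral>y'. u y' * (2 * of_real pi * \<i> / (of_real y' + \<i> * of_real e - (of_real y - \<i> * of_real e))) \<partial>LS s)"
      unfolding integral_mult_right_zero using e by (subst \<Phi>_against_kernel(1)) auto
    also have "(\<integral>y'. u y' * (2 * of_real pi * \<i> / (of_real y' + \<i> * of_real e - (of_real y - \<i> * of_real e))) \<partial>LS s) = (\<integral>y'. - (2 * of_real pi * \<i>) * (u y' / (of_real y - (of_real y' + \<i> * of_real (2 * e)))) \<partial>LS s)"
    proof (intro lebesgue_integral_cong refl)
      fix y' :: real
      have "of_real y' + \<i> * of_real e - (of_real y - \<i> * of_real e) = - (of_real y - (of_real y' + \<i> * of_real (2 * e)))" by simp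
      then show "u y' * (2 * of_real pi * \<i> / (of_real y' + \<i> * of_real e - (of_real y - \<i> * of_real e))) = - (2 * of_real pi * \<i>) * (u y' / (of_real y - (of_real y' + \<i> * of_real (2 * e))))"
        by (simp only: divide_minus_right mult_minus_right mult_minus_left) (simp add: mult_ac)
    qed
    also have "\<dots> = - (2 * of_real pi * \<i>) * \<Phi> (2 * e) y" unfolding \<Phi>_def by (rule integral_mult_right_zero)
    finally show ?thesis by (simp add: mult_ac)
  qed
  have "complex_of_real (E e) = (\<integral>t. (\<integral>y. F t y \<partial>LS s) \<partial>lborel)" unfolding i1 E_def by (rule integral_complex_of_real[symmetric])
  also have "\<dots> = (\<integral>y. (\<integral>t. F t y \<partial>lborel) \<partial>LS s)" using P.Fubini_integral[OF Fi] by simp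
  also have "\<dots> = - (2 * of_real pi * \<i>) * (\<integral>y. \<Phi> (2 * e) y * cnj (u y) \<partial>LS s)" unfolding i2 by (rule integral_mult_right_zero)
  finally show ?thesis .
qed

lemma \<Phi>_LS_integrable: "e \<noteq> 0 \<Longrightarrow> integrable (LS s) (\<lambda>x. (norm (\<Phi> e x))\<^sup>2)"
  and \<Phi>_LS_le: "e \<noteq> 0 \<Longrightarrow> (\<integral>x. (norm (\<Phi> e x))\<^sup>2 \<partial>LS s) \<le> E e"
proof -
  assume e: "e \<noteq> 0"
  have i: "integrable lebesgue (\<lambda>x. (norm (\<Phi> e x))\<^sup>2)" using \<Phi>_sq_integrable[OF e] by (simp add: integrable_completion)
  then have j: "integrable lebesgue (\<lambda>x. indicator {-s<..<s} x *\<^sub>R (norm (\<Phi> e x))\<^sup>2)" by (intro integrable_mult_indicator) auto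
  show "integrable (LS s) (\<lambda>x. (norm (\<Phi> e x))\<^sup>2)"
    using j by (subst integrable_restrict_space) (auto simp: set_integrable_def)
  have "(\<integral>x. (norm (\<Phi> e x))\<^sup>2 \<partial>LS s) = (\<integral>x. indicator {-s<..<s} x *\<^sub>R (norm (\<Phi> e x))\<^sup>2 \<partial>lebesgue)"
    by (subst integral_restrict_space) (auto simp: set_lebesgue_integral_def)
  also have "\<dots> \<le> (\<integral>x. (norm (\<Phi> e x))\<^sup>2 \<partial>lebesgue)" by (rule integral_mono[OF j i]) (auto simp: indicator_def)
  also have "\<dots> = E e" unfolding E_def
    using borel_measurable_power[OF measurable_compose[OF \<Phi>_measurable borel_measurable_norm]] by (intro integral_completion) simp
  finally show "(\<integral>x. (norm (\<Phi> e x))\<^sup>2 \<partial>LS s) \<le> E e" .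
qed

text \<open>Cauchy-Schwarz and the arithmetic-geometric mean inequality applied to \<open>E_eq\<close>.\<close>
lemma E_step: assumes e: "e > 0" shows "E e \<le> 2 * pi\<^sup>2 * q + E (2 * e) / 2"
proof -
  have "E e = norm (complex_of_real (E e))" unfolding E_def by simp
  also have "\<dots> = 2 * pi * norm (\<integral>y. \<Phi> (2 * e) y * cnj (u y) \<partial>LS s)" unfolding E_eq[OF e] by (simp add: norm_mult)
  also have "\<dots> \<le> 2 * pi * (\<integral>y. norm (\<Phi> (2 * e) y * cnj (u y)) \<partial>LS s)" by (intro mult_left_mono integral_norm_bound) auto
  also have "(\<integral>y. norm (\<Phi> (2 * e) y * cnj (u y)) \<partial>LS s) \<le> (\<integral>y. pi * (norm (u y))\<^sup>2 + (1 / (4 * pi)) * (norm (\<Phi> (2 * e) y))\<^sup>2 \<partial>LS s)"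
  proof (rule integral_mono')
    show "integrable (LS s) (\<lambda>y. pi * (norm (u y))\<^sup>2 + (1 / (4 * pi)) * (norm (\<Phi> (2 * e) y))\<^sup>2)"
      using u2 \<Phi>_LS_integrable[of "2 * e"] e by auto
    fix y
    have "0 \<le> pi * (norm (u y) - norm (\<Phi> (2 * e) y) / (2 * pi))\<^sup>2" by simp
    also have "\<dots> = pi * (norm (u y))\<^sup>2 + (1 / (4 * pi)) * (norm (\<Phi> (2 * e) y))\<^sup>2 - norm (\<Phi> (2 * e) y) * norm (u y)"
      by (simp add: power2_eq_square field_simps)
    finally show "norm (\<Phi> (2 * e) y * cnj (u y)) \<le> pi * (norm (u y))\<^sup>2 + (1 / (4 * pi)) * (norm (\<Phi> (2 * e) y))\<^sup>2"
      by (simp add: norm_mult)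
    show "0 \<le> pi * (norm (u y))\<^sup>2 + (1 / (4 * pi)) * (norm (\<Phi> (2 * e) y))\<^sup>2" by simp
  qed
  also have "\<dots> = pi * q + (1 / (4 * pi)) * (\<integral>y. (norm (\<Phi> (2 * e) y))\<^sup>2 \<partial>LS s)"
    unfolding q_def using u2 \<Phi>_LS_integrable[of "2 * e"] e by simp
  also have "\<dots> \<le> pi * q + (1 / (4 * pi)) * E (2 * e)" using \<Phi>_LS_le[of "2 * e"] e by (intro add_left_mono mult_left_mono) auto
  finally show ?thesis by (simp add: power2_eq_square algebra_simps)
qed

lemma E_crude:
  assumes e: "e > 0" "e \<le> e'"
  shows "E e' \<le> U\<^sup>2 * ((2 + 1 / e\<^sup>2 + 2 * (s / e + 1)\<^sup>2) * pi)"
proof -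
  have e': "e' > 0" using e by simp
  have "E e' \<le> (\<integral>x. U\<^sup>2 * (rr e' x * rr e' x) \<partial>lborel)"
    unfolding E_def
  proof (rule integral_mono)
    show "integrable lborel (\<lambda>x. U\<^sup>2 * (rr e' x * rr e' x))" by (intro integrable_mult_right rr_sq_integrable)
    fix x
    have "(norm (\<Phi> e' x))\<^sup>2 \<le> (U * rr e' x)\<^sup>2" using e' by (intro power_mono \<Phi>_le) auto
    then show "(norm (\<Phi> e' x))\<^sup>2 \<le> U\<^sup>2 * (rr e' x * rr e' x)" by (simp add: power2_eq_square mult_ac)
  qed (use \<Phi>_sq_integrable e' in auto)
  also have "\<dots> = U\<^sup>2 * ((2 + (1 + 2 * (s + \<bar>e'\<bar>)\<^sup>2) / e'\<^sup>2) * pi)"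
    by (simp only: rr_sq integral_mult_right_zero integrable_inverse_square(2))
  also have "\<dots> \<le> U\<^sup>2 * ((2 + 1 / e\<^sup>2 + 2 * (s / e + 1)\<^sup>2) * pi)"
  proof (intro mult_left_mono mult_right_mono)
    have "(1 + 2 * (s + \<bar>e'\<bar>)\<^sup>2) / e'\<^sup>2 = 1 / e'\<^sup>2 + 2 * (s / e' + 1)\<^sup>2"
      using e' by (simp add: power2_eq_square field_simps)
    also have "\<dots> \<le> 1 / e\<^sup>2 + 2 * (s / e + 1)\<^sup>2"
      using e e' s by (intro add_mono mult_left_mono power_mono divide_left_mono mult_pos_pos) (auto intro: power_mono)
    finally show "2 + (1 + 2 * (s + \<bar>e'\<bar>)\<^sup>2) / e'\<^sup>2 \<le> 2 + 1 / e\<^sup>2 + 2 * (s / e + 1)\<^sup>2" by simp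
  qed auto
  finally show ?thesis .
qed

text \<open>Iterating \<open>E_step\<close> over \<open>e, 2 e, 4 e, \<dots>\<close> halves the crude bound each time: the energy is bounded uniformly in \<open>e\<close>. This replaces the boundedness of the Hilbert transform on \<open>L\<^sup>2\<close>.\<close>
lemma E_bound: assumes e: "e > 0" shows "E e \<le> 4 * pi\<^sup>2 * q"
proof -
  let ?C = "U\<^sup>2 * ((2 + 1 / e\<^sup>2 + 2 * (s / e + 1)\<^sup>2) * pi)"
  have k: "E e' \<le> 4 * pi\<^sup>2 * q + ?C / 2 ^ k" if "e' \<ge> e" for k e'
    using that
  proof (induction k arbitrary: e')
    case 0
    have "0 \<le> 4 * pi\<^sup>2 * q" using q0 by simp
    then show ?case using E_crude[OF e 0] by (simp only: power_0 div_by_1)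
  next
    case (Suc k)
    have "E e' \<le> 2 * pi\<^sup>2 * q + E (2 * e') / 2" using Suc.prems e by (intro E_step) auto
    also have "\<dots> \<le> 2 * pi\<^sup>2 * q + (4 * pi\<^sup>2 * q + ?C / 2 ^ k) / 2"
      using Suc.prems e by (intro add_left_mono divide_right_mono Suc.IH) auto
    also have "\<dots> = 4 * pi\<^sup>2 * q + ?C / 2 ^ Suc k" by (simp add: add_divide_distrib)
    finally show ?case .
  qed
  have "(\<lambda>k. 4 * pi\<^sup>2 * q + ?C * (1 / 2) ^ k) \<longlonglongrightarrow> 4 * pi\<^sup>2 * q + ?C * 0"
    by (intro tendsto_intros LIMSEQ_realpow_zero) auto
  then show ?thesis using k[of e] by (intro LIMSEQ_le_const) (auto simp: power_divide)
qed

end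

lemma weak_limit_dense:
  fixes f :: "nat \<Rightarrow> real \<Rightarrow> complex"
  assumes fm[measurable]: "\<And>n. f n \<in> borel_measurable (LS s)" and vm[measurable]: "v \<in> borel_measurable (LS s)"
    and fi: "\<And>n. integrable (LS s) (\<lambda>x. (norm (f n x))\<^sup>2)" and B: "\<And>n. (\<integral>x. (norm (f n x))\<^sup>2 \<partial>LS s) \<le> B"
    and v: "integrable (LS s) (\<lambda>x. (norm (v x))\<^sup>2)"
    and lim: "\<And>g. continuous_on UNIV g \<Longrightarrow> (\<lambda>n. \<integral>x. f n x * g x \<partial>LS s) \<longlonglongrightarrow> 0"
  shows "(\<lambda>n. \<integral>x. f n x * v x \<partial>LS s) \<longlonglongrightarrow> 0"
proof (rule LIMSEQ_I)
  fix \<epsilon> :: real assume \<epsilon>: "\<epsilon> > 0"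
  have B0: "B \<ge> 0" using order_trans[OF integral_nonneg_AE B[of 0]] by auto
  define d where "d = \<epsilon> / (2 * (B + 1))"
  have d: "d > 0" using B0 \<epsilon> by (simp add: d_def)
  have dB: "d * B + d \<le> \<epsilon> / 2"
  proof -
    have "d * B + d = d * (B + 1)" by (simp add: algebra_simps)
    also have "\<dots> = \<epsilon> / 2" using B0 by (simp add: d_def field_simps)
    finally show ?thesis by simp
  qed
  have prod_i: "integrable (LS s) (\<lambda>x. f n x * w x)" if "w \<in> borel_measurable (LS s)" "integrable (LS s) (\<lambda>x. (norm (w x))\<^sup>2)" for n w
  proof (rule integrable_dominated[of _ "\<lambda>x. (norm (f n x))\<^sup>2 + (norm (w x))\<^sup>2"])
    show "AE x in LS s. norm (f n x * w x) \<le> norm ((norm (f n x))\<^sup>2 + (norm (w x))\<^sup>2)"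
    proof (rule AE_I2)
      fix x
      have "0 \<le> norm (f n x) * norm (w x)" by simp
      moreover have "2 * (norm (f n x) * norm (w x)) \<le> (norm (f n x))\<^sup>2 + (norm (w x))\<^sup>2"
        using zero_le_power2[of "norm (f n x) - norm (w x)"] by (simp add: power2_eq_square algebra_simps)
      ultimately show "norm (f n x * w x) \<le> norm ((norm (f n x))\<^sup>2 + (norm (w x))\<^sup>2)" unfolding norm_mult real_norm_def by linarith
    qed
    show "(\<lambda>x. f n x * w x) \<in> borel_measurable (LS s)" using that(1) by measurable
  qed (use fi that in auto)
  obtain g where g: "continuous_on UNIV g" "integrable (LS s) (\<lambda>x. (norm (v x - g x))\<^sup>2)" "(\<integral>x. (norm (v x - g x))\<^sup>2 \<partial>LS s) < d * d"
    using continuous_dense_L2[OF vm v, of "d * d"] d by auto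
  have [measurable]: "g \<in> borel_measurable (LS s)"
    by (rule measurable_compose[OF LS_id_measurable borel_measurable_continuous_onI[OF g(1)]])
  have vg: "(\<lambda>x. v x - g x) \<in> borel_measurable (LS s)" by measurable
  have g2: "integrable (LS s) (\<lambda>x. (norm (g x))\<^sup>2)"
  proof (rule integrable_dominated[of _ "\<lambda>x. 2 * (norm (v x))\<^sup>2 + 2 * (norm (v x - g x))\<^sup>2"])
    show "AE x in LS s. norm ((norm (g x))\<^sup>2) \<le> norm (2 * (norm (v x))\<^sup>2 + 2 * (norm (v x - g x))\<^sup>2)"
    proof (rule AE_I2)
      fix x
      show "norm ((norm (g x))\<^sup>2) \<le> norm (2 * (norm (v x))\<^sup>2 + 2 * (norm (v x - g x))\<^sup>2)"
        using square_norm_add_le[of "v x" "g x - v x"] by (simp add: norm_minus_commute)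
    qed
  qed (use v g in auto)
  from LIMSEQ_D[OF lim[OF g(1)], of "\<epsilon> / 2"] \<epsilon> obtain N where N: "\<And>n. n \<ge> N \<Longrightarrow> norm ((\<integral>x. f n x * g x \<partial>LS s) - 0) < \<epsilon> / 2" by auto
  show "\<exists>N. \<forall>n\<ge>N. norm ((\<integral>x. f n x * v x \<partial>LS s) - 0) < \<epsilon>"
  proof (intro exI allI impI)
    fix n assume n: "n \<ge> N"
    have "(\<integral>x. f n x * v x \<partial>LS s) = (\<integral>x. f n x * g x + f n x * (v x - g x) \<partial>LS s)"
      by (intro lebesgue_integral_cong) (auto simp: algebra_simps)
    also have "\<dots> = (\<integral>x. f n x * g x \<partial>LS s) + (\<integral>x. f n x * (v x - g x) \<partial>LS s)"
      by (intro Bochner_Integration.integral_add prod_i g2 vg g(2)) measurable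
    finally have eq: "(\<integral>x. f n x * v x \<partial>LS s) = (\<integral>x. f n x * g x \<partial>LS s) + (\<integral>x. f n x * (v x - g x) \<partial>LS s)" .
    have "norm (\<integral>x. f n x * (v x - g x) \<partial>LS s) \<le> (\<integral>x. norm (f n x * (v x - g x)) \<partial>LS s)" by (rule integral_norm_bound)
    also have "\<dots> \<le> (\<integral>x. d * (norm (f n x))\<^sup>2 + (1 / d) * (norm (v x - g x))\<^sup>2 \<partial>LS s)"
    proof (rule integral_mono')
      show "integrable (LS s) (\<lambda>x. d * (norm (f n x))\<^sup>2 + (1 / d) * (norm (v x - g x))\<^sup>2)" using fi g(2) by auto
      fix x
      have "0 \<le> d * (norm (f n x) - norm (v x - g x) / d)\<^sup>2" using d by simp
      also have "\<dots> = d * (norm (f n x))\<^sup>2 + (1 / d) * (norm (v x - g x))\<^sup>2 - 2 * (norm (f n x) * norm (v x - g x))"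
        using d by (simp add: power2_eq_square field_simps)
      finally have "2 * (norm (f n x) * norm (v x - g x)) \<le> d * (norm (f n x))\<^sup>2 + (1 / d) * (norm (v x - g x))\<^sup>2" by simp
      moreover have "0 \<le> norm (f n x) * norm (v x - g x)" by simp
      ultimately show "norm (f n x * (v x - g x)) \<le> d * (norm (f n x))\<^sup>2 + (1 / d) * (norm (v x - g x))\<^sup>2"
        unfolding norm_mult by linarith
      show "0 \<le> d * (norm (f n x))\<^sup>2 + (1 / d) * (norm (v x - g x))\<^sup>2" using d by simp
    qed
    also have "\<dots> = d * (\<integral>x. (norm (f n x))\<^sup>2 \<partial>LS s) + (1 / d) * (\<integral>x. (norm (v x - g x))\<^sup>2 \<partial>LS s)" using fi g(2) by simp
    also have "\<dots> \<le> d * B + (1 / d) * (d * d)" using d g(3) B by (intro add_mono mult_left_mono) auto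
    also have "\<dots> \<le> \<epsilon> / 2" using dB d by simp
    finally have "norm (\<integral>x. f n x * (v x - g x) \<partial>LS s) \<le> \<epsilon> / 2" .
    moreover have "norm ((\<integral>x. f n x * v x \<partial>LS s) - 0) \<le> norm ((\<integral>x. f n x * g x \<partial>LS s) - 0) + norm (\<integral>x. f n x * (v x - g x) \<partial>LS s)"
      unfolding eq diff_zero by (rule norm_triangle_ineq)
    ultimately show "norm ((\<integral>x. f n x * v x \<partial>LS s) - 0) < \<epsilon>" using N[OF n] by linarith
  qed
qed

lemma Poisson_limit:
  fixes g :: "real \<Rightarrow> complex"
  assumes g: "continuous_on UNIV g" and K: "\<And>y. y \<in> {-s<..<s} \<Longrightarrow> norm (g y) \<le> K" and x: "x \<in> {-s<..<s}"
  shows "(\<lambda>n. \<integral>y. g y * of_real (eps n / ((x - y)\<^sup>2 + (eps n)\<^sup>2)) \<partial>LS s) \<longlonglongrightarrow> of_real pi * g x"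
    "norm (\<integral>y. g y * of_real (eps n / ((x - y)\<^sup>2 + (eps n)\<^sup>2)) \<partial>LS s) \<le> pi * K"
proof -
  let ?S = "{-s<..<s}"
  let ?h = "\<lambda>y. indicator ?S y *\<^sub>R g y"
  have K0: "K \<ge> 0" using order_trans[OF norm_ge_zero K[OF x]] .
  have [measurable]: "g \<in> borel_measurable borel" by (rule borel_measurable_continuous_onI[OF g])
  have hm[measurable]: "?h \<in> borel_measurable borel" by measurable
  have hK: "norm (?h y) \<le> K" for y using K[of y] K0 by (auto simp: indicator_def)
  have eq: "(\<integral>y. g y * of_real (eps n / ((x - y)\<^sup>2 + (eps n)\<^sup>2)) \<partial>LS s) = (\<integral>r. ?h (x + eps n * r) * of_real (1 / (1 + r\<^sup>2)) \<partial>lborel)" for n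
  proof -
    let ?e = "eps n"
    have e: "?e > 0" by (rule eps_pos)
    have "(\<integral>y. g y * of_real (?e / ((x - y)\<^sup>2 + ?e\<^sup>2)) \<partial>LS s) = (\<integral>y. indicator ?S y *\<^sub>R (g y * of_real (?e / ((x - y)\<^sup>2 + ?e\<^sup>2))) \<partial>lebesgue)"
      by (subst integral_restrict_space) (auto simp: set_lebesgue_integral_def)
    also have "\<dots> = (\<integral>y. ?h y * of_real (?e / ((x - y)\<^sup>2 + ?e\<^sup>2)) \<partial>lborel)"
      by (subst integral_completion) (auto simp: indicator_def intro!: lebesgue_integral_cong)
    also have "\<dots> = \<bar>?e\<bar> *\<^sub>R (\<integral>r. ?h (x + ?e * r) * of_real (?e / ((x - (x + ?e * r))\<^sup>2 + ?e\<^sup>2)) \<partial>lborel)"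
      by (rule lborel_integral_real_affine) (use e in auto)
    also have "\<dots> = (\<integral>r. ?e *\<^sub>R (?h (x + ?e * r) * of_real (?e / ((x - (x + ?e * r))\<^sup>2 + ?e\<^sup>2))) \<partial>lborel)"
      using e by simp
    also have "\<dots> = (\<integral>r. ?h (x + ?e * r) * of_real (1 / (1 + r\<^sup>2)) \<partial>lborel)"
    proof (intro lebesgue_integral_cong refl)
      fix r
      have "(x - (x + ?e * r))\<^sup>2 + ?e\<^sup>2 = ?e * ?e * (1 + r\<^sup>2)" by (simp add: power2_eq_square algebra_simps)
      then have k: "?e * (?e / ((x - (x + ?e * r))\<^sup>2 + ?e\<^sup>2)) = 1 / (1 + r\<^sup>2)" using e by simp
      have "?e *\<^sub>R (?h (x + ?e * r) * of_real (?e / ((x - (x + ?e * r))\<^sup>2 + ?e\<^sup>2))) = ?h (x + ?e * r) * of_real (?e * (?e / ((x - (x + ?e * r))\<^sup>2 + ?e\<^sup>2)))"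
        by (simp only: scaleR_conv_of_real of_real_mult mult_ac)
      then show "?e *\<^sub>R (?h (x + ?e * r) * of_real (?e / ((x - (x + ?e * r))\<^sup>2 + ?e\<^sup>2))) = ?h (x + ?e * r) * of_real (1 / (1 + r\<^sup>2))"
        unfolding k .
    qed
    finally show ?thesis .
  qed
  have bd: "norm (?h (x + eps n * r) * of_real (1 / (1 + r\<^sup>2))) \<le> K * (1 / (1 + r\<^sup>2))" for n r
    unfolding norm_mult norm_of_real by (rule mult_mono[OF hK]) (use K0 in auto)
  have iK: "integrable lborel (\<lambda>r. K * (1 / (1 + (r::real)\<^sup>2)))" by (intro integrable_mult_right integrable_inverse_square)
  have "(\<lambda>n. \<integral>r. ?h (x + eps n * r) * of_real (1 / (1 + r\<^sup>2)) \<partial>lborel) \<longlonglongrightarrow> (\<integral>r. g x * of_real (1 / (1 + r\<^sup>2)) \<partial>lborel)"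
  proof (rule integral_dominated_convergence[where w="\<lambda>r. K * (1 / (1 + r\<^sup>2))"])
    show "AE r in lborel. (\<lambda>n. ?h (x + eps n * r) * of_real (1 / (1 + r\<^sup>2))) \<longlonglongrightarrow> g x * of_real (1 / (1 + r\<^sup>2))"
    proof (rule AE_I2)
      fix r
      have l: "(\<lambda>n. x + eps n * r) \<longlonglongrightarrow> x + 0 * r" by (intro tendsto_intros eps_lim)
      then have gl: "(\<lambda>n. g (x + eps n * r)) \<longlonglongrightarrow> g x" using g by (auto intro: continuous_on_tendsto_compose)
      have "\<forall>\<^sub>F n in sequentially. x + eps n * r \<in> ?S" using l x by (auto dest: topological_tendstoD[OF _ open_greaterThanLessThan])
      then have "\<forall>\<^sub>F n in sequentially. g (x + eps n * r) = ?h (x + eps n * r)" by eventually_elim simp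
      from Lim_transform_eventually[OF gl this] show "(\<lambda>n. ?h (x + eps n * r) * of_real (1 / (1 + r\<^sup>2))) \<longlonglongrightarrow> g x * of_real (1 / (1 + r\<^sup>2))"
        by (intro tendsto_intros)
    qed
    show "AE r in lborel. norm (?h (x + eps n * r) * of_real (1 / (1 + r\<^sup>2))) \<le> K * (1 / (1 + r\<^sup>2))" for n using bd by (rule AE_I2)
  qed (use iK in auto)
  also have "(\<integral>r. g x * of_real (1 / (1 + r\<^sup>2)) \<partial>lborel) = of_real pi * g x"
    by (simp only: integral_mult_right_zero integral_complex_of_real integrable_inverse_square(2) mult.commute)
  finally show "(\<lambda>n. \<integral>y. g y * of_real (eps n / ((x - y)\<^sup>2 + (eps n)\<^sup>2)) \<partial>LS s) \<longlonglongrightarrow> of_real pi * g x" unfolding eq .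
  have "norm (\<integral>r. ?h (x + eps n * r) * of_real (1 / (1 + r\<^sup>2)) \<partial>lborel) \<le> (\<integral>r. norm (?h (x + eps n * r) * of_real (1 / (1 + r\<^sup>2))) \<partial>lborel)"
    by (rule integral_norm_bound)
  also have "\<dots> \<le> (\<integral>r. K * (1 / (1 + r\<^sup>2)) \<partial>lborel)"
    by (rule integral_mono'[OF iK bd]) (use K0 in auto)
  also have "\<dots> = pi * K" by (simp only: integral_mult_right_zero integrable_inverse_square(2) mult.commute)
  finally show "norm (\<integral>y. g y * of_real (eps n / ((x - y)\<^sup>2 + (eps n)\<^sup>2)) \<partial>LS s) \<le> pi * K" unfolding eq .
qed

context cauchy_L2
begin

definition Qn where "Qn e x = (\<integral>y. u y * of_real ((x - y) / ((x - y)\<^sup>2 + e\<^sup>2)) \<partial>LS s)"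
definition Pn where "Pn e x = (\<integral>y. u y * of_real (e / ((x - y)\<^sup>2 + e\<^sup>2)) \<partial>LS s)"

text \<open>\<open>\<Phi>\<close> splits into the conjugate Poisson integral \<open>Qn\<close> and the Poisson integral \<open>Pn\<close>; changing the sign of \<open>e\<close> changes the sign of the latter.\<close>
lemma QPn:
  assumes e: "e > 0"
  shows "integrable (LS s) (\<lambda>y. u y * of_real ((x - y) / ((x - y)\<^sup>2 + e\<^sup>2)))"
    "integrable (LS s) (\<lambda>y. u y * of_real (e / ((x - y)\<^sup>2 + e\<^sup>2)))"
    "\<Phi> e x = Qn e x + \<i> * Pn e x" "\<Phi> (-e) x = Qn e x - \<i> * Pn e x"
proof -
  have k: "u y / (cden e x y) = u y * of_real ((x - y) / ((x - y)\<^sup>2 + e\<^sup>2)) + \<i> * (u y * of_real (e / ((x - y)\<^sup>2 + e\<^sup>2)))"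
    if "e \<noteq> 0" for y e
  proof -
    have p: "of_real ((x - y)\<^sup>2 + e\<^sup>2) \<noteq> (0::complex)" using that by (simp del: of_real_add add: sum_power2_eq_zero_iff)
    have nz: "cden e x y \<noteq> 0" using that by (auto simp: complex_eq_iff)
    have "1 / (cden e x y) = of_real ((x - y) / ((x - y)\<^sup>2 + e\<^sup>2)) + \<i> * of_real (e / ((x - y)\<^sup>2 + e\<^sup>2))"
    proof -
      have "(cden e x y) * (of_real (x - y) + \<i> * of_real e) = of_real ((x - y)\<^sup>2 + e\<^sup>2)"
        by (simp add: power2_eq_square algebra_simps)
      then have "1 / (cden e x y) = (of_real (x - y) + \<i> * of_real e) / of_real ((x - y)\<^sup>2 + e\<^sup>2)"
        using p nz by (simp add: divide_simps mult.commute del: of_real_add of_real_diff)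
      then show ?thesis by (simp add: add_divide_distrib)
    qed
    then have "u y * (1 / (cden e x y)) = u y * (of_real ((x - y) / ((x - y)\<^sup>2 + e\<^sup>2)) + \<i> * of_real (e / ((x - y)\<^sup>2 + e\<^sup>2)))" by (simp only:)
    then show ?thesis by (simp add: distrib_left mult_ac)
  qed
  have e0: "e \<noteq> 0" "-e \<noteq> 0" using e by auto
  define A where "A y = u y * of_real ((x - y) / ((x - y)\<^sup>2 + e\<^sup>2))" for y
  define B where "B y = u y * of_real (e / ((x - y)\<^sup>2 + e\<^sup>2))" for y
  have k1: "u y / (cden e x y) = A y + \<i> * B y" for y
    using k[OF e0(1), of y] unfolding A_def B_def .
  have k2: "u y / (of_real x - (of_real y + \<i> * of_real (- e))) = A y - \<i> * B y" for y
    using k[OF e0(2), of y] unfolding A_def B_def by simp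
  have i1: "integrable (LS s) (\<lambda>y. A y + \<i> * B y)" using \<Phi>_integrable[OF e0(1), of x] unfolding k1 .
  have i2: "integrable (LS s) (\<lambda>y. A y - \<i> * B y)" using \<Phi>_integrable[OF e0(2), of x] unfolding k2 .
  have "integrable (LS s) (\<lambda>y. (1/2) * ((A y + \<i> * B y) + (A y - \<i> * B y)))"
    by (intro integrable_mult_right Bochner_Integration.integrable_add i1 i2)
  then have iA: "integrable (LS s) A" by simp
  have "integrable (LS s) (\<lambda>y. (1/(2*\<i>)) * ((A y + \<i> * B y) - (A y - \<i> * B y)))"
    by (intro integrable_mult_right Bochner_Integration.integrable_diff i1 i2)
  then have iB: "integrable (LS s) B" by simp
  show "integrable (LS s) (\<lambda>y. u y * of_real ((x - y) / ((x - y)\<^sup>2 + e\<^sup>2)))" using iA unfolding A_def .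
  show "integrable (LS s) (\<lambda>y. u y * of_real (e / ((x - y)\<^sup>2 + e\<^sup>2)))" using iB unfolding B_def .
  show "\<Phi> e x = Qn e x + \<i> * Pn e x" unfolding \<Phi>_def k1 Qn_def Pn_def A_def[symmetric] B_def[symmetric] using iA iB by simp
  show "\<Phi> (-e) x = Qn e x - \<i> * Pn e x" unfolding \<Phi>_def k2 Qn_def Pn_def A_def[symmetric] B_def[symmetric] using iA iB by simp
qed

lemma \<Phi>_minus_bound: assumes e: "e > 0" shows "(\<integral>x. (norm (\<Phi> (-e) x))\<^sup>2 \<partial>LS s) \<le> 4 * pi\<^sup>2 * q"
proof -
  interpret C: cauchy_L2 s "\<lambda>x. cnj (u x)"
  proof
    show "(\<lambda>x. cnj (u x)) \<in> borel_measurable (LS s)"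
      by (rule measurable_compose[OF um borel_measurable_continuous_onI]) (intro continuous_intros)
  qed (use s u2 in auto)
  have "\<Phi> (-e) x = cnj (C.\<Phi> e x)" for x
    unfolding \<Phi>_def C.\<Phi>_def Bochner_Integration.integral_cnj[symmetric] by simp
  then have "(\<integral>x. (norm (\<Phi> (-e) x))\<^sup>2 \<partial>LS s) = (\<integral>x. (norm (C.\<Phi> e x))\<^sup>2 \<partial>LS s)" by simp
  also have "\<dots> \<le> 4 * pi\<^sup>2 * C.q" using C.\<Phi>_LS_le[of e] C.E_bound[OF e] e by auto
  also have "C.q = q" unfolding C.q_def q_def by simp
  finally show ?thesis .
qed

text \<open>By the parallelogram law from the energy bounds on both sides of the line.\<close>
lemma Qn_bound:
  assumes e: "e > 0"
  shows "Qn e \<in> borel_measurable (LS s)" "integrable (LS s) (\<lambda>x. (norm (Qn e x))\<^sup>2)" "(\<integral>x. (norm (Qn e x))\<^sup>2 \<partial>LS s) \<le> 4 * pi\<^sup>2 * q"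
    "Pn e \<in> borel_measurable (LS s)"
proof -
  have Q: "Qn e x = (1/2) * (\<Phi> e x + \<Phi> (-e) x)" for x using QPn(3,4)[OF e, of x] by simp
  have P: "Pn e x = (1/(2*\<i>)) * (\<Phi> e x - \<Phi> (-e) x)" for x using QPn(3,4)[OF e, of x] by simp
  show Qm: "Qn e \<in> borel_measurable (LS s)"
    unfolding Q[abs_def] using \<Phi>_measurable_LS by (intro borel_measurable_times borel_measurable_add borel_measurable_const) auto
  show "Pn e \<in> borel_measurable (LS s)"
    unfolding P[abs_def] using \<Phi>_measurable_LS by (intro borel_measurable_times borel_measurable_diff borel_measurable_const) auto
  have le: "(norm (Qn e x))\<^sup>2 \<le> (1/2) * (norm (\<Phi> e x))\<^sup>2 + (1/2) * (norm (\<Phi> (-e) x))\<^sup>2" for x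
    unfolding Q using square_norm_add_le[of "\<Phi> e x" "\<Phi> (-e) x"] by (simp add: norm_mult norm_divide power_divide)
  have e0: "e \<noteq> 0" "-e \<noteq> 0" using e by auto
  have j: "integrable (LS s) (\<lambda>x. (1/2) * (norm (\<Phi> e x))\<^sup>2 + (1/2) * (norm (\<Phi> (-e) x))\<^sup>2)"
    by (intro Bochner_Integration.integrable_add integrable_mult_right \<Phi>_LS_integrable e0)
  show i: "integrable (LS s) (\<lambda>x. (norm (Qn e x))\<^sup>2)"
  proof (rule integrable_dominated[OF j])
    show "(\<lambda>x. (norm (Qn e x))\<^sup>2) \<in> borel_measurable (LS s)" using Qm by measurable
    show "AE x in LS s. norm ((norm (Qn e x))\<^sup>2) \<le> norm ((1/2) * (norm (\<Phi> e x))\<^sup>2 + (1/2) * (norm (\<Phi> (-e) x))\<^sup>2)"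
      using le by (intro AE_I2) (simp only: real_norm_def abs_power2, rule order_trans[OF _ abs_ge_self])
  qed
  have "(\<integral>x. (norm (Qn e x))\<^sup>2 \<partial>LS s) \<le> (\<integral>x. (1/2) * (norm (\<Phi> e x))\<^sup>2 + (1/2) * (norm (\<Phi> (-e) x))\<^sup>2 \<partial>LS s)"
    by (rule integral_mono[OF i j le])
  also have "\<dots> = (1/2) * (\<integral>x. (norm (\<Phi> e x))\<^sup>2 \<partial>LS s) + (1/2) * (\<integral>x. (norm (\<Phi> (-e) x))\<^sup>2 \<partial>LS s)"
    using \<Phi>_LS_integrable[OF e0(1)] \<Phi>_LS_integrable[OF e0(2)] by simp
  also have "\<dots> \<le> 4 * pi\<^sup>2 * q"
    using \<Phi>_LS_le[OF e0(1)] E_bound[OF e] \<Phi>_minus_bound[OF e] by linarith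
  finally show "(\<integral>x. (norm (Qn e x))\<^sup>2 \<partial>LS s) \<le> 4 * pi\<^sup>2 * q" .
qed

lemma Pn_weak:
  assumes g: "continuous_on UNIV g"
  shows "(\<lambda>n. \<integral>x. Pn (eps n) x * g x \<partial>LS s) \<longlonglongrightarrow> (\<integral>x. of_real pi * (u x * g x) \<partial>LS s)"
proof -
  interpret MM: pair_sigma_finite "LS s" "LS s" ..
  have "compact (g ` {-s..s})" using g by (intro compact_continuous_image) (auto intro: continuous_on_subset)
  then obtain K where K0: "K > 0" and K: "\<And>y. y \<in> {-s..s} \<Longrightarrow> norm (g y) \<le> K"
    using compact_imp_bounded bounded_pos by (metis imageI)
  have K': "\<And>y. y \<in> {-s<..<s} \<Longrightarrow> norm (g y) \<le> K" using K by auto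
  have gm: "g \<in> borel_measurable (LS s)" by (rule measurable_compose[OF LS_id_measurable borel_measurable_continuous_onI[OF g]])
  have eq: "(\<integral>x. Pn (eps n) x * g x \<partial>LS s) = (\<integral>y. u y * (\<integral>x. g x * of_real (eps n / ((y - x)\<^sup>2 + (eps n)\<^sup>2)) \<partial>LS s) \<partial>LS s)" for n
  proof -
    let ?e = "eps n"
    have e: "?e > 0" by (rule eps_pos)
    define F where "F x y = u y * of_real (?e / ((x - y)\<^sup>2 + ?e\<^sup>2)) * g x" for x y
    have Fm: "case_prod F \<in> borel_measurable (LS s \<Otimes>\<^sub>M LS s)" unfolding F_def using gm by measurable
    have Fi: "integrable (LS s \<Otimes>\<^sub>M LS s) (case_prod F)"
    proof (rule MM.integrable_product_bound[where f="\<lambda>x. K * (1 / ?e)" and g="\<lambda>y. norm (u y)", OF Fm])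
      show "integrable (LS s) (\<lambda>y. norm (u y))" using ui by auto
      show "integrable (LS s) (\<lambda>x. K * (1 / ?e))" by (rule M.integrable_const)
      fix x y assume x: "x \<in> space (LS s)"
      have "?e / ((x - y)\<^sup>2 + ?e\<^sup>2) \<le> ?e / ?e\<^sup>2" using e by (intro divide_left_mono mult_pos_pos) (auto simp: add_nonneg_pos)
      also have "\<dots> = 1 / ?e" using e by (simp add: power2_eq_square)
      finally have "norm (u y) * (?e / ((x - y)\<^sup>2 + ?e\<^sup>2)) * norm (g x) \<le> norm (u y) * (1 / ?e) * K"
        using x e by (intro mult_mono mult_left_mono K') (auto simp: space_M intro!: mult_nonneg_nonneg divide_nonneg_nonneg)
      moreover have "norm (case_prod F (x, y)) = norm (u y) * (?e / ((x - y)\<^sup>2 + ?e\<^sup>2)) * norm (g x)"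
        unfolding F_def prod.case norm_mult norm_of_real using e by simp
      ultimately show "norm (case_prod F (x, y)) \<le> K * (1 / ?e) * norm (u y)" by (simp add: mult_ac)
    qed
    have 1: "(\<integral>y. F x y \<partial>LS s) = Pn ?e x * g x" for x unfolding F_def Pn_def by (rule integral_mult_left_zero)
    have 2: "(\<integral>x. F x y \<partial>LS s) = u y * (\<integral>x. g x * of_real (?e / ((y - x)\<^sup>2 + ?e\<^sup>2)) \<partial>LS s)" for y
      unfolding F_def integral_mult_right_zero[symmetric] by (intro lebesgue_integral_cong) (auto simp: power2_commute)
    show ?thesis using MM.Fubini_integral[OF Fi] unfolding 1 2 by simp
  qed
  have gm2: "(\<lambda>y. u y * (\<integral>x. g x * of_real (eps n / ((y - x)\<^sup>2 + (eps n)\<^sup>2)) \<partial>LS s)) \<in> borel_measurable (LS s)" for n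
  proof -
    have "(\<lambda>y. \<integral>x. g x * of_real (eps n / ((y - x)\<^sup>2 + (eps n)\<^sup>2)) \<partial>LS s) \<in> borel_measurable (LS s)"
      using gm by measurable
    then show ?thesis by measurable
  qed
  have "(\<lambda>n. \<integral>y. u y * (\<integral>x. g x * of_real (eps n / ((y - x)\<^sup>2 + (eps n)\<^sup>2)) \<partial>LS s) \<partial>LS s) \<longlonglongrightarrow> (\<integral>y. u y * (of_real pi * g y) \<partial>LS s)"
  proof (rule integral_dominated_convergence[where w="\<lambda>y. norm (u y) * (pi * K)"])
    show "AE y in LS s. (\<lambda>n. u y * (\<integral>x. g x * of_real (eps n / ((y - x)\<^sup>2 + (eps n)\<^sup>2)) \<partial>LS s)) \<longlonglongrightarrow> u y * (of_real pi * g y)"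
      by (intro AE_I2 tendsto_mult tendsto_const Poisson_limit(1)[OF g K']) (auto simp: space_M)
    show "AE y in LS s. norm (u y * (\<integral>x. g x * of_real (eps n / ((y - x)\<^sup>2 + (eps n)\<^sup>2)) \<partial>LS s)) \<le> norm (u y) * (pi * K)" for n
    proof (rule AE_I2)
      fix y assume "y \<in> space (LS s)"
      then show "norm (u y * (\<integral>x. g x * of_real (eps n / ((y - x)\<^sup>2 + (eps n)\<^sup>2)) \<partial>LS s)) \<le> norm (u y) * (pi * K)"
        unfolding norm_mult by (intro mult_left_mono Poisson_limit(2)[OF g K']) (auto simp: space_M)
    qed
    show "integrable (LS s) (\<lambda>y. norm (u y) * (pi * K))" using ui by auto
    show "(\<lambda>y. u y * (of_real pi * g y)) \<in> borel_measurable (LS s)" using gm by measurable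
  qed (rule gm2)
  then show ?thesis unfolding eq by (simp only: mult.left_commute)
qed

end

section \<open>Uniqueness for the Hilbert equation\<close>

locale hilbert_homogeneous = cauchy_L2 +
  assumes hom: "AE x in LS s. hilbert_equation_at s u (\<lambda>_. 0) x"
begin

text \<open>The smoothed principal value converges to \<open>\<pi> H u\<close>, and the equation says \<open>H u = - i u\<close>.\<close>
lemma Qn_limit: "AE x in LS s. (\<lambda>n. Qn (eps n) x) \<longlonglongrightarrow> - (\<i> * of_real pi * u x)"
  using hom
proof eventually_elim
  case (elim x)
  then obtain h where h: "has_finite_hilbert s u x h" "u x - \<i> * h = 0" unfolding hilbert_equation_at_def by auto
  have "h = - (\<i> * u x)" using h(2) by (simp add: algebra_simps)
  then have "of_real pi * h = - (\<i> * of_real pi * u x)" by simp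
  then show ?case using smoothed_hilbert_limit[OF ui h(1)] unfolding Qn_def by simp
qed

text \<open>The limits \<open>- i \<pi> u\<close> of \<open>Qn\<close> and \<open>\<pi> u\<close> of \<open>Pn\<close> cancel in \<open>\<Phi> = Qn + i Pn\<close>.\<close>
lemma \<Phi>_weak_limit:
  assumes g: "continuous_on UNIV g"
  shows "(\<lambda>n. \<integral>x. \<Phi> (eps n) x * g x \<partial>LS s) \<longlonglongrightarrow> 0"
proof -
  have gm[measurable]: "g \<in> borel_measurable (LS s)" by (rule measurable_compose[OF LS_id_measurable borel_measurable_continuous_onI[OF g]])
  have "compact (g ` {-s..s})" using g by (intro compact_continuous_image) (auto intro: continuous_on_subset)
  then obtain K where K0: "K > 0" and K: "\<And>y. y \<in> {-s..s} \<Longrightarrow> norm (g y) \<le> K"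
    using compact_imp_bounded bounded_pos by (metis imageI)
  have g2: "integrable (LS s) (\<lambda>x. (norm (g x))\<^sup>2)"
  proof (rule M.integrable_const_bound[where B="K\<^sup>2"], rule AE_I2)
    fix x assume "x \<in> space (LS s)"
    then have "(norm (g x))\<^sup>2 \<le> K\<^sup>2" by (intro power_mono K) (auto simp: space_M)
    then show "norm ((norm (g x))\<^sup>2) \<le> K\<^sup>2" by simp
  qed measurable
  have bnd: "integrable (LS s) (\<lambda>x. f x * g x)" if f: "integrable (LS s) f" for f
  proof (rule integrable_dominated[of _ "\<lambda>x. norm (f x) * K"])
    show "AE x in LS s. norm (f x * g x) \<le> norm (norm (f x) * K)"
    proof (rule AE_I2)
      fix x assume "x \<in> space (LS s)"
      then have "norm (f x) * norm (g x) \<le> norm (f x) * K" by (intro mult_left_mono K) (auto simp: space_M)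
      then show "norm (f x * g x) \<le> norm (norm (f x) * K)" using K0 by (simp add: norm_mult)
    qed
    show "(\<lambda>x. f x * g x) \<in> borel_measurable (LS s)" using f by measurable
  qed (use f in auto)
  note QB = Qn_bound[OF eps_pos]
  let ?f = "\<lambda>n x. Qn (eps n) x + \<i> * of_real pi * u x"
  have fm: "?f n \<in> borel_measurable (LS s)" for n using QB(1)[of n] by measurable
  have le: "(norm (?f n x))\<^sup>2 \<le> 2 * (norm (Qn (eps n) x))\<^sup>2 + 2 * pi\<^sup>2 * (norm (u x))\<^sup>2" for n x
    using square_norm_add_le[of "Qn (eps n) x" "\<i> * of_real pi * u x"] by (simp add: norm_mult power_mult_distrib)
  have j: "integrable (LS s) (\<lambda>x. 2 * (norm (Qn (eps n) x))\<^sup>2 + 2 * pi\<^sup>2 * (norm (u x))\<^sup>2)" for n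
    by (intro Bochner_Integration.integrable_add integrable_mult_right QB(2) u2)
  have fi: "integrable (LS s) (\<lambda>x. (norm (?f n x))\<^sup>2)" for n
  proof (rule integrable_dominated[OF j])
    show "(\<lambda>x. (norm (?f n x))\<^sup>2) \<in> borel_measurable (LS s)" using fm[of n] by measurable
    show "AE x in LS s. norm ((norm (?f n x))\<^sup>2) \<le> norm (2 * (norm (Qn (eps n) x))\<^sup>2 + 2 * pi\<^sup>2 * (norm (u x))\<^sup>2)"
      using le by (intro AE_I2) (simp only: real_norm_def abs_power2, rule order_trans[OF _ abs_ge_self])
  qed
  have fB: "(\<integral>x. (norm (?f n x))\<^sup>2 \<partial>LS s) \<le> 2 * (4 * pi\<^sup>2 * q) + 2 * pi\<^sup>2 * q" for n
  proof -
    have "(\<integral>x. (norm (?f n x))\<^sup>2 \<partial>LS s) \<le> (\<integral>x. 2 * (norm (Qn (eps n) x))\<^sup>2 + 2 * pi\<^sup>2 * (norm (u x))\<^sup>2 \<partial>LS s)"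
      by (rule integral_mono[OF fi j le])
    also have "\<dots> = 2 * (\<integral>x. (norm (Qn (eps n) x))\<^sup>2 \<partial>LS s) + 2 * pi\<^sup>2 * q"
      unfolding q_def using QB(2)[of n] u2 by simp
    finally show ?thesis using QB(3)[of n] by linarith
  qed
  have "AE x in LS s. (\<lambda>n. ?f n x) \<longlonglongrightarrow> 0"
    using Qn_limit
  proof eventually_elim
    case (elim x)
    have "(\<lambda>n. ?f n x) \<longlonglongrightarrow> - (\<i> * of_real pi * u x) + \<i> * of_real pi * u x" by (intro tendsto_add elim tendsto_const)
    then show ?case by simp
  qed
  from weak_limit[OF fm gm fi fB g2 this] have L1: "(\<lambda>n. \<integral>x. ?f n x * g x \<partial>LS s) \<longlonglongrightarrow> 0" .
  have L2: "(\<lambda>n. \<i> * (\<integral>x. Pn (eps n) x * g x \<partial>LS s) - \<i> * (\<integral>x. of_real pi * (u x * g x) \<partial>LS s)) \<longlonglongrightarrow> \<i> * (\<integral>x. of_real pi * (u x * g x) \<partial>LS s) - \<i> * (\<integral>x. of_real pi * (u x * g x) \<partial>LS s)"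
    by (intro tendsto_diff tendsto_mult tendsto_const Pn_weak[OF g])
  have "(\<integral>x. \<Phi> (eps n) x * g x \<partial>LS s) = (\<integral>x. ?f n x * g x \<partial>LS s) + (\<i> * (\<integral>x. Pn (eps n) x * g x \<partial>LS s) - \<i> * (\<integral>x. of_real pi * (u x * g x) \<partial>LS s))" for n
  proof -
    have Qi: "integrable (LS s) (Qn (eps n))" by (rule square_integrable_imp_integrable[OF QB(1,2)])
    have \<Phi>i: "integrable (LS s) (\<Phi> (eps n))"
      by (rule square_integrable_imp_integrable[OF \<Phi>_measurable_LS \<Phi>_LS_integrable]) (use eps_pos[of n] in auto)
    have Pe: "Pn (eps n) x = (1 / \<i>) * (\<Phi> (eps n) x - Qn (eps n) x)" for x using QPn(3)[OF eps_pos, of n x] by simp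
    have Pi: "integrable (LS s) (Pn (eps n))"
      unfolding Pe[abs_def] using \<Phi>i Qi by (intro integrable_mult_right Bochner_Integration.integrable_diff)
    have ug: "integrable (LS s) (\<lambda>x. u x * g x)" by (rule bnd[OF ui])
    have fgi: "integrable (LS s) (\<lambda>x. ?f n x * g x)" by (rule bnd) (intro Bochner_Integration.integrable_add Qi integrable_mult_right ui)
    have "(\<integral>x. \<Phi> (eps n) x * g x \<partial>LS s) = (\<integral>x. ?f n x * g x + (\<i> * (Pn (eps n) x * g x) - \<i> * (of_real pi * (u x * g x))) \<partial>LS s)"
      unfolding QPn(3)[OF eps_pos] by (intro lebesgue_integral_cong) (auto simp: algebra_simps)
    also have "\<dots> = (\<integral>x. ?f n x * g x \<partial>LS s) + (\<integral>x. \<i> * (Pn (eps n) x * g x) - \<i> * (of_real pi * (u x * g x)) \<partial>LS s)"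
      by (intro Bochner_Integration.integral_add fgi Bochner_Integration.integrable_diff integrable_mult_right bnd[OF Pi] ug)
    also have "(\<integral>x. \<i> * (Pn (eps n) x * g x) - \<i> * (of_real pi * (u x * g x)) \<partial>LS s) = (\<integral>x. \<i> * (Pn (eps n) x * g x) \<partial>LS s) - (\<integral>x. \<i> * (of_real pi * (u x * g x)) \<partial>LS s)"
      by (intro Bochner_Integration.integral_diff integrable_mult_right bnd[OF Pi] ug)
    finally show ?thesis by (simp only: integral_mult_right_zero)
  qed
  then show ?thesis using tendsto_add[OF L1 L2] by simp
qed

lemma E_limit: "(\<lambda>n. E (eps n / 2)) \<longlonglongrightarrow> 0"
proof -
  have um': "(\<lambda>x. cnj (u x)) \<in> borel_measurable (LS s)"
    by (rule measurable_compose[OF um borel_measurable_continuous_onI]) (intro continuous_intros)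
  have e0: "eps n \<noteq> 0" for n using eps_pos[of n] by simp
  have "(\<lambda>n. \<integral>x. \<Phi> (eps n) x * cnj (u x) \<partial>LS s) \<longlonglongrightarrow> 0"
  proof (rule weak_limit_dense[OF \<Phi>_measurable_LS um' \<Phi>_LS_integrable[OF e0] _ _ \<Phi>_weak_limit])
    show "(\<integral>x. (norm (\<Phi> (eps n) x))\<^sup>2 \<partial>LS s) \<le> 4 * pi\<^sup>2 * q" for n
      using \<Phi>_LS_le[OF e0] E_bound[OF eps_pos] by (rule order_trans)
    show "integrable (LS s) (\<lambda>x. (norm (cnj (u x)))\<^sup>2)" using u2 by simp
  qed
  from tendsto_mult[OF tendsto_const[of "- (2 * of_real pi * \<i>)"] this]
  have "(\<lambda>n. complex_of_real (E (eps n / 2))) \<longlonglongrightarrow> 0" using E_eq[of "eps n / 2" for n] eps_pos by simp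
  then show ?thesis by (simp add: tendsto_of_real_iff[where c=0, simplified])
qed

text \<open>By the Cauchy formula the value at distance \<open>d\<close> is an integral over a line close to the real axis, where the energy is arbitrarily small.\<close>
lemma \<Phi>_zero:
  assumes d: "d > 0" shows "\<Phi> d x = 0"
proof -
  define C where "C = 2 + (1 + 2 * (\<bar>x\<bar> + d)\<^sup>2) / (d/2)\<^sup>2"
  have C0: "C > 0" unfolding C_def by (intro add_pos_nonneg) auto
  have main: "4 * pi * norm (\<Phi> d x) \<le> E e / l + l * (C * pi)" if e: "e > 0" "e \<le> d / 2" and l: "l > 0" for e l
  proof -
    define b where "b = Complex x (- (d - e))"
    have b: "Im b < 0" using e d by (simp add: b_def)
    note k = \<Phi>_against_kernel[OF e(1) b]
    have kb: "1 / (norm (of_real t - b))\<^sup>2 \<le> C * (1 / (1 + t\<^sup>2))" for t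
    proof -
      have "norm b \<le> \<bar>x\<bar> + d" using cmod_le[of b] e d by (simp add: b_def)
      then have "1 / (norm (of_real t - b))\<^sup>2 \<le> C / (1 + t\<^sup>2)" unfolding C_def using e d by (intro inverse_dist_bound) (auto simp: b_def)
      then show ?thesis by simp
    qed
    have "(\<integral>y. u y * (2 * of_real pi * \<i> / (of_real y + \<i> * of_real e - b)) \<partial>LS s) = (\<integral>y. - (2 * of_real pi * \<i>) * (u y / (cden d x y)) \<partial>LS s)"
    proof (intro lebesgue_integral_cong refl)
      fix y
      have "of_real y + \<i> * of_real e - b = - (cden d x y)" by (simp add: b_def complex_eq_iff)
      then show "u y * (2 * of_real pi * \<i> / (of_real y + \<i> * of_real e - b)) = - (2 * of_real pi * \<i>) * (u y / (cden d x y))"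
        by (simp only: divide_minus_right mult_minus_right mult_minus_left) (simp add: mult_ac)
    qed
    also have "\<dots> = - (2 * of_real pi * \<i>) * \<Phi> d x" unfolding \<Phi>_def by (rule integral_mult_right_zero)
    finally have eq: "(\<integral>t. \<Phi> e t / (of_real t - b) \<partial>lborel) = - (2 * of_real pi * \<i>) * \<Phi> d x" using k(1) by simp
    have "2 * pi * norm (\<Phi> d x) = norm (\<integral>t. \<Phi> e t / (of_real t - b) \<partial>lborel)" unfolding eq by (simp add: norm_mult)
    also have "\<dots> \<le> (\<integral>t. norm (\<Phi> e t / (of_real t - b)) \<partial>lborel)" by (rule integral_norm_bound)
    also have "\<dots> \<le> (\<integral>t. (1 / (2 * l)) * (norm (\<Phi> e t))\<^sup>2 + (l / 2) * (C * (1 / (1 + t\<^sup>2))) \<partial>lborel)"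
    proof (rule integral_mono')
      show "integrable lborel (\<lambda>t. (1 / (2 * l)) * (norm (\<Phi> e t))\<^sup>2 + (l / 2) * (C * (1 / (1 + t\<^sup>2))))"
        using \<Phi>_sq_integrable[of e] e by (intro Bochner_Integration.integrable_add integrable_mult_right integrable_inverse_square) auto
      fix t
      let ?k = "1 / norm (of_real t - b)"
      have "0 \<le> (1 / (2 * l)) * (norm (\<Phi> e t) - l * ?k)\<^sup>2" using l by simp
      also have "\<dots> = (1 / (2 * l)) * (norm (\<Phi> e t))\<^sup>2 + (l / 2) * ?k\<^sup>2 - norm (\<Phi> e t) * ?k"
        using l by (simp add: power2_diff power_mult_distrib field_simps) (simp add: power2_eq_square)
      finally have "norm (\<Phi> e t) * ?k \<le> (1 / (2 * l)) * (norm (\<Phi> e t))\<^sup>2 + (l / 2) * ?k\<^sup>2" by simp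
      also have "\<dots> \<le> (1 / (2 * l)) * (norm (\<Phi> e t))\<^sup>2 + (l / 2) * (C * (1 / (1 + t\<^sup>2)))"
        using kb[of t] l by (intro add_left_mono mult_left_mono) (auto simp: power_divide)
      finally show "norm (\<Phi> e t / (of_real t - b)) \<le> (1 / (2 * l)) * (norm (\<Phi> e t))\<^sup>2 + (l / 2) * (C * (1 / (1 + t\<^sup>2)))"
        by (simp add: norm_divide)
      show "0 \<le> (1 / (2 * l)) * (norm (\<Phi> e t))\<^sup>2 + (l / 2) * (C * (1 / (1 + t\<^sup>2)))"
        using l C0 by (intro add_nonneg_nonneg mult_nonneg_nonneg) auto
    qed
    also have "\<dots> = (1 / (2 * l)) * E e + (l / 2) * (C * pi)"
    proof -
      have "(\<integral>t. (1 / (2 * l)) * (norm (\<Phi> e t))\<^sup>2 + (l / 2) * (C * (1 / (1 + t\<^sup>2))) \<partial>lborel) = (\<integral>t. (1 / (2 * l)) * (norm (\<Phi> e t))\<^sup>2 \<partial>lborel) + (\<integral>t. (l / 2) * (C * (1 / (1 + t\<^sup>2))) \<partial>lborel)"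
        using \<Phi>_sq_integrable[of e] e by (intro Bochner_Integration.integral_add integrable_mult_right integrable_inverse_square) auto
      then show ?thesis unfolding E_def by (simp only: integral_mult_right_zero integrable_inverse_square(2))
    qed
    finally show ?thesis using l by (simp add: field_simps)
  qed
  have lim: "4 * pi * norm (\<Phi> d x) \<le> l * (C * pi)" if l: "l > 0" for l
  proof -
    have "(\<lambda>n. E (eps n / 2) / l + l * (C * pi)) \<longlonglongrightarrow> 0 / l + l * (C * pi)" using l by (intro tendsto_intros E_limit) auto
    moreover have "\<forall>\<^sub>F n in sequentially. eps n < d" using eps_lim d by (rule order_tendstoD)
    then have "\<forall>\<^sub>F n in sequentially. 4 * pi * norm (\<Phi> d x) \<le> E (eps n / 2) / l + l * (C * pi)"
      by eventually_elim (rule main, use eps_pos l in auto)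
    ultimately have "4 * pi * norm (\<Phi> d x) \<le> 0 / l + l * (C * pi)" by (rule tendsto_lowerbound) simp
    then show ?thesis by simp
  qed
  have "4 * pi * norm (\<Phi> d x) \<le> 0"
  proof (rule field_le_epsilon)
    fix r :: real assume r: "r > 0"
    then show "4 * pi * norm (\<Phi> d x) \<le> 0 + r" using lim[of "r / (C * pi)"] C0 by simp
  qed
  then have "pi * norm (\<Phi> d x) \<le> 0" by simp
  then have "norm (\<Phi> d x) \<le> 0" using pi_gt_zero unfolding mult_le_0_iff by linarith
  then show ?thesis by simp
qed

lemma upow_integrable: "integrable (LS s) (\<lambda>y. u y * of_real y ^ k)"
proof (rule integrable_dominated[of _ "\<lambda>y. norm (u y) * s ^ k"])
  show "AE y in LS s. norm (u y * of_real y ^ k) \<le> norm (norm (u y) * s ^ k)"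
  proof (rule AE_I2)
    fix y assume "y \<in> space (LS s)"
    then have "norm (u y) * \<bar>y\<bar> ^ k \<le> norm (u y) * s ^ k" by (intro mult_left_mono power_mono) (auto simp: space_M)
    then show "norm (u y * of_real y ^ k) \<le> norm (norm (u y) * s ^ k)" using s by (simp add: norm_mult norm_power)
  qed
  show "(\<lambda>y. u y * of_real y ^ k) \<in> borel_measurable (LS s)" by measurable
qed (use ui in auto)

text \<open>The moments are the coefficients of the expansion at infinity of the Cauchy transform, which vanishes along the negative imaginary axis; they are peeled off one after the other.\<close>
lemma moments_zero: "(\<integral>y. u y * of_real y ^ k \<partial>LS s) = 0"
proof -
  let ?J = "\<lambda>k d. \<integral>y. u y * of_real y ^ k / (cden d 0 y) \<partial>LS s"
  let ?m = "\<lambda>k. \<integral>y. u y * of_real y ^ k \<partial>LS s"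
  have Ji: "integrable (LS s) (\<lambda>y. u y * of_real y ^ k / (cden d 0 y))" 
    and Jb: "norm (?J k d) \<le> (\<integral>y. norm (u y * of_real y ^ k) \<partial>LS s) / d" if d: "d > 0" for k d
  proof -
    have le: "norm (u y * of_real y ^ k / (cden d 0 y)) \<le> norm (u y * of_real y ^ k) * (1 / d)" for y
    proof -
      have "norm (u y * of_real y ^ k) * (1 / norm (cden d 0 y)) \<le> norm (u y * of_real y ^ k) * (1 / \<bar>d\<bar>)"
        using d by (intro mult_left_mono kernel_bound) auto
      then show ?thesis using d by (simp add: norm_divide)
    qed
    have i: "integrable (LS s) (\<lambda>y. norm (u y * of_real y ^ k) * (1 / d))" by (intro integrable_mult_left integrable_norm upow_integrable)
    show i2: "integrable (LS s) (\<lambda>y. u y * of_real y ^ k / (cden d 0 y))"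
    proof (rule integrable_dominated[OF i])
      show "AE y in LS s. norm (u y * of_real y ^ k / (cden d 0 y)) \<le> norm (norm (u y * of_real y ^ k) * (1 / d))"
        unfolding real_norm_def by (intro AE_I2 order_trans[OF le abs_ge_self])
    qed measurable
    have "norm (?J k d) \<le> (\<integral>y. norm (u y * of_real y ^ k / (cden d 0 y)) \<partial>LS s)" by (rule integral_norm_bound)
    also have "\<dots> \<le> (\<integral>y. norm (u y * of_real y ^ k) * (1 / d) \<partial>LS s)" by (rule integral_mono[OF integrable_norm[OF i2] i le])
    also have "\<dots> = (\<integral>y. norm (u y * of_real y ^ k) \<partial>LS s) * (1 / d)" by (rule integral_mult_left_zero)
    finally show "norm (?J k d) \<le> (\<integral>y. norm (u y * of_real y ^ k) \<partial>LS s) / d" by simp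
  qed
  have rec: "?J (Suc k) d = of_real 0 * ?J k d - \<i> * of_real d * ?J k d - ?m k" if d: "d > 0" for k d
  proof -
    have "u y * of_real y ^ Suc k / (cden d 0 y) = (- (\<i> * of_real d)) * (u y * of_real y ^ k / (cden d 0 y)) - u y * of_real y ^ k" for y
    proof -
      define z where "z = cden d 0 y"
      have z: "z \<noteq> 0" using d by (auto simp: z_def complex_eq_iff)
      have y: "of_real y = - (\<i> * of_real d) - z" by (simp add: z_def)
      have "u y * of_real y ^ Suc k / z = (u y * of_real y ^ k) * of_real y / z" by (simp add: mult_ac)
      also have "\<dots> = (u y * of_real y ^ k) * (- (\<i> * of_real d) - z) / z" by (subst (2) y) (rule refl)
      also have "\<dots> = (- (\<i> * of_real d)) * (u y * of_real y ^ k / z) - u y * of_real y ^ k"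
        using z by (simp add: field_simps)
      finally show ?thesis unfolding z_def .
    qed
    then have "?J (Suc k) d = (\<integral>y. (- (\<i> * of_real d)) * (u y * of_real y ^ k / (cden d 0 y)) - u y * of_real y ^ k \<partial>LS s)" by simp
    also have "\<dots> = (\<integral>y. (- (\<i> * of_real d)) * (u y * of_real y ^ k / (cden d 0 y)) \<partial>LS s) - ?m k"
      by (intro Bochner_Integration.integral_diff integrable_mult_right Ji d upow_integrable)
    finally show ?thesis by (simp only: integral_mult_right_zero) simp
  qed
  have m0: "?m k = 0" if J0: "\<And>d. d > 0 \<Longrightarrow> ?J k d = 0" for k
  proof -
    let ?W = "\<integral>y. norm (u y * of_real y ^ Suc k) \<partial>LS s"
    have "norm (?m k) \<le> ?W / d" if d: "d > 0" for d
      using Jb[OF d, of "Suc k"] rec[OF d, of k] J0[OF d] by simp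
    note W = this
    have "norm (?m k) \<le> 0"
    proof (rule field_le_epsilon)
      fix r :: real assume r: "r > 0"
      have W0: "?W \<ge> 0" by simp
      have gen: "w / ((w + 1) / r) \<le> r" "(w + 1) / r > 0" if "w \<ge> 0" for w
        using r that by (auto simp: divide_simps mult_left_mono)
      have "?W / ((?W + 1) / r) \<le> r" by (rule gen(1)[OF W0])
      moreover have "(?W + 1) / r > 0" by (rule gen(2)[OF W0])
      ultimately show "norm (?m k) \<le> 0 + r" using W[of "(?W + 1) / r"] by simp
    qed
    then show ?thesis by simp
  qed
  have J0: "\<forall>d>0. ?J k d = 0"
  proof (induction k)
    case 0 then show ?case using \<Phi>_zero[of _ 0] unfolding \<Phi>_def by simp
  next
    case (Suc k)
    then have J: "\<And>d. d > 0 \<Longrightarrow> ?J k d = 0" by blast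
    show ?case
    proof (intro allI impI)
      fix d :: real assume d: "d > 0"
      have "?m k = 0" by (rule m0, rule J)
      then show "?J (Suc k) d = 0" unfolding rec[OF d] J[OF d] by simp
    qed
  qed
  show ?thesis by (rule m0) (use J0 in blast)
qed

lemma u_zero: "AE x in LS s. u x = 0"
proof -
  have um': "(\<lambda>x. cnj (u x)) \<in> borel_measurable (LS s)"
    by (rule measurable_compose[OF um borel_measurable_continuous_onI]) (intro continuous_intros)
  have u2': "integrable (LS s) (\<lambda>x. (norm (cnj (u x)))\<^sup>2)" using u2 by simp
  have "q \<le> \<eta>" if \<eta>: "\<eta> > 0" for \<eta>
  proof -
    obtain n c where p: "integrable (LS s) (\<lambda>x. (norm (cnj (u x) - (\<Sum>i\<le>n. c i * of_real x ^ i)))\<^sup>2)"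
     "(\<integral>x. (norm (cnj (u x) - (\<Sum>i\<le>n. c i * of_real x ^ i)))\<^sup>2 \<partial>LS s) < \<eta>"
      using polynomial_dense_L2[OF um' u2' \<eta>] by blast
    define P where "P x = (\<Sum>i\<le>n. c i * of_real x ^ i)" for x :: real
    have uP: "u x * P x = (\<Sum>i\<le>n. c i * (u x * of_real x ^ i))" for x unfolding P_def by (simp add: sum_distrib_left mult_ac)
    have iuP: "integrable (LS s) (\<lambda>x. u x * P x)" unfolding uP by (intro Bochner_Integration.integrable_sum integrable_mult_right upow_integrable)
    have "(\<integral>x. u x * P x \<partial>LS s) = (\<Sum>i\<le>n. \<integral>x. c i * (u x * of_real x ^ i) \<partial>LS s)"
      unfolding uP by (intro Bochner_Integration.integral_sum integrable_mult_right upow_integrable)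
    also have "\<dots> = 0" by (simp only: integral_mult_right_zero moments_zero mult_zero_right sum.neutral_const)
    finally have z: "(\<integral>x. u x * P x \<partial>LS s) = 0" .
    have uu: "u x * cnj (u x) = of_real ((norm (u x))\<^sup>2)" for x by (simp only: complex_norm_square)
    have iuu: "integrable (LS s) (\<lambda>x. u x * cnj (u x))" unfolding uu by (intro integrable_of_real u2)
    have "complex_of_real q = (\<integral>x. u x * cnj (u x) \<partial>LS s)" unfolding uu q_def by (rule integral_complex_of_real[symmetric])
    also have "\<dots> = (\<integral>x. u x * cnj (u x) \<partial>LS s) - (\<integral>x. u x * P x \<partial>LS s)" unfolding z by simp
    also have "\<dots> = (\<integral>x. u x * cnj (u x) - u x * P x \<partial>LS s)" by (rule Bochner_Integration.integral_diff[OF iuu iuP, symmetric])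
    finally have qe: "complex_of_real q = (\<integral>x. u x * cnj (u x) - u x * P x \<partial>LS s)" .
    have "q = norm (complex_of_real q)" unfolding norm_of_real using q0 by (rule abs_of_nonneg[symmetric])
    then have "q \<le> (\<integral>x. norm (u x * cnj (u x) - u x * P x) \<partial>LS s)" unfolding qe using integral_norm_bound[of "LS s" "\<lambda>x. u x * cnj (u x) - u x * P x"] by (simp only:)
    also have "\<dots> \<le> (\<integral>x. (1/2) * (norm (u x))\<^sup>2 + (1/2) * (norm (cnj (u x) - P x))\<^sup>2 \<partial>LS s)"
    proof (rule integral_mono')
      show "integrable (LS s) (\<lambda>x. (1/2) * (norm (u x))\<^sup>2 + (1/2) * (norm (cnj (u x) - P x))\<^sup>2)"
        by (intro Bochner_Integration.integrable_add integrable_mult_right u2 p(1)[folded P_def])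
      fix x
      have "0 \<le> (norm (u x) - norm (cnj (u x) - P x))\<^sup>2" by simp
      then have "norm (u x) * norm (cnj (u x) - P x) \<le> (1/2) * (norm (u x))\<^sup>2 + (1/2) * (norm (cnj (u x) - P x))\<^sup>2"
        unfolding power2_diff by linarith
      then show "norm (u x * cnj (u x) - u x * P x) \<le> (1/2) * (norm (u x))\<^sup>2 + (1/2) * (norm (cnj (u x) - P x))\<^sup>2"
        by (simp only: right_diff_distrib[symmetric] norm_mult)
    qed auto
    also have "\<dots> = (1/2) * q + (1/2) * (\<integral>x. (norm (cnj (u x) - P x))\<^sup>2 \<partial>LS s)"
      unfolding q_def using u2 p(1)[folded P_def] by simp
    also have "\<dots> \<le> (1/2) * q + (1/2) * \<eta>" using p(2)[folded P_def] by simp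
    finally show ?thesis by simp
  qed
  then have "q \<le> 0" by - (rule field_le_epsilon, simp)
  then have "q = 0" using q0 by simp
  then have "AE x in LS s. (norm (u x))\<^sup>2 = 0"
    unfolding q_def using integral_nonneg_eq_0_iff_AE[OF u2] by simp
  then show ?thesis by simp
qed

end

lemma has_finite_hilbert_diff:
  assumes u: "integrable (LS s) u" and v: "integrable (LS s) v" and "has_finite_hilbert s u x h" "has_finite_hilbert s v x k"
  shows "has_finite_hilbert s (\<lambda>y. u y - v y) x (h - k)"
proof -
  have i: "integrable (LS s) (\<lambda>y. if e < \<bar>x - y\<bar> then w y / of_real (x - y) else 0)" if e: "e > 0" and w: "integrable (LS s) w" for e and w :: "real \<Rightarrow> complex"
  proof (rule integrable_dominated[of _ "\<lambda>y. norm (w y) * (1 / e)"])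
    have [measurable]: "w \<in> borel_measurable (LS s)" using w by auto
    show "(\<lambda>y. if e < \<bar>x - y\<bar> then w y / of_real (x - y) else 0) \<in> borel_measurable (LS s)" by measurable
    show "AE y in LS s. norm (if e < \<bar>x - y\<bar> then w y / of_real (x - y) else 0) \<le> norm (norm (w y) * (1 / e))"
      using e by (intro AE_I2) (auto simp: norm_divide abs_mult simp del: of_real_diff intro!: divide_left_mono mult_pos_pos)
  qed (use w in auto)
  have eq: "truncated_hilbert s (\<lambda>y. u y - v y) x e = truncated_hilbert s u x e - truncated_hilbert s v x e" if e: "e > 0" for e
  proof -
    have "(\<integral>y. (if e < \<bar>x - y\<bar> then (u y - v y) / of_real (x - y) else 0) \<partial>LS s) = (\<integral>y. (if e < \<bar>x - y\<bar> then u y / of_real (x - y) else 0) - (if e < \<bar>x - y\<bar> then v y / of_real (x - y) else 0) \<partial>LS s)"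
      by (intro lebesgue_integral_cong) (auto simp: diff_divide_distrib)
    also have "\<dots> = (\<integral>y. (if e < \<bar>x - y\<bar> then u y / of_real (x - y) else 0) \<partial>LS s) - (\<integral>y. (if e < \<bar>x - y\<bar> then v y / of_real (x - y) else 0) \<partial>LS s)"
      by (intro Bochner_Integration.integral_diff i e u v)
    finally show ?thesis unfolding truncated_hilbert_LS by (simp only: right_diff_distrib)
  qed
  have "((\<lambda>e. truncated_hilbert s u x e - truncated_hilbert s v x e) \<longlongrightarrow> h - k) (at_right 0)"
    using assms(3,4) unfolding has_finite_hilbert_def by (intro tendsto_diff)
  then show ?thesis unfolding has_finite_hilbert_def
  proof (rule Lim_transform_eventually)
    show "\<forall>\<^sub>F e in at_right 0. truncated_hilbert s u x e - truncated_hilbert s v x e = truncated_hilbert s (\<lambda>y. u y - v y) x e"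
      by (rule eventually_mono[OF eventually_at_right_less]) (rule eq[symmetric])
  qed
qed

text \<open>The difference of two solutions satisfies the homogeneous equation.\<close>
lemma hilbert_equation_unique:
  assumes s: "s > 0" and u: "in_L2 s u" and w: "in_L2 s w"
    and eu: "\<And>x. x \<in> {-s<..<s} \<Longrightarrow> hilbert_equation_at s u F x"
    and ew: "AE x in LS s. hilbert_equation_at s w F x"
  shows "AE x in LS s. w x = u x"
proof -
  have m: "u \<in> borel_measurable (LS s)" "w \<in> borel_measurable (LS s)"
    and i2: "integrable (LS s) (\<lambda>x. (norm (u x))\<^sup>2)" "integrable (LS s) (\<lambda>x. (norm (w x))\<^sup>2)"
    using u w unfolding in_L2_def by auto
  have i: "integrable (LS s) u" "integrable (LS s) w" 
    by (rule square_integrable_imp_integrable[OF m(1) i2(1)], rule square_integrable_imp_integrable[OF m(2) i2(2)])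
  have dm: "(\<lambda>x. w x - u x) \<in> borel_measurable (LS s)" using m by measurable
  have d2: "integrable (LS s) (\<lambda>x. (norm (w x - u x))\<^sup>2)"
  proof (rule integrable_dominated[of _ "\<lambda>x. 2 * (norm (w x))\<^sup>2 + 2 * (norm (u x))\<^sup>2"])
    show "(\<lambda>x. (norm (w x - u x))\<^sup>2) \<in> borel_measurable (LS s)" using dm by measurable
    show "AE x in LS s. norm ((norm (w x - u x))\<^sup>2) \<le> norm (2 * (norm (w x))\<^sup>2 + 2 * (norm (u x))\<^sup>2)"
    proof (rule AE_I2)
      fix x show "norm ((norm (w x - u x))\<^sup>2) \<le> norm (2 * (norm (w x))\<^sup>2 + 2 * (norm (u x))\<^sup>2)"
        using square_norm_add_le[of "w x" "- u x"] by simp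
    qed
  qed (use i2 in auto)
  have hom: "AE x in LS s. hilbert_equation_at s (\<lambda>x. w x - u x) (\<lambda>_. 0) x"
  proof (rule AE_mp[OF ew], rule AE_I2, rule impI)
    fix x assume sp: "x \<in> space (LS s)" and "hilbert_equation_at s w F x"
    then obtain h where h: "has_finite_hilbert s w x h" "w x - \<i> * h = F x" unfolding hilbert_equation_at_def by auto
    have "x \<in> {-s<..<s}" using sp by (simp add: space_restrict_space)
    then obtain k where k: "has_finite_hilbert s u x k" "u x - \<i> * k = F x" using eu unfolding hilbert_equation_at_def by blast
    have hd: "has_finite_hilbert s (\<lambda>x. w x - u x) x (h - k)"
      by (rule has_finite_hilbert_diff[OF i(2) i(1) h(1) k(1)])
    have "(w x - u x) - \<i> * (h - k) = (w x - \<i> * h) - (u x - \<i> * k)" by (simp add: algebra_simps)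
    then have "(w x - u x) - \<i> * (h - k) = 0" unfolding h(2) k(2) by simp
    with hd show "hilbert_equation_at s (\<lambda>x. w x - u x) (\<lambda>_. 0) x" unfolding hilbert_equation_at_def by blast
  qed
  have hh: "hilbert_homogeneous s (\<lambda>x. w x - u x)"
    by (rule hilbert_homogeneous.intro[OF cauchy_L2.intro[OF s dm d2] hilbert_homogeneous_axioms.intro[OF hom]])
  have "AE x in LS s. w x - u x = 0" by (rule hilbert_homogeneous.u_zero[OF hh])
  then show ?thesis by (simp only: right_minus_eq)
qed

section \<open>Geometry of the arc\<close>

lemma contour_integral_eq_integral_within:
  "contour_integral g f = integral {0..1} (\<lambda>t. f (g t) * vector_derivative g (at t within {0..1}))"
proof (cases "f contour_integrable_on g")
  case True
  then show ?thesis
    using contour_integral_unique[of f _ g] unfolding contour_integrable_on_def has_contour_integral_def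
    by (metis has_integral_iff)
next
  case False
  then show ?thesis unfolding not_integrable_contour_integral[OF False]
    by (simp add: contour_integrable_on_def has_contour_integral_def not_integrable_integral integrable_on_def)
qed

lemma contour_integral_cnj_eq: "contour_integral_cnj g h = cnj (contour_integral g (\<lambda>z. cnj (h z)))"
  unfolding contour_integral_cnj_def contour_integral_eq_integral_within Henstock_Kurzweil_Integration.integral_cnj by simp

lemma has_contour_integral_pint:
  assumes c: "continuous_on {0..1} D"
    and d: "\<And>t. t \<in> {0..1} \<Longrightarrow> (g has_vector_derivative D t) (at t within {0..1})"
    and f: "continuous_on (g ` {0..1}) f"
  shows "(f has_contour_integral pint g D f) g"
proof -
  have cg: "continuous_on {0..1} g" by (rule continuous_on_vector_derivative[OF d])
  have "continuous_on {0..1} (\<lambda>t. f (g t) * D t)" by (intro continuous_on_mult c continuous_on_compose2[OF f cg]) auto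
  then have "(\<lambda>t. f (g t) * D t) integrable_on {0..1}" by (rule integrable_continuous_real)
  then have "((\<lambda>t. f (g t) * D t) has_integral pint g D f) {0..1}" unfolding pint_eq_integral[OF cg c f] by (rule integrable_integral)
  then show ?thesis unfolding has_contour_integral_def
  proof (rule has_integral_eq[rotated])
    fix t :: real assume t: "t \<in> {0..1}"
    have "vector_derivative g (at t within {0..1}) = D t"
      using vector_derivative_within_cbox[of 0 1 t g "D t"] d[OF t] t by simp
    then show "f (g t) * D t = f (g t) * vector_derivative g (at t within {0..1})" by simp
  qed
qed

lemma valid_path_C1:
  assumes c: "continuous_on {0..1} D"
    and d: "\<And>t. t \<in> {0..1} \<Longrightarrow> (g has_vector_derivative D t) (at t within {0..1})"
  shows "valid_path g"
proof -
  have cg: "continuous_on {0..1} g" by (rule continuous_on_vector_derivative[OF d])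
  have "(g has_vector_derivative D t) (at t)" if "t \<in> {0..1} - {0,1}" for t
    using d[of t] that by (simp add: at_within_Icc_at)
  then have "g C1_differentiable_on ({0..1} - {0,1})"
    unfolding C1_differentiable_on_def using c by (meson Diff_subset continuous_on_subset)
  then show ?thesis unfolding valid_path_def piecewise_C1_differentiable_on_def using cg by (auto intro!: exI[of _ "{0,1}"])
qed

lemma C1_segment:
  "continuous_on {0..1} (\<lambda>_::real. complex_of_real (2 * s))"
  "(linepath (- of_real s) (of_real s) has_vector_derivative complex_of_real (2 * s)) (at t within {0..1})"
  "linepath (- of_real s) (of_real s) = seg s"
proof -
  show "linepath (- of_real s) (of_real s) = seg s"
    by (rule ext) (simp add: linepath_def seg_def scaleR_conv_of_real algebra_simps)
  show "(linepath (- of_real s) (of_real s) has_vector_derivative complex_of_real (2 * s)) (at t within {0..1})"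
    using has_vector_derivative_linepath_within[of "- complex_of_real s" "of_real s" t "{0..1}"] by simp
qed auto

text \<open>\<open>D\<close> is the derivative of the arc.\<close>
locale convex_arc =
  fixes \<Omega> \<Omega>p :: "complex set" and \<gamma> \<Gamma> D :: "real \<Rightarrow> complex" and s :: real
  assumes bdd: "bounded \<Omega>" and scd: "strictly_convex_domain \<Omega>"
    and arc: "arc \<gamma>" and D_cont: "continuous_on {0..1} D"
    and D_deriv: "\<And>t. t \<in> {0..1} \<Longrightarrow> (\<gamma> has_vector_derivative D t) (at t within {0..1})"
    and front: "path_image \<gamma> \<subseteq> frontier \<Omega>"
    and s: "s > 0" "pathstart \<gamma> = of_real s" "pathfinish \<gamma> = - of_real s"
    and upper: "\<And>t. t \<in> {0<..<1} \<Longrightarrow> Im (\<gamma> t) > 0"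
    and \<Omega>p: "\<Omega>p = interior (convex hull (path_image \<gamma>))"
    and \<Gamma>: "\<Gamma> = linepath (- of_real s) (of_real s) +++ \<gamma>"
begin

abbreviation "C \<equiv> convex hull (path_image \<gamma>)"

lemma \<Omega>_facts: "open \<Omega>" "convex \<Omega>"
  and \<Omega>_seg: "x \<in> closure \<Omega> \<Longrightarrow> y \<in> closure \<Omega> \<Longrightarrow> x \<noteq> y \<Longrightarrow> open_segment x y \<subseteq> \<Omega>"
  using scd unfolding strictly_convex_domain_def by auto

lemma \<gamma>_cont: "continuous_on {0..1} \<gamma>" using arc by (auto simp: arc_def path_def)

lemma ends: "\<gamma> 0 = of_real s" "\<gamma> 1 = - of_real s" using s by (auto simp: pathstart_def pathfinish_def)

lemma Im_\<gamma>: "t \<in> {0..1} \<Longrightarrow> Im (\<gamma> t) \<ge> 0"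
  using upper[of t] ends by (cases "t = 0 \<or> t = 1") auto

lemma Im_\<gamma>_zero: "t \<in> {0..1} \<Longrightarrow> Im (\<gamma> t) = 0 \<Longrightarrow> \<gamma> t = of_real s \<or> \<gamma> t = - of_real s"
  using upper[of t] ends by (cases "t = 0 \<or> t = 1") auto

lemma end_in: "of_real s \<in> path_image \<gamma>" "- of_real s \<in> path_image \<gamma>"
  using s by (metis pathstart_in_path_image, metis pathfinish_in_path_image)

lemma C_facts: "convex C" "compact C" "C \<subseteq> closure \<Omega>" "C \<subseteq> {z. Im z \<ge> 0}"
proof -
  show "compact C" using arc by (intro compact_convex_hull compact_path_image arc_imp_path)
  show "C \<subseteq> closure \<Omega>" using front \<Omega>_facts
    by (intro hull_minimal) (auto simp: frontier_def convex_closure)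
  show "C \<subseteq> {z. Im z \<ge> 0}"
    by (intro hull_minimal) (auto simp: path_image_def Im_\<gamma> convex_halfspace_Im_ge)
qed (rule convex_convex_hull)

lemma \<Omega>p_open: "open \<Omega>p" and \<Omega>p_bounded: "bounded \<Omega>p" and \<Omega>p_convex: "convex \<Omega>p"
  using C_facts unfolding \<Omega>p by (auto intro: bounded_subset[OF compact_imp_bounded interior_subset] convex_interior)

lemma \<Omega>p_subset: "\<Omega>p \<subseteq> \<Omega>"
proof -
  have "\<Omega>p \<subseteq> interior (closure \<Omega>)" unfolding \<Omega>p using C_facts(3) by (rule interior_mono)
  also have "\<dots> = \<Omega>" using \<Omega>_facts by (simp add: convex_interior_closure interior_open)
  finally show ?thesis .
qed

lemma \<Omega>p_upper: "z \<in> \<Omega>p \<Longrightarrow> Im z > 0"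
proof -
  assume "z \<in> \<Omega>p"
  then have "z \<in> interior {z. \<i> \<bullet> z \<ge> 0}" unfolding \<Omega>p using C_facts(4) interior_mono[of C "{z. \<i> \<bullet> z \<ge> 0}"] by (auto simp: inner_complex_def)
  moreover have "interior {z. \<i> \<bullet> z \<ge> 0} = {z. \<i> \<bullet> z > 0}" by (rule interior_halfspace_ge) simp
  ultimately have "\<i> \<bullet> z > 0" by blast
  then show ?thesis by (simp add: inner_complex_def)
qed

lemma \<Omega>p_\<gamma>: "z \<in> \<Omega>p \<Longrightarrow> z \<notin> \<gamma> ` {0..1}"
  using \<Omega>p_subset front \<Omega>_facts by (auto simp: frontier_def interior_open path_image_def)

lemma \<Omega>p_seg: "z \<in> \<Omega>p \<Longrightarrow> z \<notin> seg s ` {0..1}"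
  using \<Omega>p_upper[of z] by (auto simp: seg_def)

lemma chord: "x \<in> {-s<..<s} \<Longrightarrow> of_real x \<in> \<Omega>" "x \<in> {-s..s} \<Longrightarrow> of_real x \<in> C"
proof -
  have e: "(of_real s :: complex) \<in> closure \<Omega>" "- of_real s \<in> closure \<Omega>" using front end_in by (auto simp: frontier_def)
  assume x: "x \<in> {-s<..<s}"
  have "of_real x \<in> open_segment (- complex_of_real s) (of_real s)"
    unfolding in_segment using x s
    by (auto intro!: exI[of _ "(x + s) / (2 * s)"] simp: scaleR_conv_of_real complex_eq_iff field_simps)
  then show "of_real x \<in> \<Omega>" using \<Omega>_seg[OF e(2,1)] s by (auto simp: complex_eq_iff)
next
  assume x: "x \<in> {-s..s}"
  have "of_real x \<in> closed_segment (- complex_of_real s) (of_real s)"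
    unfolding in_segment using x s
    by (auto intro!: exI[of _ "(x + s) / (2 * s)"] simp: scaleR_conv_of_real complex_eq_iff field_simps)
  moreover have "closed_segment (- complex_of_real s) (of_real s) \<subseteq> C"
    using end_in by (intro closed_segment_subset convex_convex_hull) (auto intro: hull_inc)
  ultimately show "of_real x \<in> C" by blast
qed

lemma chord_\<gamma>: "x \<in> {-s<..<s} \<Longrightarrow> of_real x \<notin> \<gamma> ` {0..1}"
  using chord(1)[of x] front \<Omega>_facts by (auto simp: frontier_def interior_open path_image_def)

lemma \<Gamma>_facts: "valid_path \<gamma>" "valid_path \<Gamma>" "simple_path \<Gamma>" "pathfinish \<Gamma> = pathstart \<Gamma>"
  "path_image \<Gamma> \<subseteq> C" "path_image \<Gamma> = seg s ` {0..1} \<union> \<gamma> ` {0..1}"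
proof -
  show v: "valid_path \<gamma>" by (rule valid_path_C1[OF D_cont D_deriv])
  show "valid_path \<Gamma>" unfolding \<Gamma> using v s by (intro valid_path_join) auto
  show "pathfinish \<Gamma> = pathstart \<Gamma>" unfolding \<Gamma> using s by simp
  show pi: "path_image \<Gamma> = seg s ` {0..1} \<union> \<gamma> ` {0..1}"
    unfolding \<Gamma> using s by (subst path_image_join) (auto simp: C1_segment(3)[symmetric] path_image_def)
  show "path_image \<Gamma> \<subseteq> C"
  proof -
    have "seg s t \<in> C" if "t \<in> {0..1}" for t
    proof -
      have "2 * s * t \<le> 2 * s * 1" using that s by (intro mult_left_mono) auto
      then show ?thesis unfolding seg_def using that s by (intro chord(2)) auto
    qed
    then show ?thesis unfolding pi by (auto simp: path_image_def intro: hull_inc)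
  qed
  show "simple_path \<Gamma>" unfolding \<Gamma>
  proof (rule simple_path_join_loop)
    show "arc (linepath (- complex_of_real s) (of_real s))" using s by (intro arc_linepath) (auto simp: complex_eq_iff)
    show "path_image (linepath (- complex_of_real s) (of_real s)) \<inter> path_image \<gamma> \<subseteq> {pathstart (linepath (- of_real s) (of_real s)), pathstart \<gamma>}"
    proof (rule subsetI)
      fix z assume z: "z \<in> path_image (linepath (- complex_of_real s) (of_real s)) \<inter> path_image \<gamma>"
      then obtain t where "z = seg s t" unfolding C1_segment(3) by (auto simp: path_image_def)
      then have "Im z = 0" by (simp only: seg_def Im_complex_of_real)
      moreover obtain r where r: "r \<in> {0..1}" "z = \<gamma> r" using z by (auto simp: path_image_def)
      ultimately have "z = of_real s \<or> z = - of_real s" using Im_\<gamma>_zero by blast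
      then show "z \<in> {pathstart (linepath (- of_real s) (of_real s)), pathstart \<gamma>}" using s by auto
    qed
  qed (use arc s in auto)
qed

lemma interior_nonempty: "\<Omega>p \<noteq> {}"
proof
  assume "\<Omega>p = {}"
  then obtain a b where ab: "a \<noteq> 0" "C \<subseteq> {x. a \<bullet> x = b}"
    using empty_interior_subset_hyperplane[OF C_facts(1)] unfolding \<Omega>p by metis
  have i: "a \<bullet> of_real s = b" "a \<bullet> (- of_real s) = b" "a \<bullet> \<gamma> (1/2) = b"
  proof -
    have sub: "a \<bullet> z = b" if "z \<in> path_image \<gamma>" for z using ab(2) hull_inc[OF that, of convex] by blast
    show "a \<bullet> of_real s = b" "a \<bullet> (- of_real s) = b" by (rule sub[OF end_in(1)], rule sub[OF end_in(2)])
    show "a \<bullet> \<gamma> (1/2) = b" by (rule sub) (auto simp: path_image_def)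
  qed
  then have "Re a = 0" using s by (simp add: inner_complex_def)
  then have "Im a * Im (\<gamma> (1/2)) = 0" using i by (simp add: inner_complex_def)
  then have "Im a = 0" using upper[of "1/2"] by simp
  then show False using ab \<open>Re a = 0\<close> by (simp add: complex_eq_iff)
qed

text \<open>Near an inner point of the chord, \<open>\<Omega>p\<close> fills the upper half plane: it is convex and the whole chord lies in its closure.\<close>
lemma chord_density:
  assumes x: "x \<in> {-s<..<s}" and w: "Im w \<noteq> 0"
  shows "\<forall>\<^sub>F n in sequentially. (of_real x + eps n *\<^sub>R w \<in> \<Omega>p) = (w \<in> Hset False)"
proof (cases "Im w > 0")
  case False
  have "of_real x + eps n *\<^sub>R w \<notin> \<Omega>p" for n
  proof
    assume "of_real x + eps n *\<^sub>R w \<in> \<Omega>p"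
    then have "0 < eps n * Im w" using \<Omega>p_upper by force
    then show False using False eps_pos[of n] by (simp add: zero_less_mult_iff)
  qed
  then show ?thesis using False by (simp add: Hset_def)
next
  case True
  obtain c where c: "c \<in> \<Omega>p" using interior_nonempty by auto
  have ic: "Im c > 0" using c by (rule \<Omega>p_upper)
  define l where "l n = eps n * Im w / Im c" for n
  define y where "y n = (x + eps n * Re w - l n * Re c) / (1 - l n)" for n
  have l0: "l \<longlonglongrightarrow> 0"
  proof -
    have "(\<lambda>n. eps n * Im w / Im c) \<longlonglongrightarrow> 0 * Im w / Im c" using ic by (intro tendsto_intros eps_lim) auto
    then show ?thesis unfolding l_def[abs_def] by simp
  qed
  have "y \<longlonglongrightarrow> (x + 0 * Re w - 0 * Re c) / (1 - 0)" unfolding y_def[abs_def] by (intro tendsto_intros eps_lim l0) auto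
  then have "y \<longlonglongrightarrow> x" by simp
  then have "\<forall>\<^sub>F n in sequentially. y n \<in> {-s<..<s}" using x by (auto dest: topological_tendstoD[OF _ open_greaterThanLessThan])
  moreover have "\<forall>\<^sub>F n in sequentially. l n < 1" using l0 by (rule order_tendstoD) simp
  ultimately show ?thesis
  proof eventually_elim
    case (elim n)
    have lp: "l n > 0" using True ic eps_pos[of n] by (simp add: l_def)
    have yC: "of_real (y n) \<in> C" using elim by (intro chord(2)) auto
    have "of_real (y n) - l n *\<^sub>R (of_real (y n) - c) \<in> interior C"
      by (rule mem_interior_convex_shrink[OF C_facts(1)]) (use c yC lp elim in \<open>auto simp: \<Omega>p\<close>)
    moreover have "of_real (y n) - l n *\<^sub>R (of_real (y n) - c) = of_real x + eps n *\<^sub>R w"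
    proof -
      have "y n * (1 - l n) = x + eps n * Re w - l n * Re c" unfolding y_def using elim by simp
      then have "y n - l n * (y n - Re c) = x + eps n * Re w" by (simp add: algebra_simps)
      moreover have "l n * Im c = eps n * Im w" unfolding l_def using ic by simp
      ultimately show ?thesis by (simp add: complex_eq_iff algebra_simps)
    qed
    ultimately show ?case using True unfolding \<Omega>p by (simp add: Hset_def)
  qed
qed

text \<open>The arc stays in the closed upper half plane on its way from \<open>s\<close> to \<open>-s\<close>, so a branch of the logarithm cut along the negative imaginary axis shows that it makes half a turn.\<close>
lemma winding_number_arc_0: "winding_number \<gamma> 0 = 1/2"
proof -
  let ?S = "{w. \<not> (Re w = 0 \<and> Im w \<le> 0)}"
  have z0: "0 \<notin> path_image \<gamma>" using chord_\<gamma>[of 0] s by (auto simp: path_image_def)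
  have pi: "path_image \<gamma> \<subseteq> ?S"
  proof
    fix z assume z: "z \<in> path_image \<gamma>"
    then have "Im z \<ge> 0" using Im_\<gamma> by (auto simp: path_image_def)
    moreover have "Im z \<noteq> 0 \<or> Re z \<noteq> 0" using z z0 by (metis complex_eq_iff zero_complex.simps)
    ultimately show "z \<in> ?S" by auto
  qed
  have "((\<lambda>w. 1 / w) has_contour_integral (Ln (- \<i> * pathfinish \<gamma>) - Ln (- \<i> * pathstart \<gamma>))) \<gamma>"
  proof (rule contour_integral_primitive[OF _ \<Gamma>_facts(1) pi])
    fix w assume w: "w \<in> ?S"
    then have "w \<noteq> 0" by auto
    have "- \<i> * w \<notin> \<real>\<^sub>\<le>\<^sub>0" using w by (auto simp: complex_nonpos_Reals_iff)
    then show "((\<lambda>w. Ln (- \<i> * w)) has_field_derivative 1 / w) (at w within ?S)"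
      using \<open>w \<noteq> 0\<close> by (auto intro!: derivative_eq_intros simp: field_simps)
  qed
  moreover have "Ln (- \<i> * pathfinish \<gamma>) - Ln (- \<i> * pathstart \<gamma>) = \<i> * pi"
  proof -
    have "Ln (of_real s * \<i>) = ln s + \<i> * pi / 2" using Ln_times_of_real[of s \<i>] s Ln_of_real[of s] by simp
    moreover have "Ln (of_real s * (- \<i>)) = ln s - \<i> * pi / 2" using Ln_times_of_real[of s "- \<i>"] s Ln_of_real[of s] by (simp add: Ln_minus_ii)
    ultimately show ?thesis using s(2,3) by (simp add: mult.commute)
  qed
  ultimately have "((\<lambda>w. 1 / w) has_contour_integral \<i> * pi) \<gamma>" by (simp only:)
  then have "contour_integral \<gamma> (\<lambda>w. 1 / w) = \<i> * pi" by (rule contour_integral_unique)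
  then show ?thesis using winding_number_valid_path[OF \<Gamma>_facts(1) z0] by simp
qed

text \<open>The winding number of a simple closed curve is \<open>1\<close> or \<open>-1\<close> inside; the sign is found by crossing the chord at \<open>0\<close>.\<close>
lemma winding_number_interior: assumes z: "z \<in> \<Omega>p" shows "winding_number \<Gamma> z = 1"
proof -
  have dj: "\<Omega>p \<inter> path_image \<Gamma> = {}" unfolding \<Gamma>_facts(6) using \<Omega>p_\<gamma> \<Omega>p_seg by auto
  have pth: "path \<Gamma>" using \<Gamma>_facts(2) by (rule valid_path_imp_path)
  have "winding_number \<Gamma> constant_on \<Omega>p"
    using pth \<Gamma>_facts(4) convex_connected[OF \<Omega>p_convex] dj by (rule winding_number_constant)
  then obtain k where k: "\<And>p. p \<in> \<Omega>p \<Longrightarrow> winding_number \<Gamma> p = k" unfolding constant_on_def by auto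
  have z0: "0 \<notin> path_image \<gamma>" using chord_\<gamma>[of 0] s by (auto simp: path_image_def)
  have "continuous (at 0) (winding_number \<gamma>)" by (rule continuous_at_winding_number[OF arc_imp_path[OF arc] z0])
  moreover have "(\<lambda>n. eps n *\<^sub>R \<i>) \<longlonglongrightarrow> 0 *\<^sub>R \<i>" by (intro tendsto_intros eps_lim)
  ultimately have "(\<lambda>n. winding_number \<gamma> (eps n *\<^sub>R \<i>)) \<longlonglongrightarrow> winding_number \<gamma> 0"
    using isCont_tendsto_compose[of 0 "winding_number \<gamma>" "\<lambda>n. eps n *\<^sub>R \<i>"] by simp
  then have "(\<lambda>n. winding_number \<gamma> (eps n *\<^sub>R \<i>)) \<longlonglongrightarrow> 1/2" unfolding winding_number_arc_0 .
  then have "(\<lambda>n. Re (winding_number \<gamma> (eps n *\<^sub>R \<i>))) \<longlonglongrightarrow> Re (1/2)" by (rule tendsto_Re)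
  then have "\<forall>\<^sub>F n in sequentially. Re (winding_number \<gamma> (eps n *\<^sub>R \<i>)) > 0" by (rule order_tendstoD) simp
  moreover have "\<forall>\<^sub>F n in sequentially. eps n *\<^sub>R \<i> \<in> \<Omega>p"
    using chord_density[of 0 \<i>] s by (simp add: Hset_def)
  ultimately have "\<forall>\<^sub>F n in sequentially. Re (winding_number \<gamma> (eps n *\<^sub>R \<i>)) > 0 \<and> eps n *\<^sub>R \<i> \<in> \<Omega>p" by eventually_elim simp
  then obtain n where n: "Re (winding_number \<gamma> (eps n *\<^sub>R \<i>)) > 0" "eps n *\<^sub>R \<i> \<in> \<Omega>p" by (auto simp: eventually_sequentially)
  let ?p = "eps n *\<^sub>R \<i>"
  have p: "?p \<notin> path_image \<Gamma>" using dj n(2) by auto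
  have "winding_number \<Gamma> ?p = winding_number (linepath (- of_real s) (of_real s)) ?p + winding_number \<gamma> ?p"
    unfolding \<Gamma> using arc s p \<Gamma> by (intro winding_number_join) (auto simp: arc_imp_path path_image_join)
  moreover have "0 < Re (winding_number (linepath (- of_real s) (of_real s)) ?p)"
    by (rule winding_number_linepath_pos_lt) (use s eps_pos[of n] in simp)
  ultimately have "Re (winding_number \<Gamma> ?p) > 0" using n(1) by simp
  moreover have "winding_number \<Gamma> ?p \<in> {-1, 0, 1}"
    by (rule simple_closed_path_winding_number_cases[OF \<Gamma>_facts(3,4) p])
  ultimately have "winding_number \<Gamma> ?p = 1" by auto
  then show ?thesis using k[OF n(2)] k[OF z] by simp
qed

lemma contour_integral_\<Gamma>:
  assumes f: "continuous_on (path_image \<Gamma>) f"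
  shows "contour_integral \<Gamma> f = pint_seg s f + pint \<gamma> D f"
    "contour_integral_cnj \<Gamma> f = pint_seg s f + pint \<gamma> (\<lambda>t. cnj (D t)) f"
proof -
  have m: "contour_integral \<Gamma> h = pint_seg s h + pint \<gamma> D h" if h: "continuous_on (path_image \<Gamma>) h" for h
  proof -
    have h1: "continuous_on (linepath (- of_real s) (of_real s) ` {0..1}) h" "continuous_on (\<gamma> ` {0..1}) h"
      using h unfolding \<Gamma>_facts(6) C1_segment(3) by (auto intro: continuous_on_subset)
    note i1 = has_contour_integral_pint[OF C1_segment(1,2) h1(1)]
    note i2 = has_contour_integral_pint[OF D_cont D_deriv h1(2)]
    have "(h has_contour_integral pint (linepath (- of_real s) (of_real s)) (\<lambda>_. of_real (2 * s)) h + pint \<gamma> D h) \<Gamma>"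
      unfolding \<Gamma> by (rule has_contour_integral_join[OF i1 i2]) (use \<Gamma>_facts(1) in auto)
    then show ?thesis unfolding C1_segment(3) by (rule contour_integral_unique)
  qed
  show "contour_integral \<Gamma> f = pint_seg s f + pint \<gamma> D f" by (rule m[OF f])
  have "contour_integral \<Gamma> (\<lambda>z. cnj (f z)) = pint_seg s (\<lambda>z. cnj (f z)) + pint \<gamma> D (\<lambda>z. cnj (f z))"
    by (intro m continuous_intros f)
  then show "contour_integral_cnj \<Gamma> f = pint_seg s f + pint \<gamma> (\<lambda>t. cnj (D t)) f"
    unfolding contour_integral_cnj_eq by (simp add: pint_cnj)
qed

lemma contour_integral_\<gamma>:
  assumes f: "continuous_on (\<gamma> ` {0..1}) f"
  shows "contour_integral \<gamma> f = pint \<gamma> D f" "contour_integral_cnj \<gamma> f = pint \<gamma> (\<lambda>t. cnj (D t)) f"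
proof -
  show "contour_integral \<gamma> f = pint \<gamma> D f"
    by (rule contour_integral_unique[OF has_contour_integral_pint[OF D_cont D_deriv f]])
  have "contour_integral \<gamma> (\<lambda>z. cnj (f z)) = pint \<gamma> D (\<lambda>z. cnj (f z))"
    by (rule contour_integral_unique[OF has_contour_integral_pint[OF D_cont D_deriv]]) (auto intro!: continuous_intros f)
  then show "contour_integral_cnj \<gamma> f = pint \<gamma> (\<lambda>t. cnj (D t)) f" unfolding contour_integral_cnj_eq by (simp add: pint_cnj)
qed

sublocale region \<gamma> D s \<Omega>p
proof
  show "\<Omega>p \<in> sets borel" using \<Omega>p_open by simp
  show "AE p in lborel. pint_seg s (\<lambda>\<zeta>. 1 / (\<zeta> - p)) + pint \<gamma> D (\<lambda>\<zeta>. 1 / (\<zeta> - p)) =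
        2 * of_real pi * \<i> * indicator \<Omega>p p"
  proof -
    have "frontier C \<in> null_sets lebesgue" using negligible_convex_frontier[OF C_facts(1)] by (simp add: negligible_iff_null_sets)
    moreover have "frontier C \<in> sets borel" by (intro borel_closed frontier_closed)
    ultimately have "frontier C \<in> null_sets lborel" by (auto simp: null_sets_completion_iff)
    from AE_not_in[OF this] show ?thesis
    proof eventually_elim
      case (elim p)
      have p: "p \<notin> path_image \<Gamma>"
      proof
        assume "p \<in> path_image \<Gamma>"
        then have "p \<in> C" "p \<notin> \<Omega>p" using \<Gamma>_facts(5,6) \<Omega>p_\<gamma> \<Omega>p_seg by auto
        then have "p \<in> frontier C" using closure_subset[of C] unfolding frontier_def \<Omega>p by auto
        then show False using elim by simp
      qed
      have "continuous_on (path_image \<Gamma>) (\<lambda>\<zeta>. 1 / (\<zeta> - p))" using p by (intro continuous_intros) auto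
      from contour_integral_\<Gamma>(1)[OF this] have e: "pint_seg s (\<lambda>\<zeta>. 1 / (\<zeta> - p)) + pint \<gamma> D (\<lambda>\<zeta>. 1 / (\<zeta> - p)) = 2 * of_real pi * \<i> * winding_number \<Gamma> p"
        using winding_number_valid_path[OF \<Gamma>_facts(2) p] by simp
      show ?case
      proof (cases "p \<in> \<Omega>p")
        case True then show ?thesis unfolding e using winding_number_interior by simp
      next
        case False
        then have "p \<notin> C" using elim closure_subset[of C] unfolding frontier_def \<Omega>p by auto
        then have "winding_number \<Gamma> p = 0"
          using \<Gamma>_facts by (intro winding_number_zero_outside[OF valid_path_imp_path C_facts(1)]) auto
        then show ?thesis unfolding e using False by simp
      qed
    qed
  qed
qed (use s \<gamma>_cont D_cont \<Omega>p_bounded in auto)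

end

section \<open>Representation of one mode\<close>

text \<open>On an interval symmetric about \<open>x\<close> the kernel integrates to zero, so \<open>u x\<close> may be subtracted there, which leaves a bounded integrand.\<close>
lemma Lipschitz_has_finite_hilbert:
  fixes u :: "real \<Rightarrow> complex"
  assumes um: "u \<in> borel_measurable borel" and K: "\<And>y. norm (u y) \<le> K"
    and L: "\<And>y. norm (u y - u x) \<le> L * \<bar>y - x\<bar>" and x: "x \<in> {-s<..<s}"
  obtains h where "has_finite_hilbert s u x h"
proof -
  interpret M: finite_measure "LS s" by (rule finite_LS)
  define d where "d = min (s - x) (x + s)"
  have d: "d > 0" using x by (simp add: d_def)
  \<comment> \<open>\<open>d\<close> is the distance to the end points; on \<open>(x - d, x + d)\<close> the kernel is odd about \<open>x\<close>.\<close>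
  define k where "k e y = (if e < \<bar>x - y\<bar> \<and> \<bar>x - y\<bar> < d then 1 / of_real (x - y) else (0::complex))" for e y
  define G where "G y = (if \<bar>x - y\<bar> < d then (u y - u x) / of_real (x - y) else u y / of_real (x - y))" for y
  have K0: "K \<ge> 0" using order_trans[OF norm_ge_zero K] .
  have L0: "L \<ge> 0" using order_trans[OF norm_ge_zero L[of "x + 1"]] by simp
  have Gb: "norm (G y) \<le> L + K / d" for y
  proof (cases "\<bar>x - y\<bar> < d")
    case True
    show ?thesis
    proof (cases "y = x")
      case False
      then have "norm (G y) \<le> L" using True L[of y] by (simp add: G_def norm_divide abs_minus_commute divide_le_eq del: of_real_diff)
      moreover have "0 \<le> K / d" using K0 d by simp
      ultimately show ?thesis by linarith
    qed (use K0 L0 d in \<open>simp add: G_def\<close>)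
  next
    case False
    then have "norm (G y) = norm (u y) / \<bar>x - y\<bar>" by (simp add: G_def norm_divide del: of_real_diff)
    also have "\<dots> \<le> K / d" using False d by (intro frac_le K K0) auto
    finally show ?thesis using L0 by simp
  qed
  have "G \<in> borel_measurable borel" unfolding G_def using um by measurable
  from measurable_compose[OF LS_id_measurable this] have Gm: "G \<in> borel_measurable (LS s)" .
  have Gem: "(\<lambda>y. if e < \<bar>x - y\<bar> then G y else 0) \<in> borel_measurable (LS s)" for e using Gm by measurable
  have km: "k e \<in> borel_measurable borel" for e unfolding k_def by measurable
  have kb: "norm (k e y) \<le> 1 / e" if "e > 0" for e y
    using that by (auto simp: k_def norm_divide simp del: of_real_diff intro!: divide_left_mono mult_pos_pos)
  have kz: "(\<integral>y. k e y \<partial>LS s) = 0" for e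
  proof -
    have "(\<integral>y. k e y \<partial>LS s) = (\<integral>y. indicator {-s<..<s} y *\<^sub>R k e y \<partial>lebesgue)"
      by (subst integral_restrict_space) (auto simp: set_lebesgue_integral_def)
    also have "\<dots> = (\<integral>y. k e y \<partial>lebesgue)" by (intro lebesgue_integral_cong) (auto simp: k_def d_def indicator_def)
    also have "\<dots> = (\<integral>y. k e y \<partial>lborel)" by (rule integral_completion) (use km in simp)
    finally have 1: "(\<integral>y. k e y \<partial>LS s) = (\<integral>y. k e y \<partial>lborel)" .
    have "(\<integral>y. k e y \<partial>lborel) = \<bar>-1\<bar> *\<^sub>R (\<integral>y. k e (2 * x + (-1) * y) \<partial>lborel)" by (rule lborel_integral_real_affine) simp
    also have "\<dots> = (\<integral>y. - k e y \<partial>lborel)"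
    proof -
      have "k e (2 * x + (-1) * y) = - k e y" for y
      proof -
        have a: "x - (2 * x + (-1) * y) = - (x - y)" by simp
        have m: "1 / complex_of_real (- (x - y)) = - (1 / of_real (x - y))" by (simp only: of_real_minus divide_minus_right)
        show ?thesis unfolding k_def a abs_minus_cancel m by (simp del: of_real_diff)
      qed
      then show ?thesis by simp
    qed
    also have "\<dots> = - (\<integral>y. k e y \<partial>lborel)" by (rule integral_minus)
    finally have "(\<integral>y. k e y \<partial>lborel) = 0" by simp
    then show ?thesis unfolding 1 .
  qed
  have T: "truncated_hilbert s u x e = 1 / of_real pi * (\<integral>y. (if e < \<bar>x - y\<bar> then G y else 0) \<partial>LS s)" if e: "e > 0" for e
  proof -
    have i1: "integrable (LS s) (\<lambda>y. if e < \<bar>x - y\<bar> then G y else 0)"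
      by (rule M.integrable_const_bound[where B="L + K / d"]) (use Gb K0 L0 d Gem in \<open>auto intro!: add_nonneg_nonneg\<close>)
    have i2: "integrable (LS s) (\<lambda>y. u x * k e y)"
      by (intro integrable_mult_right M.integrable_const_bound[where B="1 / e"]) (use kb[OF e] in \<open>auto intro: measurable_compose[OF LS_id_measurable km]\<close>)
    have "(\<integral>y. (if e < \<bar>x - y\<bar> then u y / of_real (x - y) else 0) \<partial>LS s) = (\<integral>y. (if e < \<bar>x - y\<bar> then G y else 0) + u x * k e y \<partial>LS s)"
      by (intro lebesgue_integral_cong) (auto simp: G_def k_def diff_divide_distrib simp del: of_real_diff)
    also have "\<dots> = (\<integral>y. (if e < \<bar>x - y\<bar> then G y else 0) \<partial>LS s) + (\<integral>y. u x * k e y \<partial>LS s)"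
      by (rule Bochner_Integration.integral_add[OF i1 i2])
    also have "(\<integral>y. u x * k e y \<partial>LS s) = 0" unfolding integral_mult_right_zero kz by simp
    finally show ?thesis unfolding truncated_hilbert_LS by simp
  qed
  have "((\<lambda>e. \<integral>y. (if e < \<bar>x - y\<bar> then G y else 0) \<partial>LS s) \<longlongrightarrow> (\<integral>y. G y \<partial>LS s)) (at_right 0)"
    unfolding tendsto_at_iff_sequentially
  proof (intro allI impI)
    fix X :: "nat \<Rightarrow> real" assume X: "\<forall>i. X i \<in> {0<..} - {0}" "X \<longlonglongrightarrow> 0"
    show "((\<lambda>e. \<integral>y. (if e < \<bar>x - y\<bar> then G y else 0) \<partial>LS s) \<circ> X) \<longlonglongrightarrow> (\<integral>y. G y \<partial>LS s)"
      unfolding o_def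
    proof (rule integral_dominated_convergence[where w="\<lambda>_. L + K / d"])
      show "AE y in LS s. (\<lambda>n. if X n < \<bar>x - y\<bar> then G y else 0) \<longlonglongrightarrow> G y"
      proof (rule AE_I2)
        fix y
        show "(\<lambda>n. if X n < \<bar>x - y\<bar> then G y else 0) \<longlonglongrightarrow> G y"
        proof (cases "x = y")
          case False
          then have "\<forall>\<^sub>F n in sequentially. X n < \<bar>x - y\<bar>" using X(2) by (intro order_tendstoD) auto
          then have "\<forall>\<^sub>F n in sequentially. (if X n < \<bar>x - y\<bar> then G y else 0) = G y" by eventually_elim simp
          then show ?thesis by (rule tendsto_eventually)
        next
          case True
          then have "G y = 0" by (simp add: G_def d)
          then have "(\<lambda>n. if X n < \<bar>x - y\<bar> then G y else 0) = (\<lambda>n. G y)" by (simp add: fun_eq_iff)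
          then show ?thesis by (simp only: tendsto_const)
        qed
      qed
      show "AE y in LS s. norm (if X n < \<bar>x - y\<bar> then G y else 0) \<le> L + K / d" for n
        using Gb K0 L0 d by (auto intro!: add_nonneg_nonneg)
    qed (use Gm Gem in auto)
  qed
  then have "((\<lambda>e. 1 / of_real pi * (\<integral>y. (if e < \<bar>x - y\<bar> then G y else 0) \<partial>LS s)) \<longlongrightarrow> 1 / of_real pi * (\<integral>y. G y \<partial>LS s)) (at_right 0)"
    by (intro tendsto_mult tendsto_const)
  then have "has_finite_hilbert s u x (1 / of_real pi * (\<integral>y. G y \<partial>LS s))"
    unfolding has_finite_hilbert_def
  proof (rule Lim_transform_eventually)
    show "\<forall>\<^sub>F e in at_right 0. 1 / of_real pi * (\<integral>y. (if e < \<bar>x - y\<bar> then G y else 0) \<partial>LS s) = truncated_hilbert s u x e"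
      by (rule eventually_mono[OF eventually_at_right_less]) (rule T[symmetric])
  qed
  then show ?thesis by (rule that)
qed

lemma pint_seg_eq:
  assumes s: "s > 0" and g: "continuous_on UNIV g"
  shows "pint_seg s g = (\<integral>y. g (of_real y) \<partial>LS s)"
proof -
  have gm: "(\<lambda>y::real. g (of_real y)) \<in> borel_measurable borel"
    by (intro borel_measurable_continuous_onI continuous_on_compose2[OF g] continuous_intros) auto
  have gi: "(\<lambda>y::real. indicator {-s<..<s} y *\<^sub>R g (of_real y)) \<in> borel_measurable borel"
    by (intro borel_measurable_scaleR borel_measurable_indicator gm) auto
  have "(\<integral>y. g (of_real y) \<partial>LS s) = (\<integral>y. indicator {-s<..<s} y *\<^sub>R g (of_real y) \<partial>lebesgue)"
    by (subst integral_restrict_space) (auto simp: set_lebesgue_integral_def)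
  also have "\<dots> = (\<integral>y. indicator {-s<..<s} y *\<^sub>R g (of_real y) \<partial>lborel)" by (rule integral_completion) (use gi in simp)
  also have "\<dots> = \<bar>2 * s\<bar> *\<^sub>R (\<integral>t. indicator {-s<..<s} (- s + 2 * s * t) *\<^sub>R g (of_real (- s + 2 * s * t)) \<partial>lborel)"
    by (rule lborel_integral_real_affine) (use s in simp)
  also have "\<dots> = (\<integral>t. of_real (2 * s) * (indicator {-s<..<s} (- s + 2 * s * t) *\<^sub>R g (of_real (- s + 2 * s * t))) \<partial>lborel)"
    unfolding integral_mult_right_zero using s by (simp add: scaleR_conv_of_real)
  also have "\<dots> = (\<integral>t. indicator {0..1} t *\<^sub>R (g (seg s t) * of_real (2 * s)) \<partial>lborel)"
  proof (rule integral_cong_AE)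
    show "AE t in lborel. of_real (2 * s) * (indicator {-s<..<s} (- s + 2 * s * t) *\<^sub>R g (of_real (- s + 2 * s * t))) = indicator {0..1} t *\<^sub>R (g (seg s t) * of_real (2 * s))"
    proof (rule AE_I[where N="{0,1}"])
      show "{t \<in> space lborel. \<not> of_real (2 * s) * (indicator {-s<..<s} (- s + 2 * s * t) *\<^sub>R g (of_real (- s + 2 * s * t))) = indicator {0..1} t *\<^sub>R (g (seg s t) * of_real (2 * s))} \<subseteq> {0,1}"
      proof (rule subsetI, rule ccontr)
        fix t assume t: "t \<in> {t \<in> space lborel. \<not> of_real (2 * s) * (indicator {-s<..<s} (- s + 2 * s * t) *\<^sub>R g (of_real (- s + 2 * s * t))) = indicator {0..1} t *\<^sub>R (g (seg s t) * of_real (2 * s))}"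
          "t \<notin> {0,1}"
        have e: "- s + 2 * s * t = 2 * s * t - s" by simp
        have "(- s + 2 * s * t \<in> {-s<..<s}) = (t \<in> {0..1})"
        proof -
          have "(- s < - s + 2 * s * t) = (0 < t)" using s by (simp add: zero_less_mult_iff)
          moreover have "(2 * s * t < 2 * s * 1) = (t < 1)" using s by (intro mult_less_cancel_left_pos) simp
          then have "(- s + 2 * s * t < s) = (t < 1)" by auto
          ultimately show ?thesis using t(2) by auto
        qed
        then have "of_real (2 * s) * (indicator {-s<..<s} (- s + 2 * s * t) *\<^sub>R g (of_real (- s + 2 * s * t))) = indicator {0..1} t *\<^sub>R (g (seg s t) * of_real (2 * s))"
          unfolding seg_def e by (simp add: indicator_def)
        then show False using t(1) by blast
      qed
    qed (auto simp: emeasure_lborel_countable)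
    show "(\<lambda>t. of_real (2 * s) * (indicator {-s<..<s} (- s + 2 * s * t) *\<^sub>R g (of_real (- s + 2 * s * t)))) \<in> borel_measurable lborel"
    proof -
      have "(\<lambda>t. - s + 2 * s * t) \<in> borel_measurable borel" by (intro borel_measurable_continuous_onI continuous_intros)
      from measurable_compose[OF this gi] show ?thesis by (intro borel_measurable_times borel_measurable_const) simp
    qed
    have "continuous_on UNIV (\<lambda>t. g (seg s t) * of_real (2 * s))" by (intro continuous_on_mult continuous_on_compose2[OF g] seg_continuous continuous_on_const) auto
    then show "(\<lambda>t. indicator {0..1} t *\<^sub>R (g (seg s t) * of_real (2 * s))) \<in> borel_measurable lborel"
      using borel_measurable_continuous_onI by (intro borel_measurable_scaleR borel_measurable_indicator) auto
  qed
  finally show ?thesis unfolding pint_def by simp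
qed

context convex_arc
begin

lemma area_integrable:
  assumes b: "integrable lborel b" "\<And>z. norm (b z :: complex) \<le> M" "\<And>z::complex. r < norm z \<Longrightarrow> b z = 0" "M > 0"
  shows "integrable lborel (\<lambda>p. indicator \<Omega>p p * (b p * ((cnj (p - z) / (p - z)) ^ j / (p - z))))"
    "norm (indicator \<Omega>p p * (b p * ((cnj (p - z) / (p - z)) ^ j / (p - z)))) \<le> norm (b p) * (1 / norm (p - z))"
proof -
  have [measurable]: "cnj \<in> borel_measurable borel" by (intro borel_measurable_continuous_onI continuous_intros)
  have bm[measurable]: "b \<in> borel_measurable borel" using borel_measurable_integrable[OF b(1)] by simp
  show le: "norm (indicator \<Omega>p p * (b p * ((cnj (p - z) / (p - z)) ^ j / (p - z)))) \<le> norm (b p) * (1 / norm (p - z))" for p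
  proof -
    have "norm ((cnj (p - z) / (p - z)) ^ j) \<le> 1" unfolding norm_power norm_divide complex_mod_cnj by (intro power_le_one) (auto simp: divide_le_eq_1)
    then have "norm ((cnj (p - z) / (p - z)) ^ j) / norm (p - z) \<le> 1 / norm (p - z)" by (rule divide_right_mono) simp
    then have "norm (b p) * (norm ((cnj (p - z) / (p - z)) ^ j) / norm (p - z)) \<le> norm (b p) * (1 / norm (p - z))" by (rule mult_left_mono) simp
    moreover have "norm (indicator \<Omega>p p * (b p * ((cnj (p - z) / (p - z)) ^ j / (p - z)))) \<le> norm (b p) * (norm ((cnj (p - z) / (p - z)) ^ j) / norm (p - z))"
      unfolding norm_mult norm_divide by (auto simp: indicator_def)
    ultimately show ?thesis by linarith
  qed
  note bt = bounded_times_Cauchy_integrable[OF b]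
  show "integrable lborel (\<lambda>p. indicator \<Omega>p p * (b p * ((cnj (p - z) / (p - z)) ^ j / (p - z))))"
  proof (rule integrable_dominated[OF bt(1)[where c=z]])
    show "(\<lambda>p. indicator \<Omega>p p * (b p * ((cnj (p - z) / (p - z)) ^ j / (p - z)))) \<in> borel_measurable lborel" by measurable
    show "AE p in lborel. norm (indicator \<Omega>p p * (b p * ((cnj (p - z) / (p - z)) ^ j / (p - z)))) \<le> norm (M * (indicator (cball 0 r) p * (1 / norm (p - z))))"
      unfolding real_norm_def by (intro AE_I2 order_trans[OF order_trans[OF le bt(2)] abs_ge_self])
  qed
qed

end

text \<open>A solution of \<open>dbar V_n + d V_{n+2} = W_n\<close> for the indices \<open>n, n + 2, \<dots>\<close> (the minus signs of the mode numbers are dropped); \<open>a\<close> and \<open>b\<close> are \<open>d V\<close> and \<open>dbar V\<close>.\<close>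
locale mode_system = convex_arc +
  fixes V W a b :: "nat \<Rightarrow> complex \<Rightarrow> complex" and M r :: real and n :: nat
  assumes V: "\<And>m. C1c (V m) (a m) (b m)"
    and M: "M > 0" "\<And>m z. norm (a m z) \<le> M" "\<And>m z. norm (b m z) \<le> M" "\<And>m z. r < norm z \<Longrightarrow> a m z = 0 \<and> b m z = 0"
    and sys: "\<And>j z. z \<in> \<Omega>p \<Longrightarrow> b (n + 2 * j) z + a (n + 2 * j + 2) z = W (n + 2 * j) z"
    and decay: "\<And>z. z \<in> \<Omega>p \<Longrightarrow> (\<lambda>m. b m z) \<longlonglongrightarrow> 0"
    and W_sum: "\<exists>C. \<forall>z\<in>\<Omega>p. \<forall>N. (\<Sum>j<N. norm (W (n + 2 * j) z)) \<le> C"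
begin

text \<open>The weights \<open>\<omega>\<^sup>j / (p - z)\<close> are integrated over \<open>\<Omega>p\<close> against \<open>dbar V\<close>, \<open>d V\<close> and \<open>W\<close>, which gives \<open>A\<close>, \<open>A'\<close> and \<open>T\<close>; the system says \<open>T = A + A'\<close>.\<close>
definition om :: "complex \<Rightarrow> complex \<Rightarrow> complex" where "om z p = cnj (p - z) / (p - z)"
definition A where "A z j = (\<integral>p. indicator \<Omega>p p * (b (n + 2 * j) p * (om z p ^ j / (p - z))) \<partial>lborel)"
definition A' where "A' z j = (\<integral>p. indicator \<Omega>p p * (a (n + 2 * j + 2) p * (om z p ^ j / (p - z))) \<partial>lborel)"
definition T where "T z j = (\<integral>p. indicator \<Omega>p p * (W (n + 2 * j) p * (om z p ^ j / (p - z))) \<partial>lborel)"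

lemma V_bounded: obtains K where "\<And>z. norm (V m z) \<le> K"
proof (rule C1c_bounds[OF V[of m]])
  fix R M assume "\<And>z. norm (V m z) \<le> M"
  then show thesis by (rule that)
qed

lemma bi: "integrable lborel (b m)" "integrable lborel (a m)" using C1c_integrable[OF V] by auto
lemma b0: "r < norm z \<Longrightarrow> b m z = 0" "r < norm z \<Longrightarrow> a m z = 0" using M(4) by auto
lemmas Ai = area_integrable[OF bi(1) M(3) b0(1) M(1), folded om_def]
lemmas A'i = area_integrable[OF bi(2) M(2) b0(2) M(1), folded om_def]

lemma T_eq: "T z j = A z j + A' z j"
  and T_integrable: "integrable lborel (\<lambda>p. indicator \<Omega>p p * (W (n + 2 * j) p * (om z p ^ j / (p - z))))"
proof -
  have e: "indicator \<Omega>p p * (W (n + 2 * j) p * (om z p ^ j / (p - z))) = indicator \<Omega>p p * (b (n + 2 * j) p * (om z p ^ j / (p - z))) + indicator \<Omega>p p * (a (n + 2 * j + 2) p * (om z p ^ j / (p - z)))" for p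
    using sys[of p j] by (cases "p \<in> \<Omega>p") (simp_all add: distrib_right[symmetric] add_divide_distrib[symmetric])
  show "T z j = A z j + A' z j" unfolding T_def A_def A'_def e by (rule Bochner_Integration.integral_add[OF Ai(1) A'i(1)])
  show "integrable lborel (\<lambda>p. indicator \<Omega>p p * (W (n + 2 * j) p * (om z p ^ j / (p - z))))"
    unfolding e by (rule Bochner_Integration.integrable_add[OF Ai(1) A'i(1)])
qed

lemma A_limit: "A z \<longlonglongrightarrow> 0"
proof -
  note bt = bounded_times_Cauchy_integrable[OF bi(1) M(3) b0(1) M(1)]
  have "(\<lambda>j. A z j) \<longlonglongrightarrow> (\<integral>p. 0 \<partial>(lborel :: complex measure))"
    unfolding A_def
  proof (rule integral_dominated_convergence[where w="\<lambda>p. M * (indicator (cball 0 r) p * (1 / norm (p - z)))"])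
    show "AE p in lborel. (\<lambda>j. indicator \<Omega>p p * (b (n + 2 * j) p * (om z p ^ j / (p - z)))) \<longlonglongrightarrow> 0"
    proof (rule AE_I2)
      fix p
      show "(\<lambda>j. indicator \<Omega>p p * (b (n + 2 * j) p * (om z p ^ j / (p - z)))) \<longlonglongrightarrow> 0"
      proof (cases "p \<in> \<Omega>p")
        case True
        have "filterlim (\<lambda>j. n + 2 * j) at_top sequentially" 
          by (rule filterlim_subseq) (auto simp: strict_mono_def)
        then have "(\<lambda>j. b (n + 2 * j) p) \<longlonglongrightarrow> 0" by (rule filterlim_compose[OF decay[OF True]])
        then have "(\<lambda>j. norm (b (n + 2 * j) p) * (1 / norm (p - z))) \<longlonglongrightarrow> 0 * (1 / norm (p - z))"
          by (rule tendsto_mult[OF tendsto_norm_zero tendsto_const])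
        then show ?thesis
          unfolding mult_zero_left by (rule Lim_null_comparison[rotated]) (rule always_eventually, rule allI, rule Ai(2))
      qed simp
    qed
    show "AE p in lborel. norm (indicator \<Omega>p p * (b (n + 2 * j) p * (om z p ^ j / (p - z)))) \<le> M * (indicator (cball 0 r) p * (1 / norm (p - z)))" for j
      by (rule AE_I2) (rule order_trans[OF Ai(2) bt(2)])
    show "(\<lambda>p. indicator \<Omega>p p * (b (n + 2 * j) p * (om z p ^ j / (p - z)))) \<in> borel_measurable lborel" for j
      by (rule borel_measurable_integrable[OF Ai(1)])
  qed (rule borel_measurable_const, rule bt(1))
  then show ?thesis by simp
qed

lemma T_summable: "summable (T z)"
proof -
  obtain C where C: "\<And>z N. z \<in> \<Omega>p \<Longrightarrow> (\<Sum>j<N. norm (W (n + 2 * j) z)) \<le> C" using W_sum by auto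
  obtain z0 where z0: "z0 \<in> \<Omega>p" using interior_nonempty by auto
  have C0: "C \<ge> 0" using C[OF z0, of 0] by simp
  have R: "set_integrable lborel \<Omega>p (\<lambda>p. 1 / norm (p - z))" by (rule inverse_norm_integrable[OF R_bounded R_borel])
  then have Ri: "integrable lborel (\<lambda>p. C * (indicator \<Omega>p p * (1 / norm (p - z))))"
    unfolding set_integrable_def by (intro integrable_mult_right) simp
  have "summable (\<lambda>j. norm (T z j))"
  proof (rule bounded_imp_summable)
    fix N
    let ?f = "\<lambda>j p. indicator \<Omega>p p * (W (n + 2 * j) p * (om z p ^ j / (p - z)))"
    have "(\<Sum>j\<le>N. norm (T z j)) \<le> (\<Sum>j\<le>N. \<integral>p. norm (?f j p) \<partial>lborel)" unfolding T_def by (intro sum_mono integral_norm_bound)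
    also have "\<dots> = (\<integral>p. (\<Sum>j\<le>N. norm (?f j p)) \<partial>lborel)"
      by (rule Bochner_Integration.integral_sum[symmetric]) (intro integrable_norm T_integrable)
    also have "\<dots> \<le> (\<integral>p. C * (indicator \<Omega>p p * (1 / norm (p - z))) \<partial>lborel)"
    proof (rule integral_mono[OF Bochner_Integration.integrable_sum Ri])
      show "integrable lborel (\<lambda>p. norm (?f j p))" for j by (intro integrable_norm T_integrable)
      fix p
      show "(\<Sum>j\<le>N. norm (?f j p)) \<le> C * (indicator \<Omega>p p * (1 / norm (p - z)))"
      proof (cases "p \<in> \<Omega>p")
        case True
        have "norm (?f j p) \<le> norm (W (n + 2 * j) p) * (1 / norm (p - z))" for j
        proof -
          have "norm (om z p ^ j) \<le> 1" unfolding norm_power om_def norm_divide complex_mod_cnj by (intro power_le_one) (auto simp: divide_le_eq_1)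
          then have "norm (om z p ^ j) / norm (p - z) \<le> 1 / norm (p - z)" by (rule divide_right_mono) simp
          then have "norm (W (n + 2 * j) p) * (norm (om z p ^ j) / norm (p - z)) \<le> norm (W (n + 2 * j) p) * (1 / norm (p - z))" by (rule mult_left_mono) simp
          then show ?thesis using True by (simp add: norm_mult norm_divide)
        qed
        then have "(\<Sum>j\<le>N. norm (?f j p)) \<le> (\<Sum>j\<le>N. norm (W (n + 2 * j) p) * (1 / norm (p - z)))" by (intro sum_mono)
        also have "\<dots> = (\<Sum>j<Suc N. norm (W (n + 2 * j) p)) * (1 / norm (p - z))" unfolding sum_distrib_right lessThan_Suc_atMost ..
        also have "\<dots> \<le> C * (1 / norm (p - z))" by (intro mult_right_mono C True) auto
        finally show ?thesis using True by simp
      qed simp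
    qed
    finally show "(\<Sum>j\<le>N. norm (T z j)) \<le> (\<integral>p. C * (indicator \<Omega>p p * (1 / norm (p - z))) \<partial>lborel)" .
  qed auto
  then show ?thesis by (rule summable_norm_cancel)
qed

text \<open>Using \<open>d V_{n+2i+2} = W_{n+2i} - dbar V_{n+2i}\<close>, the \<open>i\<close>-th term becomes \<open>A (i + 1) - A i + T i\<close>.\<close>
lemma kernel_sums:
  assumes k: "\<And>i. k i = 2 * \<i> * ((\<integral>p. indicator \<Omega>p p * (b (n + 2 * Suc i) p * (om z p ^ Suc i / (p - z))) \<partial>lborel) + (\<integral>p. indicator \<Omega>p p * (a (n + 2 * Suc i) p * (om z p ^ Suc i / cnj (p - z))) \<partial>lborel))"
  shows "k sums (2 * \<i> * ((\<Sum>j. T z j) - A z 0))"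
proof -
  have c: "om z p ^ Suc i / cnj (p - z) = om z p ^ i / (p - z)" for p i
  proof (cases "p = z")
    case False
    have "(y / x) ^ Suc i / y = (y / x) ^ i / x" if "y \<noteq> 0" for x y :: complex using that by simp
    from this[of "cnj (p - z)" "p - z"] show ?thesis using False unfolding om_def by (simp del: complex_cnj_diff power_Suc)
  qed (simp add: om_def)
  have ki: "k i = 2 * \<i> * (A z (Suc i) - A z i + T z i)" for i
    unfolding k c T_eq A_def A'_def by simp
  have "(\<lambda>i. A z (Suc i) - A z i) sums (0 - A z 0)" by (rule telescope_sums[OF A_limit])
  then have "(\<lambda>i. A z (Suc i) - A z i + T z i) sums (0 - A z 0 + (\<Sum>j. T z j))" by (intro sums_add summable_sums T_summable)
  then have "(\<lambda>i. 2 * \<i> * (A z (Suc i) - A z i + T z i)) sums (2 * \<i> * (0 - A z 0 + (\<Sum>j. T z j)))" by (rule sums_mult)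
  then show ?thesis unfolding ki by (simp add: algebra_simps)
qed

lemma set_integral_T: "(\<integral>\<zeta>\<in>\<Omega>p. W (n + 2 * j) \<zeta> * (1 / (\<zeta> - z)) * ((cnj \<zeta> - cnj z) / (\<zeta> - z)) ^ j \<partial>lborel) = T z j"
  unfolding set_lebesgue_integral_def T_def om_def
  by (intro lebesgue_integral_cong) (auto simp: indicator_def mult_ac)

lemma kernel_cont:
  assumes "z \<notin> S" "continuous_on UNIV g"
  shows "continuous_on S (\<lambda>\<zeta>. g \<zeta> * (om z \<zeta> ^ j / (\<zeta> - z)))" "continuous_on S (\<lambda>\<zeta>. g \<zeta> * (om z \<zeta> ^ j / cnj (\<zeta> - z)))"
    "continuous_on S (\<lambda>\<zeta>. g \<zeta> * (1 / (\<zeta> - z)))"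
  unfolding om_def using assms by (auto intro!: continuous_intros continuous_on_subset[OF assms(2)])

lemma kernel_integral_om: "kernel_integral g z j h = contour_integral g (\<lambda>\<zeta>. h \<zeta> * (om z \<zeta> ^ j / (\<zeta> - z))) - contour_integral_cnj g (\<lambda>\<zeta>. h \<zeta> * (om z \<zeta> ^ j / cnj (\<zeta> - z)))"
  unfolding kernel_integral_def om_def by simp

lemma interior_formula:
  assumes z: "z \<in> \<Omega>p"
  shows "V n z = B_op \<Gamma> V n z + T_op \<Omega>p W n z"
proof -
  have z1: "z \<notin> \<gamma> ` {0..1}" and z2: "z \<notin> seg s ` {0..1}" using z \<Omega>p_\<gamma> \<Omega>p_seg by auto
  have zG: "z \<notin> path_image \<Gamma>" unfolding \<Gamma>_facts(6) using z1 z2 by simp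
  have cV: "continuous_on UNIV (V m)" for m by (rule C1c_continuous[OF V])
  let ?k = "\<lambda>i. kernel_integral \<Gamma> z (Suc i) (V (n + 2 * Suc i))"
  have "?k sums (2 * \<i> * ((\<Sum>j. T z j) - A z 0))"
  proof (rule kernel_sums)
    fix i
    show "?k i = 2 * \<i> * ((\<integral>p. indicator \<Omega>p p * (b (n + 2 * Suc i) p * (om z p ^ Suc i / (p - z))) \<partial>lborel) + (\<integral>p. indicator \<Omega>p p * (a (n + 2 * Suc i) p * (om z p ^ Suc i / cnj (p - z))) \<partial>lborel))"
    proof -
      have gen: "(x + x') - (y + y') = w" if "(x - y) + (x' - y') = w" for x x' y y' w :: complex
        using that by (simp add: algebra_simps)
      show ?thesis
        unfolding kernel_integral_om contour_integral_\<Gamma>(1)[OF kernel_cont(1)[OF zG cV]] contour_integral_\<Gamma>(2)[OF kernel_cont(2)[OF zG cV]]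
        by (rule gen[OF kernel_Suc_interior[OF V z1 z2, of "n + 2 * Suc i" i, folded om_def]])
    qed
  qed
  then have S: "(\<Sum>i. ?k i) = 2 * \<i> * ((\<Sum>j. T z j) - A z 0)" by (rule sums_unique[symmetric])
  have "contour_integral \<Gamma> (\<lambda>\<zeta>. V n \<zeta> * (1 / (\<zeta> - z))) = 2 * \<i> * A z 0 + 2 * \<i> * of_real pi * V n z"
  proof -
    have A0: "(\<integral>p. indicator \<Omega>p p * (b n p * (1 / (p - z))) \<partial>lborel) = A z 0" unfolding A_def by simp
    show ?thesis
      unfolding contour_integral_\<Gamma>(1)[OF kernel_cont(3)[OF zG cV]] kernel_zero_interior[OF V z1 z2 \<Omega>p_open z] A0 ..
  qed
  then have c: "contour_integral \<Gamma> (\<lambda>\<zeta>. V n \<zeta> / (\<zeta> - z)) = 2 * \<i> * A z 0 + 2 * \<i> * of_real pi * V n z"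
    by (simp only: times_divide_eq_right mult_1_right)
  have alg: "1 / (2 * P * \<i>) * (2 * \<i> * a + 2 * \<i> * P * v) + 1 / (2 * P * \<i>) * (2 * \<i> * (t - a)) = v + 1 / P * t" if P: "P \<noteq> 0" for P a v t :: complex
  proof -
    have "(2 * \<i> * a + 2 * \<i> * P * v) + 2 * \<i> * (t - a) = 2 * P * \<i> * (v + 1 / P * t)" using P by (simp add: algebra_simps)
    then have "1 / (2 * P * \<i>) * ((2 * \<i> * a + 2 * \<i> * P * v) + 2 * \<i> * (t - a)) = v + 1 / P * t" using P by simp
    then show ?thesis by (simp only: distrib_left)
  qed
  have "B_op \<Gamma> V n z = V n z + (1 / of_real pi) * (\<Sum>j. T z j)"
    unfolding B_op_def c S by (rule alg) simp
  moreover have "T_op \<Omega>p W n z = - (1 / of_real pi) * (\<Sum>j. T z j)" unfolding T_op_def set_integral_T ..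
  ultimately show ?thesis by simp
qed

text \<open>On the chord the Cauchy integral over \<open>seg s\<close> survives as a principal value and the density is one half; solving for these two terms gives \<open>[I - i H] V = F\<close>.\<close>
lemma boundary_formula:
  assumes x: "x \<in> {-s<..<s}"
  shows "hilbert_equation_at s (\<lambda>x. V n (of_real x)) (F_fun \<gamma> \<Omega>p V W n) x"
proof -
  let ?z = "complex_of_real x" and ?u = "\<lambda>x. V n (of_real x)"
  have z1: "?z \<notin> \<gamma> ` {0..1}" by (rule chord_\<gamma>[OF x])
  have cV: "continuous_on UNIV (V m)" for m by (rule C1c_continuous[OF V])
  have cu: "continuous_on UNIV ?u" by (rule continuous_on_compose2[OF cV continuous_on_of_real_id]) simp
  obtain K where K: "\<And>z. norm (V n z) \<le> K" using V_bounded[of n] by blast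
  obtain L where L: "L > 0" "\<And>x y. norm (V n x - V n y) \<le> L * norm (x - y)" using C1c_Lipschitz[OF V[of n]] by blast
  obtain h where h: "has_finite_hilbert s ?u x h"
  proof (rule Lipschitz_has_finite_hilbert[of ?u K x L s])
    show "norm (?u y - ?u x) \<le> L * \<bar>y - x\<bar>" for y using L(2)[of "of_real y" "of_real x"] by (simp add: of_real_diff[symmetric] del: of_real_diff)
  qed (use K x cu in \<open>auto intro: borel_measurable_continuous_onI\<close>)
  let ?k = "\<lambda>i. kernel_integral \<gamma> ?z (Suc i) (V (n + 2 * Suc i))"
  have "?k sums (2 * \<i> * ((\<Sum>j. T ?z j) - A ?z 0))"
  proof (rule kernel_sums)
    fix i
    show "?k i = 2 * \<i> * ((\<integral>p. indicator \<Omega>p p * (b (n + 2 * Suc i) p * (om ?z p ^ Suc i / (p - ?z))) \<partial>lborel) + (\<integral>p. indicator \<Omega>p p * (a (n + 2 * Suc i) p * (om ?z p ^ Suc i / cnj (p - ?z))) \<partial>lborel))"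
      unfolding kernel_integral_om contour_integral_\<gamma>(1)[OF kernel_cont(1)[OF z1 cV]] contour_integral_\<gamma>(2)[OF kernel_cont(2)[OF z1 cV]]
      by (rule kernel_Suc_real[OF V z1, of "n + 2 * Suc i" i, folded om_def]) simp
  qed
  then have S: "(\<Sum>i. ?k i) = 2 * \<i> * ((\<Sum>j. T ?z j) - A ?z 0)" by (rule sums_unique[symmetric])
  have rk_real: "rk e 0 1 1 (of_real y - ?z) = - of_real ((x - y) / ((x - y)\<^sup>2 + e\<^sup>2))" for e y
  proof -
    have "of_real y - ?z = of_real (y - x)" by simp
    then have "rk e 0 1 1 (of_real y - ?z) = of_real (y - x) / of_real ((y - x)\<^sup>2 + e\<^sup>2)"
      unfolding rk_def qq_eq by (simp del: of_real_diff of_real_add)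
    also have "\<dots> = of_real ((y - x) / ((x - y)\<^sup>2 + e\<^sup>2))" by (simp add: power2_commute)
    also have "(y - x) / ((x - y)\<^sup>2 + e\<^sup>2) = - ((x - y) / ((x - y)\<^sup>2 + e\<^sup>2))" by (metis minus_diff_eq minus_divide_left)
    finally show ?thesis by simp
  qed
  have "(\<lambda>m. - (\<integral>y. ?u y * of_real ((x - y) / ((x - y)\<^sup>2 + (eps m)\<^sup>2)) \<partial>LS s)) \<longlonglongrightarrow> - (of_real pi * h)"
  proof (intro tendsto_minus smoothed_hilbert_limit h)
    interpret M: finite_measure "LS s" by (rule finite_LS)
    show "integrable (LS s) ?u"
      by (rule M.integrable_const_bound[where B=K]) (use K in \<open>auto intro: measurable_compose[OF LS_id_measurable borel_measurable_continuous_onI[OF cu]]\<close>)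
  qed
  moreover have "- (\<integral>y. ?u y * of_real ((x - y) / ((x - y)\<^sup>2 + (eps m)\<^sup>2)) \<partial>LS s) = pint_seg s (\<lambda>\<zeta>. V n \<zeta> * rk (eps m) 0 1 1 (\<zeta> - ?z))" for m
  proof -
    have "continuous_on UNIV (\<lambda>\<zeta>. V n \<zeta> * rk (eps m) 0 1 1 (\<zeta> - ?z))" by (intro continuous_on_mult cV continuous_rk(1)[OF eps_pos])
    then have "pint_seg s (\<lambda>\<zeta>. V n \<zeta> * rk (eps m) 0 1 1 (\<zeta> - ?z)) = (\<integral>y. V n (of_real y) * rk (eps m) 0 1 1 (of_real y - ?z) \<partial>LS s)"
      by (rule pint_seg_eq[OF s(1)])
    also have "\<dots> = (\<integral>y. - (?u y * of_real ((x - y) / ((x - y)\<^sup>2 + (eps m)\<^sup>2))) \<partial>LS s)"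
      unfolding rk_real by (simp only: mult_minus_right)
    finally show ?thesis by (simp only: integral_minus)
  qed
  ultimately have "(\<lambda>m. pint_seg s (\<lambda>\<zeta>. V n \<zeta> * rk (eps m) 0 1 1 (\<zeta> - ?z))) \<longlonglongrightarrow> - (of_real pi * h)" by (simp only:)
  from LIMSEQ_unique[OF this kernel_zero[OF V z1 chord_density[OF x]]]
  have e: "- (of_real pi * h) = 2 * \<i> * A ?z 0 + 2 * \<i> * of_real (pi * dens False) * V n ?z - pint \<gamma> D (\<lambda>\<zeta>. V n \<zeta> * (1 / (\<zeta> - ?z)))"
    unfolding A_def by simp
  have d2: "2 * \<i> * complex_of_real (pi * dens False) * v = \<i> * of_real pi * v" for v by (simp add: dens_def)
  have mv: "X = y + z + w" if "- w = y + z - X" for w X y z :: complex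
  proof -
    have "X = y + z - (y + z - X)" by simp
    then show ?thesis unfolding that[symmetric] by simp
  qed
  note e' = mv[OF e[unfolded d2]]
  have "contour_integral \<gamma> (\<lambda>\<zeta>. V n \<zeta> * (1 / (\<zeta> - ?z))) = 2 * \<i> * A ?z 0 + \<i> * of_real pi * V n ?z + of_real pi * h"
    unfolding contour_integral_\<gamma>(1)[OF kernel_cont(3)[OF z1 cV]] by (rule e')
  then have c: "contour_integral \<gamma> (\<lambda>\<zeta>. V n \<zeta> / (\<zeta> - ?z)) = 2 * \<i> * A ?z 0 + \<i> * of_real pi * V n ?z + of_real pi * h"
    by (simp only: times_divide_eq_right mult_1_right)
  have Tj: "(\<integral>\<zeta>\<in>\<Omega>p. W (n + 2 * j) \<zeta> / (\<zeta> - ?z) * ((cnj \<zeta> - ?z) / (\<zeta> - ?z)) ^ j \<partial>lborel) = T ?z j" for j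
    using set_integral_T[of j ?z] by simp
  have F: "F_fun \<gamma> \<Omega>p V W n x = V n ?z - \<i> * h"
  proof -
    have alg: "1 / (\<i> * P) * (2 * \<i> * a + \<i> * P * v + P * h) + 1 / (\<i> * P) * (2 * \<i> * (t - a)) - 2 / P * t = v - \<i> * h"
      if P: "P \<noteq> 0" for P a v t :: complex
    proof -
      \<comment> \<open>The new variable \<open>k\<close> removes the only division from the identity.\<close>
      define k where "k = t / P"
      have t: "t = P * k" using P by (simp add: k_def)
      have ii: "P * h = - (\<i> * (\<i> * (P * h)))" by simp
      have sum: "(2 * \<i> * a + \<i> * P * v + P * h) + 2 * \<i> * (t - a) = (\<i> * P) * (v - \<i> * h + 2 * k)"
        unfolding t by (subst ii) (simp add: algebra_simps)
      have c: "1 / c * (c * y) = y" if "c \<noteq> 0" for c y :: complex using that by simp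
      have "1 / (\<i> * P) * ((2 * \<i> * a + \<i> * P * v + P * h) + 2 * \<i> * (t - a)) = v - \<i> * h + 2 * k"
        unfolding sum by (rule c) (use P in simp)
      moreover have "2 / P * t = 2 * k" unfolding t using P by simp
      ultimately show ?thesis unfolding distrib_left[symmetric] by (simp only: add_diff_cancel_right')
    qed
    show ?thesis unfolding F_fun_def Let_def Tj c S by (rule alg) simp
  qed
  show ?thesis unfolding hilbert_equation_at_def
    by (rule exI[of _ h], rule conjI[OF h F[symmetric]])
qed

lemma in_L2_chord: "in_L2 s (\<lambda>x. V n (of_real x))"
proof -
  interpret MM: finite_measure "LS s" by (rule finite_LS)
  have cu: "continuous_on UNIV (\<lambda>x. V n (of_real x))" by (rule continuous_on_compose2[OF C1c_continuous[OF V] continuous_on_of_real_id]) simp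
  have m: "(\<lambda>x. V n (of_real x)) \<in> borel_measurable (LS s)" by (rule measurable_compose[OF LS_id_measurable borel_measurable_continuous_onI[OF cu]])
  obtain K where K: "\<And>z. norm (V n z) \<le> K" using V_bounded[of n] by blast
  have "integrable (LS s) (\<lambda>x. (norm (V n (of_real x)))\<^sup>2)"
  proof (rule MM.integrable_const_bound[where B="K\<^sup>2"], rule AE_I2)
    fix x
    have "(norm (V n (of_real x)))\<^sup>2 \<le> K\<^sup>2" by (intro power_mono K) auto
    then show "norm ((norm (V n (complex_of_real x)))\<^sup>2) \<le> K\<^sup>2" by simp
  qed (intro borel_measurable_power measurable_compose[OF m borel_measurable_norm])
  with m show ?thesis unfolding in_L2_def by blast
qed

lemma unique_solution_chord: "unique_L2_solution s (F_fun \<gamma> \<Omega>p V W n) (\<lambda>x. V n (of_real x))"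
  unfolding unique_L2_solution_def
proof (rule conjI[OF in_L2_chord conjI], rule ballI)
  fix x assume "x \<in> {-s<..<s}"
  then show "hilbert_equation_at s (\<lambda>x. V n (of_real x)) (F_fun \<gamma> \<Omega>p V W n) x" by (rule boundary_formula)
next
  show "\<forall>w. in_L2 s w \<and> (AE x in lebesgue_on {-s<..<s}. hilbert_equation_at s w (F_fun \<gamma> \<Omega>p V W n) x) \<longrightarrow>
      (AE x in lebesgue_on {-s<..<s}. w x = V n (of_real x))"
  proof (rule allI, rule impI, elim conjE)
    fix w assume w: "in_L2 s w" "AE x in lebesgue_on {-s<..<s}. hilbert_equation_at s w (F_fun \<gamma> \<Omega>p V W n) x"
    show "AE x in lebesgue_on {-s<..<s}. w x = V n (of_real x)"
      by (rule hilbert_equation_unique[OF s(1) in_L2_chord w(1) boundary_formula w(2)])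
  qed
qed

end

section \<open>Fourier modes of ray integrals\<close>

definition ray_int :: "real \<Rightarrow> nat \<Rightarrow> (complex \<Rightarrow> complex) \<Rightarrow> complex \<Rightarrow> real \<Rightarrow> complex" where
  "ray_int T k g z \<phi> = integral {0..T} (\<lambda>t. of_real (t ^ k) * g (z - of_real t * cis \<phi>))"

text \<open>A Fourier coefficient of a moment of \<open>g\<close> along rays of fixed length. The modes of the transport solutions are combinations of two of these, because \<open>\<theta> \<cdot> f = (cnj \<theta> f + \<theta> cnj f) / 2\<close>.\<close>
definition ray_mode :: "real \<Rightarrow> nat \<Rightarrow> int \<Rightarrow> (complex \<Rightarrow> complex) \<Rightarrow> complex \<Rightarrow> complex" where
  "ray_mode T k m g z = 1 / (2 * of_real pi) * integral {-pi..pi} (\<lambda>\<phi>. cis (of_int m * \<phi>) * ray_int T k g z \<phi>)"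

lemma ray_cont:
  assumes g: "continuous_on UNIV g"
    and "continuous_on S z" "continuous_on S t" "continuous_on S p"
  shows "continuous_on S (\<lambda>x. g (z x - of_real (t x) * cis (p x)))"
  by (rule continuous_on_compose2[OF g]) (auto intro!: continuous_intros assms)

lemma ray_int_continuous:
  assumes g: "continuous_on UNIV g"
  shows "continuous_on UNIV (\<lambda>(z, \<phi>). ray_int T k g z \<phi>)"
proof -
  have "continuous_on (UNIV \<times> cbox 0 T) (\<lambda>(p, t). of_real (t ^ k) * g (fst p - of_real t * cis (snd p)))"
    unfolding split_beta by (intro continuous_on_mult continuous_on_of_real continuous_on_power ray_cont[OF g] continuous_intros)
  from integral_continuous_on_param[OF this]
  show ?thesis unfolding ray_int_def by (simp add: split_beta)
qed

lemma ray_int_continuous_angle: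
  assumes g: "continuous_on UNIV g"
  shows "continuous_on S (ray_int T k g z)"
proof -
  have "continuous_on S (\<lambda>\<phi>. (z, \<phi>))" by (intro continuous_intros)
  from continuous_on_compose2[OF ray_int_continuous[OF g, of T k] this] show ?thesis by simp
qed

lemma ray_int_bound:
  assumes g: "continuous_on UNIV g" "\<And>w. norm (g w) \<le> M" and T: "T \<ge> 0"
  shows "norm (ray_int T k g z \<phi>) \<le> T ^ k * M * T"
proof -
  have M: "M \<ge> 0" using order_trans[OF norm_ge_zero g(2)] .
  have "norm (integral (cbox 0 T) (\<lambda>t. of_real (t ^ k) * g (z - of_real t * cis \<phi>))) \<le> T ^ k * M * measure lborel (cbox 0 T)"
  proof (rule integrable_bound)
    show "(\<lambda>t. of_real (t ^ k) * g (z - of_real t * cis \<phi>)) integrable_on cbox 0 T"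
      by (intro integrable_continuous continuous_on_mult continuous_on_of_real continuous_on_power ray_cont[OF g(1)] continuous_intros)
    show "norm (of_real (t ^ k) * g (z - of_real t * cis \<phi>)) \<le> T ^ k * M" if "t \<in> cbox 0 T" for t
    proof -
      have "\<bar>t ^ k\<bar> \<le> T ^ k" using that by (simp add: power_abs power_mono)
      then have "\<bar>t ^ k\<bar> * norm (g (z - of_real t * cis \<phi>)) \<le> T ^ k * M" by (intro mult_mono g(2)) (use T in auto)
      then show ?thesis by (simp add: norm_mult norm_power power_abs)
    qed
  qed (use M T in auto)
  then show ?thesis unfolding ray_int_def using T by simp
qed

lemma fourier_coeff_bound:
  fixes H :: "real \<Rightarrow> complex"
  assumes "continuous_on {-pi..pi} H" "\<And>\<phi>. norm (H \<phi>) \<le> B"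
  shows "norm (1 / (2 * of_real pi) * integral {-pi..pi} (\<lambda>\<phi>. cis (of_int m * \<phi>) * H \<phi>)) \<le> B"
proof -
  have B: "B \<ge> 0" using order_trans[OF norm_ge_zero assms(2)] .
  have "norm (integral (cbox (-pi) pi) (\<lambda>\<phi>. cis (of_int m * \<phi>) * H \<phi>)) \<le> B * measure lborel (cbox (-pi) pi)"
    by (rule integrable_bound) (use assms B in \<open>auto intro!: integrable_continuous_real continuous_intros simp: norm_mult\<close>)
  then show ?thesis by (simp add: norm_mult norm_divide field_simps)
qed

lemma ray_mode_bound:
  assumes g: "continuous_on UNIV g" "\<And>w. norm (g w) \<le> M" and T: "T \<ge> 0"
  shows "norm (ray_mode T k m g z) \<le> T ^ k * M * T"
  unfolding ray_mode_def
  by (rule fourier_coeff_bound) (rule ray_int_continuous_angle[OF g(1)], rule ray_int_bound[OF assms])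

lemma ray_mode_prod:
  assumes g: "continuous_on UNIV g"
  shows "ray_mode T k m g z = 1 / (2 * of_real pi) *
     integral (cbox (-pi, 0) (pi, T)) (\<lambda>p. cis (of_int m * fst p) * of_real (snd p ^ k) * g (z - of_real (snd p) * cis (fst p)))"
proof -
  have "continuous_on (cbox (-pi, 0) (pi, T)) (\<lambda>p. cis (of_int m * fst p) * of_real (snd p ^ k) * g (z - of_real (snd p) * cis (fst p)))"
    by (intro continuous_on_mult continuous_on_of_real continuous_on_power ray_cont[OF g] continuous_intros)
  from integral_prod_continuous[OF this] show ?thesis
    unfolding ray_mode_def ray_int_def by (simp add: mult.assoc)
qed

lemma ray_mode_support:
  assumes g: "\<And>z. r < norm z \<Longrightarrow> g z = 0" and z: "r + T < norm z"
  shows "ray_mode T k m g z = 0"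
proof -
  have "ray_int T k g z \<phi> = 0" for \<phi>
  proof -
    have "of_real (t ^ k) * g (z - of_real t * cis \<phi>) = 0" if "t \<in> {0..T}" for t
    proof -
      have "norm z \<le> norm (z - of_real t * cis \<phi>) + norm (of_real t * cis \<phi>)"
        using norm_triangle_ineq[of "z - of_real t * cis \<phi>" "of_real t * cis \<phi>"] by simp
      then have "r < norm (z - of_real t * cis \<phi>)" using z that by (simp add: norm_mult)
      then show ?thesis by (simp add: g)
    qed
    then have "integral {0..T} (\<lambda>t. of_real (t ^ k) * g (z - of_real t * cis \<phi>)) = integral {0..T} (\<lambda>t. 0)" by (rule integral_cong)
    then show ?thesis unfolding ray_int_def by simp
  qed
  then show ?thesis unfolding ray_mode_def by simp
qed

text \<open>Differentiation commutes with averages over translates, and the support grows by at most \<open>T\<close>.\<close>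
lemma C1c_ray_mode:
  assumes g: "C1c g a b" and T: "T \<ge> 0"
  shows "C1c (ray_mode T k m g) (ray_mode T k m a) (ray_mode T k m b)"
proof -
  note cg = C1c_continuous[OF g]
  have ca: "continuous_on UNIV a" and cb: "continuous_on UNIV b" and gd: "\<And>z. (g has_derivative (\<lambda>h. a z * h + b z * cnj h)) (at z)"
    using g unfolding C1c_def by auto
  obtain R where R: "R > 0" "\<And>z. R < norm z \<Longrightarrow> g z = 0 \<and> a z = 0 \<and> b z = 0"
    using g unfolding C1c_def by auto
  define q where "q p = cis (of_int m * fst p) * of_real (snd p ^ k)" for p :: "real \<times> real"
  define w where "w p = complex_of_real (snd p) * cis (fst p)" for p :: "real \<times> real"
  have cq: "continuous_on S q" for S unfolding q_def by (intro continuous_intros)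
  have cw: "continuous_on S w" for S unfolding w_def by (intro continuous_intros)
  have qb: "ray_mode T k m u z = 1 / (2 * of_real pi) * integral (cbox (-pi, 0) (pi, T)) (\<lambda>p. q p * u (z - w p))" if "continuous_on UNIV u" for u z
    unfolding ray_mode_prod[OF that] q_def w_def ..
  have cu: "continuous_on S (\<lambda>x. q (pp x) * u (zz x - w (pp x)))" if "continuous_on UNIV u" "continuous_on S zz" "continuous_on S pp"
    for u :: "complex \<Rightarrow> complex" and S :: "'x::topological_space set" and zz pp
    by (intro continuous_on_mult continuous_on_compose2[OF that(1)] continuous_on_compose2[OF cq[of UNIV]] continuous_on_diff that(2,3) continuous_on_compose2[OF cw[of UNIV]]) auto
  define Cn where "Cn = Blinfun cnj"
  have Cn: "blinfun_apply Cn h = cnj h" for h unfolding Cn_def by (simp add: bounded_linear_Blinfun_apply bounded_linear_cnj)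
  define Fx where "Fx z p = blinfun_mult_right (q p * a (z - w p)) + (blinfun_mult_right (q p * b (z - w p)) o\<^sub>L Cn)" for z p
  have Fx: "blinfun_apply (Fx z p) h = q p * a (z - w p) * h + q p * b (z - w p) * cnj h" for z p h
    unfolding Fx_def by (simp add: blinfun.add_left Cn)
  have cF: "continuous_on (UNIV \<times> cbox (-pi, 0) (pi, T)) (\<lambda>(z, p). Fx z p)"
    unfolding Fx_def split_beta
    by (intro continuous_on_add bounded_linear.continuous_on[OF bounded_linear_blinfun_mult_right] cu ca cb
        bounded_bilinear.continuous_on[OF bounded_bilinear_blinfun_compose] continuous_intros)
  have "((\<lambda>z. integral (cbox (-pi, 0) (pi, T)) (\<lambda>p. q p * g (z - w p))) has_derivative
        blinfun_apply (integral (cbox (-pi, 0) (pi, T)) (Fx z))) (at z)" for z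
  proof (rule leibniz_rule[where U=UNIV, OF _ _ cF])
    fix z p
    have "((\<lambda>z. g (z - w p)) has_derivative (\<lambda>h. a (z - w p) * h + b (z - w p) * cnj h)) (at z)"
      by (rule has_derivative_compose[OF _ gd, of "\<lambda>z. z - w p" "\<lambda>h. h", simplified]) (auto intro!: derivative_eq_intros)
    then have "((\<lambda>z. q p * g (z - w p)) has_derivative (\<lambda>h. q p * (a (z - w p) * h + b (z - w p) * cnj h))) (at z)"
      by (rule has_derivative_mult_right)
    moreover have "(\<lambda>h. q p * (a (z - w p) * h + b (z - w p) * cnj h)) = blinfun_apply (Fx z p)"
      by (auto simp: Fx distrib_left mult.assoc)
    ultimately show "((\<lambda>z. q p * g (z - w p)) has_derivative blinfun_apply (Fx z p)) (at z)" by simp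
    show "(\<lambda>p. q p * g (z - w p)) integrable_on cbox (-pi, 0) (pi, T)"
      by (intro integrable_continuous cu cg continuous_intros)
  qed auto
  from has_derivative_mult_right[OF this, of "1 / (2 * of_real pi)"]
  have d: "((\<lambda>z. ray_mode T k m g z) has_derivative (\<lambda>h. 1 / (2 * of_real pi) * blinfun_apply (integral (cbox (-pi, 0) (pi, T)) (Fx z)) h)) (at z)" for z
    unfolding qb[OF cg] .
  have e: "1 / (2 * of_real pi) * blinfun_apply (integral (cbox (-pi, 0) (pi, T)) (Fx z)) h = ray_mode T k m a z * h + ray_mode T k m b z * cnj h" for z h
  proof -
    have i: "(\<lambda>p. q p * a (z - w p)) integrable_on cbox (-pi, 0) (pi, T)" "(\<lambda>p. q p * b (z - w p)) integrable_on cbox (-pi, 0) (pi, T)"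
      by (intro integrable_continuous cu ca cb continuous_intros)+
    have "Fx z integrable_on cbox (-pi, 0) (pi, T)"
    proof (rule integrable_continuous)
      have "continuous_on (cbox (-pi, 0) (pi, T)) (\<lambda>p. (z, p))" by (intro continuous_intros)
      from continuous_on_compose2[OF cF this] show "continuous_on (cbox (-pi, 0) (pi, T)) (Fx z)" by auto
    qed
    from blinfun_apply_integral[OF this, of h]
    have "blinfun_apply (integral (cbox (-pi, 0) (pi, T)) (Fx z)) h = integral (cbox (-pi, 0) (pi, T)) (\<lambda>p. q p * a (z - w p) * h + q p * b (z - w p) * cnj h)"
      unfolding Fx .
    also have "\<dots> = integral (cbox (-pi, 0) (pi, T)) (\<lambda>p. q p * a (z - w p) * h) + integral (cbox (-pi, 0) (pi, T)) (\<lambda>p. q p * b (z - w p) * cnj h)"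
      by (intro integral_add integrable_on_mult_left i)
    also have "\<dots> = integral (cbox (-pi, 0) (pi, T)) (\<lambda>p. q p * a (z - w p)) * h + integral (cbox (-pi, 0) (pi, T)) (\<lambda>p. q p * b (z - w p)) * cnj h"
      by simp
    finally have x: "blinfun_apply (integral (cbox (-pi, 0) (pi, T)) (Fx z)) h = integral (cbox (-pi, 0) (pi, T)) (\<lambda>p. q p * a (z - w p)) * h + integral (cbox (-pi, 0) (pi, T)) (\<lambda>p. q p * b (z - w p)) * cnj h" .
    show ?thesis unfolding x qb[OF ca] qb[OF cb] by (simp only: distrib_left mult.assoc)
  qed
  have cont: "continuous_on UNIV (ray_mode T k m u)" if u: "continuous_on UNIV u" for u
  proof -
    have "continuous_on (UNIV \<times> cbox (-pi, 0) (pi, T)) (\<lambda>(z, p). q p * u (z - w p))"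
      unfolding split_beta by (intro cu u continuous_intros)
    from integral_continuous_on_param[OF this] show ?thesis
      unfolding qb[OF u] by (intro continuous_on_mult continuous_on_const)
  qed
  have supp: "ray_mode T k m u z = 0" if "\<And>z. R < norm z \<Longrightarrow> u z = 0" "R + T < norm z" for u z
    by (rule ray_mode_support[OF that])
  show ?thesis unfolding C1c_def
  proof (intro conjI allI exI[of _ "R + T"] impI)
    show "(ray_mode T k m g has_derivative (\<lambda>h. ray_mode T k m a z * h + ray_mode T k m b z * cnj h)) (at z)" for z
      using d[of z] unfolding e .
  qed (use R T in \<open>auto intro!: cont ca cb supp\<close>)
qed

lemma ray_mode_cnj:
  assumes g: "continuous_on UNIV g"
  shows "cnj (ray_mode T k m g z) = ray_mode T k (- m) (\<lambda>w. cnj (g w)) z"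
proof -
  have 1: "cnj (ray_int T k g z \<phi>) = ray_int T k (\<lambda>w. cnj (g w)) z \<phi>" for \<phi>
    unfolding ray_int_def integral_cnj by simp
  show ?thesis unfolding ray_mode_def by (simp add: integral_cnj 1 cis_cnj)
qed

lemma ray_mode_linear:
  assumes "continuous_on UNIV g" "continuous_on UNIV h"
  shows "ray_mode T k (m + 1) g z + c * ray_mode T k (m - 1) h z
    = 1 / (2 * of_real pi) * integral {-pi..pi} (\<lambda>\<phi>. cis (of_int m * \<phi>) * (cis \<phi> * ray_int T k g z \<phi> + c * (cis (- \<phi>) * ray_int T k h z \<phi>)))"
proof -
  have i: "(\<lambda>\<phi>. cis (of_int m * \<phi>) * (cis \<phi> * ray_int T k g z \<phi>)) integrable_on {-pi..pi}"
     "(\<lambda>\<phi>. cis (of_int m * \<phi>) * (cis (- \<phi>) * ray_int T k h z \<phi>)) integrable_on {-pi..pi}"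
    by (intro integrable_continuous_real continuous_on_mult ray_int_continuous_angle assms continuous_intros)+
  have e: "cis (of_int (m + 1) * \<phi>) = cis (of_int m * \<phi>) * cis \<phi>" "cis (of_int (m - 1) * \<phi>) = cis (of_int m * \<phi>) * cis (- \<phi>)" for \<phi>
    by (simp_all add: cis_mult algebra_simps)
  have "integral {-pi..pi} (\<lambda>\<phi>. cis (of_int m * \<phi>) * (cis \<phi> * ray_int T k g z \<phi> + c * (cis (- \<phi>) * ray_int T k h z \<phi>)))
    = integral {-pi..pi} (\<lambda>\<phi>. cis (of_int m * \<phi>) * (cis \<phi> * ray_int T k g z \<phi>) + c * (cis (of_int m * \<phi>) * (cis (- \<phi>) * ray_int T k h z \<phi>)))"
    by (simp add: distrib_left mult.left_commute)
  also have "\<dots> = integral {-pi..pi} (\<lambda>\<phi>. cis (of_int m * \<phi>) * (cis \<phi> * ray_int T k g z \<phi>)) + c * integral {-pi..pi} (\<lambda>\<phi>. cis (of_int m * \<phi>) * (cis (- \<phi>) * ray_int T k h z \<phi>))"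
    using integral_add[OF i(1) integrable_on_mult_right[OF i(2), of c]] by simp
  finally show ?thesis unfolding ray_mode_def e by (simp add: distrib_left mult.assoc mult.left_commute)
qed

lemma has_vector_derivative_wirt:
  assumes "wirt g a b (c t)" "(c has_vector_derivative c') (at t within S)"
  shows "((\<lambda>t. g (c t)) has_vector_derivative (a * c' + b * cnj c')) (at t within S)"
proof -
  have "((\<lambda>t. g (c t)) has_derivative (\<lambda>x. a * (x *\<^sub>R c') + b * cnj (x *\<^sub>R c'))) (at t within S)"
    using assms unfolding wirt_def has_vector_derivative_def
    by (rule has_derivative_compose[rotated])
  then show ?thesis unfolding has_vector_derivative_def by (simp add: algebra_simps)
qed

lemma C1c_wirt: "C1c g a b \<Longrightarrow> wirt g (a z) (b z) z"
  unfolding C1c_def wirt_def by blast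

lemma ray_derivative:
  assumes g: "C1c g a b"
  shows "((\<lambda>t. g (z - of_real t * cis \<phi>)) has_vector_derivative
     - (cis \<phi> * a (z - of_real t * cis \<phi>) + cis (- \<phi>) * b (z - of_real t * cis \<phi>))) (at t within S)"
proof -
  have "((\<lambda>t. z - of_real t * cis \<phi>) has_vector_derivative - cis \<phi>) (at t within S)"
    by (auto intro!: derivative_eq_intros)
  from has_vector_derivative_wirt[OF C1c_wirt[OF g] this] show ?thesis
    by (simp add: cis_cnj algebra_simps)
qed

lemma ray_int_combine:
  assumes "continuous_on UNIV a" "continuous_on UNIV b"
  shows "c * ray_int T k a z \<phi> + d * ray_int T k b z \<phi> = integral {0..T} (\<lambda>t. of_real (t ^ k) * (c * a (z - of_real t * cis \<phi>) + d * b (z - of_real t * cis \<phi>)))"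
proof -
  have i: "(\<lambda>t. of_real (t ^ k) * u (z - of_real t * cis \<phi>)) integrable_on {0..T}" if "continuous_on UNIV u" for u :: "complex \<Rightarrow> complex"
    by (intro integrable_continuous_real continuous_on_mult continuous_on_of_real continuous_on_power ray_cont[OF that] continuous_intros)
  have "integral {0..T} (\<lambda>t. of_real (t ^ k) * (c * a (z - of_real t * cis \<phi>) + d * b (z - of_real t * cis \<phi>)))
    = integral {0..T} (\<lambda>t. c * (of_real (t ^ k) * a (z - of_real t * cis \<phi>)) + d * (of_real (t ^ k) * b (z - of_real t * cis \<phi>)))"
    by (simp add: distrib_left mult.left_commute)
  also have "\<dots> = c * ray_int T k a z \<phi> + d * ray_int T k b z \<phi>"
    unfolding ray_int_def
    using integral_add[OF integrable_on_mult_right[OF i[OF assms(1)], of c] integrable_on_mult_right[OF i[OF assms(2)], of d]] by simp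
  finally show ?thesis by simp
qed

text \<open>Along the ray, \<open>cis \<phi> * d g + cis (- \<phi>) * dbar g\<close> is the derivative of \<open>g\<close> up to sign.\<close>
lemma ray_int_transport0:
  assumes g: "C1c g a b" and T: "T \<ge> 0"
  shows "cis \<phi> * ray_int T 0 a z \<phi> + cis (- \<phi>) * ray_int T 0 b z \<phi> = g z - g (z - of_real T * cis \<phi>)"
proof -
  note c = C1c_derivatives_continuous[OF g]
  have "((\<lambda>t. - (cis \<phi> * a (z - of_real t * cis \<phi>) + cis (- \<phi>) * b (z - of_real t * cis \<phi>))) has_integral
      (g (z - of_real T * cis \<phi>) - g (z - of_real 0 * cis \<phi>))) {0..T}"
    by (rule fundamental_theorem_of_calculus[OF T ray_derivative[OF g]])
  from integral_unique[OF this] show ?thesis unfolding ray_int_combine[OF c] integral_neg by (simp add: neg_equal_iff_equal[of _ "g z - _", symmetric] del: neg_equal_iff_equal)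
qed

text \<open>As before, with one integration by parts for the weight \<open>t\<close>.\<close>
lemma ray_int_transport1:
  assumes g: "C1c g a b" and T: "T \<ge> 0"
  shows "cis \<phi> * ray_int T 1 a z \<phi> + cis (- \<phi>) * ray_int T 1 b z \<phi> = ray_int T 0 g z \<phi> - of_real T * g (z - of_real T * cis \<phi>)"
proof -
  note c = C1c_derivatives_continuous[OF g]
  note cg = C1c_continuous[OF g]
  define E where "E t = cis \<phi> * a (z - of_real t * cis \<phi>) + cis (- \<phi>) * b (z - of_real t * cis \<phi>)" for t
  have "((\<lambda>t. of_real t * - E t + 1 * g (z - of_real t * cis \<phi>)) has_integral
      (of_real T * g (z - of_real T * cis \<phi>) - of_real 0 * g (z - of_real 0 * cis \<phi>))) {0..T}"
    unfolding E_def
    by (rule fundamental_theorem_of_calculus[OF T has_vector_derivative_mult[OF _ ray_derivative[OF g]]])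
      (auto intro!: derivative_eq_intros)
  from integral_unique[OF this]
  have 1: "integral {0..T} (\<lambda>t. g (z - of_real t * cis \<phi>) - of_real t * E t) = of_real T * g (z - of_real T * cis \<phi>)" by simp
  have "(\<lambda>t. g (z - of_real t * cis \<phi>)) integrable_on {0..T}" "(\<lambda>t. of_real t * E t) integrable_on {0..T}"
    unfolding E_def by (intro integrable_continuous_real continuous_on_mult continuous_on_add continuous_on_of_real ray_cont[OF cg] ray_cont[OF c(1)] ray_cont[OF c(2)] continuous_intros)+
  from integral_diff[OF this] 1
  show ?thesis unfolding ray_int_combine[OF c] E_def[symmetric] by (simp add: ray_int_def)
qed

lemma cis_vector_derivative:
  "((\<lambda>\<phi>. cis (c * \<phi>)) has_vector_derivative \<i> * of_real c * cis (c * \<phi>)) (at \<phi> within S)"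
proof -
  have "((\<lambda>w. exp (\<i> * of_real c * w)) has_field_derivative \<i> * of_real c * exp (\<i> * of_real c * of_real \<phi>)) (at (of_real \<phi>))"
    by (auto intro!: derivative_eq_intros)
  from has_vector_derivative_real_field[OF this] show ?thesis by (simp add: cis_conv_exp mult.assoc)
qed

lemma cis_int_pi: "cis (of_int m * pi) = cis (of_int m * (- pi))"
  using sin_npi_int[of m] by (simp add: complex_eq_iff mult.commute)

lemma integral_cis_int: "integral {-pi..pi} (\<lambda>\<phi>. cis (of_int m * \<phi>)) = (if m = 0 then 2 * of_real pi else 0)"
proof (cases "m = 0")
  case False
  have "((\<lambda>\<phi>. \<i> * of_real (of_int m) * cis (of_int m * \<phi>)) has_integral (cis (of_int m * pi) - cis (of_int m * (- pi)))) {-pi..pi}"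
    by (rule fundamental_theorem_of_calculus[OF _ cis_vector_derivative]) simp
  then have "((\<lambda>\<phi>. \<i> * of_real (of_int m) * cis (of_int m * \<phi>)) has_integral 0) {-pi..pi}" unfolding cis_int_pi by simp
  from integral_unique[OF this] False show ?thesis by simp
qed (simp add: scaleR_conv_of_real)

lemma ray_int_angular:
  assumes g: "C1c g a b" and "\<phi> \<in> {-pi..pi}"
  shows "(ray_int T 0 g z has_vector_derivative - \<i> * (cis \<phi> * ray_int T 1 a z \<phi> - cis (- \<phi>) * ray_int T 1 b z \<phi>)) (at \<phi> within {-pi..pi})"
proof -
  note c = C1c_derivatives_continuous[OF g]
  note cg = C1c_continuous[OF g]
  define E where "E \<phi> t = of_real (t ^ 1) * ((- \<i> * cis \<phi>) * a (z - of_real t * cis \<phi>) + (\<i> * cis (- \<phi>)) * b (z - of_real t * cis \<phi>))" for \<phi> t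
  have "((\<lambda>\<phi>. integral (cbox 0 T) (\<lambda>t. g (z - of_real t * cis \<phi>))) has_vector_derivative integral (cbox 0 T) (E \<phi>)) (at \<phi> within {-pi..pi})"
  proof (rule leibniz_rule_vector_derivative)
    fix \<phi> t
    have "((\<lambda>\<phi>. z - of_real t * cis \<phi>) has_vector_derivative - (of_real t * (\<i> * cis \<phi>))) (at \<phi> within {-pi..pi})"
      using has_vector_derivative_diff[OF has_vector_derivative_const has_vector_derivative_mult_right[OF cis_vector_derivative[of 1 \<phi>]], of z "of_real t"]
      by simp
    from has_vector_derivative_wirt[OF C1c_wirt[OF g] this]
    show "((\<lambda>\<phi>. g (z - of_real t * cis \<phi>)) has_vector_derivative E \<phi> t) (at \<phi> within {-pi..pi})"
      unfolding E_def by (simp add: cis_cnj algebra_simps)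
    show "(\<lambda>t. g (z - of_real t * cis \<phi>)) integrable_on cbox 0 T"
      by (intro integrable_continuous ray_cont[OF cg] continuous_intros)
    show "continuous_on ({-pi..pi} \<times> cbox 0 T) (\<lambda>(x, t). E x t)" unfolding E_def split_beta
      by (intro continuous_on_mult continuous_on_add continuous_on_of_real continuous_on_power ray_cont[OF c(1)] ray_cont[OF c(2)] continuous_intros)
  qed (use assms in auto)
  moreover have "integral {0..T} (E \<phi>) = - \<i> * (cis \<phi> * ray_int T 1 a z \<phi> - cis (- \<phi>) * ray_int T 1 b z \<phi>)"
    using ray_int_combine[OF c, of "- \<i> * cis \<phi>" T 1 z \<phi> "\<i> * cis (- \<phi>)"] unfolding E_def by (simp add: algebra_simps)
  ultimately show ?thesis unfolding ray_int_def by simp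
qed

text \<open>Integration by parts in the angle gains a factor \<open>1 / m\<close>, at the price of derivatives of \<open>g\<close> whose modes are square summable.\<close>
lemma ray_mode_angular:
  assumes g: "C1c g a b"
  shows "of_int m * ray_mode T 0 m g z = ray_mode T 1 (m + 1) a z - ray_mode T 1 (m - 1) b z"
proof -
  note c = C1c_derivatives_continuous[OF g]
  note cg = C1c_continuous[OF g]
  define X where "X \<phi> = cis (of_int m * \<phi>) * ray_int T 0 g z \<phi>" for \<phi>
  define Y where "Y \<phi> = cis (of_int m * \<phi>) * (cis \<phi> * ray_int T 1 a z \<phi> + (-1) * (cis (- \<phi>) * ray_int T 1 b z \<phi>))" for \<phi>
  have "((\<lambda>\<phi>. \<i> * (of_int m * X \<phi> - Y \<phi>)) has_integral (X pi - X (- pi))) {-pi..pi}"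
  proof (rule fundamental_theorem_of_calculus)
    fix \<phi> assume p: "\<phi> \<in> {-pi..pi}"
    have "of_int m * X \<phi> * \<i> - \<i> * Y \<phi> = cis (of_int m * \<phi>) * (- \<i> * (cis \<phi> * ray_int T 1 a z \<phi> - cis (- \<phi>) * ray_int T 1 b z \<phi>)) + \<i> * of_real (of_int m) * cis (of_int m * \<phi>) * ray_int T 0 g z \<phi>"
      unfolding X_def Y_def by (simp add: distrib_left right_diff_distrib mult_ac)
    then have e: "\<i> * (of_int m * X \<phi> - Y \<phi>) = cis (of_int m * \<phi>) * (- \<i> * (cis \<phi> * ray_int T 1 a z \<phi> - cis (- \<phi>) * ray_int T 1 b z \<phi>)) + \<i> * of_real (of_int m) * cis (of_int m * \<phi>) * ray_int T 0 g z \<phi>"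
      by (simp only: right_diff_distrib mult.commute[of _ \<i>])
    show "(X has_vector_derivative \<i> * (of_int m * X \<phi> - Y \<phi>)) (at \<phi> within {-pi..pi})"
      unfolding e unfolding X_def by (rule has_vector_derivative_mult[OF cis_vector_derivative ray_int_angular[OF g p]])
  qed simp
  moreover have "X pi = X (- pi)"
  proof -
    have "cis pi = cis (- pi)" by (simp add: complex_eq_iff)
    with cis_int_pi[of m] show ?thesis unfolding X_def ray_int_def by (simp only:)
  qed
  ultimately have "integral {-pi..pi} (\<lambda>\<phi>. \<i> * (of_int m * X \<phi> - Y \<phi>)) = X pi - X pi" by (simp only: integral_unique)
  then have 1: "integral {-pi..pi} (\<lambda>\<phi>. of_int m * X \<phi> - Y \<phi>) = 0" by simp
  have i: "(\<lambda>\<phi>. of_int m * X \<phi>) integrable_on {-pi..pi}" "Y integrable_on {-pi..pi}"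
    unfolding X_def Y_def by (intro integrable_continuous_real continuous_on_mult continuous_on_add ray_int_continuous_angle cg c continuous_intros)+
  from integral_diff[OF i] 1 have "of_int m * integral {-pi..pi} X = integral {-pi..pi} Y" by simp
  moreover have "ray_mode T 1 (m + 1) a z - ray_mode T 1 (m - 1) b z = 1 / (2 * of_real pi) * integral {-pi..pi} Y"
    using ray_mode_linear[OF c, of T 1 m z "-1"] unfolding Y_def by simp
  moreover have "ray_mode T 0 m g z = 1 / (2 * of_real pi) * integral {-pi..pi} X" unfolding ray_mode_def X_def ..
  ultimately show ?thesis by simp
qed

text \<open>The transport equation in Fourier modes: the source of the plain moment is \<open>g\<close> in the mode \<open>m = 0\<close> only, that of the first moment is the plain moment.\<close>
lemma ray_mode_transport:
  assumes g: "C1c g a b" and T: "T \<ge> 0" and far: "\<And>\<phi>. g (z - of_real T * cis \<phi>) = 0"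
  shows "ray_mode T 0 (m + 1) a z + ray_mode T 0 (m - 1) b z = (if m = 0 then g z else 0)" (is ?A)
    and "ray_mode T 1 (m + 1) a z + ray_mode T 1 (m - 1) b z = ray_mode T 0 m g z" (is ?B)
proof -
  note c = C1c_derivatives_continuous[OF g]
  show ?A using ray_mode_linear[OF c, of T 0 m z 1]
    by (simp only: mult_1 ray_int_transport0[OF g T] far diff_zero integral_mult_left integral_cis_int) simp
  show ?B using ray_mode_linear[OF c, of T 1 m z 1]
    by (simp only: mult_1 ray_int_transport1[OF g T] far diff_zero mult_zero_right) (simp add: ray_mode_def)
qed

lemma Bessel:
  fixes H :: "real \<Rightarrow> complex" and m :: "nat \<Rightarrow> int"
  assumes H: "continuous_on {-pi..pi} H" "\<And>\<phi>. norm (H \<phi>) \<le> B" and m: "inj m"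
  shows "(\<Sum>j<N. (norm (1 / (2 * of_real pi) * integral {-pi..pi} (\<lambda>\<phi>. cis (of_int (m j) * \<phi>) * H \<phi>)))\<^sup>2) \<le> B\<^sup>2"
proof -
  define e where "e j \<phi> = cis (of_int (m j) * \<phi>)" for j \<phi>
  define I where "I f = integral {-pi..pi} f" for f :: "real \<Rightarrow> complex"
  define c where "c j = 1 / (2 * of_real pi) * I (\<lambda>\<phi>. e j \<phi> * H \<phi>)" for j
  define S where "S \<phi> = (\<Sum>j<N. c j * cnj (e j \<phi>))" for \<phi>
  define D where "D \<phi> = H \<phi> - S \<phi>" for \<phi>
  have ce: "continuous_on {-pi..pi} (e j)" for j unfolding e_def by (intro continuous_intros)
  have cS: "continuous_on {-pi..pi} S" unfolding S_def by (intro continuous_intros ce)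
  have cD: "continuous_on {-pi..pi} D" unfolding D_def by (intro continuous_intros cS H)
  note ci = integrable_continuous_real
  have Ic: "I (\<lambda>\<phi>. e j \<phi> * H \<phi>) = 2 * of_real pi * c j" for j unfolding c_def by simp
  have orth: "I (\<lambda>\<phi>. e k \<phi> * cnj (e j \<phi>)) = (if j = k then 2 * of_real pi else 0)" for j k
  proof -
    have "e k \<phi> * cnj (e j \<phi>) = cis (of_int (m k - m j) * \<phi>)" for \<phi>
      unfolding e_def by (simp add: cis_cnj cis_mult algebra_simps)
    then show ?thesis unfolding I_def using integral_cis_int[of "m k - m j"] m by (auto dest: injD)
  qed
  have IS: "I (\<lambda>\<phi>. e k \<phi> * S \<phi>) = 2 * of_real pi * c k" if "k < N" for k
  proof -
    have "I (\<lambda>\<phi>. e k \<phi> * S \<phi>) = I (\<lambda>\<phi>. \<Sum>j<N. c j * (e k \<phi> * cnj (e j \<phi>)))"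
      unfolding S_def by (simp add: sum_distrib_left mult.left_commute)
    also have "\<dots> = (\<Sum>j<N. I (\<lambda>\<phi>. c j * (e k \<phi> * cnj (e j \<phi>))))"
      unfolding I_def by (intro integral_sum ci continuous_intros ce) auto
    also have "\<dots> = (\<Sum>j<N. c j * I (\<lambda>\<phi>. e k \<phi> * cnj (e j \<phi>)))" unfolding I_def by simp
    also have "\<dots> = (\<Sum>j<N. if j = k then 2 * of_real pi * c k else 0)" unfolding orth by (intro sum.cong) auto
    finally show ?thesis using that by simp
  qed
  have ID: "I (\<lambda>\<phi>. e k \<phi> * D \<phi>) = 0" if "k < N" for k
  proof -
    have "I (\<lambda>\<phi>. e k \<phi> * D \<phi>) = I (\<lambda>\<phi>. e k \<phi> * H \<phi>) - I (\<lambda>\<phi>. e k \<phi> * S \<phi>)"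
      unfolding I_def D_def right_diff_distrib by (intro integral_diff ci continuous_intros ce cS H)
    then show ?thesis unfolding Ic IS[OF that] by simp
  qed
  have cS': "cnj (S \<phi>) = (\<Sum>j<N. cnj (c j) * e j \<phi>)" for \<phi> unfolding S_def by simp
  have lin: "I (\<lambda>\<phi>. U \<phi> * cnj (S \<phi>)) = (\<Sum>j<N. cnj (c j) * I (\<lambda>\<phi>. e j \<phi> * U \<phi>))" if "continuous_on {-pi..pi} U" for U
  proof -
    have "I (\<lambda>\<phi>. U \<phi> * cnj (S \<phi>)) = I (\<lambda>\<phi>. \<Sum>j<N. cnj (c j) * (e j \<phi> * U \<phi>))"
      unfolding cS' by (simp add: sum_distrib_left mult_ac)
    also have "\<dots> = (\<Sum>j<N. I (\<lambda>\<phi>. cnj (c j) * (e j \<phi> * U \<phi>)))"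
      unfolding I_def by (intro integral_sum ci continuous_intros ce that) auto
    finally show ?thesis unfolding I_def by simp
  qed
  have "I (\<lambda>\<phi>. D \<phi> * cnj (D \<phi>)) = I (\<lambda>\<phi>. H \<phi> * cnj (H \<phi>) - cnj (H \<phi> * cnj (S \<phi>)) - D \<phi> * cnj (S \<phi>))"
    unfolding D_def by (simp add: algebra_simps)
  also have "\<dots> = I (\<lambda>\<phi>. H \<phi> * cnj (H \<phi>)) - I (\<lambda>\<phi>. cnj (H \<phi> * cnj (S \<phi>))) - I (\<lambda>\<phi>. D \<phi> * cnj (S \<phi>))"
    unfolding I_def by (subst integral_diff, (intro ci continuous_intros H cS cD)+, subst integral_diff, (intro ci continuous_intros H cS cD)+) (rule refl)
  also have "I (\<lambda>\<phi>. D \<phi> * cnj (S \<phi>)) = 0" unfolding lin[OF cD] by (intro sum.neutral) (simp add: ID)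
  also have "I (\<lambda>\<phi>. cnj (H \<phi> * cnj (S \<phi>))) = cnj (I (\<lambda>\<phi>. H \<phi> * cnj (S \<phi>)))"
    unfolding I_def by (rule integral_cnj[symmetric])
  also have "\<dots> = 2 * of_real pi * of_real (\<Sum>j<N. (norm (c j))\<^sup>2)"
    unfolding lin[OF H(1)] Ic by (simp add: sum_distrib_left complex_norm_square mult_ac del: of_real_power)
  finally have "I (\<lambda>\<phi>. D \<phi> * cnj (D \<phi>)) = I (\<lambda>\<phi>. H \<phi> * cnj (H \<phi>)) - of_real (2 * pi * (\<Sum>j<N. (norm (c j))\<^sup>2))" by simp
  moreover have nn: "I (\<lambda>\<phi>. U \<phi> * cnj (U \<phi>)) = of_real (integral {-pi..pi} (\<lambda>\<phi>. (norm (U \<phi>))\<^sup>2))" if "continuous_on {-pi..pi} U" for U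
  proof -
    have "(\<lambda>\<phi>. (norm (U \<phi>))\<^sup>2) integrable_on {-pi..pi}" by (intro ci continuous_intros that)
    then have "((\<lambda>\<phi>. of_real ((norm (U \<phi>))\<^sup>2)) has_integral (of_real (integral {-pi..pi} (\<lambda>\<phi>. (norm (U \<phi>))\<^sup>2)) :: complex)) {-pi..pi}"
      by (intro has_integral_of_real integrable_integral)
    then show ?thesis unfolding I_def complex_norm_square by (rule integral_unique)
  qed
  ultimately have "complex_of_real (integral {-pi..pi} (\<lambda>\<phi>. (norm (D \<phi>))\<^sup>2)) = of_real (integral {-pi..pi} (\<lambda>\<phi>. (norm (H \<phi>))\<^sup>2) - 2 * pi * (\<Sum>j<N. (norm (c j))\<^sup>2))"
    unfolding nn[OF cD] nn[OF H(1)] by simp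
  then have "integral {-pi..pi} (\<lambda>\<phi>. (norm (D \<phi>))\<^sup>2) = integral {-pi..pi} (\<lambda>\<phi>. (norm (H \<phi>))\<^sup>2) - 2 * pi * (\<Sum>j<N. (norm (c j))\<^sup>2)"
    unfolding of_real_eq_iff .
  moreover have "0 \<le> integral {-pi..pi} (\<lambda>\<phi>. (norm (D \<phi>))\<^sup>2)" by (intro integral_nonneg ci continuous_intros cD) simp
  moreover have "integral {-pi..pi} (\<lambda>\<phi>. (norm (H \<phi>))\<^sup>2) \<le> integral {-pi..pi} (\<lambda>\<phi>. B\<^sup>2)"
    by (intro integral_le ci continuous_intros H(1) power_mono H(2)) auto
  moreover have "integral {-pi..pi} (\<lambda>\<phi>. B\<^sup>2) = 2 * pi * B\<^sup>2" by simp
  ultimately have "2 * pi * (\<Sum>j<N. (norm (c j))\<^sup>2) \<le> 2 * pi * B\<^sup>2" by linarith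
  then have "(\<Sum>j<N. (norm (c j))\<^sup>2) \<le> B\<^sup>2" by (rule mult_left_le_imp_le) simp
  then show ?thesis unfolding c_def I_def e_def .
qed

lemma summable_bound_square:
  fixes x :: "nat \<Rightarrow> complex"
  assumes "\<And>N. (\<Sum>j<N. (norm (x j))\<^sup>2) \<le> B"
  shows "x \<longlonglongrightarrow> 0"
proof -
  have "summable (\<lambda>j. (norm (x j))\<^sup>2)"
    by (rule bounded_imp_summable[of _ B]) (use assms[of "Suc _"] in \<open>auto simp: lessThan_Suc_atMost\<close>)
  then have "(\<lambda>j. (norm (x j))\<^sup>2) \<longlonglongrightarrow> 0" by (rule summable_LIMSEQ_zero)
  then have "(\<lambda>j. sqrt ((norm (x j))\<^sup>2)) \<longlonglongrightarrow> sqrt 0" by (rule tendsto_real_sqrt)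
  then show ?thesis by (simp add: tendsto_norm_zero_iff)
qed

lemma ray_mode_Bessel:
  fixes m :: "nat \<Rightarrow> int"
  assumes g: "continuous_on UNIV g" "\<And>w. norm (g w) \<le> M" and T: "T \<ge> 0" and m: "inj m"
  shows "(\<Sum>j<N. (norm (ray_mode T k (m j) g z))\<^sup>2) \<le> (T ^ k * M * T)\<^sup>2"
  unfolding ray_mode_def
  by (rule Bessel[OF _ _ m]) (rule ray_int_continuous_angle[OF g(1)], rule ray_int_bound[OF g T])

lemma ray_mode_decay:
  fixes m :: "nat \<Rightarrow> int"
  assumes g: "continuous_on UNIV g" "\<And>w. norm (g w) \<le> M" and T: "T \<ge> 0" and m: "inj m"
  shows "(\<lambda>j. ray_mode T k (m j) g z) \<longlonglongrightarrow> 0"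
  by (rule summable_bound_square) (rule ray_mode_Bessel[OF assms])

text \<open>By \<open>ray_mode_angular\<close> the terms are products of \<open>1 / m\<close> and a square summable sequence; Bessel's inequality bounds the sum uniformly in \<open>z\<close>.\<close>
lemma ray_mode_sum_bound:
  fixes m :: "nat \<Rightarrow> int"
  assumes g: "C1c g a b" and M: "\<And>w. norm (a w) \<le> M" "\<And>w. norm (b w) \<le> M" and T: "T \<ge> 0" and m: "inj m" "\<And>j. m j \<ge> int j"
    and G: "\<And>w. norm (g w) \<le> M"
  shows "(\<Sum>j<N. norm (ray_mode T 0 (m j) g z)) \<le> 2 * (T * M * T)\<^sup>2 + (\<Sum>j. 1 / (real (Suc j))\<^sup>2) + M * T"
proof -
  note c = C1c_derivatives_continuous[OF g]
  have inv: "summable (\<lambda>j. 1 / (real (Suc j))\<^sup>2)" using inverse_squares_sums unfolding sums_iff by simp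
  have j1: "inj (\<lambda>j. m (Suc j) + 1)" "inj (\<lambda>j. m (Suc j) - 1)" using m(1) by (auto simp: inj_def)
  have step: "norm (ray_mode T 0 (m (Suc j)) g z) \<le> 1 / (real (Suc j))\<^sup>2 + ((norm (ray_mode T 1 (m (Suc j) + 1) a z))\<^sup>2 + (norm (ray_mode T 1 (m (Suc j) - 1) b z))\<^sup>2)" for j
  proof -
    define A where "A = norm (ray_mode T 1 (m (Suc j) + 1) a z)"
    define B where "B = norm (ray_mode T 1 (m (Suc j) - 1) b z)"
    define C where "C = norm (ray_mode T 0 (m (Suc j)) g z)"
    have mj: "real (Suc j) \<le> of_int (m (Suc j))" using m(2)[of "Suc j"] by linarith
    have "real (Suc j) * C \<le> of_int (m (Suc j)) * C" using mj by (rule mult_right_mono) (simp add: C_def)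
    also have "\<dots> = norm (of_int (m (Suc j)) * ray_mode T 0 (m (Suc j)) g z)" using mj by (simp add: C_def norm_mult)
    also have "\<dots> \<le> A + B" unfolding ray_mode_angular[OF g] A_def B_def by (rule norm_triangle_ineq4)
    finally have le: "real (Suc j) * C \<le> A + B" .
    define x where "x = 1 / real (Suc j)"
    have "C = x * (real (Suc j) * C)" by (simp add: x_def)
    also have "\<dots> \<le> x * (A + B)" by (rule mult_left_mono[OF le]) (simp add: x_def)
    also have "\<dots> \<le> x\<^sup>2 + (A\<^sup>2 + B\<^sup>2)"
    proof -
      \<comment> \<open>The inequality of the arithmetic and geometric mean, written as a sum of squares.\<close>
      have "0 \<le> (x / 2 - A)\<^sup>2 + (x / 2 - B)\<^sup>2 + x\<^sup>2 / 2" by simp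
      also have "\<dots> = x\<^sup>2 + (A\<^sup>2 + B\<^sup>2) - x * (A + B)" by (simp add: power2_eq_square field_simps)
      finally show ?thesis by simp
    qed
    finally show ?thesis unfolding A_def B_def C_def x_def power_one_over .
  qed
  have "(\<Sum>j<N. norm (ray_mode T 0 (m j) g z)) \<le> (\<Sum>j<Suc N. norm (ray_mode T 0 (m j) g z))" by (simp add: sum_mono2)
  also have "\<dots> = norm (ray_mode T 0 (m 0) g z) + (\<Sum>j<N. norm (ray_mode T 0 (m (Suc j)) g z))" by (rule sum.lessThan_Suc_shift)
  finally have 1: "(\<Sum>j<N. norm (ray_mode T 0 (m j) g z)) \<le> norm (ray_mode T 0 (m 0) g z) + (\<Sum>j<N. norm (ray_mode T 0 (m (Suc j)) g z))" .
  have 2: "norm (ray_mode T 0 (m 0) g z) \<le> M * T"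
    using ray_mode_bound[OF C1c_continuous[OF g] G T, of 0 "m 0" z] by simp
  have "(\<Sum>j<N. norm (ray_mode T 0 (m (Suc j)) g z)) \<le> (\<Sum>j<N. 1 / (real (Suc j))\<^sup>2 + ((norm (ray_mode T 1 (m (Suc j) + 1) a z))\<^sup>2 + (norm (ray_mode T 1 (m (Suc j) - 1) b z))\<^sup>2))"
    by (rule sum_mono) (rule step)
  then have 3: "(\<Sum>j<N. norm (ray_mode T 0 (m (Suc j)) g z)) \<le> (\<Sum>j<N. 1 / (real (Suc j))\<^sup>2) + ((\<Sum>j<N. (norm (ray_mode T 1 (m (Suc j) + 1) a z))\<^sup>2) + (\<Sum>j<N. (norm (ray_mode T 1 (m (Suc j) - 1) b z))\<^sup>2))"
    unfolding sum.distrib .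
  have 4: "(\<Sum>j<N. 1 / (real (Suc j))\<^sup>2) \<le> (\<Sum>j. 1 / (real (Suc j))\<^sup>2)" by (rule sum_le_suminf[OF inv]) auto
  note 5 = ray_mode_Bessel[OF c(1) M(1) T j1(1), where k=1 and z=z and N=N]
    ray_mode_Bessel[OF c(2) M(2) T j1(2), where k=1 and z=z and N=N]
  show ?thesis using 1 2 3 4 5 unfolding power_one_right by linarith
qed

definition real_mode :: "real \<Rightarrow> nat \<Rightarrow> (complex \<Rightarrow> complex) \<Rightarrow> (complex \<Rightarrow> complex) \<Rightarrow> nat \<Rightarrow> complex \<Rightarrow> complex" where
  "real_mode T k g h n z = (ray_mode T k (int n - 1) g z + ray_mode T k (int n + 1) h z) / 2"

text \<open>The choice \<open>T \<ge> 2 R\<close> makes every ray from a point of the ball leave the support before time \<open>T\<close>. The names \<open>V\<close>, \<open>a\<close>, \<open>b\<close> below match \<open>mode_system\<close>.\<close>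
locale field_modes =
  fixes f fa fb :: "complex \<Rightarrow> complex" and R T :: real
  assumes f: "C1c f fa fb" and R: "R > 0" "\<And>z. R \<le> norm z \<Longrightarrow> f z = 0" and T: "T \<ge> 2 * R"
begin

definition V where "V k = real_mode T k f (\<lambda>w. cnj (f w))"
definition a where "a k = real_mode T k fa (\<lambda>w. cnj (fb w))"
definition b where "b k = real_mode T k fb (\<lambda>w. cnj (fa w))"

lemma T0: "T \<ge> 0" using R T by linarith

lemma cf: "C1c (\<lambda>w. cnj (f w)) (\<lambda>w. cnj (fb w)) (\<lambda>w. cnj (fa w))" by (rule C1c_cnj[OF f])

lemma cont: "continuous_on UNIV f" "continuous_on UNIV fa" "continuous_on UNIV fb"
    "continuous_on UNIV (\<lambda>w. cnj (f w))" "continuous_on UNIV (\<lambda>w. cnj (fa w))" "continuous_on UNIV (\<lambda>w. cnj (fb w))"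
  using C1c_continuous[OF f] C1c_continuous[OF cf] f cf unfolding C1c_def by auto

lemma V_C1c: "C1c (V k n) (a k n) (b k n)"
proof -
  note g = C1c_ray_mode[OF f T0, of k "int n - 1"] and h = C1c_ray_mode[OF cf T0, of k "int n + 1"]
  obtain r1 where r1: "r1 > 0" "\<And>z. r1 < norm z \<Longrightarrow> ray_mode T k (int n - 1) f z = 0 \<and> ray_mode T k (int n - 1) fa z = 0 \<and> ray_mode T k (int n - 1) fb z = 0"
    using g unfolding C1c_def by blast
  obtain r2 where r2: "r2 > 0" "\<And>z. r2 < norm z \<Longrightarrow> ray_mode T k (int n + 1) (\<lambda>w. cnj (f w)) z = 0 \<and> ray_mode T k (int n + 1) (\<lambda>w. cnj (fb w)) z = 0 \<and> ray_mode T k (int n + 1) (\<lambda>w. cnj (fa w)) z = 0"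
    using h unfolding C1c_def by blast
  have "wirt (V k n) (a k n z) (b k n z) z" for z
  proof -
    have "V k n = (\<lambda>z. 1 / 2 * (ray_mode T k (int n - 1) f z + ray_mode T k (int n + 1) (\<lambda>w. cnj (f w)) z))"
      unfolding V_def real_mode_def by (auto simp: fun_eq_iff)
    then show ?thesis
      using wirt_cmult[OF wirt_add[OF C1c_wirt[OF g] C1c_wirt[OF h]], of "1/2" z] unfolding a_def b_def real_mode_def by simp
  qed
  moreover have "continuous_on UNIV (a k n)" "continuous_on UNIV (b k n)"
    using g h unfolding C1c_def a_def b_def real_mode_def[abs_def] by (auto intro!: continuous_intros)
  moreover have "max r1 r2 > 0" using r1(1) by auto
  moreover have "V k n z = 0 \<and> a k n z = 0 \<and> b k n z = 0" if "max r1 r2 < norm z" for z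
    using r1(2)[of z] r2(2)[of z] that unfolding V_def a_def b_def real_mode_def by simp
  ultimately show ?thesis unfolding C1c_def wirt_def by blast
qed

lemma uniform_bounds:
  obtains M r where "M > 0" "\<And>m z. norm (a k m z) \<le> M" "\<And>m z. norm (b k m z) \<le> M" "\<And>m z. r < norm z \<Longrightarrow> a k m z = 0 \<and> b k m z = 0"
proof -
  obtain r M where M: "M > 0" "\<And>z. r < norm z \<Longrightarrow> f z = 0 \<and> fa z = 0 \<and> fb z = 0"
    "\<And>z. norm (f z) \<le> M" "\<And>z. norm (fa z) \<le> M" "\<And>z. norm (fb z) \<le> M"
    by (rule C1c_bounds[OF f]) (rule that)
  have half: "norm ((x + y) / 2) \<le> T ^ k * M * T" if "norm x \<le> T ^ k * M * T" "norm y \<le> T ^ k * M * T" for x y :: complex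
    using norm_triangle_ineq[of x y] that by (simp add: norm_divide)
  have rb: "norm (ray_mode T k j g z) \<le> T ^ k * M * T" if "continuous_on UNIV g" "\<And>w. norm (g w) \<le> M" for g j z
    by (rule ray_mode_bound[OF that T0])
  have supp: "ray_mode T k j g z = 0" if "\<And>z. r < norm z \<Longrightarrow> g z = 0" "r + T < norm z" for g j z
    by (rule ray_mode_support[OF that])
  show ?thesis
  proof (rule that[of "T ^ k * M * T + 1" "r + T"])
    have "0 \<le> T ^ k * M * T" using T0 M(1) by simp
    then show "0 < T ^ k * M * T + 1" by simp
    show "norm (a k m z) \<le> T ^ k * M * T + 1" for m z
    proof -
      have "norm (a k m z) \<le> T ^ k * M * T" unfolding a_def real_mode_def by (intro half rb cont) (simp_all add: M)
      then show ?thesis by simp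
    qed
    show "norm (b k m z) \<le> T ^ k * M * T + 1" for m z
    proof -
      have "norm (b k m z) \<le> T ^ k * M * T" unfolding b_def real_mode_def by (intro half rb cont) (simp_all add: M)
      then show ?thesis by simp
    qed
    show "r + T < norm z \<Longrightarrow> a k m z = 0 \<and> b k m z = 0" for m z
      unfolding a_def b_def real_mode_def by (simp add: supp M)
  qed
qed

lemma far: assumes "norm z < R" shows "f (z - of_real T * cis \<phi>) = 0"
proof (rule R(2))
  have "norm (of_real T * cis \<phi>) \<le> norm (z - of_real T * cis \<phi>) + norm z" using norm_triangle_ineq4[of z "z - of_real T * cis \<phi>"] by simp
  then show "R \<le> norm (z - of_real T * cis \<phi>)" using assms T R by (simp add: norm_mult)
qed

lemma far_cnj: assumes "norm z < R" shows "cnj (f (z - of_real T * cis \<phi>)) = 0"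
  using far[OF assms] by simp

lemma system0: "norm z < R \<Longrightarrow> b 0 n z + a 0 (n + 2) z = (if n = 0 then f z / 2 else 0)"
  and system1: "norm z < R \<Longrightarrow> b 1 n z + a 1 (n + 2) z = V 0 (Suc n) z"
proof -
  assume z: "norm z < R"
  have i: "int (n + 2) - 1 = int n + 1" "int (n + 2) + 1 = int n + 2 + 1" "int n + 1 = int n + 2 - 1" "int (Suc n) - 1 = int n" "int (Suc n) + 1 = int n + 2" by auto
  have r: "(x + y) / 2 + (x' + y') / 2 = ((x' + x) + (y' + y)) / 2" for x y x' y' :: complex by (simp add: add_divide_distrib)
  show "b 0 n z + a 0 (n + 2) z = (if n = 0 then f z / 2 else 0)"
    unfolding a_def b_def real_mode_def r i(1,2)
    using ray_mode_transport(1)[OF f T0 far[OF z], of "int n"] ray_mode_transport(1)[OF cf T0 far_cnj[OF z], of "int n + 2"]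
    by (auto simp: algebra_simps)
  show "b 1 n z + a 1 (n + 2) z = V 0 (Suc n) z"
    unfolding a_def b_def V_def real_mode_def r i(1,2,4,5)
    using ray_mode_transport(2)[OF f T0 far[OF z], of "int n"] ray_mode_transport(2)[OF cf T0 far_cnj[OF z], of "int n + 2"]
    by (simp add: algebra_simps)
qed

text \<open>The system at the index \<open>-1\<close>, where the two derivatives are conjugate to each other because the field is real.\<close>
lemma recover_mode: assumes z: "norm z < R" shows "V 0 0 z = of_real (2 * Re (a 1 1 z))"
proof -
  have "V 0 0 z = (ray_mode T 1 0 fa z + ray_mode T 1 (-2) fb z + (ray_mode T 1 2 (\<lambda>w. cnj (fb w)) z + ray_mode T 1 0 (\<lambda>w. cnj (fa w)) z)) / 2"
    unfolding V_def real_mode_def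
    using ray_mode_transport(2)[OF f T0 far[OF z], of "-1"] ray_mode_transport(2)[OF cf T0 far_cnj[OF z], of 1] by simp
  also have "\<dots> = (ray_mode T 1 0 fa z + ray_mode T 1 2 (\<lambda>w. cnj (fb w)) z) / 2 + cnj ((ray_mode T 1 0 fa z + ray_mode T 1 2 (\<lambda>w. cnj (fb w)) z) / 2)"
    using ray_mode_cnj[OF cont(2), of T 1 0 z] ray_mode_cnj[OF cont(6), of T 1 2 z] by (simp add: add_divide_distrib)
  also have "\<dots> = a 1 1 z + cnj (a 1 1 z)" unfolding a_def real_mode_def by simp
  finally show ?thesis by (simp only: complex_add_cnj)
qed

lemma decay: "(\<lambda>m. b k m z) \<longlonglongrightarrow> 0"
proof -
  obtain M where M: "\<And>z. norm (fa z) \<le> M" "\<And>z. norm (fb z) \<le> M"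
    by (rule C1c_bounds[OF f]) (rule that)
  have i: "inj (\<lambda>m. int m - 1)" "inj (\<lambda>m. int m + 1)" by (auto simp: inj_def)
  have M': "norm (cnj (fa z)) \<le> M" for z using M(1) by simp
  have "(\<lambda>m. ray_mode T k (int m - 1) fb z) \<longlonglongrightarrow> 0"
    by (rule ray_mode_decay[OF cont(3) M(2) T0 i(1)])
  moreover have "(\<lambda>m. ray_mode T k (int m + 1) (\<lambda>w. cnj (fa w)) z) \<longlonglongrightarrow> 0"
    by (rule ray_mode_decay[OF cont(5) M' T0 i(2)])
  ultimately have "(\<lambda>m. (ray_mode T k (int m - 1) fb z + ray_mode T k (int m + 1) (\<lambda>w. cnj (fa w)) z) / 2) \<longlonglongrightarrow> (0 + 0) / 2"
    by (rule tendsto_divide[OF tendsto_add tendsto_const]) simp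
  then show ?thesis unfolding b_def real_mode_def by simp
qed

lemma sum_bound: "\<exists>C. \<forall>z N. (\<Sum>j<N. norm (V 0 (Suc (n + 2 * j)) z)) \<le> C"
proof -
  obtain M where M: "\<And>z. norm (f z) \<le> M" "\<And>z. norm (fa z) \<le> M" "\<And>z. norm (fb z) \<le> M"
    by (rule C1c_bounds[OF f]) (rule that)
  define B where "B = 2 * (T * M * T)\<^sup>2 + (\<Sum>j. 1 / (real (Suc j))\<^sup>2) + M * T"
  have "(\<Sum>j<N. norm (V 0 (Suc (n + 2 * j)) z)) \<le> (B + B) / 2" for z N
  proof -
    have 1: "(\<Sum>j<N. norm (ray_mode T 0 (int (n + 2 * j)) f z)) \<le> B"
      unfolding B_def by (rule ray_mode_sum_bound[OF f M(2,3) T0 _ _ M(1)]) (auto simp: inj_def)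
    have 2: "(\<Sum>j<N. norm (ray_mode T 0 (int (n + 2 * j) + 2) (\<lambda>w. cnj (f w)) z)) \<le> B"
      unfolding B_def by (rule ray_mode_sum_bound[OF cf _ _ T0]) (use M in \<open>auto simp: inj_def\<close>)
    have "norm (V 0 (Suc m) z) \<le> (norm (ray_mode T 0 (int m) f z) + norm (ray_mode T 0 (int m + 2) (\<lambda>w. cnj (f w)) z)) / 2" for m
    proof -
      have "int (Suc m) - 1 = int m" "int (Suc m) + 1 = int m + 2" by auto
      then show ?thesis unfolding V_def real_mode_def norm_divide
        using norm_triangle_ineq[of "ray_mode T 0 (int m) f z" "ray_mode T 0 (int m + 2) (\<lambda>w. cnj (f w)) z"] by (simp only:) simp
    qed
    then have "(\<Sum>j<N. norm (V 0 (Suc (n + 2 * j)) z)) \<le> (\<Sum>j<N. (norm (ray_mode T 0 (int (n + 2 * j)) f z) + norm (ray_mode T 0 (int (n + 2 * j) + 2) (\<lambda>w. cnj (f w)) z)) / 2)"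
      by (intro sum_mono)
    also have "\<dots> = ((\<Sum>j<N. norm (ray_mode T 0 (int (n + 2 * j)) f z)) + (\<Sum>j<N. norm (ray_mode T 0 (int (n + 2 * j) + 2) (\<lambda>w. cnj (f w)) z))) / 2"
      unfolding sum.distrib[symmetric] sum_divide_distrib ..
    finally have 3: "(\<Sum>j<N. norm (V 0 (Suc (n + 2 * j)) z)) \<le> \<dots>" .
    show ?thesis by (rule order_trans[OF 3 divide_right_mono[OF add_mono[OF 1 2]]]) simp
  qed
  then show ?thesis by blast
qed

end

section \<open>Transport solutions and their data\<close>

lemma holder_field_C1c:
  assumes f: "C0_1_holder \<Omega> \<mu> f" and \<mu>: "\<mu> > 0"
  obtains fa fb where "C1c f fa fb" "\<And>z. z \<notin> \<Omega> \<Longrightarrow> f z = 0"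
proof -
  obtain K f' C where K: "compact K" "K \<subseteq> \<Omega>" "\<And>z. z \<notin> K \<Longrightarrow> f z = 0"
    and d: "\<And>z. (f has_derivative blinfun_apply (f' z)) (at z)"
    and C: "\<And>x y. norm (f' x - f' y) \<le> C * dist x y powr \<mu>"
    using f unfolding C0_1_holder_def by blast
  have "isCont f' x" for x
  proof -
    have "((\<lambda>y. C * dist y x powr \<mu>) \<longlongrightarrow> C * 0 powr \<mu>) (at x)"
    proof (intro tendsto_mult tendsto_const tendsto_powr')
      show "((\<lambda>y. dist y x) \<longlongrightarrow> 0) (at x)" by (simp add: tendsto_dist_iff[symmetric])
    qed (use \<mu> in auto)
    then have l: "((\<lambda>y. C * dist y x powr \<mu>) \<longlongrightarrow> 0) (at x)" using \<mu> by simp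
    have "((\<lambda>y. f' y - f' x) \<longlongrightarrow> 0) (at x)"
      by (rule Lim_null_comparison[OF always_eventually l]) (rule allI, rule C)
    then show ?thesis unfolding isCont_def by (simp add: LIM_zero_iff)
  qed
  then have cf': "continuous_on UNIV f'" by (simp add: continuous_on_eq_continuous_at)
  define fa where "fa z = (f' z 1 - \<i> * f' z \<i>) / 2" for z
  define fb where "fb z = (f' z 1 + \<i> * f' z \<i>) / 2" for z
  have "blinfun_apply (f' z) h = fa z * h + fb z * cnj h" for z h
  proof -
    have h: "h = Re h *\<^sub>R 1 + Im h *\<^sub>R \<i>" by (simp add: complex_eq_iff)
    have "blinfun_apply (f' z) h = f' z (Re h *\<^sub>R 1 + Im h *\<^sub>R \<i>)" using h by simp
    also have "\<dots> = Re h *\<^sub>R f' z 1 + Im h *\<^sub>R f' z \<i>"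
      by (simp only: blinfun.add_right blinfun.scaleR_right)
    also have "\<dots> = of_real (Re h) * f' z 1 + of_real (Im h) * f' z \<i>"
      by (simp only: scaleR_conv_of_real)
    also have "\<dots> = fa z * (of_real (Re h) + \<i> * of_real (Im h)) + fb z * (of_real (Re h) - \<i> * of_real (Im h))"
    proof -
      have k: "(p - \<i> * q) * (x + \<i> * y) + (p + \<i> * q) * (x - \<i> * y) = 2 * (x * p + y * q)" for p q x y :: complex
        by (simp add: distrib_left distrib_right left_diff_distrib right_diff_distrib mult_ac)
      have d: "p' / 2 * x + q' / 2 * y = (p' * x + q' * y) / 2" for p' q' x y :: complex
        by (simp add: add_divide_distrib)
      show ?thesis unfolding fa_def fb_def d k by simp
    qed
    also have "\<dots> = fa z * h + fb z * cnj h" by (simp add: complex_eq_iff)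
    finally show ?thesis .
  qed
  then have D: "(f has_derivative (\<lambda>h. fa z * h + fb z * cnj h)) (at z)" for z using d[of z] by presburger
  obtain R where R: "R > 0" "K \<subseteq> ball 0 R" using bounded_subset_ballD[OF compact_imp_bounded[OF K(1)], of 0] by auto
  have z: "f z = 0 \<and> fa z = 0 \<and> fb z = 0" if "R < norm z" for z
  proof -
    have "open (- cball 0 R :: complex set)" by (simp add: open_Compl)
    moreover have "z \<in> - cball 0 R" using that by simp
    moreover have 0: "0 = f w" if "w \<in> - cball 0 R" for w
    proof -
      have "w \<notin> K" using that R(2) by (auto simp: subset_iff)
      then show ?thesis using K(3) by simp
    qed
    ultimately have "(f has_derivative (\<lambda>h. 0)) (at z)"
      by (rule has_derivative_transform_within_open[OF has_derivative_const])
    then have e: "blinfun_apply (f' z) = (\<lambda>h. 0)" by (rule has_derivative_unique[OF d])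
    show ?thesis using 0[of z] that unfolding fa_def fb_def e by simp
  qed
  have "continuous_on UNIV fa" "continuous_on UNIV fb" unfolding fa_def fb_def
    by (intro continuous_on_divide continuous_on_const continuous_intros cf'; simp)+
  then have "C1c f fa fb" unfolding C1c_def using D R(1) z by (intro conjI exI[of _ R] allI impI) auto
  moreover have "f z = 0" if "z \<notin> \<Omega>" for z using K(2,3) that by (meson subsetD)
  ultimately show ?thesis by (rule that)
qed

lemma C1c_line:
  assumes f: "C1c f fa fb"
  defines "F' \<equiv> \<lambda>z \<theta> y. \<theta> \<bullet> (fa (z + of_real y * \<theta>) * \<theta> + fb (z + of_real y * \<theta>) * cnj \<theta>)"
  shows "((\<lambda>y. \<theta> \<bullet> f (z + of_real y * \<theta>)) has_vector_derivative F' z \<theta> y) (at y within S)"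
    and "continuous_on S (F' z \<theta>)" "continuous_on S (\<lambda>y. \<theta> \<bullet> f (z + of_real y * \<theta>))"
proof -
  have "((\<lambda>y. z + of_real y * \<theta>) has_vector_derivative \<theta>) (at y within S)" for y
    by (auto intro!: derivative_eq_intros)
  note d = has_vector_derivative_wirt[OF C1c_wirt[OF f] this]
  show "((\<lambda>y. \<theta> \<bullet> f (z + of_real y * \<theta>)) has_vector_derivative F' z \<theta> y) (at y within S)" for y
    unfolding F'_def by (rule bounded_linear.has_vector_derivative[OF bounded_linear_inner_right d])
  have c: "continuous_on UNIV fa" "continuous_on UNIV fb" "continuous_on UNIV f" using f C1c_continuous[OF f] unfolding C1c_def by auto
  have l: "continuous_on S (\<lambda>y. g (z + of_real y * \<theta>))" if "continuous_on UNIV g" for g :: "complex \<Rightarrow> complex"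
    by (rule continuous_on_compose2[OF that]) (auto intro!: continuous_intros)
  show "continuous_on S (F' z \<theta>)" unfolding F'_def by (intro continuous_intros l c)
  show "continuous_on S (\<lambda>y. \<theta> \<bullet> f (z + of_real y * \<theta>))" by (intro continuous_intros l c)
qed

text \<open>Differentiating under the integral and integrating back, so that the end points \<open>0\<close> and \<open>T\<close> produce the right-hand sides of the two transport equations.\<close>
lemma sliding_integral_derivative:
  fixes F F' :: "real \<Rightarrow> real"
  assumes d: "\<And>y. (F has_vector_derivative F' y) (at y)" and c: "continuous_on UNIV F'" and T: "T \<ge> 0" and z: "F (- T) = 0"
  shows "((\<lambda>y. integral {0..T} (\<lambda>t. F (y - t))) has_vector_derivative F 0) (at 0)"
    and "((\<lambda>y. integral {0..T} (\<lambda>t. t * F (y - t))) has_vector_derivative integral {0..T} (\<lambda>t. F (- t))) (at 0)"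
proof -
  have cF: "continuous_on UNIV F" using has_vector_derivative_continuous[OF d] by (simp add: continuous_on_eq_continuous_at)
  have sh: "((\<lambda>y. F (y - t)) has_vector_derivative F' (y - t)) (at y within S)" for y t S
  proof -
    have "((\<lambda>y. y - t) has_vector_derivative 1) (at y within S)" by (auto intro!: derivative_eq_intros)
    from vector_diff_chain_within[OF this has_vector_derivative_at_within[OF d]] show ?thesis by (simp add: o_def)
  qed
  have sh': "((\<lambda>t. F (- t)) has_vector_derivative - F' (- t)) (at t within S)" for t S
  proof -
    have "((\<lambda>t. - t) has_vector_derivative -1) (at t within S)" by (auto intro!: derivative_eq_intros)
    from vector_diff_chain_within[OF this has_vector_derivative_at_within[OF d]] show ?thesis by (simp add: o_def)
  qed
  have cc: "continuous_on S (\<lambda>x. G (a x - b x))" if "continuous_on UNIV G" "continuous_on S a" "continuous_on S b"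
    for G :: "real \<Rightarrow> real" and S :: "'x::topological_space set" and a b
    by (rule continuous_on_compose2[OF that(1)]) (auto intro!: continuous_intros that)
  have cn: "continuous_on S (\<lambda>t. G (- t))" if "continuous_on UNIV G" for G :: "real \<Rightarrow> real" and S
    by (rule continuous_on_compose2[OF that]) (auto intro!: continuous_intros)
  have "((\<lambda>y. integral (cbox 0 T) (\<lambda>t. F (y - t))) has_vector_derivative integral (cbox 0 T) (\<lambda>t. F' (0 - t))) (at 0 within UNIV)"
  proof (rule leibniz_rule_vector_derivative)
    show "(\<lambda>t. F (y - t)) integrable_on cbox 0 T" for y by (intro integrable_continuous cc[OF cF] continuous_intros)
    show "continuous_on (UNIV \<times> cbox 0 T) (\<lambda>(x, t). F' (x - t))" unfolding split_beta by (intro cc[OF c] continuous_intros)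
    qed (rule sh, rule UNIV_I, rule convex_UNIV)
  moreover have "((\<lambda>t. - F' (- t)) has_integral F (- T) - F (- 0)) {0..T}"
    by (rule fundamental_theorem_of_calculus[OF T]) (rule sh')
  from integral_unique[OF this] have "integral {0..T} (\<lambda>t. F' (- t)) = F 0" unfolding integral_neg z by simp
  ultimately show "((\<lambda>y. integral {0..T} (\<lambda>t. F (y - t))) has_vector_derivative F 0) (at 0)" by simp
  have "((\<lambda>y. integral (cbox 0 T) (\<lambda>t. t * F (y - t))) has_vector_derivative integral (cbox 0 T) (\<lambda>t. t * F' (0 - t))) (at 0 within UNIV)"
  proof (rule leibniz_rule_vector_derivative)
    show "(\<lambda>t. t * F (y - t)) integrable_on cbox 0 T" for y by (intro integrable_continuous continuous_on_mult cc[OF cF] continuous_intros)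
    show "continuous_on (UNIV \<times> cbox 0 T) (\<lambda>(x, t). t * F' (x - t))" unfolding split_beta by (intro continuous_on_mult cc[OF c] continuous_intros)
    show "((\<lambda>y. t * F (y - t)) has_vector_derivative t * F' (y - t)) (at y within UNIV)" for y t
      by (rule has_vector_derivative_mult_right[OF sh])
  qed auto
  moreover have "((\<lambda>t. t * F (- t)) has_vector_derivative (t * - F' (- t) + 1 * F (- t))) (at t within {0..T})" for t
    by (rule has_vector_derivative_mult[OF has_vector_derivative_id sh'])
  then have "((\<lambda>t. t * - F' (- t) + 1 * F (- t)) has_integral T * F (- T) - 0 * F (- 0)) {0..T}"
    by (rule fundamental_theorem_of_calculus[OF T])
  from integral_unique[OF this] have 1: "integral {0..T} (\<lambda>t. F (- t) - t * F' (- t)) = 0" unfolding z by simp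
  have "integral {0..T} (\<lambda>t. F (- t) - t * F' (- t)) = integral {0..T} (\<lambda>t. F (- t)) - integral {0..T} (\<lambda>t. t * F' (- t))"
    by (intro integral_diff integrable_continuous_real continuous_on_mult cn[OF cF] cn[OF c] continuous_intros)
  then have "integral {0..T} (\<lambda>t. t * F' (- t)) = integral {0..T} (\<lambda>t. F (- t))" unfolding 1 by simp
  ultimately show "((\<lambda>y. integral {0..T} (\<lambda>t. t * F (y - t))) has_vector_derivative integral {0..T} (\<lambda>t. F (- t))) (at 0)" by simp
qed

lemma outer_normal_strict:
  assumes "open \<Omega>" "outer_unit_normal \<Omega> \<zeta> n" "x \<in> \<Omega>"
  shows "(x - \<zeta>) \<bullet> n < 0"
proof -
  obtain e where e: "e > 0" "ball x e \<subseteq> \<Omega>" using assms by (meson openE)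
  have n: "norm n = 1" using assms(2) unfolding outer_unit_normal_def by simp
  have "x + (e / 2) *\<^sub>R n \<in> ball x e" using e n by (simp add: dist_norm)
  then have "(x + (e / 2) *\<^sub>R n - \<zeta>) \<bullet> n \<le> 0" using assms(2) e(2) unfolding outer_unit_normal_def by blast
  moreover have "(x + (e / 2) *\<^sub>R n - \<zeta>) \<bullet> n = (x - \<zeta>) \<bullet> n + e / 2"
    using n by (simp add: inner_diff_left inner_add_left dot_square_norm)
  ultimately show ?thesis using e(1) by linarith
qed

locale transport = field_modes +
  fixes \<Omega> :: "complex set" and \<nu> :: "complex \<Rightarrow> complex"
  assumes scd: "strictly_convex_domain \<Omega>"
    and \<nu>: "\<And>\<zeta>. \<zeta> \<in> frontier \<Omega> \<Longrightarrow> outer_unit_normal \<Omega> \<zeta> (\<nu> \<zeta>)"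
    and \<Omega>R: "closure \<Omega> \<subseteq> ball 0 R"
    and f0: "\<And>z. z \<notin> \<Omega> \<Longrightarrow> f z = 0"
begin

definition u :: "nat \<Rightarrow> complex \<Rightarrow> complex \<Rightarrow> real" where
  "u k z \<theta> = (if z \<in> closure \<Omega> \<and> \<theta> \<in> sphere 0 1 then integral {0..T} (\<lambda>t. t ^ k * (\<theta> \<bullet> f (z - of_real t * \<theta>))) else 0)"

lemma \<Omega>_open: "open \<Omega>" and \<Omega>_segment: "\<And>x y. x \<in> closure \<Omega> \<Longrightarrow> y \<in> closure \<Omega> \<Longrightarrow> x \<noteq> y \<Longrightarrow> open_segment x y \<subseteq> \<Omega>"
  using scd unfolding strictly_convex_domain_def by auto

lemma u_continuous: "continuous_on (closure \<Omega> \<times> sphere 0 1) (\<lambda>(z, \<theta>). u k z \<theta>)"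
proof -
  have c: "continuous_on S (\<lambda>x. f (g x))" if "continuous_on S g" for g and S :: "'x::topological_space set"
    by (rule continuous_on_compose2[OF cont(1) that]) auto
  have "continuous_on ((closure \<Omega> \<times> sphere 0 1) \<times> cbox 0 T) (\<lambda>(x, t). t ^ k * (snd x \<bullet> f (fst x - of_real t * snd x)))"
    unfolding split_beta by (intro continuous_intros c)
  from integral_continuous_on_param[OF this]
  have "continuous_on (closure \<Omega> \<times> sphere 0 1) (\<lambda>x. integral (cbox 0 T) (\<lambda>t. t ^ k * (snd x \<bullet> f (fst x - of_real t * snd x))))" .
  then show ?thesis by (rule continuous_on_eq) (auto simp: u_def)
qed

lemma f_behind:
  assumes "\<zeta> \<in> frontier \<Omega>" "\<nu> \<zeta> \<bullet> \<theta> * t \<le> 0"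
  shows "f (\<zeta> - of_real t * \<theta>) = 0"
proof (rule f0, rule notI)
  assume "\<zeta> - of_real t * \<theta> \<in> \<Omega>"
  from outer_normal_strict[OF \<Omega>_open \<nu>[OF assms(1)] this]
  have "(- (t *\<^sub>R \<theta>)) \<bullet> \<nu> \<zeta> < 0" by (simp add: scaleR_conv_of_real)
  then show False using assms(2) by (simp add: inner_commute mult.commute)
qed

text \<open>From an inflow or tangential boundary point the backward ray never enters \<open>\<Omega>\<close>.\<close>
lemma u_inflow:
  assumes "\<zeta> \<in> frontier \<Omega>" "\<nu> \<zeta> \<bullet> \<theta> \<le> 0"
  shows "u k \<zeta> \<theta> = 0"
proof -
  have "t ^ k * (\<theta> \<bullet> f (\<zeta> - of_real t * \<theta>)) = 0" if "t \<in> {0..T}" for t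
    using f_behind[OF assms(1), of \<theta> t] assms(2) that by (simp add: mult_nonpos_nonneg)
  then have "integral {0..T} (\<lambda>t. t ^ k * (\<theta> \<bullet> f (\<zeta> - of_real t * \<theta>))) = integral {0..T} (\<lambda>t. 0)" by (rule integral_cong)
  then show ?thesis unfolding u_def by simp
qed

lemma unit_cis: "\<theta> \<in> sphere 0 1 \<Longrightarrow> \<exists>\<phi>. \<theta> = cis \<phi>"
  using cis_Arg by (metis mem_sphere_0 norm_zero zero_neq_one sgn_div_norm inverse_1 scaleR_one)

lemma u_derivative:
  assumes z: "z \<in> \<Omega>" and \<theta>: "\<theta> \<in> sphere 0 1"
  shows "((\<lambda>t. u 0 (z + t *\<^sub>R \<theta>) \<theta>) has_real_derivative \<theta> \<bullet> f z) (at 0)"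
    and "((\<lambda>t. u 1 (z + t *\<^sub>R \<theta>) \<theta>) has_real_derivative u 0 z \<theta>) (at 0)"
proof -
  define F where "F y = \<theta> \<bullet> f (z + of_real y * \<theta>)" for y
  obtain \<phi> where \<phi>: "\<theta> = cis \<phi>" using unit_cis[OF \<theta>] by blast
  have zc: "z \<in> closure \<Omega>" using z closure_subset by auto
  then have FT: "F (- T) = 0" using far[of z \<phi>] \<Omega>R unfolding F_def \<phi> by auto
  note L = C1c_line[OF f, where z=z and \<theta>=\<theta>, folded F_def]
  note D = sliding_integral_derivative[OF L(1)[of _ UNIV] L(2) T0 FT]
  obtain e where e: "e > 0" "ball z e \<subseteq> \<Omega>" using z \<Omega>_open by (meson openE)
  have eq: "u k (z + y *\<^sub>R \<theta>) \<theta> = integral {0..T} (\<lambda>t. t ^ k * F (y - t))" if "y \<in> ball 0 e" for y k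
  proof -
    have "z + y *\<^sub>R \<theta> \<in> ball z e" using that \<theta> by (simp add: dist_norm)
    then have "z + y *\<^sub>R \<theta> \<in> closure \<Omega>" using e(2) closure_subset by blast
    then show ?thesis using \<theta> unfolding u_def F_def by (simp add: scaleR_conv_of_real algebra_simps)
  qed
  have F0: "F 0 = \<theta> \<bullet> f z" unfolding F_def by simp
  have u0: "integral {0..T} (\<lambda>t. F (- t)) = u 0 z \<theta>" unfolding F_def u_def using zc \<theta> by simp
  have "((\<lambda>t. u 0 (z + t *\<^sub>R \<theta>) \<theta>) has_vector_derivative F 0) (at 0)"
    by (rule has_vector_derivative_transform_within_open[OF D(1) open_ball[of 0 e]]) (use e(1) eq[of _ 0] in auto)
  then show "((\<lambda>t. u 0 (z + t *\<^sub>R \<theta>) \<theta>) has_real_derivative \<theta> \<bullet> f z) (at 0)"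
    unfolding F0 has_real_derivative_iff_has_vector_derivative .
  have "((\<lambda>t. u 1 (z + t *\<^sub>R \<theta>) \<theta>) has_vector_derivative u 0 z \<theta>) (at 0)"
    by (rule has_vector_derivative_transform_within_open[OF D(2)[unfolded u0] open_ball[of 0 e]]) (use e(1) eq[of _ 1] in auto)
  then show "((\<lambda>t. u 1 (z + t *\<^sub>R \<theta>) \<theta>) has_real_derivative u 0 z \<theta>) (at 0)"
    unfolding has_real_derivative_iff_has_vector_derivative .
qed

lemma u_zero: "z \<notin> closure \<Omega> \<or> \<theta> \<notin> sphere 0 1 \<Longrightarrow> u k z \<theta> = 0"
  unfolding u_def by argo

lemma solves: "solves_transport \<Omega> \<nu> (\<lambda>z \<theta>. \<theta> \<bullet> f z) (u 0)" "solves_transport \<Omega> \<nu> (u 0) (u 1)"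
proof -
  have "\<forall>\<zeta>\<in>frontier \<Omega>. \<forall>\<theta>\<in>sphere 0 1. \<nu> \<zeta> \<bullet> \<theta> < 0 \<longrightarrow> u k \<zeta> \<theta> = 0" "\<forall>z \<theta>. z \<notin> closure \<Omega> \<or> \<theta> \<notin> sphere 0 1 \<longrightarrow> u k z \<theta> = 0" for k
    using u_inflow[OF _ less_imp_le] u_zero by blast+
  then show "solves_transport \<Omega> \<nu> (\<lambda>z \<theta>. \<theta> \<bullet> f z) (u 0)" "solves_transport \<Omega> \<nu> (u 0) (u 1)"
    unfolding solves_transport_def using u_continuous u_derivative by blast+
qed

text \<open>At the point where the backward ray leaves \<open>\<Omega>\<close> the direction is strictly inward.\<close>
lemma entry_point:
  assumes z: "z \<in> \<Omega>" and \<theta>: "\<theta> \<in> sphere 0 1"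
  obtains \<tau> where "\<tau> > 0" "z - of_real \<tau> * \<theta> \<in> frontier \<Omega>" "\<nu> (z - of_real \<tau> * \<theta>) \<bullet> \<theta> < 0"
    "\<And>t. 0 \<le> t \<Longrightarrow> t < \<tau> \<Longrightarrow> z - of_real t * \<theta> \<in> \<Omega>"
proof -
  have b: "bounded \<Omega>" using \<Omega>R bounded_subset[OF bounded_ball] closure_subset by blast
  have "- \<theta> \<noteq> 0" using \<theta> by auto
  from ray_to_frontier[OF b _ this, of z] z \<Omega>_open
  obtain \<tau> where \<tau>: "\<tau> > 0" "z + \<tau> *\<^sub>R (- \<theta>) \<in> frontier \<Omega>" "\<And>e. 0 \<le> e \<Longrightarrow> e < \<tau> \<Longrightarrow> z + e *\<^sub>R (- \<theta>) \<in> interior \<Omega>"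
    by (auto simp: interior_open)
  have e: "z + t *\<^sub>R (- \<theta>) = z - of_real t * \<theta>" for t by (simp add: scaleR_conv_of_real)
  let ?\<zeta> = "z - of_real \<tau> * \<theta>"
  have "(z - ?\<zeta>) \<bullet> \<nu> ?\<zeta> < 0" by (rule outer_normal_strict[OF \<Omega>_open \<nu> z]) (use \<tau>(2) e in simp)
  then have "\<tau> * (\<nu> ?\<zeta> \<bullet> \<theta>) < 0" by (simp add: scaleR_conv_of_real[symmetric] inner_commute)
  then have "\<nu> ?\<zeta> \<bullet> \<theta> < 0" using \<tau>(1) by (simp add: mult_less_0_iff)
  then show ?thesis using \<tau> e \<Omega>_open by (intro that[of \<tau>]) (auto simp: interior_open)
qed

text \<open>The difference of two solutions is constant along the ray, up to its inflow end point by continuity; continuity also extends the equality to boundary points.\<close>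
lemma transport_unique:
  assumes v: "solves_transport \<Omega> \<nu> h v" and w: "solves_transport \<Omega> \<nu> h w"
  shows "v = w"
proof -
  have on: "v z \<theta> = w z \<theta>" if z: "z \<in> \<Omega>" and \<theta>: "\<theta> \<in> sphere 0 1" for z \<theta>
  proof -
    obtain \<tau> where \<tau>: "\<tau> > 0" "z - of_real \<tau> * \<theta> \<in> frontier \<Omega>" "\<nu> (z - of_real \<tau> * \<theta>) \<bullet> \<theta> < 0"
      "\<And>t. 0 \<le> t \<Longrightarrow> t < \<tau> \<Longrightarrow> z - of_real t * \<theta> \<in> \<Omega>"
      by (rule entry_point[OF z \<theta>]) (rule that)
    define d where "d t = v (z - of_real t * \<theta>) \<theta> - w (z - of_real t * \<theta>) \<theta>" for t
    have incl: "z - of_real t * \<theta> \<in> closure \<Omega>" if "t \<in> {0..\<tau>}" for t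
      using \<tau>(2,4) that closure_subset[of \<Omega>] by (cases "t = \<tau>") (auto simp: frontier_def)
    have c: "continuous_on {0..\<tau>} (\<lambda>t. q (z - of_real t * \<theta>) \<theta>)" if "solves_transport \<Omega> \<nu> h q" for q
    proof -
      have "continuous_on (closure \<Omega> \<times> sphere 0 1) (\<lambda>(z, \<theta>). q z \<theta>)" using that unfolding solves_transport_def by blast
      moreover have "continuous_on {0..\<tau>} (\<lambda>t. (z - of_real t * \<theta>, \<theta>))" by (intro continuous_intros)
      ultimately have "continuous_on {0..\<tau>} (\<lambda>t. case (z - of_real t * \<theta>, \<theta>) of (z, \<theta>) \<Rightarrow> q z \<theta>)"
        by (rule continuous_on_compose2) (use incl \<theta> in auto)
      then show ?thesis by simp
    qed
    have dd: "((\<lambda>t. q (z - of_real t * \<theta>) \<theta>) has_real_derivative - h (z - of_real t * \<theta>) \<theta>) (at t)" if "solves_transport \<Omega> \<nu> h q" "0 < t" "t < \<tau>" for q t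
    proof -
      have "((\<lambda>r. q ((z - of_real t * \<theta>) + r *\<^sub>R \<theta>) \<theta>) has_real_derivative h (z - of_real t * \<theta>) \<theta>) (at 0)"
        using that \<tau>(4)[of t] \<theta> unfolding solves_transport_def by auto
      then have "((\<lambda>r. q ((z - of_real t * \<theta>) + r *\<^sub>R \<theta>) \<theta>) has_real_derivative h (z - of_real t * \<theta>) \<theta>) (at (t - t))" by simp
      moreover have "((\<lambda>r. t - r) has_real_derivative -1) (at t)" by (auto intro!: derivative_eq_intros)
      ultimately have "((\<lambda>r. q ((z - of_real t * \<theta>) + (t - r) *\<^sub>R \<theta>) \<theta>) has_real_derivative h (z - of_real t * \<theta>) \<theta> * -1) (at t)"
        by (rule DERIV_chain2[where g="\<lambda>r. t - r"])
      moreover have "(z - of_real t * \<theta>) + (t - r) *\<^sub>R \<theta> = z - of_real r * \<theta>" for r by (simp add: scaleR_conv_of_real algebra_simps)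
      ultimately show ?thesis by simp
    qed
    have "d \<tau> = d 0"
    proof (rule DERIV_isconst2[OF \<tau>(1)])
      show "continuous_on {0..\<tau>} d" unfolding d_def by (intro continuous_on_diff c v w)
      show "(d has_real_derivative 0) (at t)" if "0 < t" "t < \<tau>" for t
        unfolding d_def using DERIV_diff[OF dd[OF v that] dd[OF w that]] by simp
    qed (use \<tau>(1) in auto)
    moreover have "d \<tau> = 0" using v w \<tau>(2,3) \<theta> unfolding solves_transport_def d_def by auto
    ultimately show ?thesis unfolding d_def by simp
  qed
  have "v z \<theta> = w z \<theta>" for z \<theta>
  proof (cases "z \<in> closure \<Omega> \<and> \<theta> \<in> sphere 0 1")
    case True
    have c: "continuous_on (closure \<Omega>) (\<lambda>z. q z \<theta>)" if "solves_transport \<Omega> \<nu> h q" for q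
    proof -
      have "continuous_on (closure \<Omega> \<times> sphere 0 1) (\<lambda>(z, \<theta>). q z \<theta>)" using that unfolding solves_transport_def by blast
      moreover have "continuous_on (closure \<Omega>) (\<lambda>z. (z, \<theta>))" by (intro continuous_intros)
      ultimately have "continuous_on (closure \<Omega>) (\<lambda>z. case (z, \<theta>) of (z, \<theta>) \<Rightarrow> q z \<theta>)"
        by (rule continuous_on_compose2) (use True in auto)
      then show ?thesis by simp
    qed
    have "v z \<theta> - w z \<theta> = 0"
      by (rule continuous_constant_on_closure[of \<Omega> "\<lambda>z. v z \<theta> - w z \<theta>"])
        (rule continuous_on_diff[OF c[OF v] c[OF w]], use True on in auto)
    then show ?thesis by simp
  next
    case False
    then show ?thesis using v w unfolding solves_transport_def by auto
  qed
  then show ?thesis by (intro ext)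
qed

lemma ex1: "\<exists>!v. solves_transport \<Omega> \<nu> (\<lambda>z \<theta>. \<theta> \<bullet> f z) v" "\<exists>!v. solves_transport \<Omega> \<nu> (u 0) v"
  by (rule ex1I, rule solves, erule transport_unique[OF _ solves(1)])
    (rule ex1I, rule solves, erule transport_unique[OF _ solves(2)])

lemma solution: "transport_solution \<Omega> \<nu> (\<lambda>z \<theta>. \<theta> \<bullet> f z) = u 0" "transport_solution \<Omega> \<nu> (u 0) = u 1"
  unfolding transport_solution_def
  by (rule the_equality, rule solves, erule transport_unique[OF _ solves(1)])
    (rule the_equality, rule solves, erule transport_unique[OF _ solves(2)])

text \<open>At an outflow boundary point the whole line integral is carried by the backward ray of length \<open>T\<close>.\<close>
lemma line_integral:
  assumes \<zeta>: "\<zeta> \<in> frontier \<Omega>" and \<theta>: "\<theta> \<in> sphere 0 1" and pos: "\<nu> \<zeta> \<bullet> \<theta> > 0"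
    and g: "continuous_on UNIV g"
  shows "(\<integral>t. g t * (\<theta> \<bullet> f (\<zeta> - (\<zeta> \<bullet> \<theta>) *\<^sub>R \<theta> + t *\<^sub>R \<theta>)) \<partial>lborel) = integral {0..T} (\<lambda>t. g (\<zeta> \<bullet> \<theta> - t) * (\<theta> \<bullet> f (\<zeta> - of_real t * \<theta>)))"
proof -
  let ?h = "\<lambda>t. g (\<zeta> \<bullet> \<theta> - t) * (\<theta> \<bullet> f (\<zeta> - of_real t * \<theta>))"
  obtain \<phi> where \<phi>: "\<theta> = cis \<phi>" using unit_cis[OF \<theta>] by blast
  have ch: "continuous_on S ?h" for S
    by (intro continuous_intros continuous_on_compose2[OF g] continuous_on_compose2[OF cont(1)]) auto
  have out: "?h t = 0" if "t \<notin> {0..T}" for t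
  proof (cases "t < 0")
    case True
    then show ?thesis using f_behind[OF \<zeta>, of \<theta> t] pos by (simp add: mult_nonneg_nonpos)
  next
    case False
    have "\<zeta> \<in> closure \<Omega>" using \<zeta> unfolding frontier_def by auto
    then have "norm \<zeta> < R" using \<Omega>R by auto
    moreover have "norm (of_real t * \<theta>) \<le> norm (\<zeta> - of_real t * \<theta>) + norm \<zeta>" using norm_triangle_ineq4[of \<zeta> "\<zeta> - of_real t * \<theta>"] by simp
    then have "t \<le> norm (\<zeta> - of_real t * \<theta>) + norm \<zeta>" using \<theta> False by (simp add: norm_mult)
    ultimately have "R \<le> norm (\<zeta> - of_real t * \<theta>)" using False that T by simp
    then show ?thesis by (simp add: R(2))
  qed
  have "(\<integral>t. g t * (\<theta> \<bullet> f (\<zeta> - (\<zeta> \<bullet> \<theta>) *\<^sub>R \<theta> + t *\<^sub>R \<theta>)) \<partial>lborel)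
      = \<bar>-1\<bar> *\<^sub>R (\<integral>t. g (\<zeta> \<bullet> \<theta> + (-1) * t) * (\<theta> \<bullet> f (\<zeta> - (\<zeta> \<bullet> \<theta>) *\<^sub>R \<theta> + (\<zeta> \<bullet> \<theta> + (-1) * t) *\<^sub>R \<theta>)) \<partial>lborel)"
    by (rule lborel_integral_real_affine) simp
  also have "\<dots> = (\<integral>t. ?h t \<partial>lborel)" by (simp add: scaleR_conv_of_real algebra_simps)
  also have "\<dots> = (\<integral>t\<in>{0..T}. ?h t \<partial>lborel)"
    unfolding set_lebesgue_integral_def by (intro lebesgue_integral_cong) (use out in \<open>auto simp: indicator_def\<close>)
  also have "\<dots> = integral {0..T} ?h"
    by (rule set_borel_integral_eq_integral(2)) (rule borel_integrable_atLeastAtMost'[OF ch])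
  finally show ?thesis .
qed

lemma data:
  assumes \<zeta>: "\<zeta> \<in> frontier \<Omega>" and \<theta>: "\<theta> \<in> sphere 0 1"
  shows "u 0 \<zeta> \<theta> = data0 \<nu> f \<zeta> \<theta>" "u 1 \<zeta> \<theta> = data1 \<nu> f \<zeta> \<theta>"
proof -
  have zc: "\<zeta> \<in> closure \<Omega>" using \<zeta> unfolding frontier_def by auto
  have "u 0 \<zeta> \<theta> = data0 \<nu> f \<zeta> \<theta> \<and> u 1 \<zeta> \<theta> = data1 \<nu> f \<zeta> \<theta>"
  proof (cases "\<nu> \<zeta> \<bullet> \<theta> > 0")
    case True
    have u0: "ray_moment 0 f \<zeta> \<theta> = u 0 \<zeta> \<theta>"
      using line_integral[OF \<zeta> \<theta> True, of "\<lambda>_. 1"] zc \<theta> unfolding ray_moment_def u_def by simp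
    have cf: "continuous_on {0..T} (\<lambda>t. \<theta> \<bullet> f (\<zeta> - of_real t * \<theta>))"
      by (intro continuous_intros continuous_on_compose2[OF cont(1)]) auto
    have "ray_moment 1 f \<zeta> \<theta> = integral {0..T} (\<lambda>t. (\<zeta> \<bullet> \<theta> - t) * (\<theta> \<bullet> f (\<zeta> - of_real t * \<theta>)))"
      using line_integral[OF \<zeta> \<theta> True, of "\<lambda>t. t"] unfolding ray_moment_def by simp
    also have "\<dots> = integral {0..T} (\<lambda>t. (\<zeta> \<bullet> \<theta>) * (\<theta> \<bullet> f (\<zeta> - of_real t * \<theta>))) - integral {0..T} (\<lambda>t. t * (\<theta> \<bullet> f (\<zeta> - of_real t * \<theta>)))"
      unfolding left_diff_distrib by (intro integral_diff integrable_continuous_real continuous_intros cf)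
    also have "\<dots> = (\<zeta> \<bullet> \<theta>) * u 0 \<zeta> \<theta> - u 1 \<zeta> \<theta>" using zc \<theta> unfolding u_def by simp
    finally have u1: "ray_moment 1 f \<zeta> \<theta> = (\<zeta> \<bullet> \<theta>) * u 0 \<zeta> \<theta> - u 1 \<zeta> \<theta>" .
    show ?thesis using True unfolding data0_def data1_def u0 u1 by simp
  next
    case False
    then show ?thesis using u_inflow[OF \<zeta>, of \<theta>] unfolding data0_def data1_def by simp
  qed
  then show "u 0 \<zeta> \<theta> = data0 \<nu> f \<zeta> \<theta>" "u 1 \<zeta> \<theta> = data1 \<nu> f \<zeta> \<theta>" by auto
qed

text \<open>This identifies the modes, which are defined on \<open>closure \<Omega>\<close> only, with smooth functions on the plane.\<close>
lemma modes_eq: assumes z: "z \<in> closure \<Omega>" shows "modes (u k) n z = V k n z"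
proof -
  have e: "complex_of_real (u k z (cis \<phi>)) = (cis \<phi> * ray_int T k (\<lambda>w. cnj (f w)) z \<phi> + 1 * (cis (- \<phi>) * ray_int T k f z \<phi>)) / 2" for \<phi>
  proof -
    have "(\<lambda>t. t ^ k * (cis \<phi> \<bullet> f (z - of_real t * cis \<phi>))) integrable_on {0..T}"
      by (intro integrable_continuous_real continuous_intros continuous_on_compose2[OF cont(1)]) auto
    then have "((\<lambda>t. complex_of_real (t ^ k * (cis \<phi> \<bullet> f (z - of_real t * cis \<phi>)))) has_integral of_real (integral {0..T} (\<lambda>t. t ^ k * (cis \<phi> \<bullet> f (z - of_real t * cis \<phi>))))) {0..T}"
      by (intro has_integral_of_real integrable_integral)
    then have "complex_of_real (u k z (cis \<phi>)) = integral {0..T} (\<lambda>t. complex_of_real (t ^ k * (cis \<phi> \<bullet> f (z - of_real t * cis \<phi>))))"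
      using z unfolding u_def by (simp add: integral_unique)
    also have "\<dots> = integral {0..T} (\<lambda>t. of_real (t ^ k) * (cis \<phi> / 2 * cnj (f (z - of_real t * cis \<phi>)) + cis (- \<phi>) / 2 * f (z - of_real t * cis \<phi>)))"
    proof (rule integral_cong)
      fix t
      have "complex_of_real (cis \<phi> \<bullet> y) = cis \<phi> / 2 * cnj y + cis (- \<phi>) / 2 * y" for y
        by (simp add: complex_eq_iff inner_complex_def add_divide_distrib diff_divide_distrib)
      then show "complex_of_real (t ^ k * (cis \<phi> \<bullet> f (z - of_real t * cis \<phi>))) = of_real (t ^ k) * (cis \<phi> / 2 * cnj (f (z - of_real t * cis \<phi>)) + cis (- \<phi>) / 2 * f (z - of_real t * cis \<phi>))"
        by (simp only: of_real_mult)
    qed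
    also have "\<dots> = cis \<phi> / 2 * ray_int T k (\<lambda>w. cnj (f w)) z \<phi> + cis (- \<phi>) / 2 * ray_int T k f z \<phi>"
      by (rule ray_int_combine[OF cont(4,1), symmetric])
    finally show ?thesis by (simp add: add_divide_distrib)
  qed
  have x: "exp (- \<i> * of_int (- int n) * of_real \<phi>) = cis (of_int (int n) * \<phi>)" for \<phi>
    by (simp add: cis_conv_exp mult_ac)
  have "modes (u k) n z = 1 / (2 * of_real pi) * integral {-pi..pi} (\<lambda>\<phi>. cis (of_int (int n) * \<phi>) * (cis \<phi> * ray_int T k (\<lambda>w. cnj (f w)) z \<phi> + 1 * (cis (- \<phi>) * ray_int T k f z \<phi>)) / 2)"
    unfolding modes_def fourier_mode_def e x by (simp add: mult.commute)
  also have "\<dots> = (ray_mode T k (int n + 1) (\<lambda>w. cnj (f w)) z + 1 * ray_mode T k (int n - 1) f z) / 2"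
    unfolding ray_mode_linear[OF cont(4,1)] by simp
  finally show ?thesis unfolding V_def real_mode_def by (simp add: add.commute)
qed

end

section \<open>Recovery of the field\<close>

lemma wirt_derivatives:
  assumes "wirt g a b z"
  shows "g differentiable (at z)" "d_z g z = a" "d_zbar g z = b"
proof -
  have d: "(g has_derivative (\<lambda>h. a * h + b * cnj h)) (at z)" using assms unfolding wirt_def .
  then show "g differentiable (at z)" unfolding differentiable_def by blast
  have e: "frechet_derivative g (at z) = (\<lambda>h. a * h + b * cnj h)" by (rule frechet_derivative_at[OF d, symmetric])
  show "d_z g z = a" unfolding d_z_def e by (simp add: algebra_simps)
  show "d_zbar g z = b" unfolding d_zbar_def e by (simp add: algebra_simps)
qed

lemma wirt_transform:
  assumes "wirt g a b z" "open S" "z \<in> S" "\<And>w. w \<in> S \<Longrightarrow> g w = g' w"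
  shows "wirt g' a b z"
  unfolding wirt_def by (rule has_derivative_transform_within_open[OF assms(1)[unfolded wirt_def] assms(2-4)])

lemma contour_integral_cnj_eq_on:
  assumes "\<And>\<zeta>. \<zeta> \<in> path_image p \<Longrightarrow> g \<zeta> = h \<zeta>"
  shows "contour_integral_cnj p g = contour_integral_cnj p h"
  unfolding contour_integral_cnj_def by (rule integral_cong) (simp add: assms path_image_def)

lemma kernel_integral_eq_on:
  assumes "\<And>\<zeta>. \<zeta> \<in> path_image p \<Longrightarrow> g \<zeta> = h \<zeta>"
  shows "kernel_integral p z j g = kernel_integral p z j h"
proof -
  have 1: "contour_integral p (\<lambda>\<zeta>. g \<zeta> * ((cnj \<zeta> - cnj z) / (\<zeta> - z)) ^ j / (\<zeta> - z)) = contour_integral p (\<lambda>\<zeta>. h \<zeta> * ((cnj \<zeta> - cnj z) / (\<zeta> - z)) ^ j / (\<zeta> - z))"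
    by (rule contour_integral_eq) (simp only: assms)
  have 2: "contour_integral_cnj p (\<lambda>\<zeta>. g \<zeta> * ((cnj \<zeta> - cnj z) / (\<zeta> - z)) ^ j / (cnj \<zeta> - cnj z)) = contour_integral_cnj p (\<lambda>\<zeta>. h \<zeta> * ((cnj \<zeta> - cnj z) / (\<zeta> - z)) ^ j / (cnj \<zeta> - cnj z))"
    by (rule contour_integral_cnj_eq_on) (simp only: assms)
  show ?thesis unfolding kernel_integral_def 1 2 ..
qed

lemma B_op_eq_on:
  assumes "\<And>j \<zeta>. \<zeta> \<in> path_image p \<Longrightarrow> v (n + 2 * j) \<zeta> = v' (n' + 2 * j) \<zeta>"
  shows "B_op p v n z = B_op p v' n' z"
proof -
  have 1: "contour_integral p (\<lambda>\<zeta>. v n \<zeta> / (\<zeta> - z)) = contour_integral p (\<lambda>\<zeta>. v' n' \<zeta> / (\<zeta> - z))"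
    by (rule contour_integral_eq) (use assms[of _ 0] in simp)
  have 2: "kernel_integral p z (Suc i) (v (n + 2 * Suc i)) = kernel_integral p z (Suc i) (v' (n' + 2 * Suc i))" for i
    by (rule kernel_integral_eq_on[OF assms])
  show ?thesis unfolding B_op_def 1 2 ..
qed

lemma T_op_eq_on:
  assumes "\<And>j \<zeta>. \<zeta> \<in> S \<Longrightarrow> w (n + 2 * j) \<zeta> = w' (n' + 2 * j) \<zeta>"
  shows "T_op S w n z = T_op S w' n' z"
proof -
  have "(\<integral>\<zeta>\<in>S. w (n + 2 * j) \<zeta> * (1 / (\<zeta> - z)) * ((cnj \<zeta> - cnj z) / (\<zeta> - z)) ^ j \<partial>lborel) = (\<integral>\<zeta>\<in>S. w' (n' + 2 * j) \<zeta> * (1 / (\<zeta> - z)) * ((cnj \<zeta> - cnj z) / (\<zeta> - z)) ^ j \<partial>lborel)" for j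
    unfolding set_lebesgue_integral_def
  proof (rule lebesgue_integral_cong[OF refl])
    fix \<zeta>
    show "indicator S \<zeta> *\<^sub>R (w (n + 2 * j) \<zeta> * (1 / (\<zeta> - z)) * ((cnj \<zeta> - cnj z) / (\<zeta> - z)) ^ j) = indicator S \<zeta> *\<^sub>R (w' (n' + 2 * j) \<zeta> * (1 / (\<zeta> - z)) * ((cnj \<zeta> - cnj z) / (\<zeta> - z)) ^ j)"
      by (cases "\<zeta> \<in> S") (simp_all only: assms, simp_all)
  qed
  then show ?thesis unfolding T_op_def by (simp only:)
qed

lemma F_fun_eq_on:
  assumes "\<And>j \<zeta>. \<zeta> \<in> path_image p \<Longrightarrow> v (n + 2 * j) \<zeta> = v' (n + 2 * j) \<zeta>"
    and w: "\<And>j \<zeta>. \<zeta> \<in> S \<Longrightarrow> w (n + 2 * j) \<zeta> = w' (n + 2 * j) \<zeta>"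
  shows "F_fun p S v w n x = F_fun p S v' w' n x"
proof -
  have 1: "contour_integral p (\<lambda>\<zeta>. v n \<zeta> / (\<zeta> - of_real x)) = contour_integral p (\<lambda>\<zeta>. v' n \<zeta> / (\<zeta> - of_real x))"
    by (rule contour_integral_eq) (use assms(1)[of _ 0] in simp)
  have 2: "kernel_integral p (of_real x) (Suc i) (v (n + 2 * Suc i)) = kernel_integral p (of_real x) (Suc i) (v' (n + 2 * Suc i))" for i
    by (rule kernel_integral_eq_on[OF assms(1)])
  have 3: "(\<integral>\<zeta>\<in>S. w (n + 2 * j) \<zeta> / (\<zeta> - of_real x) * ((cnj \<zeta> - of_real x) / (\<zeta> - of_real x)) ^ j \<partial>lborel) = (\<integral>\<zeta>\<in>S. w' (n + 2 * j) \<zeta> / (\<zeta> - of_real x) * ((cnj \<zeta> - of_real x) / (\<zeta> - of_real x)) ^ j \<partial>lborel)" for j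
    unfolding set_lebesgue_integral_def
  proof (rule lebesgue_integral_cong[OF refl])
    fix \<zeta>
    show "indicator S \<zeta> *\<^sub>R (w (n + 2 * j) \<zeta> / (\<zeta> - of_real x) * ((cnj \<zeta> - of_real x) / (\<zeta> - of_real x)) ^ j) = indicator S \<zeta> *\<^sub>R (w' (n + 2 * j) \<zeta> / (\<zeta> - of_real x) * ((cnj \<zeta> - of_real x) / (\<zeta> - of_real x)) ^ j)"
      by (cases "\<zeta> \<in> S") (simp_all only: w, simp_all)
  qed
  show ?thesis unfolding F_fun_def Let_def 1 2 3 ..
qed

lemma hilbert_equation_at_eq_on:
  assumes u: "\<And>y. y \<in> {-s<..<s} \<Longrightarrow> u y = u' y" and "F x = F' x" "x \<in> {-s<..<s}"
  shows "hilbert_equation_at s u F x = hilbert_equation_at s u' F' x"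
proof -
  have "truncated_hilbert s u x = truncated_hilbert s u' x"
  proof
    fix e
    have "(\<integral>y\<in>{y\<in>{-s<..<s}. e < \<bar>x - y\<bar>}. u y / of_real (x - y) \<partial>lebesgue) = (\<integral>y\<in>{y\<in>{-s<..<s}. e < \<bar>x - y\<bar>}. u' y / of_real (x - y) \<partial>lebesgue)"
      unfolding set_lebesgue_integral_def
      by (rule lebesgue_integral_cong[OF refl]) (simp add: indicator_def u)
    then show "truncated_hilbert s u x e = truncated_hilbert s u' x e" unfolding truncated_hilbert_def by (simp only:)
  qed
  then show ?thesis unfolding hilbert_equation_at_def has_finite_hilbert_def using assms by simp
qed

text \<open>The modes and their smooth extensions agree on the relevant sets only. This congruence rule and those above transfer the statements from the extensions to the modes.\<close>
lemma unique_L2_solution_eq_on: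
  assumes sol: "unique_L2_solution s F u" and u: "\<And>y. y \<in> {-s<..<s} \<Longrightarrow> u y = u' y" and F: "\<And>y. y \<in> {-s<..<s} \<Longrightarrow> F y = F' y"
  shows "unique_L2_solution s F' u'"
  unfolding unique_L2_solution_def
proof (intro conjI ballI allI impI)
  have sp: "x \<in> space (LS s) \<Longrightarrow> x \<in> {-s<..<s}" for x by simp
  have in2: "in_L2 s u" and eq: "\<And>x. x \<in> {-s<..<s} \<Longrightarrow> hilbert_equation_at s u F x"
    and un: "\<And>w. in_L2 s w \<Longrightarrow> AE x in LS s. hilbert_equation_at s w F x \<Longrightarrow> AE x in LS s. w x = u x"
    using sol unfolding unique_L2_solution_def by blast+
  show "in_L2 s u'"
    using in2 measurable_cong[of "LS s" u u' borel] Bochner_Integration.integrable_cong[OF refl, of "LS s" "\<lambda>x. (norm (u x))\<^sup>2" "\<lambda>x. (norm (u' x))\<^sup>2"] u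
    unfolding in_L2_def by simp
  show "hilbert_equation_at s u' F' x" if "x \<in> {-s<..<s}" for x
    using eq[OF that] hilbert_equation_at_eq_on[of s u u' F x F', OF u F[OF that] that] by simp
  fix w assume w: "in_L2 s w \<and> (AE x in LS s. hilbert_equation_at s w F' x)"
  have "AE x in LS s. hilbert_equation_at s w F x"
    using conjunct2[OF w]
  proof (rule AE_mp[OF _ AE_I2[OF impI]])
    fix x assume "x \<in> space (LS s)" "hilbert_equation_at s w F' x"
    then show "hilbert_equation_at s w F x" using hilbert_equation_at_eq_on[of s w w F x F', OF refl F[OF sp] sp] by blast
  qed
  from un[OF conjunct1[OF w] this] show "AE x in LS s. w x = u' x"
  proof (rule AE_mp[OF _ AE_I2[OF impI]])
    fix x assume "x \<in> space (LS s)" "w x = u x"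
    then show "w x = u' x" using u[OF sp] by simp
  qed
qed

lemma continuous_AE_eq_interval:
  fixes u w :: "real \<Rightarrow> complex"
  assumes "continuous_on UNIV u" "continuous_on UNIV w" "AE x in LS s. w x = u x" "x \<in> {-s<..<s}"
  shows "w x = u x"
proof -
  have "closed {y. w y = u y}" using assms(1,2) by (intro closed_Collect_eq)
  moreover have "AE y\<in>{-s<..<s} in lebesgue. y \<in> {y. w y = u y}" using assms(3) by (simp add: AE_restrict_space_iff)
  ultimately have "x \<in> {y. w y = u y}"
    by (intro mem_closed_if_AE_lebesgue_open[OF _ _ _ assms(4)]) auto
  then show ?thesis by simp
qed

locale arc_field = geo: convex_arc \<Omega> \<Omega>p \<gamma> \<Gamma> D s + tr: transport f fa fb R T \<Omega> \<nu>
  for \<Omega> \<Omega>p \<gamma> \<Gamma> D s f fa fb R T \<nu>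
begin

lemma in_\<Omega>p: "z \<in> \<Omega>p \<Longrightarrow> z \<in> closure \<Omega>" "z \<in> \<Omega>p \<Longrightarrow> norm z < R"
proof -
  show c: "z \<in> closure \<Omega>" if "z \<in> \<Omega>p" for z using geo.\<Omega>p_subset closure_subset[of \<Omega>] that by blast
  show "norm z < R" if "z \<in> \<Omega>p" using c[OF that] tr.\<Omega>R by auto
qed

lemma in_\<gamma>: "z \<in> path_image \<gamma> \<Longrightarrow> z \<in> closure \<Omega>" using geo.front by (auto simp: frontier_def)

lemma in_\<Gamma>: "z \<in> path_image \<Gamma> \<Longrightarrow> z \<in> closure \<Omega>"
  using geo.\<Gamma>_facts(5) geo.C_facts(3) by blast

lemma in_chord: "x \<in> {-s<..<s} \<Longrightarrow> of_real x \<in> closure \<Omega>"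
  using geo.chord(1) closure_subset by blast

lemma system0: "n \<ge> 1 \<Longrightarrow> \<exists>M r. mode_system \<Omega> \<Omega>p \<gamma> \<Gamma> D s (tr.V 0) (\<lambda>_ _. 0) (tr.a 0) (tr.b 0) M r n"
proof -
  assume n: "n \<ge> 1"
  obtain M r where "M > 0" "\<And>m z. norm (tr.a 0 m z) \<le> M" "\<And>m z. norm (tr.b 0 m z) \<le> M" "\<And>m z. r < norm z \<Longrightarrow> tr.a 0 m z = 0 \<and> tr.b 0 m z = 0"
    by (rule tr.uniform_bounds) (rule that)
  then have "mode_system \<Omega> \<Omega>p \<gamma> \<Gamma> D s (tr.V 0) (\<lambda>_ _. 0) (tr.a 0) (tr.b 0) M r n"
    using tr.system0[OF in_\<Omega>p(2), of _ "n + 2 * _"] n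
    by unfold_locales (auto intro!: tr.V_C1c tr.decay)
  then show ?thesis by blast
qed

lemma system1: "\<exists>M r. mode_system \<Omega> \<Omega>p \<gamma> \<Gamma> D s (tr.V 1) (left_shift (tr.V 0)) (tr.a 1) (tr.b 1) M r n"
proof -
  obtain M r where "M > 0" "\<And>m z. norm (tr.a 1 m z) \<le> M" "\<And>m z. norm (tr.b 1 m z) \<le> M" "\<And>m z. r < norm z \<Longrightarrow> tr.a 1 m z = 0 \<and> tr.b 1 m z = 0"
    by (rule tr.uniform_bounds) (rule that)
  moreover have "\<exists>C. \<forall>z\<in>\<Omega>p. \<forall>N. (\<Sum>j<N. norm (left_shift (tr.V 0) (n + 2 * j) z)) \<le> C"
    using tr.sum_bound[of n] unfolding left_shift_def by blast
  ultimately have "mode_system \<Omega> \<Omega>p \<gamma> \<Gamma> D s (tr.V 1) (left_shift (tr.V 0)) (tr.a 1) (tr.b 1) M r n"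
    using tr.system1[OF in_\<Omega>p(2), of _ "n + 2 * _"]
    by unfold_locales (auto intro!: tr.V_C1c tr.decay simp: left_shift_def)
  then show ?thesis by blast
qed

lemma V0_unique: "n \<ge> 1 \<Longrightarrow> unique_L2_solution s (F_fun \<gamma> \<Omega>p (tr.V 0) (\<lambda>_ _. 0) n) (\<lambda>x. tr.V 0 n (of_real x))"
  using system0 mode_system.unique_solution_chord by blast

lemma V1_unique: "unique_L2_solution s (F_fun \<gamma> \<Omega>p (tr.V 1) (left_shift (tr.V 0)) n) (\<lambda>x. tr.V 1 n (of_real x))"
  using system1 mode_system.unique_solution_chord by blast

lemma V0_interior: assumes "z \<in> \<Omega>p" "n \<ge> 1" shows "tr.V 0 n z = B_op \<Gamma> (tr.V 0) n z"
proof -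
  have "tr.V 0 n z = B_op \<Gamma> (tr.V 0) n z + T_op \<Omega>p (\<lambda>_ _. 0) n z"
    using system0[OF assms(2)] mode_system.interior_formula assms(1) by blast
  then show ?thesis by (simp add: T_op_def set_lebesgue_integral_def)
qed

lemma V1_interior: "z \<in> \<Omega>p \<Longrightarrow> tr.V 1 n z = B_op \<Gamma> (tr.V 1) n z + T_op \<Omega>p (left_shift (tr.V 0)) n z"
  using system1 mode_system.interior_formula by blast

lemma V0_zero: "z \<in> \<Omega>p \<Longrightarrow> tr.V 0 0 z = of_real (2 * Re (d_z (tr.V 1 1) z))"
  unfolding wirt_derivatives(2)[OF C1c_wirt[OF tr.V_C1c]] by (rule tr.recover_mode[OF in_\<Omega>p(2)])

lemma field_recovery: "z \<in> \<Omega>p \<Longrightarrow> f z = 2 * (d_zbar (tr.V 0 0) z + d_z (tr.V 0 2) z)"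
  using tr.system0[OF in_\<Omega>p(2), of z 0]
  unfolding wirt_derivatives(2,3)[OF C1c_wirt[OF tr.V_C1c]] by (simp add: numeral_2_eq_2 mult.commute)

lemma modes_wirt: "z \<in> \<Omega>p \<Longrightarrow> wirt (modes (tr.u k) n) (tr.a k n z) (tr.b k n z) z"
  by (rule wirt_transform[OF C1c_wirt[OF tr.V_C1c] geo.\<Omega>p_open]) (simp_all add: tr.modes_eq in_\<Omega>p)

lemma recovery:
  defines "V0 \<equiv> modes (tr.u 0)" and "V1 \<equiv> modes (tr.u 1)"
  shows "n \<ge> 1 \<Longrightarrow> unique_L2_solution s (F_fun \<gamma> \<Omega>p V0 (\<lambda>_ _. 0) n) (\<lambda>x. V0 n (of_real x))"
    and "z \<in> \<Omega>p \<Longrightarrow> left_shift V0 n z = B_op \<Gamma> (left_shift V0) n z"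
    and "unique_L2_solution s (F_fun \<gamma> \<Omega>p V1 (left_shift V0) n) (\<lambda>x. V1 n (of_real x))"
    and "z \<in> \<Omega>p \<Longrightarrow> V1 n z = B_op \<Gamma> V1 n z + T_op \<Omega>p (left_shift V0) n z"
    and "z \<in> \<Omega>p \<Longrightarrow> V1 1 differentiable (at z) \<and> V0 0 z = of_real (2 * Re (d_z (V1 1) z))"
    and "z \<in> \<Omega>p \<Longrightarrow> V0 0 differentiable (at z) \<and> V0 2 differentiable (at z) \<and>
        f z = Complex (2 * Re (d_zbar (V0 0) z + d_z (V0 2) z)) (2 * Im (d_zbar (V0 0) z + d_z (V0 2) z))"
proof -
  have e0: "V0 m \<zeta> = tr.V 0 m \<zeta>" and e1: "V1 m \<zeta> = tr.V 1 m \<zeta>" if "\<zeta> \<in> closure \<Omega>" for m \<zeta>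
    unfolding V0_def V1_def by (rule tr.modes_eq[OF that])+
  show "unique_L2_solution s (F_fun \<gamma> \<Omega>p V0 (\<lambda>_ _. 0) n) (\<lambda>x. V0 n (of_real x))" if "n \<ge> 1"
    by (rule unique_L2_solution_eq_on[OF V0_unique[OF that]])
      (rule e0[symmetric] in_chord F_fun_eq_on in_\<gamma> refl; assumption?)+
  show "unique_L2_solution s (F_fun \<gamma> \<Omega>p V1 (left_shift V0) n) (\<lambda>x. V1 n (of_real x))"
    unfolding left_shift_def
    by (rule unique_L2_solution_eq_on[OF V1_unique[unfolded left_shift_def]])
      (rule e0[symmetric] e1[symmetric] in_chord F_fun_eq_on in_\<gamma> in_\<Omega>p; assumption?)+
  show "left_shift V0 n z = B_op \<Gamma> (left_shift V0) n z" if z: "z \<in> \<Omega>p"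
  proof -
    have "left_shift V0 n z = tr.V 0 (Suc n) z" unfolding left_shift_def by (rule e0[OF in_\<Omega>p(1)[OF z]])
    moreover have "B_op \<Gamma> (left_shift V0) n z = B_op \<Gamma> (tr.V 0) (Suc n) z"
      by (rule B_op_eq_on) (simp add: left_shift_def e0 in_\<Gamma>)
    ultimately show ?thesis using V0_interior[OF z, of "Suc n"] by simp
  qed
  show "V1 n z = B_op \<Gamma> V1 n z + T_op \<Omega>p (left_shift V0) n z" if z: "z \<in> \<Omega>p"
  proof -
    have "B_op \<Gamma> V1 n z = B_op \<Gamma> (tr.V 1) n z" by (rule B_op_eq_on) (simp add: e1 in_\<Gamma>)
    moreover have "T_op \<Omega>p (left_shift V0) n z = T_op \<Omega>p (left_shift (tr.V 0)) n z"
      by (rule T_op_eq_on) (simp add: left_shift_def e0 in_\<Omega>p)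
    ultimately show ?thesis using V1_interior[OF z, of n] e1[OF in_\<Omega>p(1)[OF z]] by simp
  qed
  assume z: "z \<in> \<Omega>p"
  note w = wirt_derivatives[OF modes_wirt[OF z], folded V0_def V1_def] wirt_derivatives[OF C1c_wirt[OF tr.V_C1c]]
  show "V1 1 differentiable (at z) \<and> V0 0 z = of_real (2 * Re (d_z (V1 1) z))"
    using V0_zero[OF z] unfolding w e0[OF in_\<Omega>p(1)[OF z]] V1_def w using w(1) by simp
  show "V0 0 differentiable (at z) \<and> V0 2 differentiable (at z) \<and>
        f z = Complex (2 * Re (d_zbar (V0 0) z + d_z (V0 2) z)) (2 * Im (d_zbar (V0 0) z + d_z (V0 2) z))"
    using field_recovery[OF z] unfolding V0_def w using w(1) by (simp add: complex_eq_iff)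
qed

end

text \<open>The recovery formulas are applied to both fields in turn: arc, chord, interior, and finally the field.\<close>
lemma field_determined:
  assumes f: "arc_field \<Omega> \<Omega>p \<gamma> \<Gamma> D s f fa fb R T \<nu>" and h: "arc_field \<Omega> \<Omega>p \<gamma> \<Gamma> D s h ha hb R T \<nu>"
    and eq: "\<And>\<zeta> \<theta>. \<zeta> \<in> path_image \<gamma> \<Longrightarrow> \<theta> \<in> sphere 0 1 \<Longrightarrow> data0 \<nu> f \<zeta> \<theta> = data0 \<nu> h \<zeta> \<theta> \<and> data1 \<nu> f \<zeta> \<theta> = data1 \<nu> h \<zeta> \<theta>"
    and z: "z \<in> \<Omega>p"
  shows "h z = f z"
proof -
  interpret f: arc_field \<Omega> \<Omega>p \<gamma> \<Gamma> D s f fa fb R T \<nu> by (rule f)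
  interpret h: arc_field \<Omega> \<Omega>p \<gamma> \<Gamma> D s h ha hb R T \<nu> by (rule h)
  have on_\<gamma>: "h.tr.V k n \<zeta> = f.tr.V k n \<zeta>" if \<zeta>: "\<zeta> \<in> path_image \<gamma>" and k: "k = 0 \<or> k = 1" for k n \<zeta>
  proof -
    have fr: "\<zeta> \<in> frontier \<Omega>" using f.geo.front \<zeta> by auto
    have "h.tr.u k \<zeta> (cis \<phi>) = f.tr.u k \<zeta> (cis \<phi>)" for \<phi>
    proof -
      have c: "cis \<phi> \<in> sphere 0 1" by simp
      show ?thesis using k eq[OF \<zeta> c] h.tr.data[OF fr c] f.tr.data[OF fr c] by auto
    qed
    then have "modes (h.tr.u k) n \<zeta> = modes (f.tr.u k) n \<zeta>" unfolding modes_def fourier_mode_def by simp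
    then show ?thesis using h.tr.modes_eq f.tr.modes_eq f.in_\<gamma>[OF \<zeta>] by simp
  qed
  have chord: "q x = p x" if p: "unique_L2_solution s F p" and q: "unique_L2_solution s G q" and FG: "F = G"
    and c: "continuous_on UNIV p" "continuous_on UNIV q" and x: "x \<in> {-s<..<s}" for F G p q x
  proof (rule continuous_AE_eq_interval[OF c _ x])
    have "in_L2 s q" "AE x in LS s. hilbert_equation_at s q F x"
      using q unfolding unique_L2_solution_def FG by (blast, intro AE_I2) simp
    then show "AE x in LS s. q x = p x" using p unfolding unique_L2_solution_def by blast
  qed
  have cont: "continuous_on UNIV (\<lambda>x. g (of_real x))" if "C1c g a b" for g a b
    by (rule continuous_on_compose2[OF C1c_continuous[OF that] continuous_on_of_real_id]) simp
  have on_\<Gamma>: "h.tr.V k n \<zeta> = f.tr.V k n \<zeta>"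
    if "\<zeta> \<in> path_image \<Gamma>" and k: "k = 0 \<or> k = 1" and ch: "\<And>x. x \<in> {-s<..<s} \<Longrightarrow> h.tr.V k n (of_real x) = f.tr.V k n (of_real x)" for k n \<zeta>
  proof (cases "\<zeta> \<in> path_image \<gamma>")
    case False
    then have "\<zeta> \<in> seg s ` {0..1}" using that(1) f.geo.\<Gamma>_facts(6) by (auto simp: path_image_def)
    then obtain t where t: "t \<in> {0..1}" "\<zeta> = seg s t" by auto
    have "t \<noteq> 0" "t \<noteq> 1"
    proof -
      have "pathstart \<gamma> \<in> path_image \<gamma>" "pathfinish \<gamma> \<in> path_image \<gamma>" by auto
      then have "of_real s \<noteq> \<zeta>" "- of_real s \<noteq> \<zeta>" using False f.geo.s by auto
      then show "t \<noteq> 0" "t \<noteq> 1" unfolding t(2) seg_def by auto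
    qed
    then have "0 < t" "t < 1" using t(1) by auto
    then have "0 < 2 * s * t" "2 * s * t < 2 * s * 1" using f.geo.s(1) by (simp_all only: mult_pos_pos zero_less_numeral mult_less_cancel_left_pos)
    then have "2 * s * t - s \<in> {-s<..<s}" by auto
    moreover have "\<zeta> = of_real (2 * s * t - s)" unfolding t(2) seg_def by simp
    ultimately show ?thesis using ch[of "2 * s * t - s"] by simp
  qed (use on_\<gamma> k in auto)
  have ch0: "h.tr.V 0 n (of_real x) = f.tr.V 0 n (of_real x)" if "n \<ge> 1" "x \<in> {-s<..<s}" for n x
  proof (rule chord[OF f.V0_unique[OF that(1)] h.V0_unique[OF that(1)] _ cont[OF f.tr.V_C1c] cont[OF h.tr.V_C1c] that(2)])
    show "F_fun \<gamma> \<Omega>p (f.tr.V 0) (\<lambda>_ _. 0) n = F_fun \<gamma> \<Omega>p (h.tr.V 0) (\<lambda>_ _. 0) n"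
      by (rule ext, rule F_fun_eq_on) (simp_all add: on_\<gamma>)
  qed
  have in0: "h.tr.V 0 n z = f.tr.V 0 n z" if "n \<ge> 1" "z \<in> \<Omega>p" for n z
    unfolding f.V0_interior[OF that(2,1)] h.V0_interior[OF that(2,1)]
    by (rule B_op_eq_on) (use on_\<Gamma> ch0 that(1) in auto)
  have ls: "left_shift (h.tr.V 0) m z = left_shift (f.tr.V 0) m z" if "z \<in> \<Omega>p" for m z
    unfolding left_shift_def by (rule in0[OF _ that]) simp
  have ch1: "h.tr.V 1 n (of_real x) = f.tr.V 1 n (of_real x)" if "x \<in> {-s<..<s}" for n x
  proof (rule chord[OF f.V1_unique h.V1_unique _ cont[OF f.tr.V_C1c] cont[OF h.tr.V_C1c] that])
    show "F_fun \<gamma> \<Omega>p (f.tr.V 1) (left_shift (f.tr.V 0)) n = F_fun \<gamma> \<Omega>p (h.tr.V 1) (left_shift (h.tr.V 0)) n"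
      by (rule ext, rule F_fun_eq_on) (simp_all add: on_\<gamma> ls)
  qed
  have in1: "h.tr.V 1 n z = f.tr.V 1 n z" if "z \<in> \<Omega>p" for n z
  proof -
    have 1: "B_op \<Gamma> (h.tr.V 1) n z = B_op \<Gamma> (f.tr.V 1) n z" by (rule B_op_eq_on) (use on_\<Gamma> ch1 in auto)
    have 2: "T_op \<Omega>p (left_shift (h.tr.V 0)) n z = T_op \<Omega>p (left_shift (f.tr.V 0)) n z" by (rule T_op_eq_on) (rule ls)
    show ?thesis unfolding f.V1_interior[OF that, of n] h.V1_interior[OF that, of n] 1 2 ..
  qed
  have same: "d_z p z = d_z q z" "d_zbar p z = d_zbar q z" if "C1c q a b" "\<And>w. w \<in> \<Omega>p \<Longrightarrow> q w = p w" "z \<in> \<Omega>p" for p q a b z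
  proof -
    have w: "wirt q (a z) (b z) z" by (rule C1c_wirt[OF that(1)])
    have w': "wirt p (a z) (b z) z" by (rule wirt_transform[OF w f.geo.\<Omega>p_open that(3,2)])
    show "d_z p z = d_z q z" by (simp only: wirt_derivatives(2)[OF w] wirt_derivatives(2)[OF w'])
    show "d_zbar p z = d_zbar q z" by (simp only: wirt_derivatives(3)[OF w] wirt_derivatives(3)[OF w'])
  qed
  have in00: "h.tr.V 0 0 z = f.tr.V 0 0 z" if "z \<in> \<Omega>p" for z
    unfolding f.V0_zero[OF that] h.V0_zero[OF that] using same(1)[OF f.tr.V_C1c in1[symmetric] that] by simp
  show ?thesis unfolding f.field_recovery[OF z] h.field_recovery[OF z]
    using same(2)[OF f.tr.V_C1c in00[symmetric] z] same(1)[OF f.tr.V_C1c in0[symmetric] z, of 2] by simp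
qed

lemma smooth_arc_C1:
  assumes "smooth_arc \<gamma>"
  obtains D where "arc \<gamma>" "continuous_on {0..1} D" "\<And>t. t \<in> {0..1} \<Longrightarrow> (\<gamma> has_vector_derivative D t) (at t within {0..1})"
proof -
  obtain D where D: "arc \<gamma>" "D 0 = \<gamma>" "\<And>k t. t \<in> {0..1} \<Longrightarrow> (D k has_vector_derivative D (Suc k) t) (at t within {0..1})"
    using assms unfolding smooth_arc_def by blast
  have "continuous_on {0..1} (D 1)"
    unfolding continuous_on_eq_continuous_within using has_vector_derivative_continuous[OF D(3)] by blast
  moreover have "(\<gamma> has_vector_derivative D 1 t) (at t within {0..1})" if "t \<in> {0..1}" for t
    using D(3)[OF that, of 0] D(2) by simp
  ultimately show ?thesis using that D(1) by blast
qed

theorem mainTheorem1: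
  fixes \<Omega> \<Omega>p \<Lambda> :: "complex set" and \<nu> f :: "complex \<Rightarrow> complex" and s \<mu> :: real
    and \<gamma> \<Gamma> :: "real \<Rightarrow> complex"
    and v0 v1 :: "complex \<Rightarrow> complex \<Rightarrow> real" and V0 V1 :: mode_seq
  assumes \<Omega>: "bounded \<Omega>" "strictly_convex_domain \<Omega>"
    and \<nu>: "\<And>\<zeta> n. \<zeta> \<in> frontier \<Omega> \<Longrightarrow> outer_unit_normal \<Omega> \<zeta> n \<longleftrightarrow> n = \<nu> \<zeta>"
    and \<gamma>: "smooth_arc \<gamma>" and \<Lambda>: "\<Lambda> = path_image \<gamma>" "\<Lambda> \<subseteq> frontier \<Omega>"
    and s: "s > 0" "pathstart \<gamma> = of_real s" "pathfinish \<gamma> = - of_real s"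
    and upper: "\<And>t. t \<in> {0<..<1} \<Longrightarrow> Im (\<gamma> t) > 0"
    and \<Omega>p: "\<Omega>p = interior (convex hull \<Lambda>)"
    and \<Gamma>: "\<Gamma> = linepath (- of_real s) (of_real s) +++ \<gamma>"
    and \<mu>: "1/2 < \<mu>" "\<mu> < 1" and f: "C0_1_holder \<Omega> \<mu> f"
    and v0: "v0 = transport_solution \<Omega> \<nu> (\<lambda>z \<theta>. \<theta> \<bullet> f z)"
    and v1: "v1 = transport_solution \<Omega> \<nu> v0"
    and V0: "V0 = modes v0" and V1: "V1 = modes v1"
  shows
    "(\<exists>!v. solves_transport \<Omega> \<nu> (\<lambda>z \<theta>. \<theta> \<bullet> f z) v) \<and> (\<exists>!v. solves_transport \<Omega> \<nu> v0 v) \<and>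
     (\<forall>\<zeta>\<in>\<Lambda>. \<forall>\<theta>\<in>sphere 0 1. v0 \<zeta> \<theta> = data0 \<nu> f \<zeta> \<theta> \<and> v1 \<zeta> \<theta> = data1 \<nu> f \<zeta> \<theta>) \<and>
     (\<forall>n\<ge>1. unique_L2_solution s (F_fun \<gamma> \<Omega>p V0 (\<lambda>_ _. 0) n) (\<lambda>x. V0 n (of_real x))) \<and>
     (\<forall>n. \<forall>z\<in>\<Omega>p. left_shift V0 n z = B_op \<Gamma> (left_shift V0) n z) \<and>
     (\<forall>n. unique_L2_solution s (F_fun \<gamma> \<Omega>p V1 (left_shift V0) n) (\<lambda>x. V1 n (of_real x))) \<and>
     (\<forall>n. \<forall>z\<in>\<Omega>p. V1 n z = B_op \<Gamma> V1 n z + T_op \<Omega>p (left_shift V0) n z) \<and>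
     (\<forall>z\<in>\<Omega>p. V1 1 differentiable (at z) \<and> V0 0 z = of_real (2 * Re (d_z (V1 1) z))) \<and>
     (\<forall>z\<in>\<Omega>p. V0 0 differentiable (at z) \<and> V0 2 differentiable (at z) \<and>
        f z = Complex (2 * Re (d_zbar (V0 0) z + d_z (V0 2) z))
                      (2 * Im (d_zbar (V0 0) z + d_z (V0 2) z))) \<and>
     (\<forall>h. C0_1_holder \<Omega> \<mu> h \<and>
        (\<forall>\<zeta>\<in>\<Lambda>. \<forall>\<theta>\<in>sphere 0 1. \<nu> \<zeta> \<bullet> \<theta> > 0 \<longrightarrow>
           ray_moment 0 h \<zeta> \<theta> = ray_moment 0 f \<zeta> \<theta> \<and> ray_moment 1 h \<zeta> \<theta> = ray_moment 1 f \<zeta> \<theta>) \<longrightarrow>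
        (\<forall>z\<in>\<Omega>p. h z = f z))"
proof -
  obtain D where D: "arc \<gamma>" "continuous_on {0..1} D" "\<And>t. t \<in> {0..1} \<Longrightarrow> (\<gamma> has_vector_derivative D t) (at t within {0..1})"
    by (rule smooth_arc_C1[OF \<gamma>]) (rule that)
  have geo: "convex_arc \<Omega> \<Omega>p \<gamma> \<Gamma> D s"
    using \<Omega> D \<Lambda> s upper \<Omega>p \<Gamma> by unfold_locales auto
  obtain R where R: "R > 0" "closure \<Omega> \<subseteq> ball 0 R"
    using bounded_subset_ballD[OF bounded_closure[OF \<Omega>(1)], of 0] by auto
  \<comment> \<open>One radius serves all admissible fields, so that two fields can be compared in the same setting.\<close>
  have field: "\<exists>ga gb. arc_field \<Omega> \<Omega>p \<gamma> \<Gamma> D s g ga gb R (2 * R) \<nu>" if g: "C0_1_holder \<Omega> \<mu> g" for g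
  proof -
    have "\<mu> > 0" using \<mu> by simp
    then obtain ga gb where g: "C1c g ga gb" "\<And>z. z \<notin> \<Omega> \<Longrightarrow> g z = 0"
      by (rule holder_field_C1c[OF g]) (rule that)
    have out: "g z = 0" if "R \<le> norm z" for z
    proof (rule g(2), rule notI)
      assume "z \<in> \<Omega>"
      then have "z \<in> ball 0 R" using closure_subset R(2) by blast
      then show False using that by simp
    qed
    have "transport g ga gb R (2 * R) \<Omega> \<nu>"
      by unfold_locales (use g R out \<nu> \<Omega>(2) in auto)
    then show ?thesis using geo unfolding arc_field_def by blast
  qed
  obtain fa fb where ff: "arc_field \<Omega> \<Omega>p \<gamma> \<Gamma> D s f fa fb R (2 * R) \<nu>" using field[OF f] by blast
  interpret f: arc_field \<Omega> \<Omega>p \<gamma> \<Gamma> D s f fa fb R "2 * R" \<nu> by (rule ff)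
  have u0: "v0 = f.tr.u 0" unfolding v0 by (rule f.tr.solution)
  have u1: "v1 = f.tr.u 1" unfolding v1 u0 by (rule f.tr.solution)
  have fr: "\<zeta> \<in> frontier \<Omega>" if "\<zeta> \<in> \<Lambda>" for \<zeta> using that \<Lambda>(2) by blast
  show ?thesis unfolding V0 V1 u0 u1
  proof (intro conjI allI ballI impI)
    fix h z assume h: "C0_1_holder \<Omega> \<mu> h \<and>
        (\<forall>\<zeta>\<in>\<Lambda>. \<forall>\<theta>\<in>sphere 0 1. \<nu> \<zeta> \<bullet> \<theta> > 0 \<longrightarrow>
           ray_moment 0 h \<zeta> \<theta> = ray_moment 0 f \<zeta> \<theta> \<and> ray_moment 1 h \<zeta> \<theta> = ray_moment 1 f \<zeta> \<theta>)"
      and z: "z \<in> \<Omega>p"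
    obtain ha hb where hh: "arc_field \<Omega> \<Omega>p \<gamma> \<Gamma> D s h ha hb R (2 * R) \<nu>" using field h by blast
    show "h z = f z"
      by (rule field_determined[OF ff hh _ z]) (use h in \<open>auto simp: \<Lambda>(1) data0_def data1_def\<close>)
  qed (assumption | rule f.tr.ex1 f.tr.data f.recovery(1-4) f.recovery(5)[THEN conjunct1] f.recovery(5)[THEN conjunct2]
      f.recovery(6)[THEN conjunct1] f.recovery(6)[THEN conjunct2, THEN conjunct1] f.recovery(6)[THEN conjunct2, THEN conjunct2] fr)+
qed

end
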